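(* Let $X=(x_t,\infty,\mathcal M_t,P_x)$ be a quasi-diffusion process corresponding to $L$. Then the process $(x_t,\bar{\mathcal N}_{t+},P_x)$ is strong Markov: for every $x\in\mathbb R^d$, every stopping time $\tau$ with respect to the filtration $(\bar{\mathcal N}_{t+})_{t\ge 0}$, every $t\ge 0$ and every bounded Borel function $f$ on $\mathbb R^d$, $$E_x\big(f(x_{\tau+t})\mid \bar{\mathcal N}_{\tau+}\big)=E_{x_\tau}f(x_t)\qquad P_x\text{-a.s. on }\{\tau<\infty\}.$$
   Context: Fix the dimension $d$, $\delta\in(0,1)$ and a number denoted $\|b\|\in(0,\infty)$. $\mathbb S_\delta$ is the set of symmetric $d\times d$ matrices with eigenvalues in $[\delta,\delta^{-1}]$. $a:\mathbb R^d\to\mathbb S_\delta$ and $b:\mathbb R^d\to\mathbb R^d$ are Borel with $\|b\|_{L_d(\mathbb R^d)}\le\|b\|$ (the right side is the fixed number). $L=(1/2)a^{ij}(x)D_{ij}+b^i(x)D_i$, where $D_i=\partial/\partial x^i$, $D_{ij}=D_iD_j$, with summation over repeated indices. A quasi-diffusion process corresponding to $L$ is a continuous time-homogeneous Markov process $X=(x_t,\infty,\mathcal M_t,P_x)$ in $\mathbb R^d$ with infinite lifetime (in Dynkin's sense; $P_x$ is the law for the starting point $x$, $E_x$ the expectation) such that for any $x\in\mathbb R^d$, $t\ge0$, $E_x\int_0^t|b(x_s)|\,ds<\infty$ and, for any twice continuously differentiable compactly supported $u$, $u(x)=E_xu(x_t)-E_x\int_0^tLu(x_s)\,ds$. Only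 the Markov property (not the strong Markov property) is assumed. $\mathcal N_t$ is the $\sigma$-field generated by the events $\{\omega: x_s\in\Gamma\}$, $s\le t$, $\Gamma\subset\mathbb R^d$ Borel; $\bar{\mathcal N}^{x}_t$ is the completion of $\mathcal N_t$ with respect to $(\mathcal N_\infty,P_x)$; $\bar{\mathcal N}_t=\bigcap_{x\in\mathbb R^d}\bar{\mathcal N}_t^x$ and $\bar{\mathcal N}_{t+}=\bigcap_{s>t}\bar{\mathcal N}_s$. For a stopping time $\tau$, $\bar{\mathcal N}_{\tau+}$ is the $\sigma$-field of events $A\in\bar{\mathcal N}_\infty:=\bigcap_x\bar{\mathcal N}^x_\infty$ such that $A\cap\{\tau\le t\}\in\bar{\mathcal N}_{t+}$ for all $t\ge 0$. *)

theory Defs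
  imports "HOL-Probability.Probability"
begin

section \<open>Coefficients and the operator L\<close>

definition sym_elliptic :: "real \<Rightarrow> (real ^ 'n ^ 'n) set" where
  "sym_elliptic \<delta> = {A. transpose A = A \<and>
     (\<forall>c. (\<exists>v. v \<noteq> 0 \<and> A *v v = c *\<^sub>R v) \<longrightarrow> \<delta> \<le> c \<and> c \<le> 1 / \<delta>)}"

text \<open>The Bochner integral of a non-integrable function is 0, so integrability is a separate conjunct.\<close>

definition Ld_norm_le :: "(real ^ 'n \<Rightarrow> real ^ 'n) \<Rightarrow> real \<Rightarrow> bool" where
  "Ld_norm_le b K \<longleftrightarrow>
     integrable lborel (\<lambda>x. norm (b x) ^ CARD('n)) \<and>
     root CARD('n) (\<integral>x. norm (b x) ^ CARD('n) \<partial>lborel) \<le> K"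

definition pd :: "'n::finite \<Rightarrow> (real ^ 'n \<Rightarrow> real) \<Rightarrow> real ^ 'n \<Rightarrow> real" where
  "pd i u x = deriv (\<lambda>h. u (x + h *\<^sub>R axis i 1)) 0"

text \<open>Existence and continuity of all first order partial derivatives on the whole space
  (this implies that \<open>u\<close> itself is continuous).\<close>

definition C1_fun :: "(real ^ 'n \<Rightarrow> real) \<Rightarrow> bool" where
  "C1_fun u \<longleftrightarrow>
     (\<forall>i. (\<forall>x. (\<lambda>h. u (x + h *\<^sub>R axis i 1)) differentiable (at (0::real))) \<and>
          continuous_on UNIV (pd i u))"

definition C2c_fun :: "(real ^ 'n \<Rightarrow> real) \<Rightarrow> bool" where
  "C2c_fun u \<longleftrightarrow> C1_fun u \<and> (\<forall>i. C1_fun (pd i u)) \<and> compact (closure {x. u x \<noteq> 0})"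

definition Lop :: "(real ^ 'n \<Rightarrow> real ^ 'n ^ 'n) \<Rightarrow> (real ^ 'n \<Rightarrow> real ^ 'n)
    \<Rightarrow> (real ^ 'n \<Rightarrow> real) \<Rightarrow> real ^ 'n \<Rightarrow> real" where
  "Lop a b u x = (1/2) * (\<Sum>i\<in>UNIV. \<Sum>j\<in>UNIV. a x $ i $ j * pd i (pd j u) x)
     + (\<Sum>i\<in>UNIV. b x $ i * pd i u x)"

section \<open>Markov processes\<close>

text \<open>Processes are functions \<open>X :: real \<Rightarrow> 'w \<Rightarrow> real ^ 'n\<close> of which only the times \<open>t \<ge> 0\<close> matter.
  The measurable space \<open>M0\<close> carries the sample space and the sigma-field on which all the laws
  \<open>P x\<close> live; \<open>M t\<close> are its sub-sigma-fields. In Dynkin's list of axioms for infinite lifetime we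
  leave out the requirement that the sample space be closed under time shifts of paths, which only
  serves to define shift operators.\<close>

definition markov_process :: "'w measure \<Rightarrow> (real \<Rightarrow> 'w measure) \<Rightarrow> (real ^ 'n \<Rightarrow> 'w measure)
    \<Rightarrow> (real \<Rightarrow> 'w \<Rightarrow> real ^ 'n) \<Rightarrow> bool" where
  "markov_process M0 M P X \<longleftrightarrow>
     (\<forall>x. prob_space (P x) \<and> sets (P x) = sets M0) \<and>
     (\<forall>t\<ge>0. subalgebra M0 (M t)) \<and>
     (\<forall>s t. 0 \<le> s \<and> s \<le> t \<longrightarrow> sets (M s) \<subseteq> sets (M t)) \<and>
     (\<forall>t\<ge>0. X t \<in> M t \<rightarrow>\<^sub>M borel) \<and>
     (\<forall>t\<ge>0. \<forall>\<Gamma>\<in>sets borel.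
        (\<lambda>x. measure (P x) {\<omega>\<in>space M0. X t \<omega> \<in> \<Gamma>}) \<in> borel_measurable borel) \<and>
     (\<forall>x. AE \<omega> in P x. X 0 \<omega> = x) \<and>
     (\<forall>x. \<forall>s\<ge>0. \<forall>t\<ge>0. \<forall>\<Gamma>\<in>sets borel. AE \<omega> in P x.
        real_cond_exp (P x) (M t) (\<lambda>\<omega>'. indicator \<Gamma> (X (t + s) \<omega>')) \<omega>
          = measure (P (X t \<omega>)) {\<omega>'\<in>space M0. X s \<omega>' \<in> \<Gamma>})"

definition continuous_paths :: "'w measure \<Rightarrow> (real \<Rightarrow> 'w \<Rightarrow> real ^ 'n) \<Rightarrow> bool" where
  "continuous_paths M0 X \<longleftrightarrow> (\<forall>\<omega>\<in>space M0. continuous_on {0..} (\<lambda>t. X t \<omega>))"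

definition quasi_diffusion :: "(real ^ 'n \<Rightarrow> real ^ 'n ^ 'n) \<Rightarrow> (real ^ 'n \<Rightarrow> real ^ 'n)
    \<Rightarrow> 'w measure \<Rightarrow> (real \<Rightarrow> 'w measure) \<Rightarrow> (real ^ 'n \<Rightarrow> 'w measure)
    \<Rightarrow> (real \<Rightarrow> 'w \<Rightarrow> real ^ 'n) \<Rightarrow> bool" where
  "quasi_diffusion a b M0 M P X \<longleftrightarrow>
     markov_process M0 M P X \<and> continuous_paths M0 X \<and>
     (\<forall>x. \<forall>t\<ge>0.
        (\<integral>\<^sup>+\<omega>. (\<integral>\<^sup>+s\<in>{0..t}. ennreal (norm (b (X s \<omega>))) \<partial>lborel) \<partial>P x) < \<infinity> \<and>
        (\<forall>u. C2c_fun u \<longrightarrow>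
           u x = (\<integral>\<omega>. u (X t \<omega>) \<partial>P x)
               - (\<integral>\<omega>. (LINT s:{0..t}|lborel. Lop a b u (X s \<omega>)) \<partial>P x)))"

section \<open>Completed filtrations\<close>

definition path_sigma :: "'w measure \<Rightarrow> (real \<Rightarrow> 'w \<Rightarrow> real ^ 'n) \<Rightarrow> real set \<Rightarrow> 'w measure" where
  "path_sigma M0 X T =
     sigma (space M0) {{\<omega>\<in>space M0. X s \<omega> \<in> \<Gamma>} | s \<Gamma>. s \<in> T \<and> \<Gamma> \<in> sets borel}"

abbreviation N_upto :: "'w measure \<Rightarrow> (real \<Rightarrow> 'w \<Rightarrow> real ^ 'n) \<Rightarrow> real \<Rightarrow> 'w measure" where
  "N_upto M0 X t \<equiv> path_sigma M0 X {0..t}"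

abbreviation N_infty :: "'w measure \<Rightarrow> (real \<Rightarrow> 'w \<Rightarrow> real ^ 'n) \<Rightarrow> 'w measure" where
  "N_infty M0 X \<equiv> path_sigma M0 X {0..}"

text \<open>Completion of a sub-sigma-field \<open>G\<close> of \<open>Q\<close> with respect to \<open>Q\<close>: its members are the sets that
  differ from a member of \<open>G\<close> by a subset of a \<open>Q\<close>-null set, the null set being one of \<open>sets Q\<close>
  and not necessarily of \<open>sets G\<close>.\<close>

definition completion_wrt :: "'w measure \<Rightarrow> 'w measure \<Rightarrow> 'w set set" where
  "completion_wrt Q G = {A. A \<subseteq> space Q \<and>
     (\<exists>B\<in>sets G. \<exists>C\<in>null_sets Q. (A - B) \<union> (B - A) \<subseteq> C)}"

definition Nbar :: "'w measure \<Rightarrow> (real ^ 'n \<Rightarrow> 'w measure) \<Rightarrow> (real \<Rightarrow> 'w \<Rightarrow> real ^ 'n)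
    \<Rightarrow> real \<Rightarrow> 'w set set" where
  "Nbar M0 P X t =
     (\<Inter>x. completion_wrt (restr_to_subalg (P x) (N_infty M0 X)) (N_upto M0 X t))"

definition Nbar_infty :: "'w measure \<Rightarrow> (real ^ 'n \<Rightarrow> 'w measure) \<Rightarrow> (real \<Rightarrow> 'w \<Rightarrow> real ^ 'n)
    \<Rightarrow> 'w set set" where
  "Nbar_infty M0 P X =
     (\<Inter>x. completion_wrt (restr_to_subalg (P x) (N_infty M0 X)) (N_infty M0 X))"

definition Nbar_plus :: "'w measure \<Rightarrow> (real ^ 'n \<Rightarrow> 'w measure) \<Rightarrow> (real \<Rightarrow> 'w \<Rightarrow> real ^ 'n)
    \<Rightarrow> real \<Rightarrow> 'w set set" where
  "Nbar_plus M0 P X t = (\<Inter>s\<in>{t<..}. Nbar M0 P X s)"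

text \<open>The library's \<open>stopping_time\<close> gives times and values the same type; here time is real and the
  value may be infinite.\<close>

definition ext_stopping_time :: "'w measure \<Rightarrow> (real \<Rightarrow> 'w set set) \<Rightarrow> ('w \<Rightarrow> ennreal) \<Rightarrow> bool" where
  "ext_stopping_time M0 F \<tau> \<longleftrightarrow> (\<forall>t\<ge>0. {\<omega>\<in>space M0. \<tau> \<omega> \<le> ennreal t} \<in> F t)"

text \<open>The generating family is itself a sigma-field for a stopping time \<open>\<tau>\<close>; \<open>sigma\<close> only packs it
  as a measurable space.\<close>

definition Nbar_tau_plus :: "'w measure \<Rightarrow> (real ^ 'n \<Rightarrow> 'w measure) \<Rightarrow> (real \<Rightarrow> 'w \<Rightarrow> real ^ 'n)
    \<Rightarrow> ('w \<Rightarrow> ennreal) \<Rightarrow> 'w measure" where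
  "Nbar_tau_plus M0 P X \<tau> = sigma (space M0)
     {A \<in> Nbar_infty M0 P X. \<forall>t\<ge>0. A \<inter> {\<omega>\<in>space M0. \<tau> \<omega> \<le> ennreal t} \<in> Nbar_plus M0 P X t}"

text \<open>The law \<open>P x\<close> on the completion of the path sigma-field. The sigma-field at a stopping time is
  contained in this completion, but not necessarily in \<open>sets M0\<close>.\<close>

definition Pbar :: "'w measure \<Rightarrow> (real ^ 'n \<Rightarrow> 'w measure) \<Rightarrow> (real \<Rightarrow> 'w \<Rightarrow> real ^ 'n)
    \<Rightarrow> real ^ 'n \<Rightarrow> 'w measure" where
  "Pbar M0 P X x = completion (restr_to_subalg (P x) (N_infty M0 X))"

text \<open>The value \<open>f (x\<^bsub>\<tau>+t\<^esub>)\<close> on \<open>{\<tau> < \<infinity>}\<close>, extended by 0. As \<open>{\<tau> < \<infinity>}\<close> belongs to the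
  sigma-field at \<open>\<tau>\<close>, the extension does not affect its conditional expectation on that event.\<close>

definition value_after :: "(real \<Rightarrow> 'w \<Rightarrow> real ^ 'n) \<Rightarrow> ('w \<Rightarrow> ennreal) \<Rightarrow> real
    \<Rightarrow> (real ^ 'n \<Rightarrow> real) \<Rightarrow> 'w \<Rightarrow> real" where
  "value_after X \<tau> t f \<omega> = (if \<tau> \<omega> < \<infinity> then f (X (enn2real (\<tau> \<omega>) + t) \<omega>) else 0)"

end

theory Submission
  imports Defs
begin

text \<open>
  The law of the process is only assumed to be Markov, and its strong form would follow if \<open>x \<mapsto> E\<^sub>x f(x\<^sub>t)\<close> were
  continuous. What is accessible instead is the continuity of \<open>x \<mapsto> E\<^sub>x \<integral> f(x\<^sub>s) ds\<close> over \<open>[0, r]\<close>, and it suffices: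
  approximate \<open>\<tau>\<close> from above by discrete times, pass to the limit in the Markov property integrated over
  \<open>[0, r]\<close>, and differentiate in \<open>r\<close>, both sides being continuous in time for continuous \<open>f\<close>.

  The continuity is a Krylov--Safonov argument on occupation measures. The Krylov estimate in \<open>L\<^sub>d\<close> uses Dynkin's
  formula for mollified convex piecewise linear functions whose subdifferentials have prescribed volumes, so
  that no Monge--Ampere equation is solved; arithmetic-geometric means bound the generator from below.
  The drift term is absorbed on small cubes, where its \<open>L\<^sub>d\<close> norm is small. A barrier then shows that a set nearly
  filling a cube is visited for a definite time, a Calderon--Zygmund covering propagates this to sets of half
  density, and the oscillation of the time-integrated expectation decays.
\<close>

text \<open>The usual Krylov-Safonov argument stops the process when it leaves a ball, and
  restarting it there already presupposes the strong Markov property. Every estimate is therefore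
  made at deterministic times: occupation measures over \<open>[0, t]\<close> with \<open>t\<close>
  comparable to the square of the scale, chained by Chapman-Kolmogorov, and the probability of being
  outside a ball at a fixed time in place of an exit time. The role of harmonicity is played by
  almost invariance: if \<open>u(x)\<close> is the time-integrated expectation of a function with
  values in \<open>[0, 1]\<close>, then averaging \<open>u\<close> over the law at time
  \<open>s\<close> changes it by at most \<open>s\<close>, since the two quantities differ by
  integrals over time intervals of length \<open>s\<close>. This error and the exit probabilities
  vanish with the scale, so the argument gives continuity but no modulus. In the Krylov estimate a
  slope cell of volume \<open>(h f)^n\<close> contains two slopes at distance
  \<open>h f / 4\<close>; this alone bounds the trace of the mollified Hessian from below by a
  multiple of \<open>f\<close>.\<close>

section \<open>Nonnegative symmetric matrices and consequences of ellipticity\<close>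

lemma symmetric_dot:
  fixes A :: "real ^ 'n ^ 'n"
  assumes "transpose A = A"
  shows "x \<bullet> (A *v y) = y \<bullet> (A *v x)"
proof -
  have "x \<bullet> (A *v y) = (x v* A) \<bullet> y" by (simp add: dot_lmul_matrix)
  also have "\<dots> = (A *v x) \<bullet> y" using assms by (metis transpose_matrix_vector)
  finally show ?thesis by (simp add: inner_commute)
qed

definition psd :: "real ^ 'n ^ 'n \<Rightarrow> bool" where
  "psd A \<longleftrightarrow> transpose A = A \<and> (\<forall>v. 0 \<le> v \<bullet> (A *v v))"

text \<open>The form at \<open>u + t v\<close> is a nonnegative quadratic polynomial in
  \<open>t\<close>, so its discriminant is not positive; if the leading coefficient \<open>s\<close>
  vanishes, the polynomial is affine and \<open>r\<close> must vanish too.\<close>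

lemma psd_Cauchy_Schwarz:
  assumes "psd A"
  shows "(u \<bullet> (A *v v))\<^sup>2 \<le> (u \<bullet> (A *v u)) * (v \<bullet> (A *v v))"
proof -
  have q: "0 \<le> u \<bullet> (A *v u) + 2 * t * (u \<bullet> (A *v v)) + t\<^sup>2 * (v \<bullet> (A *v v))" for t
  proof -
    have "0 \<le> (u + t *\<^sub>R v) \<bullet> (A *v (u + t *\<^sub>R v))" using assms by (simp add: psd_def)
    also have "\<dots> = u \<bullet> (A *v u) + t * (u \<bullet> (A *v v)) + t * (v \<bullet> (A *v u)) + t\<^sup>2 * (v \<bullet> (A *v v))"
      by (simp add: matrix_vector_right_distrib matrix_vector_mult_scaleR inner_add_left inner_add_right
          power2_eq_square algebra_simps)
    also have "v \<bullet> (A *v u) = u \<bullet> (A *v v)" using assms by (simp add: psd_def symmetric_dot)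
    finally show ?thesis by simp
  qed
  define p r s where "p = u \<bullet> (A *v u)" and "r = u \<bullet> (A *v v)" and "s = v \<bullet> (A *v v)"
  have q': "0 \<le> p + 2 * t * r + t\<^sup>2 * s" for t using q by (simp add: p_def r_def s_def)
  have s0: "0 \<le> s" using assms by (simp add: psd_def s_def)
  have "r\<^sup>2 \<le> p * s"
  proof (cases "s = 0")
    case True
    have "r = 0"
    proof (rule ccontr)
      assume r: "r \<noteq> 0"
      \<comment> \<open>This \<open>t\<close> makes the affine polynomial equal to
        \<open>-1\<close>.\<close>
      have "0 \<le> p + 2 * (- (p + 1) / (2 * r)) * r" using q'[of "- (p + 1) / (2 * r)"] True by simp
      also have "2 * (- (p + 1) / (2 * r)) * r = - (p + 1)" using r by (simp add: field_simps)
      finally show False by simp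
    qed
    then show ?thesis using True by simp
  next
    case False
    have "0 \<le> p + 2 * (- r / s) * r + (- r / s)\<^sup>2 * s" by (rule q')
    also have "\<dots> = p - r\<^sup>2 / s" using False by (simp add: power2_eq_square field_simps)
    finally show ?thesis using False s0 by (simp add: field_simps)
  qed
  then show ?thesis by (simp add: p_def r_def s_def)
qed

lemma psd_kernel:
  assumes "psd A" "v \<bullet> (A *v v) = 0"
  shows "A *v v = 0"
proof -
  have "((A *v v) \<bullet> (A *v v))\<^sup>2 \<le> 0"
    using psd_Cauchy_Schwarz[OF assms(1), of "A *v v" v] assms(2) by simp
  then show ?thesis by simp
qed

text \<open>Induction on the rank, without eigenvectors: for \<open>v\<close> with positive form,
  subtract the square of \<open>w = A v / sqrt (v . A v)\<close>. Cauchy-Schwarz keeps the remainder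
  nonnegative, and its kernel contains that of \<open>A\<close> and also \<open>v\<close>.\<close>

lemma psd_sum_rank_one:
  assumes "psd A"
  shows "\<exists>(\<sigma> :: nat \<Rightarrow> real ^ 'n) m. \<forall>i j. A $ i $ j = (\<Sum>k<m. \<sigma> k $ i * \<sigma> k $ j)"
  using assms
proof (induction "CARD('n) - dim {v. A *v v = 0}" arbitrary: A rule: less_induct)
  case less
  note sym = symmetric_dot[of A]
  show ?case
  proof (cases "\<forall>v. v \<bullet> (A *v v) = 0")
    case True
    then have "A *v v = 0 *v v" for v using psd_kernel[OF less.prems] by simp
    then have "A = 0" by (simp add: matrix_eq)
    then show ?thesis by (intro exI[of _ "\<lambda>_. 0"] exI[of _ 0]) simp
  next
    case False
    then obtain v where v: "v \<bullet> (A *v v) \<noteq> 0" by auto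
    define s where "s = v \<bullet> (A *v v)"
    have s: "s > 0" using v less.prems unfolding s_def psd_def by (metis less_eq_real_def)
    define w where "w = (1 / sqrt s) *\<^sub>R (A *v v)"
    define B :: "real ^ 'n ^ 'n" where "B = (\<chi> i j. A $ i $ j - w $ i * w $ j)"
    have "(B *v x) $ i = (A *v x) $ i - (w \<bullet> x) * w $ i" for x i
    proof -
      have "(B *v x) $ i = (\<Sum>j\<in>UNIV. A $ i $ j * x $ j) - (\<Sum>j\<in>UNIV. w $ i * (w $ j * x $ j))"
        by (simp add: B_def matrix_vector_mult_def left_diff_distrib sum_subtractf mult.assoc)
      also have "(\<Sum>j\<in>UNIV. w $ i * (w $ j * x $ j)) = (w \<bullet> x) * w $ i"
        by (simp add: inner_vec_def sum_distrib_left[symmetric])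
      finally show ?thesis by (simp add: matrix_vector_mult_def)
    qed
    then have Bv: "B *v x = A *v x - (w \<bullet> x) *\<^sub>R w" for x by (simp add: vec_eq_iff)
    have wx: "(w \<bullet> x)\<^sup>2 = (x \<bullet> (A *v v))\<^sup>2 / s" for x
      using s by (simp add: w_def power_divide inner_commute)
    have Bpsd: "psd B"
      unfolding psd_def
    proof
      show "transpose B = B"
        using less.prems by (simp add: psd_def B_def transpose_def vec_eq_iff)
      show "\<forall>x. 0 \<le> x \<bullet> (B *v x)"
      proof
        fix x
        have "x \<bullet> (B *v x) = x \<bullet> (A *v x) - (w \<bullet> x)\<^sup>2"
          by (simp add: Bv inner_diff_right power2_eq_square inner_commute)
        moreover have "(w \<bullet> x)\<^sup>2 \<le> x \<bullet> (A *v x)"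
          unfolding wx using psd_Cauchy_Schwarz[OF less.prems, of x v] s
          by (simp add: divide_le_eq s_def)
        ultimately show "0 \<le> x \<bullet> (B *v x)" by simp
      qed
    qed
    have trA: "transpose A = A" using less.prems by (simp add: psd_def)
    have wv: "w \<bullet> v = sqrt s"
    proof -
      have "w \<bullet> v = s / sqrt s" by (simp add: w_def s_def inner_commute)
      then show ?thesis using s by (simp add: real_div_sqrt)
    qed
    have sub: "{x. A *v x = 0} \<subseteq> {x. B *v x = 0}"
    proof safe
      fix x assume "A *v x = 0"
      moreover have "w \<bullet> x = 0"
        using sym[OF trA, of v x] \<open>A *v x = 0\<close> by (simp add: w_def inner_commute)
      ultimately show "B *v x = 0" by (simp add: Bv)
    qed
    have "B *v v = 0"
      unfolding Bv wv using s by (simp add: w_def)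
    moreover have "A *v v \<noteq> 0" using v by auto
    ultimately have psub: "{x. A *v x = 0} \<subset> {x. B *v x = 0}" using sub by auto
    have subsp: "subspace {x. M *v x = 0}" for M :: "real ^ 'n ^ 'n"
      by (auto simp: subspace_def matrix_vector_right_distrib matrix_vector_mult_scaleR)
    have "dim {x. A *v x = 0} < dim {x. B *v x = 0}"
      by (rule dim_psubset) (use psub subsp in \<open>simp add: span_eq_iff[THEN iffD2]\<close>)
    moreover have "dim {x. B *v x = 0} \<le> CARD('n)" using dim_subset_UNIV[of "{x. B *v x = 0}"] by simp
    ultimately have "CARD('n) - dim {x. B *v x = 0} < CARD('n) - dim {x. A *v x = 0}" by linarith
    from less.hyps[OF this Bpsd] obtain \<sigma> :: "nat \<Rightarrow> real ^ 'n" and m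
      where IH: "\<forall>i j. B $ i $ j = (\<Sum>k<m. \<sigma> k $ i * \<sigma> k $ j)" by blast
    have "A $ i $ j = (\<Sum>k<Suc m. (\<sigma>(m := w)) k $ i * (\<sigma>(m := w)) k $ j)" for i j
      using IH[rule_format, of i j] by (simp add: B_def)
    then show ?thesis by blast
  qed
qed

text \<open>With \<open>A\<close> a sum of squares of vectors \<open>\<sigma> k\<close>, the double
  sum becomes the sum of the values of the form of \<open>H\<close> at these vectors.\<close>

lemma psd_product_nonneg:
  fixes A H :: "real ^ 'n ^ 'n"
  assumes "psd A" and H: "\<And>v. 0 \<le> v \<bullet> (H *v v)"
  shows "0 \<le> (\<Sum>i\<in>UNIV. \<Sum>j\<in>UNIV. A $ i $ j * H $ i $ j)"
proof -
  obtain \<sigma> m where s: "\<And>i j. A $ i $ j = (\<Sum>k<(m::nat). \<sigma> k $ i * \<sigma> k $ j)"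
    using psd_sum_rank_one[OF assms(1)] by blast
  have "(\<Sum>i\<in>UNIV. \<Sum>j\<in>UNIV. A $ i $ j * H $ i $ j)
      = (\<Sum>i\<in>UNIV. \<Sum>j\<in>UNIV. \<Sum>k<m. \<sigma> k $ i * (H $ i $ j * \<sigma> k $ j))"
    unfolding s sum_distrib_right by (intro sum.cong refl) (simp only: mult.assoc mult.commute[of "H $ _ $ _"])
  also have "\<dots> = (\<Sum>i\<in>UNIV. \<Sum>k<m. \<Sum>j\<in>UNIV. \<sigma> k $ i * (H $ i $ j * \<sigma> k $ j))"
    by (intro sum.cong refl sum.swap)
  also have "\<dots> = (\<Sum>k<m. \<Sum>i\<in>UNIV. \<Sum>j\<in>UNIV. \<sigma> k $ i * (H $ i $ j * \<sigma> k $ j))"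
    by (rule sum.swap)
  also have "\<dots> = (\<Sum>k<m. \<sigma> k \<bullet> (H *v \<sigma> k))"
    unfolding inner_vec_def matrix_vector_mult_def inner_real_def vec_lambda_beta sum_distrib_left by (rule refl)
  finally show ?thesis using H by (simp add: sum_nonneg)
qed

text \<open>At a minimiser \<open>v\<close> of the form on the unit sphere, with minimum
  \<open>c\<close>, the matrix \<open>A - c I\<close> is nonnegative and its form vanishes at
  \<open>v\<close>; hence \<open>v\<close> lies in its kernel.\<close>

lemma min_Rayleigh_eigenvalue:
  fixes A :: "real ^ 'n ^ 'n"
  assumes tr: "transpose A = A"
  shows "\<exists>c v. v \<noteq> 0 \<and> A *v v = c *\<^sub>R v \<and> (\<forall>w. c * (w \<bullet> w) \<le> w \<bullet> (A *v w))"
proof -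
  have ne: "sphere (0::real ^ 'n) 1 \<noteq> {}" by simp
  have cont: "continuous_on (sphere 0 1) (\<lambda>v. v \<bullet> (A *v v))"
    by (intro continuous_intros matrix_vector_mult_linear_continuous_on)
  obtain v where v: "v \<in> sphere 0 1" and min: "\<And>w. w \<in> sphere 0 1 \<Longrightarrow> v \<bullet> (A *v v) \<le> w \<bullet> (A *v w)"
    using continuous_attains_inf[OF compact_sphere ne cont] by auto
  define c where "c = v \<bullet> (A *v v)"
  have ge: "c * (w \<bullet> w) \<le> w \<bullet> (A *v w)" for w
  proof (cases "w = 0")
    case False
    have "c \<le> (inverse (norm w) *\<^sub>R w) \<bullet> (A *v (inverse (norm w) *\<^sub>R w))"
      unfolding c_def using False by (intro min) simp
    also have "\<dots> = (w \<bullet> (A *v w)) / (w \<bullet> w)"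
      using False by (simp add: matrix_vector_mult_scaleR power2_norm_eq_inner[symmetric] power2_eq_square divide_inverse)
    finally show ?thesis using False by (simp add: le_divide_eq)
  qed simp
  define B where "B = A - c *\<^sub>R mat 1"
  have Bv: "B *v w = A *v w - c *\<^sub>R w" for w
    by (simp add: B_def matrix_vector_mult_diff_rdistrib scaleR_matrix_vector_assoc[symmetric])
  have "psd B"
    unfolding psd_def
  proof
    show "transpose B = B"
      using tr by (auto simp add: B_def transpose_def vec_eq_iff mat_def)
    show "\<forall>w. 0 \<le> w \<bullet> (B *v w)" using ge by (simp add: Bv inner_diff_right)
  qed
  moreover have "v \<bullet> (B *v v) = 0"
    using v by (simp add: Bv inner_diff_right c_def power2_norm_eq_inner[symmetric])
  ultimately have "B *v v = 0" by (rule psd_kernel)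
  then have "A *v v = c *\<^sub>R v" by (simp add: Bv)
  moreover have "v \<noteq> 0" using v by auto
  ultimately show ?thesis using ge by blast
qed

text \<open>\<open>sym_elliptic\<close> speaks of eigenvalues only. The smallest value of the form
  of \<open>A\<close>, and of that of \<open>-A\<close>, is attained at an eigenvector, which turns
  the spectral condition into bounds for the form.\<close>

lemma sym_elliptic_bounds:
  fixes A :: "real ^ 'n ^ 'n"
  assumes "A \<in> sym_elliptic \<delta>"
  shows "\<delta> * (w \<bullet> w) \<le> w \<bullet> (A *v w)" "w \<bullet> (A *v w) \<le> (w \<bullet> w) / \<delta>"
proof -
  have tr: "transpose A = A" and ev: "\<And>c v. v \<noteq> 0 \<Longrightarrow> A *v v = c *\<^sub>R v \<Longrightarrow> \<delta> \<le> c \<and> c \<le> 1 / \<delta>"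
    using assms by (auto simp: sym_elliptic_def)
  obtain c v where c: "v \<noteq> 0" "A *v v = c *\<^sub>R v" "\<And>w. c * (w \<bullet> w) \<le> w \<bullet> (A *v w)"
    using min_Rayleigh_eigenvalue[OF tr] by blast
  have "\<delta> * (w \<bullet> w) \<le> c * (w \<bullet> w)" using ev[OF c(1,2)] by (intro mult_right_mono) auto
  then show "\<delta> * (w \<bullet> w) \<le> w \<bullet> (A *v w)" using c(3)[of w] by simp
  have "transpose (- A) = - A" using tr by (simp add: transpose_def vec_eq_iff)
  then obtain c v where c: "v \<noteq> 0" "- A *v v = c *\<^sub>R v" "\<And>w. c * (w \<bullet> w) \<le> w \<bullet> (- A *v w)"
    using min_Rayleigh_eigenvalue by blast
  have neg: "- A *v x = - (A *v x)" for x
    using matrix_vector_mult_diff_rdistrib[of 0 A x] by simp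
  have "A *v v = (- c) *\<^sub>R v" using c(2) by (metis neg minus_minus scaleR_minus_left)
  then have "- c \<le> 1 / \<delta>" using ev[OF c(1)] by blast
  then have "- c * (w \<bullet> w) \<le> 1 / \<delta> * (w \<bullet> w)" by (intro mult_right_mono) auto
  then show "w \<bullet> (A *v w) \<le> (w \<bullet> w) / \<delta>" using c(3)[of w] by (simp add: neg)
qed

lemma sym_elliptic_psd:
  fixes A :: "real ^ 'n ^ 'n"
  assumes "A \<in> sym_elliptic \<delta>"
  shows "psd (A - \<delta> *\<^sub>R mat 1)"
  unfolding psd_def
proof
  have tr: "transpose A = A" using assms by (auto simp: sym_elliptic_def)
  show "transpose (A - \<delta> *\<^sub>R mat 1) = A - \<delta> *\<^sub>R mat 1"
    using tr by (auto simp add: transpose_def vec_eq_iff mat_def)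
  show "\<forall>w. 0 \<le> w \<bullet> ((A - \<delta> *\<^sub>R mat 1) *v w)"
    using sym_elliptic_bounds(1)[OF assms]
    by (simp add: matrix_vector_mult_diff_rdistrib scaleR_matrix_vector_assoc[symmetric] inner_diff_right)
qed

text \<open>\<open>A - \<delta> I\<close> is nonnegative and is paired with \<open>H\<close>. For
  \<open>H\<close> the Hessian of a convex function this bounds the second order part of the
  generator below by a multiple of the Laplacian.\<close>

lemma sym_elliptic_trace_ge:
  fixes A H :: "real ^ 'n ^ 'n"
  assumes "A \<in> sym_elliptic \<delta>" and H: "\<And>v. 0 \<le> v \<bullet> (H *v v)"
  shows "\<delta> * (\<Sum>i\<in>UNIV. H $ i $ i) \<le> (\<Sum>i\<in>UNIV. \<Sum>j\<in>UNIV. A $ i $ j * H $ i $ j)"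
proof -
  have "0 \<le> (\<Sum>i\<in>UNIV. \<Sum>j\<in>UNIV. (A - \<delta> *\<^sub>R mat 1) $ i $ j * H $ i $ j)"
    by (rule psd_product_nonneg[OF sym_elliptic_psd[OF assms(1)] H])
  also have "\<dots> = (\<Sum>i\<in>UNIV. (\<Sum>j\<in>UNIV. A $ i $ j * H $ i $ j) - \<delta> * H $ i $ i)"
    by (rule sum.cong[OF refl]) (simp add: mat_def left_diff_distrib sum_subtractf if_distrib[of "\<lambda>x. \<delta> * x * _"]
      if_distrib[of "\<lambda>x. x * _"] cong: if_cong)
  also have "\<dots> = (\<Sum>i\<in>UNIV. \<Sum>j\<in>UNIV. A $ i $ j * H $ i $ j) - \<delta> * (\<Sum>i\<in>UNIV. H $ i $ i)"
    by (simp add: sum_subtractf sum_distrib_left)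
  finally show ?thesis by simp
qed

text \<open>Cauchy-Schwarz for the form of \<open>A\<close>, applied to two coordinate
  vectors.\<close>

lemma sym_elliptic_entry_le:
  fixes A :: "real ^ 'n ^ 'n"
  assumes "A \<in> sym_elliptic \<delta>" and \<delta>: "0 < \<delta>"
  shows "\<bar>A $ i $ j\<bar> \<le> 1 / \<delta>"
proof -
  have nn: "0 \<le> v \<bullet> (A *v v)" for v
    by (rule order_trans[OF _ sym_elliptic_bounds(1)[OF assms(1)]]) (use \<delta> in simp)
  then have "psd A" using assms(1) by (auto simp: psd_def sym_elliptic_def)
  then have "(axis i 1 \<bullet> (A *v axis j 1))\<^sup>2 \<le> (axis i 1 \<bullet> (A *v axis i 1)) * (axis j 1 \<bullet> (A *v axis j 1))"
    by (rule psd_Cauchy_Schwarz)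
  also have "\<dots> \<le> (1 / \<delta>) * (1 / \<delta>)"
    using nn sym_elliptic_bounds(2)[OF assms(1), of "axis _ 1"] \<delta>
    by (intro mult_mono) (auto simp: inner_axis_axis)
  also have "\<dots> = (1 / \<delta>)\<^sup>2" by (simp add: power2_eq_square)
  finally have "\<bar>axis i 1 \<bullet> (A *v axis j 1)\<bar> \<le> \<bar>1 / \<delta>\<bar>" by (simp only: abs_le_square_iff)
  then show ?thesis using \<delta> by (simp add: matrix_vector_mul_component inner_axis' inner_axis)
qed

section \<open>Explicit test functions\<close>

text \<open>Gradient and Hessian are carried along as explicit functions, so that \<open>Lop\<close>
  of products and convolutions is computed by algebra. The partial derivatives in
  \<open>C1_fun\<close> are read off afterwards.\<close>

definition C2_data :: "(real ^ 'n \<Rightarrow> real) \<Rightarrow> (real ^ 'n \<Rightarrow> real ^ 'n) \<Rightarrow> (real ^ 'n \<Rightarrow> real ^ 'n ^ 'n) \<Rightarrow> bool" where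
  "C2_data u g H \<longleftrightarrow> (\<forall>x. (u has_derivative (\<lambda>v. g x \<bullet> v)) (at x)) \<and>
     (\<forall>x. (g has_derivative (\<lambda>v. H x *v v)) (at x)) \<and> continuous_on UNIV H"

lemma partial_deriv:
  fixes u :: "real ^ 'n \<Rightarrow> real"
  assumes "(u has_derivative (\<lambda>v. l \<bullet> v)) (at x)"
  shows "((\<lambda>h. u (x + h *\<^sub>R axis i 1)) has_real_derivative l $ i) (at 0)"
    and "pd i u x = l $ i"
proof -
  have "((\<lambda>h::real. x + h *\<^sub>R axis i 1) has_derivative (\<lambda>h. h *\<^sub>R axis i 1)) (at 0)"
    by (auto intro!: derivative_eq_intros)
  moreover have "(u has_derivative (\<lambda>v. l \<bullet> v)) (at (x + 0 *\<^sub>R axis i 1))" using assms by simp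
  ultimately have "((\<lambda>h. u (x + h *\<^sub>R axis i 1)) has_derivative (\<lambda>h. l \<bullet> (h *\<^sub>R axis i 1))) (at 0)"
    by (rule has_derivative_compose[where g = u])
  then show *: "((\<lambda>h. u (x + h *\<^sub>R axis i 1)) has_real_derivative l $ i) (at 0)"
    by (rule has_derivative_imp_has_field_derivative) (simp add: inner_axis)
  show "pd i u x = l $ i" unfolding pd_def by (rule DERIV_imp_deriv[OF *])
qed

text \<open>Row \<open>j\<close> of \<open>H\<close> is the gradient of the \<open>j\<close>-th
  partial derivative. As \<open>C2_data\<close> does not include symmetry of \<open>H\<close>, the
  order of the indices matters, here and in \<open>Lop_C2_data\<close>.\<close>

lemma C2_data_pd:
  assumes "C2_data u g H"
  shows "pd i u x = g x $ i" "pd i (pd j u) x = H x $ j $ i"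
proof -
  have 1: "pd j u = (\<lambda>x. g x $ j)" for j
    using assms partial_deriv(2)[of u "g _"] by (auto simp: C2_data_def)
  then show "pd i u x = g x $ i" by simp
  have "(g has_derivative (\<lambda>v. H x *v v)) (at x)" using assms by (simp add: C2_data_def)
  then have "((\<lambda>x. g x $ j) has_derivative (\<lambda>v. (H x *v v) $ j)) (at x)"
    by (rule bounded_linear.has_derivative[OF bounded_linear_vec_nth])
  then have "((\<lambda>x. g x $ j) has_derivative (\<lambda>v. H x $ j \<bullet> v)) (at x)"
    by (simp add: matrix_vector_mul_component)
  then show "pd i (pd j u) x = H x $ j $ i" unfolding 1 by (rule partial_deriv)
qed

lemma C2_data_continuous:
  assumes "C2_data u g H"
  shows "continuous_on S u" "continuous_on S g" "continuous_on S H"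
  using assms unfolding C2_data_def
  by (meson continuous_at_imp_continuous_on has_derivative_continuous continuous_on_subset subset_UNIV)+

text \<open>The link to the class of test functions for which a quasi-diffusion satisfies its
  integral identity.\<close>

lemma C2_data_imp_C2c_fun:
  fixes u :: "real ^ 'n \<Rightarrow> real"
  assumes u: "C2_data u g H" and z: "\<And>x. x \<notin> cball c r \<Longrightarrow> u x = 0"
  shows "C2c_fun u"
proof -
  have d: "(u has_derivative (\<lambda>v. g x \<bullet> v)) (at x)" for x using u by (simp add: C2_data_def)
  have pdu: "pd j u = (\<lambda>x. g x $ j)" for j using C2_data_pd(1)[OF u] by auto
  have d2: "((\<lambda>x. g x $ j) has_derivative (\<lambda>v. H x $ j \<bullet> v)) (at x)" for x j
  proof -
    have "(g has_derivative (\<lambda>v. H x *v v)) (at x)" using u by (simp add: C2_data_def)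
    then have "((\<lambda>x. g x $ j) has_derivative (\<lambda>v. (H x *v v) $ j)) (at x)"
      by (rule bounded_linear.has_derivative[OF bounded_linear_vec_nth])
    then show ?thesis by (simp add: matrix_vector_mul_component)
  qed
  have 1: "C1_fun u"
    unfolding C1_fun_def pdu
    using partial_deriv(1)[OF d] C2_data_continuous(2)[OF u]
    by (auto simp: real_differentiable_def intro!: continuous_intros)
  have "C1_fun (pd j u)" for j
  proof -
    have "pd i (\<lambda>x. g x $ j) = (\<lambda>x. H x $ j $ i)" for i using C2_data_pd(2)[OF u] by (auto simp: pdu)
    moreover have "(\<lambda>h. g (x + h *\<^sub>R axis i 1) $ j) differentiable (at 0)" for x i
      using partial_deriv(1)[OF d2] unfolding real_differentiable_def by blast
    ultimately show ?thesis
      unfolding C1_fun_def pdu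
      using C2_data_continuous(3)[OF u] by (auto intro!: continuous_intros)
  qed
  moreover have "compact (closure {x. u x \<noteq> 0})"
  proof -
    have "{x. u x \<noteq> 0} \<subseteq> cball c r" using z by blast
    then show ?thesis by (meson bounded_cball bounded_subset compact_closure)
  qed
  ultimately show ?thesis using 1 by (simp add: C2c_fun_def)
qed

lemma Lop_C2_data:
  assumes "C2_data u g H"
  shows "Lop a b u x = (1/2) * (\<Sum>i\<in>UNIV. \<Sum>j\<in>UNIV. a x $ i $ j * H x $ j $ i) + b x \<bullet> g x"
  by (simp add: Lop_def C2_data_pd[OF assms] inner_vec_def)

lemma C2_data_mult:
  fixes u1 u2 :: "real ^ 'n \<Rightarrow> real"
  assumes 1: "C2_data u1 g1 H1" and 2: "C2_data u2 g2 H2"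
  shows "C2_data (\<lambda>x. u1 x * u2 x) (\<lambda>x. u1 x *\<^sub>R g2 x + u2 x *\<^sub>R g1 x)
     (\<lambda>x. u1 x *\<^sub>R H2 x + u2 x *\<^sub>R H1 x + (\<chi> i j. g1 x $ i * g2 x $ j + g2 x $ i * g1 x $ j))"
proof -
  have d: "(u1 has_derivative (\<lambda>v. g1 x \<bullet> v)) (at x)" "(u2 has_derivative (\<lambda>v. g2 x \<bullet> v)) (at x)"
     "(g1 has_derivative (\<lambda>v. H1 x *v v)) (at x)" "(g2 has_derivative (\<lambda>v. H2 x *v v)) (at x)" for x
    using assms by (auto simp: C2_data_def)
  have e: "(\<chi> i j. p $ i * q $ j + q $ i * p $ j) *v v = (q \<bullet> v) *\<^sub>R p + (p \<bullet> v) *\<^sub>R q" for p q v :: "real ^ 'n"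
    by (simp add: vec_eq_iff matrix_vector_mult_def inner_vec_def sum_distrib_left sum_distrib_right
        sum.distrib algebra_simps)
  show ?thesis
    unfolding C2_data_def
  proof (intro conjI allI)
    fix x
    show "((\<lambda>x. u1 x * u2 x) has_derivative (\<lambda>v. (u1 x *\<^sub>R g2 x + u2 x *\<^sub>R g1 x) \<bullet> v)) (at x)"
      by (rule has_derivative_eq_rhs[OF has_derivative_mult[OF d(1,2)]])
        (auto simp: inner_add_left)
    show "((\<lambda>x. u1 x *\<^sub>R g2 x + u2 x *\<^sub>R g1 x) has_derivative
       (\<lambda>v. (u1 x *\<^sub>R H2 x + u2 x *\<^sub>R H1 x + (\<chi> i j. g1 x $ i * g2 x $ j + g2 x $ i * g1 x $ j)) *v v)) (at x)"
      by (rule has_derivative_eq_rhs[OF has_derivative_add[OF has_derivative_scaleR[OF d(1,4)] has_derivative_scaleR[OF d(2,3)]]])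
        (simp add: fun_eq_iff matrix_vector_mult_add_rdistrib e scaleR_matrix_vector_assoc[symmetric] add_ac)
    show "continuous_on UNIV (\<lambda>x. u1 x *\<^sub>R H2 x + u2 x *\<^sub>R H1 x + (\<chi> i j. g1 x $ i * g2 x $ j + g2 x $ i * g1 x $ j))"
      by (intro continuous_intros C2_data_continuous[OF 1] C2_data_continuous[OF 2])
  qed
qed

section \<open>Radial bump functions and their derivatives\<close>

definition pospow :: "nat \<Rightarrow> real \<Rightarrow> real" where
  "pospow k s = (max 0 s) ^ k"

text \<open>At 0 the difference quotient is at most \<open>\<bar>h\<bar>\<close> for small
  \<open>h\<close>, because the exponent is at least 2; elsewhere the function is locally a power or
  zero.\<close>

lemma pospow_deriv:
  assumes "k \<ge> 2"
  shows "(pospow k has_real_derivative real k * pospow (k - 1) s) (at s)"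
proof -
  consider "s > 0" | "s < 0" | "s = 0" by linarith
  then show ?thesis
  proof cases
    case 1
    have "((\<lambda>s. s ^ k) has_real_derivative real k * s ^ (k - 1)) (at s)"
      by (auto intro!: derivative_eq_intros)
    moreover have "eventually (\<lambda>s. s ^ k = pospow k s) (nhds s)"
      using 1 eventually_nhds_in_open[of "{0<..}" s] by (auto elim!: eventually_mono simp: pospow_def max_def)
    ultimately have "(pospow k has_real_derivative real k * s ^ (k - 1)) (at s)"
      by (subst (asm) DERIV_cong_ev[OF refl _ refl]) auto
    then show ?thesis using 1 by (simp add: pospow_def max_def)
  next
    case 2
    have "((\<lambda>s. 0) has_real_derivative 0) (at s)" by simp
    moreover have "eventually (\<lambda>s. 0 = pospow k s) (nhds s)"
      using 2 eventually_nhds_in_open[of "{..<0}" s] assms by (auto elim!: eventually_mono simp: pospow_def max_def)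
    ultimately have "(pospow k has_real_derivative 0) (at s)"
      by (subst (asm) DERIV_cong_ev[OF refl _ refl]) auto
    then show ?thesis using 2 assms by (simp add: pospow_def max_def power_0_left)
  next
    case 3
    have "((\<lambda>h. pospow k h / h) \<longlongrightarrow> 0) (at 0)"
    proof (rule Lim_null_comparison)
      have "norm (pospow k h / h) \<le> \<bar>h\<bar>" if "\<bar>h\<bar> < 1" for h :: real
      proof (cases "h > 0")
        case True
        have "h ^ k \<le> h ^ 2" using True that assms by (intro power_decreasing) auto
        then show ?thesis using True by (simp add: pospow_def max_def divide_le_eq power2_eq_square)
      qed (use assms in \<open>simp add: pospow_def max_def power_0_left\<close>)
      moreover have "eventually (\<lambda>h. h \<in> ball 0 1) (at (0::real))"
        by (rule eventually_at_in_open') auto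
      ultimately show "eventually (\<lambda>h. norm (pospow k h / h) \<le> \<bar>h\<bar>) (at 0)"
        by (auto elim!: eventually_mono)
      show "((\<lambda>h::real. \<bar>h\<bar>) \<longlongrightarrow> 0) (at 0)" by (auto intro!: tendsto_eq_intros)
    qed
    then show ?thesis using 3 assms by (simp add: DERIV_def pospow_def power_0_left)
  qed
qed

lemma pospow_cont: "continuous_on S (pospow k)"
  unfolding pospow_def by (intro continuous_intros)

lemma pospow_nonneg [simp]: "0 \<le> pospow k s" by (simp add: pospow_def)

lemma pospow_le1: "s \<le> 1 \<Longrightarrow> pospow k s \<le> 1" by (simp add: pospow_def power_le_one)

text \<open>Exponent 3 gives a C2 function and serves for cutoffs and mollifiers, exponent 2 is the
  weight in the lower bound for the Laplacian, and a large exponent gives the barrier.\<close>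

definition bump :: "nat \<Rightarrow> real ^ 'n \<Rightarrow> real \<Rightarrow> real ^ 'n \<Rightarrow> real" where
  "bump k c R x = pospow k (1 - (norm (x - c))\<^sup>2 / R\<^sup>2)"

definition bump_grad :: "nat \<Rightarrow> real ^ 'n \<Rightarrow> real \<Rightarrow> real ^ 'n \<Rightarrow> real ^ 'n" where
  "bump_grad k c R x = (- (2 * real k / R\<^sup>2) * pospow (k - 1) (1 - (norm (x - c))\<^sup>2 / R\<^sup>2)) *\<^sub>R (x - c)"

text \<open>A nonnegative radial part of rank one minus a multiple of the identity. The first grows
  like \<open>k^2\<close>, the second like \<open>k\<close>; this is why a large exponent makes a
  subsolution away from the centre.\<close>

definition bump_hess :: "nat \<Rightarrow> real ^ 'n \<Rightarrow> real \<Rightarrow> real ^ 'n \<Rightarrow> real ^ 'n ^ 'n" where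
  "bump_hess k c R x =
     (\<chi> i j. 4 * real k * real (k - 1) / R ^ 4 * pospow (k - 2) (1 - (norm (x - c))\<^sup>2 / R\<^sup>2) * (x - c) $ i * (x - c) $ j
       - (if i = j then 2 * real k / R\<^sup>2 * pospow (k - 1) (1 - (norm (x - c))\<^sup>2 / R\<^sup>2) else 0))"

lemma rank_one_minus_scalar_mult:
  fixes y v :: "real ^ 'n"
  shows "(\<chi> i j. \<alpha> * y $ i * y $ j - (if i = j then \<beta> else 0)) *v v = (\<alpha> * (y \<bullet> v)) *\<^sub>R y - \<beta> *\<^sub>R v"
proof -
  have "(\<Sum>j\<in>UNIV. (\<alpha> * y $ i * y $ j - (if i = j then \<beta> else 0)) * v $ j) = \<alpha> * (y \<bullet> v) * y $ i - \<beta> * v $ i" for i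
  proof -
    have "(\<Sum>j\<in>UNIV. (\<alpha> * y $ i * y $ j - (if i = j then \<beta> else 0)) * v $ j)
       = (\<Sum>j\<in>UNIV. \<alpha> * y $ i * (y $ j * v $ j)) - (\<Sum>j\<in>UNIV. (if i = j then \<beta> * v $ j else 0))"
      unfolding sum_subtractf[symmetric] by (intro sum.cong refl) (simp add: left_diff_distrib)
    then show ?thesis by (simp add: inner_vec_def sum_distrib_left[symmetric])
  qed
  then show ?thesis by (simp add: vec_eq_iff matrix_vector_mult_def)
qed

lemma bump_hess_mult:
  "bump_hess k c R x *v v =
     (4 * real k * real (k - 1) / R ^ 4 * pospow (k - 2) (1 - (norm (x - c))\<^sup>2 / R\<^sup>2) * ((x - c) \<bullet> v)) *\<^sub>R (x - c)
      - (2 * real k / R\<^sup>2 * pospow (k - 1) (1 - (norm (x - c))\<^sup>2 / R\<^sup>2)) *\<^sub>R v"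
  unfolding bump_hess_def by (rule rank_one_minus_scalar_mult)

lemma bump_C2_data:
  fixes c :: "real ^ 'n"
  assumes k: "k \<ge> 3" and R: "0 < R"
  shows "C2_data (bump k c R) (bump_grad k c R) (bump_hess k c R)"
proof -
  define q where "q = (\<lambda>x::real^'n. 1 - ((x - c) \<bullet> (x - c)) / R\<^sup>2)"
  have qn: "1 - (norm (x - c))\<^sup>2 / R\<^sup>2 = q x" for x by (simp add: q_def power2_norm_eq_inner)
  have dq: "(q has_derivative (\<lambda>v. - 2 / R\<^sup>2 * ((x - c) \<bullet> v))) (at x)" for x
    unfolding q_def using R
    by (auto intro!: derivative_eq_intros simp: inner_commute field_simps fun_eq_iff)
  have dp: "((\<lambda>x. pospow k (q x)) has_derivative (\<lambda>v. real k * pospow (k - 1) (q x) * (- 2 / R\<^sup>2 * ((x - c) \<bullet> v)))) (at x)"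
    if "k \<ge> 2" for x k
    by (rule has_derivative_compose[OF dq pospow_deriv[OF that, unfolded has_field_derivative_def]])
  show ?thesis
    unfolding C2_data_def
  proof (intro conjI allI)
    fix x
    show "(bump k c R has_derivative (\<lambda>v. bump_grad k c R x \<bullet> v)) (at x)"
      unfolding bump_def[abs_def] bump_grad_def qn
      by (rule has_derivative_eq_rhs[OF dp]) (use k in \<open>simp_all add: fun_eq_iff\<close>)
    have k1: "k - 1 \<ge> 2" and k2: "k - 1 - 1 = k - 2" using k by simp_all
    have coef: "- (2 * real k / R\<^sup>2) * (real (k - 1) * p * (- 2 / R\<^sup>2 * d)) = 4 * real k * real (k - 1) / R ^ 4 * p * d"
      for p d using R by (simp add: field_simps power4_eq_xxxx power2_eq_square)
    have "((\<lambda>x. (- (2 * real k / R\<^sup>2) * pospow (k - 1) (q x)) *\<^sub>R (x - c)) has_derivative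
       (\<lambda>v. (- (2 * real k / R\<^sup>2) * pospow (k - 1) (q x)) *\<^sub>R v +
          (- (2 * real k / R\<^sup>2) * (real (k - 1) * pospow (k - 1 - 1) (q x) * (- 2 / R\<^sup>2 * ((x - c) \<bullet> v)))) *\<^sub>R (x - c))) (at x)"
      by (rule has_derivative_eq_rhs[OF has_derivative_scaleR[OF has_derivative_mult_right[OF dp[OF k1]] has_derivative_diff[OF has_derivative_ident has_derivative_const]]])
        auto
    then show "(bump_grad k c R has_derivative (\<lambda>v. bump_hess k c R x *v v)) (at x)"
      unfolding bump_grad_def[abs_def] bump_hess_mult qn
      by (rule has_derivative_eq_rhs) (simp only: k2, simp only: coef, simp)
  next
    have c: "continuous_on UNIV (\<lambda>x. pospow m (q x))" for m
      unfolding q_def by (rule continuous_on_compose2[OF pospow_cont]) (auto intro!: continuous_intros simp: divide_inverse)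
    have "continuous_on UNIV (\<lambda>x. if i = j then 2 * real k / R\<^sup>2 * pospow (k - 1) (q x) else 0)" for i j :: 'n
      using c R by (cases "i = j") (auto intro!: continuous_intros)
    then show "continuous_on UNIV (bump_hess k c R)"
      unfolding bump_hess_def[abs_def] qn by (intro continuous_intros c)
  qed
qed

lemma bump_nonneg [simp]: "0 \<le> bump k c R x" by (simp add: bump_def)

lemma bump_le1: "bump k c R x \<le> 1"
  unfolding bump_def by (rule pospow_le1) simp

lemma bump_zero:
  assumes "0 < R" "R \<le> norm (x - c)" "k \<ge> 1" shows "bump k c R x = 0"
proof -
  have "R\<^sup>2 \<le> (norm (x - c))\<^sup>2" using assms by (intro power_mono) auto
  then have "1 - (norm (x - c))\<^sup>2 / R\<^sup>2 \<le> 0" using assms by (simp add: le_divide_eq)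
  then show ?thesis using assms(3) by (auto simp: bump_def pospow_def max_def)
qed

section \<open>Convex functions with prescribed slope cells\<close>

abbreviation "vol \<equiv> measure lborel"

text \<open>The slopes for which \<open>x\<close> is a maximiser in the discrete Legendre transform
  of \<open>w\<close>. For \<open>x\<close> in \<open>I\<close> with a nonempty cell it is the
  subdifferential at \<open>x\<close> of the convex envelope of \<open>w\<close> on
  \<open>I\<close>, cut to \<open>B\<close>; in optimal transport it is a Laguerre cell.\<close>

definition slope_cell :: "(real ^ 'n) set \<Rightarrow> (real ^ 'n) set \<Rightarrow> (real ^ 'n \<Rightarrow> real) \<Rightarrow> real ^ 'n \<Rightarrow> (real ^ 'n) set" where
  "slope_cell B I w x = {p \<in> B. \<forall>y\<in>I. p \<bullet> y - w y \<le> p \<bullet> x - w x}"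

lemma slope_cell_compact:
  assumes "compact B" shows "compact (slope_cell B I w x)"
proof -
  have "slope_cell B I w x = B \<inter> (\<Inter>y\<in>I. {p. p \<bullet> y - w y \<le> p \<bullet> x - w x})"
    by (auto simp: slope_cell_def)
  moreover have "closed {p. p \<bullet> y - w y \<le> p \<bullet> x - w x}" for y
    by (intro closed_Collect_le continuous_intros)
  ultimately show ?thesis using assms by (auto intro!: compact_Int_closed)
qed

lemma slope_cell_cover:
  assumes "finite I" "I \<noteq> {}" shows "B = (\<Union>x\<in>I. slope_cell B I w x)"
proof safe
  fix p assume p: "p \<in> B"
  have "Max ((\<lambda>y. p \<bullet> y - w y) ` I) \<in> (\<lambda>y. p \<bullet> y - w y) ` I" using assms by (intro Max_in) auto
  then obtain x where x: "x \<in> I" "Max ((\<lambda>y. p \<bullet> y - w y) ` I) = p \<bullet> x - w x" by auto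
  have "p \<bullet> y - w y \<le> p \<bullet> x - w x" if "y \<in> I" for y
    using assms that unfolding x(2)[symmetric] by (intro Max_ge) auto
  then show "p \<in> (\<Union>x\<in>I. slope_cell B I w x)" using x p by (auto simp: slope_cell_def)
qed (auto simp: slope_cell_def)

lemma slope_cell_cover_measure:
  assumes "finite I" "I \<noteq> {}" "compact B"
  shows "vol B \<le> (\<Sum>x\<in>I. vol (slope_cell B I w x))"
proof -
  have fm: "slope_cell B I w x \<in> fmeasurable lborel" for x
    by (intro fmeasurable_compact slope_cell_compact assms)
  have "vol B = vol (\<Union>x\<in>I. slope_cell B I w x)"
    using slope_cell_cover[OF assms(1,2)] by metis
  also have "\<dots> \<le> (\<Sum>x\<in>I. vol (slope_cell B I w x))"
    using assms(1) fm by (intro measure_UNION_le) (auto dest: fmeasurableD simp del: sets_lborel)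
  finally show ?thesis .
qed

text \<open>Off the finitely many hyperplanes of slopes where \<open>x\<close> ties with another
  point, membership in \<open>B\<close> apart, the cell is decided by strict inequalities, which
  persist for nearby heights. Dominated convergence does the rest.\<close>

lemma slope_cell_measure_tendsto:
  fixes I :: "(real ^ 'n) set"
  assumes I: "finite I" "x \<in> I" and B: "compact B" and lim: "\<And>y. y \<in> I \<Longrightarrow> (\<lambda>n. v n y) \<longlonglongrightarrow> w y"
  shows "(\<lambda>n. vol (slope_cell B I (v n) x)) \<longlonglongrightarrow> vol (slope_cell B I w x)"
proof -
  have [measurable]: "slope_cell B I u x \<in> sets borel" for u by (intro borel_compact slope_cell_compact B)
  define Hy where "Hy = (\<Union>y\<in>I - {x}. {p. (y - x) \<bullet> p = w y - w x})"
  have "negligible Hy"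
    unfolding Hy_def using I by (intro negligible_Union) (auto intro!: negligible_hyperplane)
  then have "AE p in lebesgue. p \<notin> Hy" by (simp add: negligible_iff_null_sets AE_not_in)
  moreover have "Hy \<in> sets borel"
    unfolding Hy_def using I by (intro sets.finite_UN) (auto intro!: borel_closed closed_hyperplane)
  ultimately have AEH: "AE p in lborel. p \<notin> Hy"
    by (subst (asm) AE_completion_iff) auto
  have "(\<lambda>n. \<integral>p. indicator (slope_cell B I (v n) x) p \<partial>lborel) \<longlonglongrightarrow> (\<integral>p. indicator (slope_cell B I w x) p \<partial>lborel :: real)"
  proof (rule integral_dominated_convergence[where w = "indicator B"])
    show "AE p in lborel. (\<lambda>n. indicator (slope_cell B I (v n) x) p) \<longlonglongrightarrow> (indicator (slope_cell B I w x) p :: real)"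
      using AEH
    proof eventually_elim
      case (elim p)
      have "eventually (\<lambda>n. (p \<bullet> y - v n y \<le> p \<bullet> x - v n x) \<longleftrightarrow> (p \<bullet> y - w y \<le> p \<bullet> x - w x)) sequentially" if y: "y \<in> I" for y
      proof (cases "y = x")
        case False
        define d where "d = (p \<bullet> x - w x) - (p \<bullet> y - w y)"
        have "(\<lambda>n. (p \<bullet> x - v n x) - (p \<bullet> y - v n y)) \<longlonglongrightarrow> d"
          unfolding d_def by (intro tendsto_intros lim y I)
        note ev = order_tendstoD[OF this, of 0]
        have "(y - x) \<bullet> p \<noteq> w y - w x" using elim y False by (auto simp: Hy_def)
        then have "d \<noteq> 0" by (simp add: d_def inner_diff_left inner_commute[of p])
        then consider "0 < d" | "d < 0" by linarith
        then show ?thesis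
        proof cases
          case 1 then show ?thesis by (intro eventually_mono[OF ev(1)]) (auto simp: d_def)
        next
          case 2 then show ?thesis by (intro eventually_mono[OF ev(2)]) (auto simp: d_def)
        qed
      qed simp
      then have "eventually (\<lambda>n. \<forall>y\<in>I. (p \<bullet> y - v n y \<le> p \<bullet> x - v n x) \<longleftrightarrow> (p \<bullet> y - w y \<le> p \<bullet> x - w x)) sequentially"
        using I by (simp add: eventually_ball_finite_distrib)
      then have "eventually (\<lambda>n. indicator (slope_cell B I (v n) x) p = (indicator (slope_cell B I w x) p :: real)) sequentially"
        by (rule eventually_mono) (auto simp: slope_cell_def indicator_def)
      then show ?case by (rule tendsto_eventually)
    qed
    show "integrable lborel (indicator B :: _ \<Rightarrow> real)"
      using emeasure_compact_finite[OF B] B by (intro integrable_real_indicator) (auto simp: borel_compact)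
    show "AE p in lborel. norm (indicator (slope_cell B I (v n) x) p :: real) \<le> indicator B p" for n
      by (intro AE_I2) (auto simp: slope_cell_def indicator_def)
  qed measurable
  then show ?thesis by simp
qed

text \<open>Lowering \<open>w x\<close> enlarges the cell of \<open>x\<close> and shrinks the others. The heights are the minimal ones for
  which no cell but that of a base point exceeds its prescribed volume.\<close>

lemma exists_heights_with_cell_volumes:
  fixes I :: "(real ^ 'n) set" and m :: "real ^ 'n \<Rightarrow> real"
  assumes I: "finite I" "I \<noteq> {}" and m: "\<And>x. x \<in> I \<Longrightarrow> 0 < m x"
    and B: "compact B" "vol B = sum m I"
  shows "\<exists>w. \<forall>x\<in>I. m x \<le> vol (slope_cell B I w x)"
proof -
  obtain x0 where x0: "x0 \<in> I" using I by auto
  define \<mu> where "\<mu> = (\<lambda>w x. vol (slope_cell B I w x))"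
  have fm: "slope_cell B I w x \<in> fmeasurable lborel" for w x
    by (intro fmeasurable_compact slope_cell_compact B)
  obtain N where N: "\<And>p. p \<in> B \<Longrightarrow> norm p \<le> N" using compact_imp_bounded[OF B(1)] by (auto simp: bounded_iff)
  define D where "D = (\<Sum>x\<in>I. norm (x - x0))"
  have D: "norm (x - x0) \<le> D" if "x \<in> I" for x
    unfolding D_def using I that by (intro member_le_sum) auto
  define M where "M = \<bar>N\<bar> * D"
  have M: "\<bar>p \<bullet> (x - x0)\<bar> \<le> M" if "p \<in> B" "x \<in> I" for p x
  proof -
    have "\<bar>p \<bullet> (x - x0)\<bar> \<le> norm p * norm (x - x0)" by (rule Cauchy_Schwarz_ineq2)
    also have "\<dots> \<le> \<bar>N\<bar> * D" using N[OF that(1)] D[OF that(2)] by (intro mult_mono) auto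
    finally show ?thesis by (simp add: M_def)
  qed
  \<comment> \<open>Adding a constant to \<open>w\<close> does not change the cells, whence the
    normalisation at the base point \<open>x0\<close>.\<close>
  define S where "S = {w. w x0 = 0 \<and> (\<forall>x\<in>I - {x0}. \<mu> w x \<le> m x)}"
  \<comment> \<open>A height below \<open>-M\<close> makes the cell of \<open>x0\<close> empty, and
    then the other cells are too small to cover \<open>B\<close>, because \<open>m x0\<close> is
    positive.\<close>
  have S_lower: "- M \<le> w y" if "w \<in> S" "y \<in> I" for w y
  proof (rule ccontr)
    assume neg: "\<not> - M \<le> w y"
    have "slope_cell B I w x0 = {}"
    proof (rule equals0I)
      fix p assume p: "p \<in> slope_cell B I w x0"
      then have "p \<bullet> y - w y \<le> p \<bullet> x0 - w x0" using that by (auto simp: slope_cell_def)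
      moreover have "\<bar>p \<bullet> (y - x0)\<bar> \<le> M" using p that by (intro M) (auto simp: slope_cell_def)
      ultimately show False using that neg by (auto simp: S_def inner_diff_right)
    qed
    then have "\<mu> w x0 = 0" by (simp add: \<mu>_def)
    have "sum m I \<le> (\<Sum>x\<in>I. \<mu> w x)" using slope_cell_cover_measure[OF I B(1)] B(2) by (simp add: \<mu>_def)
    also have "\<dots> = (\<Sum>x\<in>I - {x0}. \<mu> w x)" using I x0 \<open>\<mu> w x0 = 0\<close> by (simp add: sum.remove)
    also have "\<dots> \<le> (\<Sum>x\<in>I - {x0}. m x)" using that by (intro sum_mono) (auto simp: S_def)
    also have "\<dots> < sum m I" using I x0 m[OF x0] by (simp add: sum.remove)
    finally show False by simp
  qed
  have S_ne: "(\<lambda>x. if x = x0 then 0 else M + 1) \<in> S"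
  proof -
    have "slope_cell B I (\<lambda>x. if x = x0 then 0 else M + 1) x = {}" if "x \<in> I - {x0}" for x
    proof (rule equals0I)
      fix p assume p: "p \<in> slope_cell B I (\<lambda>x. if x = x0 then 0 else M + 1) x"
      then have "p \<bullet> x0 \<le> p \<bullet> x - (M + 1)" using that x0 by (auto simp: slope_cell_def)
      moreover have "\<bar>p \<bullet> (x - x0)\<bar> \<le> M" using p that by (intro M) (auto simp: slope_cell_def)
      ultimately show False by (auto simp: inner_diff_right)
    qed
    then show ?thesis using m by (auto simp: S_def \<mu>_def less_imp_le)
  qed
  \<comment> \<open>The cell of \<open>x\<close> for the minimum lies in its cell for whichever of
    \<open>v\<close> and \<open>w\<close> is smaller at \<open>x\<close>. Closure under minima makes
    the pointwise infimum a limit of single members of \<open>S\<close>.\<close>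
  have S_min: "(\<lambda>x. min (v x) (w x)) \<in> S" if "v \<in> S" "w \<in> S" for v w
  proof -
    have "\<mu> (\<lambda>x. min (v x) (w x)) x \<le> m x" if x: "x \<in> I - {x0}" for x
    proof -
      define u where "u = (if v x \<le> w x then v else w)"
      have u: "u x = min (v x) (w x)" "min (v y) (w y) \<le> u y" for y by (auto simp: u_def)
      have "slope_cell B I (\<lambda>x. min (v x) (w x)) x \<subseteq> slope_cell B I u x"
      proof
        fix p assume p: "p \<in> slope_cell B I (\<lambda>x. min (v x) (w x)) x"
        have "p \<bullet> y - u y \<le> p \<bullet> x - u x" if "y \<in> I" for y
        proof -
          have "p \<bullet> y - min (v y) (w y) \<le> p \<bullet> x - min (v x) (w x)" using p that unfolding slope_cell_def by blast
          then show ?thesis using u(1) u(2)[of y] by linarith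
        qed
        then show "p \<in> slope_cell B I u x" using p by (simp add: slope_cell_def)
      qed
      then have "\<mu> (\<lambda>x. min (v x) (w x)) x \<le> \<mu> u x"
        unfolding \<mu>_def by (intro measure_mono_fmeasurable fm fmeasurableD) auto
      also have "\<dots> \<le> m x" using \<open>v \<in> S\<close> \<open>w \<in> S\<close> x by (auto simp: S_def u_def)
      finally show ?thesis .
    qed
    then show ?thesis using that by (auto simp: S_def)
  qed
  have S_ne': "S \<noteq> {}" using S_ne by blast
  define w where "w x = Inf ((\<lambda>v. v x) ` S)" for x
  have w_le: "w x \<le> v x" if "v \<in> S" "x \<in> I" for v x
    unfolding w_def using S_lower that by (intro cINF_lower bdd_belowI2[of S "- M"]) auto
  have approx: "\<exists>v\<in>S. \<forall>y\<in>J. v y < w y + e" if "finite J" "0 < e" for J e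
    using that(1)
  proof induction
    case empty show ?case using S_ne by blast
  next
    case (insert y J)
    then obtain v where v: "v \<in> S" "\<forall>y\<in>J. v y < w y + e" by blast
    obtain u where "u \<in> S" "u y < w y + e"
      using cInf_lessD[of "(\<lambda>v. v y) ` S" "w y + e"] S_ne' \<open>0 < e\<close> by (auto simp: w_def)
    then show ?case using v by (intro bexI[OF _ S_min[OF v(1), of u]]) (auto simp: min_less_iff_disj)
  qed
  obtain vs where vs: "\<And>n. vs n \<in> S" "\<And>n y. y \<in> I \<Longrightarrow> vs n y < w y + inverse (real (Suc n))"
    using approx[OF I(1), of "inverse (real (Suc _))"] by (metis inverse_positive_iff_positive of_nat_0_less_iff zero_less_Suc)
  have lim: "(\<lambda>n. vs n y) \<longlonglongrightarrow> w y" if "y \<in> I" for y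
  proof (rule tendsto_sandwich[OF _ _ tendsto_const[of "w y"]])
    show "(\<lambda>n. w y + inverse (real (Suc n))) \<longlonglongrightarrow> w y"
      using tendsto_add[OF tendsto_const[of "w y"] LIMSEQ_inverse_real_of_nat] by simp
  qed (use vs w_le that in \<open>auto intro!: always_eventually less_imp_le\<close>)
  have wx0: "w x0 = 0"
  proof -
    have "(\<lambda>n. vs n x0) = (\<lambda>_. 0)" using vs by (auto simp: S_def)
    then show ?thesis using lim[OF x0] LIMSEQ_const_iff by metis
  qed
  have "\<mu> w x \<le> m x" if x: "x \<in> I - {x0}" for x
  proof (rule LIMSEQ_le_const2)
    show "(\<lambda>n. \<mu> (vs n) x) \<longlonglongrightarrow> \<mu> w x"
      unfolding \<mu>_def using x by (intro slope_cell_measure_tendsto I B lim) auto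
    show "\<exists>n0. \<forall>n\<ge>n0. \<mu> (vs n) x \<le> m x" using vs(1) x by (auto simp: S_def)
  qed
  then have wS: "w \<in> S" using wx0 by (simp add: S_def)
  \<comment> \<open>If this cell were too small, lowering \<open>w x\<close> slightly would stay in
    \<open>S\<close> by continuity, contradicting minimality of \<open>w\<close>.\<close>
  have ge: "m x \<le> \<mu> w x" if x: "x \<in> I - {x0}" for x
  proof (rule ccontr)
    assume "\<not> m x \<le> \<mu> w x"
    then have less: "\<mu> w x < m x" by simp
    define wn where "wn = (\<lambda>n::nat. w(x := w x - inverse (real (Suc n))))"
    have "(\<lambda>n. wn n y) \<longlonglongrightarrow> w y" for y
      using tendsto_diff[OF tendsto_const[of "w x"] LIMSEQ_inverse_real_of_nat] by (cases "y = x") (simp_all add: wn_def)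
    then have "(\<lambda>n. \<mu> (wn n) x) \<longlonglongrightarrow> \<mu> w x"
      unfolding \<mu>_def using x by (intro slope_cell_measure_tendsto I B) auto
    then have "eventually (\<lambda>n. \<mu> (wn n) x < m x) sequentially" using less by (rule order_tendstoD)
    then obtain n where n: "\<mu> (wn n) x < m x" by (auto simp: eventually_sequentially)
    have "wn n \<in> S"
    proof -
      have "\<mu> (wn n) y \<le> m y" if y: "y \<in> I - {x0}" for y
      proof (cases "y = x")
        case True then show ?thesis using n by simp
      next
        case False
        have pos: "0 < inverse (real (Suc n))" by simp
        have "slope_cell B I (wn n) y \<subseteq> slope_cell B I w y"
        proof
          fix p assume p: "p \<in> slope_cell B I (wn n) y"
          have "p \<bullet> u - w u \<le> p \<bullet> y - w y" if "u \<in> I" for u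
          proof -
            have "p \<bullet> u - wn n u \<le> p \<bullet> y - wn n y" using p that by (simp add: slope_cell_def)
            moreover have "wn n u \<le> w u" "wn n y = w y" using pos False by (auto simp: wn_def)
            ultimately show ?thesis by simp
          qed
          then show "p \<in> slope_cell B I w y" using p by (simp add: slope_cell_def)
        qed
        then have "\<mu> (wn n) y \<le> \<mu> w y"
          unfolding \<mu>_def by (intro measure_mono_fmeasurable fm fmeasurableD) auto
        also have "\<dots> \<le> m y" using wS y by (simp add: S_def)
        finally show ?thesis .
      qed
      moreover have "wn n x0 = 0" using x wx0 by (auto simp: wn_def)
      ultimately show ?thesis by (simp add: S_def)
    qed
    then show False using w_le[of "wn n" x] x by (simp add: wn_def)
  qed
  have "m x0 \<le> \<mu> w x0"
  proof -
    have "sum m I \<le> (\<Sum>x\<in>I. \<mu> w x)" using slope_cell_cover_measure[OF I B(1)] B(2) by (simp add: \<mu>_def)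
    also have "\<dots> = \<mu> w x0 + (\<Sum>x\<in>I - {x0}. \<mu> w x)" using I x0 by (simp add: sum.remove)
    also have "\<dots> \<le> \<mu> w x0 + (\<Sum>x\<in>I - {x0}. m x)" using wS by (intro add_left_mono sum_mono) (auto simp: S_def)
    finally show ?thesis using I x0 by (simp add: sum.remove)
  qed
  then show ?thesis using ge by (auto simp: \<mu>_def)
qed

section \<open>Cubes, and convex functions built from the cells\<close>

definition cube :: "real ^ 'n \<Rightarrow> real \<Rightarrow> (real ^ 'n) set" where
  "cube c r = cbox (\<chi> i. c $ i - r) (\<chi> i. c $ i + r)"

lemma mem_cube: "x \<in> cube c r \<longleftrightarrow> (\<forall>i. \<bar>x $ i - c $ i\<bar> \<le> r)"
  unfolding cube_def mem_box_cart by (intro all_cong1) (auto simp: abs_le_iff)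

lemma measure_cube:
  fixes c :: "real ^ 'n"
  assumes "0 \<le> r" shows "vol (cube c r) = (2 * r) ^ CARD('n)"
proof -
  have "cbox (\<chi> i. c $ i - r) (\<chi> i. c $ i + r) \<noteq> {}" using assms by (simp add: interval_ne_empty_cart)
  then have "vol (cube c r) = (\<Prod>i\<in>(UNIV :: 'n set). 2 * r)"
    unfolding cube_def by (subst content_cbox_cart) auto
  then show ?thesis by simp
qed

lemma emeasure_cube:
  fixes c :: "real ^ 'n"
  assumes "0 \<le> r" shows "emeasure lborel (cube c r) = ennreal ((2 * r) ^ CARD('n))"
  using measure_cube[OF assms, of c] emeasure_lborel_cbox_finite
  by (metis cube_def emeasure_eq_ennreal_measure less_irrefl infinity_ennreal_def)

lemma compact_cube [simp]: "compact (cube c r)" by (simp add: cube_def)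

lemma cball_subset_cube: "cball c r \<subseteq> cube c r"
  unfolding subset_iff mem_cube mem_cball dist_norm
  by (metis component_le_norm_cart norm_minus_commute order_trans vector_minus_component)

lemma cube_norm_le:
  fixes x :: "real ^ 'n"
  assumes "x \<in> cube c r" shows "norm (x - c) \<le> sqrt CARD('n) * r"
proof -
  have r: "0 \<le> r" using assms[unfolded mem_cube, rule_format, of undefined] by simp
  have "(norm (x - c))\<^sup>2 = (\<Sum>i\<in>UNIV. (x $ i - c $ i)\<^sup>2)"
    unfolding power2_norm_eq_inner by (simp add: inner_vec_def power2_eq_square)
  also have "\<dots> \<le> (\<Sum>i\<in>(UNIV :: 'n set). r\<^sup>2)"
    using assms r by (intro sum_mono) (auto simp: mem_cube abs_le_square_iff[symmetric])
  also have "\<dots> = (sqrt CARD('n) * r)\<^sup>2" by (simp add: power_mult_distrib)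
  finally show ?thesis using r by (metis mult_nonneg_nonneg power2_le_imp_le real_sqrt_ge_zero of_nat_0_le_iff)
qed

text \<open>Otherwise \<open>S\<close> would lie in the cube of half side \<open>D\<close> about any
  of its points.\<close>

lemma two_far_points:
  fixes S :: "(real ^ 'n) set"
  assumes S: "compact S" and D: "0 < D" "(2 * D) ^ CARD('n) < vol S"
  shows "\<exists>p\<in>S. \<exists>q\<in>S. D \<le> norm (p - q)"
proof (rule ccontr)
  assume neg: "\<not> ?thesis"
  have "S \<noteq> {}"
  proof
    assume "S = {}"
    then have "(2 * D) ^ CARD('n) < 0" using D by simp
    moreover have "0 \<le> (2 * D) ^ CARD('n)" using D(1) by (intro zero_le_power) simp
    ultimately show False by linarith
  qed
  then obtain p where p: "p \<in> S" by auto
  have "S \<subseteq> cube p D"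
  proof
    fix q assume "q \<in> S"
    then have "q \<in> cball p D" using neg p by (force simp: dist_norm)
    then show "q \<in> cube p D" using cball_subset_cube by blast
  qed
  then have "vol S \<le> vol (cube p D)"
    by (intro measure_mono_fmeasurable fmeasurable_compact) (use S in \<open>auto simp: compact_imp_closed\<close>)
  then show False using D measure_cube[of D p] by simp
qed

text \<open>\<open>z\<close> is the supremum of the affine functions that take the value
  \<open>w y\<close> at a point \<open>y\<close> of \<open>I\<close> with a slope from the cell of
  \<open>y\<close>. It agrees with \<open>w\<close> on \<open>I\<close>, all slopes of the cell of
  \<open>x\<close> are subgradients at \<open>x\<close>, and since all slopes lie in
  \<open>B\<close> it is Lipschitz with a constant proportional to \<open>F\<close>.\<close>

lemma convex_function_with_slopes:
  fixes I :: "(real ^ 'n) set" and f :: "real ^ 'n \<Rightarrow> real" and h F :: real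
  assumes I: "finite I" "I \<noteq> {}" and f: "\<And>x. x \<in> I \<Longrightarrow> 0 < f x" and h: "0 < h"
    and F: "0 < F" "F ^ CARD('n) = (\<Sum>x\<in>I. (h * f x) ^ CARD('n))"
  shows "\<exists>z. (\<forall>x. \<exists>s. \<forall>y. z x + s \<bullet> (y - x) \<le> z y) \<and>
     (\<forall>x y. \<bar>z x - z y\<bar> \<le> CARD('n) * F * norm (x - y)) \<and>
     (\<forall>x\<in>I. \<exists>p q. h * f x / 4 \<le> norm (p - q) \<and> (\<forall>y. z x + p \<bullet> (y - x) \<le> z y) \<and> (\<forall>y. z x + q \<bullet> (y - x) \<le> z y))"
proof -
  \<comment> \<open>A cube of side \<open>F\<close>: its volume is exactly the sum of the prescribed
    cell volumes.\<close>
  define B where "B = cube (0 :: real ^ 'n) (F / 2)"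
  have Bc: "compact B" by (simp add: B_def)
  have mB: "vol B = (\<Sum>x\<in>I. (h * f x) ^ CARD('n))"
    using F unfolding B_def by (subst measure_cube) auto
  have normB: "norm p \<le> real CARD('n) * F" if "p \<in> B" for p
  proof -
    have "norm p \<le> (\<Sum>i\<in>UNIV. \<bar>p $ i\<bar>)" by (rule norm_le_l1_cart)
    also have "\<dots> \<le> sum (\<lambda>_. F) (UNIV :: 'n set)"
    proof (rule sum_mono)
      fix i
      have "\<bar>p $ i\<bar> \<le> F / 2" using that by (simp add: B_def mem_cube)
      then show "\<bar>p $ i\<bar> \<le> F" using F by simp
    qed
    finally show ?thesis by simp
  qed
  obtain w where w: "\<And>x. x \<in> I \<Longrightarrow> (h * f x) ^ CARD('n) \<le> vol (slope_cell B I w x)"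
    using exists_heights_with_cell_volumes[OF I _ Bc mB] f h by auto
  define C where "C = slope_cell B I w"
  have Cc: "compact (C x)" for x unfolding C_def by (rule slope_cell_compact[OF Bc])
  have CB: "C x \<subseteq> B" for x by (auto simp: C_def slope_cell_def)
  \<comment> \<open>The set of values is compact, so the supremum is attained by an affine function,
    and its slope is a subgradient at \<open>x\<close>.\<close>
  define V where "V x = (\<Union>y\<in>I. (\<lambda>p. p \<bullet> (x - y) + w y) ` C y)" for x
  have Vc: "compact (V x)" for x
    unfolding V_def using I by (intro compact_UN compact_continuous_image Cc continuous_intros) auto
  have Cne: "C y \<noteq> {}" if "y \<in> I" for y
  proof
    assume "C y = {}"
    then have "(h * f y) ^ CARD('n) \<le> 0" using w[OF that] by (simp add: C_def)
    moreover have "0 < (h * f y) ^ CARD('n)" using h f[OF that] by simp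
    ultimately show False by simp
  qed
  have Vne: "V x \<noteq> {}" for x using I Cne by (auto simp: V_def)
  define z where "z x = Sup (V x)" for x
  have zV: "z x \<in> V x" for x
    unfolding z_def using Vc[of x] Vne[of x] by (intro closed_contains_Sup) (auto simp: compact_imp_closed compact_imp_bounded bounded_imp_bdd_above)
  have z_ge: "v \<le> z x" if "v \<in> V x" for v x
    unfolding z_def using Vc[of x] that by (intro cSup_upper) (auto simp: compact_imp_bounded bounded_imp_bdd_above)
  have sub: "\<exists>s\<in>B. \<forall>y. z x + s \<bullet> (y - x) \<le> z y" for x
  proof -
    obtain u p where u: "u \<in> I" "p \<in> C u" "z x = p \<bullet> (x - u) + w u" using zV[of x] by (auto simp: V_def)
    have "z x + p \<bullet> (y - x) \<le> z y" for y
    proof -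
      have "p \<bullet> (y - u) + w u \<le> z y" using u by (intro z_ge) (auto simp: V_def)
      then show ?thesis using u(3) by (simp add: inner_diff_right)
    qed
    then show ?thesis using u CB by blast
  qed
  have lip1: "z x - z y \<le> CARD('n) * F * norm (x - y)" for x y
  proof -
    obtain s where s: "s \<in> B" "z x + s \<bullet> (y - x) \<le> z y" using sub by blast
    have "z x - z y \<le> s \<bullet> (x - y)" using s by (simp add: inner_diff_right)
    also have "\<dots> \<le> norm s * norm (x - y)" by (rule norm_cauchy_schwarz)
    also have "\<dots> \<le> CARD('n) * F * norm (x - y)" using normB[OF s(1)] by (intro mult_right_mono) auto
    finally show ?thesis .
  qed
  have lip: "\<bar>z x - z y\<bar> \<le> CARD('n) * F * norm (x - y)" for x y
    using lip1[of x y] lip1[of y x] by (simp add: norm_minus_commute abs_le_iff)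
  have zI: "z x = w x" if x: "x \<in> I" for x
  proof (rule antisym)
    obtain u p where u: "u \<in> I" "p \<in> C u" "z x = p \<bullet> (x - u) + w u" using zV[of x] by (auto simp: V_def)
    have "p \<bullet> x - w x \<le> p \<bullet> u - w u" using u x by (auto simp: C_def slope_cell_def)
    then show "z x \<le> w x" using u by (simp add: inner_diff_right)
    obtain p where "p \<in> C x" using Cne[OF x] by auto
    then have "p \<bullet> (x - x) + w x \<in> V x" unfolding V_def using x by blast
    then have "p \<bullet> (x - x) + w x \<le> z x" by (rule z_ge)
    then show "w x \<le> z x" by simp
  qed
  have slope: "z x + p \<bullet> (y - x) \<le> z y" if "x \<in> I" "p \<in> C x" for x p y
  proof -
    have "p \<bullet> (y - x) + w x \<le> z y" using that by (intro z_ge) (auto simp: V_def)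
    then show ?thesis using zI[OF that(1)] by simp
  qed
  have "\<exists>p q. h * f x / 4 \<le> norm (p - q) \<and> (\<forall>y. z x + p \<bullet> (y - x) \<le> z y) \<and> (\<forall>y. z x + q \<bullet> (y - x) \<le> z y)"
    if x: "x \<in> I" for x
  proof -
    have hf: "0 < h * f x" using h f[OF x] by simp
    \<comment> \<open>The divisor 4 rather than 2 makes the comparison of volumes strict.\<close>
    have "(2 * (h * f x / 4)) ^ CARD('n) < (h * f x) ^ CARD('n)"
      using hf by (intro power_strict_mono) auto
    also have "\<dots> \<le> vol (C x)" using w[OF x] by (simp add: C_def)
    finally obtain p q where "p \<in> C x" "q \<in> C x" "h * f x / 4 \<le> norm (p - q)"
      using two_far_points[OF Cc, of "h * f x / 4" x] hf by auto
    then show ?thesis using slope[OF x] by blast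
  qed
  then show ?thesis using sub lip by (intro exI[of _ z]) blast
qed

section \<open>Mollification of convex Lipschitz functions\<close>

text \<open>The derivative falls on the smooth kernel and \<open>z\<close> need only be continuous.
  The box is fixed, independent of \<open>x\<close>, so that the Leibniz rule applies.\<close>

lemma conv_has_derivative:
  fixes k z :: "real ^ 'n \<Rightarrow> real" and dk :: "real ^ 'n \<Rightarrow> real ^ 'n"
  assumes k: "\<And>x. (k has_derivative (\<lambda>v. dk x \<bullet> v)) (at x)" and dk: "continuous_on UNIV dk"
    and z: "continuous_on UNIV z"
  shows "((\<lambda>x. integral (cbox a b) (\<lambda>y. z y * k (x - y))) has_derivative
     (\<lambda>v. integral (cbox a b) (\<lambda>y. z y *\<^sub>R dk (x - y)) \<bullet> v)) (at x)"
proof -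
  have kc: "continuous_on UNIV k" using k by (meson continuous_at_imp_continuous_on has_derivative_continuous)
  have c1: "continuous_on S (\<lambda>y. z y)" for S using z continuous_on_subset by blast
  have c2: "continuous_on S (\<lambda>y. k (g y))" if "continuous_on S g" for S :: "(real^'n) set" and g
    using continuous_on_compose2[OF kc that] by auto
  have c3: "continuous_on S (\<lambda>y. dk (g y))" if "continuous_on S g" for S :: "'b::topological_space set" and g
    using continuous_on_compose2[OF dk that] by auto
  have c4: "continuous_on S (\<lambda>y. z (g y))" if "continuous_on S g" for S :: "'b::topological_space set" and g
    using continuous_on_compose2[OF z that] by auto
  have 1: "((\<lambda>x. integral (cbox a b) ((\<lambda>x y. z y * k (x - y)) x)) has_derivative
     blinfun_apply (integral (cbox a b) ((\<lambda>x y. blinfun_inner_left (z y *\<^sub>R dk (x - y))) x))) (at x within UNIV)"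
  proof (rule leibniz_rule)
    show "((\<lambda>x. z t * k (x - t)) has_derivative blinfun_apply (blinfun_inner_left (z t *\<^sub>R dk (x - t)))) (at x within UNIV)" for x t
    proof -
      have "((\<lambda>x. k (x - t)) has_derivative (\<lambda>v. dk (x - t) \<bullet> v)) (at x)"
        by (rule has_derivative_compose[OF _ k, of "\<lambda>x. x - t" "\<lambda>v. v", simplified]) (auto intro!: derivative_eq_intros)
      then have "((\<lambda>x. z t * k (x - t)) has_derivative (\<lambda>v. z t * (dk (x - t) \<bullet> v))) (at x)"
        by (rule has_derivative_mult_right)
      then show ?thesis by (rule has_derivative_eq_rhs) (auto simp: inner_commute)
    qed
    show "(\<lambda>y. z y * k (x - y)) integrable_on cbox a b" for x
      by (intro integrable_continuous continuous_intros c1 c2)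
    show "continuous_on (UNIV \<times> cbox a b) (\<lambda>(x, y). blinfun_inner_left (z y *\<^sub>R dk (x - y)))"
      unfolding split_beta by (intro continuous_intros bounded_linear.continuous_on[OF bounded_linear_blinfun_inner_left] c3 c4)
  qed auto
  have 2: "blinfun_apply (integral (cbox a b) (\<lambda>y. blinfun_inner_left (z y *\<^sub>R dk (x - y)))) v
      = integral (cbox a b) (\<lambda>y. z y *\<^sub>R dk (x - y)) \<bullet> v" for v
  proof -
    have i: "(\<lambda>y. z y *\<^sub>R dk (x - y)) integrable_on cbox a b"
      by (intro integrable_continuous continuous_intros c1 c3)
    have "integral (cbox a b) (blinfun_inner_left \<circ> (\<lambda>y. z y *\<^sub>R dk (x - y)))
        = blinfun_inner_left (integral (cbox a b) (\<lambda>y. z y *\<^sub>R dk (x - y)))"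
      by (rule integral_linear[OF i bounded_linear_blinfun_inner_left])
    then show ?thesis by (simp add: o_def inner_commute)
  qed
  show ?thesis using has_derivative_eq_rhs[OF 1, OF ext[OF 2]] .
qed

lemma lborel_integral_affine:
  fixes f :: "real ^ 'n \<Rightarrow> real"
  assumes "c \<noteq> 0" and f: "f \<in> borel_measurable borel"
  shows "(\<integral>x. f x \<partial>lborel) = \<bar>c\<bar> ^ CARD('n) * (\<integral>x. f (t + c *\<^sub>R x) \<partial>lborel)"
proof -
  have "(\<integral>x. f x \<partial>lborel) = (\<integral>x. f x \<partial>density (distr lborel borel (\<lambda>x. t + c *\<^sub>R x)) (\<lambda>_. ennreal (\<bar>c\<bar> ^ CARD('n))))"
    using lborel_affine[OF assms(1), of t] by (simp add: ennreal_power)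
  also have "\<dots> = (\<integral>x. \<bar>c\<bar> ^ CARD('n) *\<^sub>R f x \<partial>distr lborel borel (\<lambda>x. t + c *\<^sub>R x))"
    using f by (intro integral_density) auto
  also have "\<dots> = (\<integral>x. \<bar>c\<bar> ^ CARD('n) *\<^sub>R f (t + c *\<^sub>R x) \<partial>lborel)"
    using f by (intro integral_distr) auto
  finally show ?thesis by simp
qed

lemma integrable_continuous_compact_support:
  fixes f :: "real ^ 'n \<Rightarrow> 'b :: {banach, second_countable_topology}"
  assumes "continuous_on UNIV f" "\<And>x. x \<notin> S \<Longrightarrow> f x = 0" "compact S"
  shows "integrable lborel f"
proof -
  have "integrable lborel (\<lambda>x. indicator S x *\<^sub>R f x)"
    using assms by (intro borel_integrable_compact) (auto intro: continuous_on_subset)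
  moreover have "(\<lambda>x. indicator S x *\<^sub>R f x) = f" using assms(2) by (auto simp: indicator_def)
  ultimately show ?thesis by simp
qed

lemma integral_cbox_eq_lborel:
  fixes f :: "real ^ 'n \<Rightarrow> 'b :: euclidean_space"
  assumes "continuous_on UNIV f" "\<And>x. x \<notin> cbox a b \<Longrightarrow> f x = 0"
  shows "integral (cbox a b) f = (\<integral>x. f x \<partial>lborel)"
proof -
  have i: "integrable lborel f"
    by (rule integrable_continuous_compact_support[OF assms(1), where S = "cbox a b"]) (use assms(2) in auto)
  have eq: "(\<lambda>x. indicator (cbox a b) x *\<^sub>R f x) = f" using assms(2) by (auto simp: indicator_def)
  have "set_integrable lborel (cbox a b) f" unfolding set_integrable_def eq by (rule i)
  then show ?thesis using set_borel_integral_eq_integral(2) by (metis eq set_lebesgue_integral_def)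
qed

lemma bump_hess_trace:
  fixes v :: "real ^ 'n"
  shows "(\<Sum>i\<in>UNIV. bump_hess 3 0 \<epsilon> v $ i $ i) =
    6 / \<epsilon>\<^sup>2 * (4 * ((norm v)\<^sup>2 / \<epsilon>\<^sup>2) * pospow 1 (1 - (norm v)\<^sup>2 / \<epsilon>\<^sup>2) - CARD('n) * pospow 2 (1 - (norm v)\<^sup>2 / \<epsilon>\<^sup>2))"
proof -
  define P1 P2 where "P1 = pospow 1 (1 - (norm v)\<^sup>2 / \<epsilon>\<^sup>2)" and "P2 = pospow 2 (1 - (norm v)\<^sup>2 / \<epsilon>\<^sup>2)"
  have "(\<Sum>i\<in>UNIV. bump_hess 3 0 \<epsilon> v $ i $ i) = (\<Sum>i\<in>UNIV. 24 / \<epsilon> ^ 4 * P1 * (v $ i * v $ i) - 6 / \<epsilon>\<^sup>2 * P2)"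
    by (intro sum.cong refl) (simp add: bump_hess_def P1_def P2_def mult.assoc)
  also have "\<dots> = 24 / \<epsilon> ^ 4 * P1 * (norm v)\<^sup>2 - 6 / \<epsilon>\<^sup>2 * P2 * CARD('n)"
    unfolding power2_norm_eq_inner sum_subtractf inner_vec_def sum_distrib_left by simp
  finally show ?thesis
    unfolding P1_def[symmetric] P2_def[symmetric]
    by (simp add: power4_eq_xxxx power2_eq_square right_diff_distrib diff_divide_distrib mult_ac)
qed

text \<open>Convexity is recorded through subgradients, which is what the slope cells
  deliver.\<close>

locale convex_lipschitz =
  fixes z :: "real ^ 'n \<Rightarrow> real" and L :: real
  assumes subgradient: "\<exists>s. \<forall>y. z x + s \<bullet> (y - x) \<le> z y"
    and lipschitz: "\<bar>z x - z y\<bar> \<le> L * norm (x - y)"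
begin

lemma L_nonneg: "0 \<le> L"
proof -
  have "0 \<le> L * norm (axis undefined 1 - 0 :: real ^ 'n)"
    using lipschitz[of "axis undefined 1" 0] by (rule order_trans[OF abs_ge_zero])
  then show ?thesis by simp
qed

lemma z_cont: "continuous_on S z"
proof -
  have "L-lipschitz_on S z"
    by (rule lipschitz_onI) (use lipschitz L_nonneg in \<open>auto simp: dist_norm\<close>)
  then show ?thesis by (rule lipschitz_on_continuous_on)
qed

lemma z_cont_compose: "continuous_on S g \<Longrightarrow> continuous_on S (\<lambda>y. z (g y))"
  using continuous_on_compose2[OF z_cont[of UNIV]] by auto

lemma second_difference: "2 * z x \<le> z (x + v) + z (x - v)"
proof -
  obtain s where s: "\<And>y. z x + s \<bullet> (y - x) \<le> z y" using subgradient by blast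
  show ?thesis using s[of "x + v"] s[of "x - v"] by simp
qed

text \<open>A subgradient at \<open>x - v\<close>, evaluated at \<open>x\<close> and at
  \<open>x - r v\<close>: along a ray the increments of a convex function grow.\<close>

lemma dilation_difference:
  assumes "1 \<le> r"
  shows "(r - 1) * (z (x - v) - z x) \<le> z (x - r *\<^sub>R v) - z (x - v)"
proof -
  obtain s where s: "\<And>y. z (x - v) + s \<bullet> (y - (x - v)) \<le> z y" using subgradient by blast
  have "z (x - v) - z x \<le> - (s \<bullet> v)" using s[of x] by simp
  then have "(r - 1) * (z (x - v) - z x) \<le> (r - 1) * (- (s \<bullet> v))" using assms by (intro mult_left_mono) auto
  also have "\<dots> = s \<bullet> ((x - r *\<^sub>R v) - (x - v))" by (simp add: inner_diff_right algebra_simps)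
  also have "\<dots> \<le> z (x - r *\<^sub>R v) - z (x - v)" using s[of "x - r *\<^sub>R v"] by simp
  finally show ?thesis .
qed

text \<open>The integral over a fixed cube is the form that can be differentiated; the integral over
  the whole space is the form in which \<open>z\<close> is translated. They agree as long as the
  \<open>\<epsilon>\<close>-ball about \<open>x\<close> stays in the cube.\<close>

lemma conv_eq:
  fixes m :: "real ^ 'n \<Rightarrow> real"
  assumes m: "continuous_on UNIV m" "\<And>v. \<epsilon> \<le> norm v \<Longrightarrow> m v = 0" and x: "norm x + \<epsilon> \<le> K"
  shows "integral (cube 0 K) (\<lambda>y. z y * m (x - y)) = (\<integral>v. z (x - v) * m v \<partial>lborel)"
    and "integrable lborel (\<lambda>v. z (x - v) * m v)"
proof -
  have mc: "continuous_on S g \<Longrightarrow> continuous_on S (\<lambda>y. m (g y))" for S :: "(real^'n) set" and g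
    using continuous_on_compose2[OF m(1)] by auto
  have c: "continuous_on UNIV (\<lambda>y. z y * m (x - y))" by (intro continuous_intros z_cont mc)
  have "integral (cube 0 K) (\<lambda>y. z y * m (x - y)) = (\<integral>y. z y * m (x - y) \<partial>lborel)"
    unfolding cube_def
  proof (rule integral_cbox_eq_lborel[OF c])
    fix y assume "y \<notin> cbox (\<chi> i. 0 $ i - K) (\<chi> i. (0 :: real^'n) $ i + K)"
    then have "y \<notin> cball 0 K" using cball_subset_cube[of 0 K] unfolding cube_def by blast
    then have "K < norm y" by simp
    then have "\<epsilon> \<le> norm (x - y)" using x norm_triangle_ineq4[of x "x - y"] by simp
    then show "z y * m (x - y) = 0" using m by simp
  qed
  also have "\<dots> = (\<integral>v. z (x - v) * m v \<partial>lborel)"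
    using lborel_integral_affine[of "-1" "\<lambda>y. z y * m (x - y)" x] borel_measurable_continuous_onI[OF c] by simp
  finally show "integral (cube 0 K) (\<lambda>y. z y * m (x - y)) = (\<integral>v. z (x - v) * m v \<partial>lborel)" .
  show "integrable lborel (\<lambda>v. z (x - v) * m v)"
  proof (rule integrable_continuous_compact_support[where S = "cball 0 \<epsilon>"])
    show "continuous_on UNIV (\<lambda>v. z (x - v) * m v)" by (intro continuous_intros z_cont_compose mc)
  qed (use m in auto)
qed

text \<open>The kernel is not normalised; its integral is of order \<open>\<epsilon>^n\<close>, and
  the compensating division is made on \<open>z\<close> in
  \<open>test_function_exists\<close>.\<close>

definition mol :: "real \<Rightarrow> real \<Rightarrow> real ^ 'n \<Rightarrow> real" where
  "mol \<epsilon> K x = integral (cube 0 K) (\<lambda>y. z y * bump 3 0 \<epsilon> (x - y))"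

definition mol_grad :: "real \<Rightarrow> real \<Rightarrow> real ^ 'n \<Rightarrow> real ^ 'n" where
  "mol_grad \<epsilon> K x = integral (cube 0 K) (\<lambda>y. z y *\<^sub>R bump_grad 3 0 \<epsilon> (x - y))"

definition mol_hess :: "real \<Rightarrow> real \<Rightarrow> real ^ 'n \<Rightarrow> real ^ 'n ^ 'n" where
  "mol_hess \<epsilon> K x = (\<chi> i. integral (cube 0 K) (\<lambda>y. z y *\<^sub>R (bump_hess 3 0 \<epsilon> (x - y) $ i)))"

lemma bump_cont:
  assumes "0 < \<epsilon>"
  shows "continuous_on S g \<Longrightarrow> continuous_on S (\<lambda>y. bump 3 (0 :: real^'n) \<epsilon> (g y))"
    "continuous_on S g \<Longrightarrow> continuous_on S (\<lambda>y. bump_grad 3 (0 :: real^'n) \<epsilon> (g y))"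
    "continuous_on S g \<Longrightarrow> continuous_on S (\<lambda>y. bump_hess 3 (0 :: real^'n) \<epsilon> (g y))"
  using C2_data_continuous[OF bump_C2_data[OF _ assms, of 3 "0 :: real^'n"], of UNIV]
    continuous_on_compose2[of UNIV _ S g] by auto

lemma mol_hess_nth:
  assumes \<epsilon>: "0 < \<epsilon>"
  shows "mol_hess \<epsilon> K x $ i $ j = integral (cube 0 K) (\<lambda>y. z y * bump_hess 3 0 \<epsilon> (x - y) $ i $ j)"
proof -
  have "(\<lambda>y. z y *\<^sub>R (bump_hess 3 0 \<epsilon> (x - y) $ i)) integrable_on cube 0 K"
    unfolding cube_def by (intro integrable_continuous continuous_intros z_cont bump_cont \<epsilon>)
  from integral_linear[OF this bounded_linear_vec_nth[of j]] show ?thesis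
    by (simp add: mol_hess_def o_def)
qed

lemma mol_C2_data:
  assumes \<epsilon>: "0 < \<epsilon>"
  shows "C2_data (mol \<epsilon> K) (mol_grad \<epsilon> K) (mol_hess \<epsilon> K)"
proof -
  have C2: "C2_data (bump 3 (0 :: real^'n) \<epsilon>) (bump_grad 3 0 \<epsilon>) (bump_hess 3 0 \<epsilon>)"
    by (rule bump_C2_data) (use \<epsilon> in auto)
  have d1: "(mol \<epsilon> K has_derivative (\<lambda>v. mol_grad \<epsilon> K x \<bullet> v)) (at x)" for x
    unfolding mol_def[abs_def] mol_grad_def cube_def
    by (rule conv_has_derivative) (use C2 in \<open>auto simp: C2_data_def z_cont intro: C2_data_continuous(2)[OF C2]\<close>)
  have d2: "((\<lambda>x. mol_grad \<epsilon> K x $ i) has_derivative (\<lambda>v. mol_hess \<epsilon> K x $ i \<bullet> v)) (at x)" for x i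
  proof -
    have eq: "mol_grad \<epsilon> K x $ i = integral (cube 0 K) (\<lambda>y. z y * bump_grad 3 0 \<epsilon> (x - y) $ i)" for x
    proof -
      have "(\<lambda>y. z y *\<^sub>R bump_grad 3 0 \<epsilon> (x - y)) integrable_on cube 0 K"
        unfolding cube_def by (intro integrable_continuous continuous_intros z_cont bump_cont \<epsilon>)
      from integral_linear[OF this bounded_linear_vec_nth[of i]] show ?thesis
        by (simp add: mol_grad_def o_def)
    qed
    have db: "((\<lambda>x. bump_grad 3 0 \<epsilon> x $ i) has_derivative (\<lambda>v. bump_hess 3 0 \<epsilon> x $ i \<bullet> v)) (at x)" for x :: "real^'n"
    proof -
      have "(bump_grad 3 0 \<epsilon> has_derivative (\<lambda>v. bump_hess 3 0 \<epsilon> x *v v)) (at x)" using C2 by (simp add: C2_data_def)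
      then have "((\<lambda>x. bump_grad 3 0 \<epsilon> x $ i) has_derivative (\<lambda>v. (bump_hess 3 0 \<epsilon> x *v v) $ i)) (at x)"
        by (rule bounded_linear.has_derivative[OF bounded_linear_vec_nth])
      then show ?thesis by (simp add: matrix_vector_mul_component)
    qed
    show ?thesis
      unfolding eq[abs_def] mol_hess_def cube_def vec_lambda_beta
      by (rule conv_has_derivative[OF db])
        (auto intro!: continuous_intros z_cont C2_data_continuous(3)[OF C2])
  qed
  have d2': "(mol_grad \<epsilon> K has_derivative (\<lambda>v. mol_hess \<epsilon> K x *v v)) (at x)" for x
    unfolding has_derivative_componentwise_within[of "mol_grad \<epsilon> K"]
    using d2 by (auto simp: Basis_vec_def inner_axis matrix_vector_mul_component)
  have "continuous_on UNIV (mol_hess \<epsilon> K)"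
    unfolding mol_hess_def[abs_def] cube_def
    by (intro continuous_on_vec_lambda integral_continuous_on_param)
      (auto simp: split_beta intro!: continuous_intros z_cont_compose bump_cont \<epsilon>)
  then show ?thesis unfolding C2_data_def using d1 d2' by blast
qed

lemma bump_integral_le:
  assumes "0 < \<epsilon>"
  shows "integrable lborel (bump 3 (0 :: real ^ 'n) \<epsilon>)"
    and "(\<integral>v. bump 3 (0 :: real ^ 'n) \<epsilon> v \<partial>lborel) \<le> (2 * \<epsilon>) ^ CARD('n)"
proof -
  have z: "bump 3 (0 :: real ^ 'n) \<epsilon> x = 0" if "x \<notin> cball 0 \<epsilon>" for x
    using that assms by (intro bump_zero) auto
  show i: "integrable lborel (bump 3 (0 :: real ^ 'n) \<epsilon>)"
    by (rule integrable_continuous_compact_support[where S = "cball 0 \<epsilon>"])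
      (use z bump_cont[OF assms, of UNIV "\<lambda>x. x"] in auto)
  have c: "cube (0 :: real ^ 'n) \<epsilon> \<in> sets lborel" by (simp add: cube_def)
  have ic: "integrable lborel (indicator (cube (0 :: real ^ 'n) \<epsilon>) :: _ \<Rightarrow> real)"
    using c emeasure_cube[of \<epsilon> "0 :: real ^ 'n"] assms by (intro integrable_real_indicator) auto
  have "(\<integral>v. bump 3 (0 :: real ^ 'n) \<epsilon> v \<partial>lborel) \<le> (\<integral>v. indicator (cube (0 :: real ^ 'n) \<epsilon>) v \<partial>lborel)"
  proof (rule integral_mono[OF i ic])
    fix v :: "real ^ 'n"
    show "bump 3 0 \<epsilon> v \<le> indicator (cube 0 \<epsilon>) v"
      using z[of v] bump_le1[of 3 0 \<epsilon> v] cball_subset_cube[of 0 \<epsilon>]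
      by (cases "v \<in> cball 0 \<epsilon>") (auto simp: indicator_def)
  qed
  also have "\<dots> = (2 * \<epsilon>) ^ CARD('n)" using c assms by (simp add: measure_cube)
  finally show "(\<integral>v. bump 3 (0 :: real ^ 'n) \<epsilon> v \<partial>lborel) \<le> (2 * \<epsilon>) ^ CARD('n)" .
qed

lemma mol_eq:
  assumes \<epsilon>: "0 < \<epsilon>" and x: "norm x + \<epsilon> \<le> K"
  shows "mol \<epsilon> K x = (\<integral>v. z (x - v) * bump 3 0 \<epsilon> v \<partial>lborel)"
    "integrable lborel (\<lambda>v. z (x - v) * bump 3 0 \<epsilon> v)"
  unfolding mol_def using bump_cont[OF \<epsilon>, of UNIV "\<lambda>x. x"] \<epsilon> x
  by (auto intro!: conv_eq[where \<epsilon> = \<epsilon> and K = K] bump_zero)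

lemma mol_lipschitz:
  assumes \<epsilon>: "0 < \<epsilon>" and x: "norm x + \<epsilon> \<le> K" and y: "norm y + \<epsilon> \<le> K"
  shows "\<bar>mol \<epsilon> K x - mol \<epsilon> K y\<bar> \<le> L * (2 * \<epsilon>) ^ CARD('n) * norm (x - y)"
proof -
  have "\<bar>mol \<epsilon> K x - mol \<epsilon> K y\<bar> = \<bar>\<integral>v. z (x - v) * bump 3 0 \<epsilon> v - z (y - v) * bump 3 0 \<epsilon> v \<partial>lborel\<bar>"
    using mol_eq[OF \<epsilon> x] mol_eq[OF \<epsilon> y] by simp
  also have "\<dots> \<le> (\<integral>v. L * norm (x - y) * bump 3 (0 :: real^'n) \<epsilon> v \<partial>lborel)"
  proof (rule order_trans[OF integral_norm_bound[where 'a = real, unfolded real_norm_def]], rule integral_mono)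
    show "integrable lborel (\<lambda>v. \<bar>z (x - v) * bump 3 0 \<epsilon> v - z (y - v) * bump 3 0 \<epsilon> v\<bar>)"
      using mol_eq[OF \<epsilon> x] mol_eq[OF \<epsilon> y] by simp
    show "integrable lborel (\<lambda>v. L * norm (x - y) * bump 3 (0 :: real^'n) \<epsilon> v)"
      using bump_integral_le(1)[OF \<epsilon>] by simp
    fix v
    have "\<bar>(z (x - v) - z (y - v)) * bump 3 0 \<epsilon> v\<bar> \<le> (L * norm (x - y)) * bump 3 0 \<epsilon> v"
      unfolding abs_mult using lipschitz[of "x - v" "y - v"] by (simp add: mult_right_mono)
    then show "\<bar>z (x - v) * bump 3 0 \<epsilon> v - z (y - v) * bump 3 0 \<epsilon> v\<bar> \<le> L * norm (x - y) * bump 3 0 \<epsilon> v"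
      by (simp add: left_diff_distrib)
  qed
  also have "\<dots> = L * norm (x - y) * (\<integral>v. bump 3 (0 :: real^'n) \<epsilon> v \<partial>lborel)" by simp
  also have "\<dots> \<le> L * norm (x - y) * (2 * \<epsilon>) ^ CARD('n)"
    using bump_integral_le(2)[OF \<epsilon>] L_nonneg by (intro mult_left_mono) auto
  finally show ?thesis by (simp add: mult_ac)
qed

text \<open>The derivative in the direction of the gradient \<open>g\<close> itself is
  \<open>g . g\<close>, and the Lipschitz bound makes it at most a constant times the norm of
  \<open>g\<close>.\<close>

lemma mol_grad_le:
  assumes \<epsilon>: "0 < \<epsilon>" and x: "norm x + \<epsilon> < K"
  shows "norm (mol_grad \<epsilon> K x) \<le> L * (2 * \<epsilon>) ^ CARD('n)"
proof -
  define C where "C = L * (2 * \<epsilon>) ^ CARD('n)"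
  have C0: "0 \<le> C" using L_nonneg \<epsilon> by (simp add: C_def)
  define g where "g = mol_grad \<epsilon> K x"
  have d: "((\<lambda>t. mol \<epsilon> K (x + t *\<^sub>R g)) has_real_derivative g \<bullet> g) (at 0)"
  proof -
    have "((\<lambda>t::real. x + t *\<^sub>R g) has_derivative (\<lambda>t. t *\<^sub>R g)) (at 0)" by (auto intro!: derivative_eq_intros)
    moreover have "(mol \<epsilon> K has_derivative (\<lambda>v. g \<bullet> v)) (at (x + 0 *\<^sub>R g))"
      using mol_C2_data[OF \<epsilon>] by (simp add: C2_data_def g_def)
    ultimately have "((\<lambda>t. mol \<epsilon> K (x + t *\<^sub>R g)) has_derivative (\<lambda>t. g \<bullet> (t *\<^sub>R g))) (at 0)"
      by (rule has_derivative_compose[where g = "mol \<epsilon> K"])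
    then show ?thesis by (rule has_derivative_imp_has_field_derivative) simp
  qed
  have "g \<bullet> g \<le> C * norm g"
  proof (rule tendsto_upperbound)
    show "((\<lambda>t. (mol \<epsilon> K (x + t *\<^sub>R g) - mol \<epsilon> K x) / t) \<longlongrightarrow> g \<bullet> g) (at 0)"
      using d by (simp add: DERIV_def)
    have "eventually (\<lambda>t. norm (x + t *\<^sub>R g) + \<epsilon> < K) (at 0)"
    proof (rule order_tendstoD(2))
      show "((\<lambda>t. norm (x + t *\<^sub>R g) + \<epsilon>) \<longlongrightarrow> norm (x + 0 *\<^sub>R g) + \<epsilon>) (at 0)" by (intro tendsto_intros)
    qed (use x in simp)
    then show "eventually (\<lambda>t. (mol \<epsilon> K (x + t *\<^sub>R g) - mol \<epsilon> K x) / t \<le> C * norm g) (at 0)"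
    proof eventually_elim
      case (elim t)
      have "\<bar>mol \<epsilon> K (x + t *\<^sub>R g) - mol \<epsilon> K x\<bar> \<le> C * norm (x + t *\<^sub>R g - x)"
        unfolding C_def using elim x by (intro mol_lipschitz[OF \<epsilon>]) auto
      then have "\<bar>(mol \<epsilon> K (x + t *\<^sub>R g) - mol \<epsilon> K x) / t\<bar> \<le> C * norm g"
        using C0 by (cases "t = 0") (auto simp: abs_divide divide_le_eq mult_ac)
      then show ?case by linarith
    qed
  qed simp
  then have "norm g * norm g \<le> C * norm g" by (simp add: power2_norm_eq_inner[symmetric] power2_eq_square)
  then show ?thesis using C0 by (cases "norm g = 0") (simp_all only: g_def[symmetric] C_def[symmetric], auto)
qed

text \<open>\<open>\<phi>\<close>, the symmetric sum of values at \<open>x + t v\<close> and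
  \<open>x - t v\<close>, has derivative \<open>\<psi>\<close>, and the derivative of
  \<open>\<psi>\<close> at 0 is twice the form. A negative form would make \<open>\<phi>\<close>
  decrease for small \<open>t\<close>, against \<open>second_difference\<close> averaged with the
  bump.\<close>

lemma mol_hess_nonneg:
  assumes \<epsilon>: "0 < \<epsilon>" and x: "norm x + \<epsilon> < K"
  shows "0 \<le> v \<bullet> (mol_hess \<epsilon> K x *v v)"
proof (rule ccontr)
  assume neg: "\<not> ?thesis"
  define \<phi> where "\<phi> t = mol \<epsilon> K (x + t *\<^sub>R v) + mol \<epsilon> K (x - t *\<^sub>R v)" for t
  define \<psi> where "\<psi> t = mol_grad \<epsilon> K (x + t *\<^sub>R v) \<bullet> v - mol_grad \<epsilon> K (x - t *\<^sub>R v) \<bullet> v" for t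
  have C2: "(mol \<epsilon> K has_derivative (\<lambda>u. mol_grad \<epsilon> K y \<bullet> u)) (at y)"
    "(mol_grad \<epsilon> K has_derivative (\<lambda>u. mol_hess \<epsilon> K y *v u)) (at y)" for y
    using mol_C2_data[OF \<epsilon>] by (auto simp: C2_data_def)
  have l: "((\<lambda>t::real. x + t *\<^sub>R v) has_derivative (\<lambda>t. t *\<^sub>R v)) (at t)"
    "((\<lambda>t::real. x - t *\<^sub>R v) has_derivative (\<lambda>t. - (t *\<^sub>R v))) (at t)" for t
    by (auto intro!: derivative_eq_intros)
  have d\<phi>: "(\<phi> has_real_derivative \<psi> t) (at t)" for t
  proof -
    have "(\<phi> has_derivative (\<lambda>h. mol_grad \<epsilon> K (x + t *\<^sub>R v) \<bullet> (h *\<^sub>R v) + mol_grad \<epsilon> K (x - t *\<^sub>R v) \<bullet> (- (h *\<^sub>R v)))) (at t)"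
      unfolding \<phi>_def[abs_def]
      by (intro has_derivative_add has_derivative_compose[OF l(1) C2(1)] has_derivative_compose[OF l(2) C2(1)])
    then show ?thesis by (rule has_derivative_imp_has_field_derivative) (simp add: \<psi>_def algebra_simps)
  qed
  have d\<psi>: "(\<psi> has_real_derivative 2 * (v \<bullet> (mol_hess \<epsilon> K x *v v))) (at 0)"
  proof -
    have "(\<psi> has_derivative (\<lambda>h. (mol_hess \<epsilon> K (x + 0 *\<^sub>R v) *v (h *\<^sub>R v)) \<bullet> v - (mol_hess \<epsilon> K (x - 0 *\<^sub>R v) *v (- (h *\<^sub>R v))) \<bullet> v)) (at 0)"
      unfolding \<psi>_def[abs_def]
      by (intro has_derivative_diff has_derivative_inner_left has_derivative_compose[OF l(1) C2(2)] has_derivative_compose[OF l(2) C2(2)])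
    then show ?thesis
    proof (rule has_derivative_imp_has_field_derivative)
      have m: "mol_hess \<epsilon> K x *v (- (h *\<^sub>R v)) = - (h *\<^sub>R (mol_hess \<epsilon> K x *v v))" for h
        using matrix_vector_mult_scaleR[of "mol_hess \<epsilon> K x" "- h" v] by simp
      show "h * (2 * (v \<bullet> (mol_hess \<epsilon> K x *v v))) = (mol_hess \<epsilon> K (x + 0 *\<^sub>R v) *v (h *\<^sub>R v)) \<bullet> v - (mol_hess \<epsilon> K (x - 0 *\<^sub>R v) *v (- (h *\<^sub>R v))) \<bullet> v" for h
        by (simp add: m matrix_vector_mult_scaleR inner_commute)
    qed
  qed
  obtain d where d: "d > 0" "\<And>h. 0 < h \<Longrightarrow> h < d \<Longrightarrow> \<psi> (0 + h) < \<psi> 0"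
    using DERIV_neg_dec_right[OF d\<psi>] neg by auto
  have "eventually (\<lambda>t. norm (x + t *\<^sub>R v) + \<epsilon> < K \<and> norm (x - t *\<^sub>R v) + \<epsilon> < K) (at_right 0)"
  proof (rule eventually_conj)
    have "((\<lambda>t. norm (x + t *\<^sub>R v) + \<epsilon>) \<longlongrightarrow> norm (x + 0 *\<^sub>R v) + \<epsilon>) (at_right 0)" by (intro tendsto_intros)
    then show "eventually (\<lambda>t. norm (x + t *\<^sub>R v) + \<epsilon> < K) (at_right 0)" using x by (intro order_tendstoD(2)) auto
    have "((\<lambda>t. norm (x - t *\<^sub>R v) + \<epsilon>) \<longlongrightarrow> norm (x - 0 *\<^sub>R v) + \<epsilon>) (at_right 0)" by (intro tendsto_intros)
    then show "eventually (\<lambda>t. norm (x - t *\<^sub>R v) + \<epsilon> < K) (at_right 0)" using x by (intro order_tendstoD(2)) auto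
  qed
  moreover have "eventually (\<lambda>t. t < d) (at_right 0)" using d(1) by (rule order_tendstoD(2)[OF tendsto_ident_at])
  moreover have "eventually (\<lambda>t. 0 < t) (at_right (0::real))" by (rule eventually_at_right_less)
  ultimately have "eventually (\<lambda>t. norm (x + t *\<^sub>R v) + \<epsilon> < K \<and> norm (x - t *\<^sub>R v) + \<epsilon> < K \<and> t < d \<and> 0 < t) (at_right 0)"
    by eventually_elim auto
  then obtain t where t: "norm (x + t *\<^sub>R v) + \<epsilon> < K" "norm (x - t *\<^sub>R v) + \<epsilon> < K" "t < d" "0 < t"
    by (metis (mono_tags, lifting) eventually_happens' trivial_limit_at_right_real)
  have "\<phi> t < \<phi> 0"
  proof (rule DERIV_neg_imp_decreasing_open[OF t(4)])
    show "\<exists>y. (\<phi> has_real_derivative y) (at s) \<and> y < 0" if "0 < s" "s < t" for s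
      using d\<phi>[of s] d(2)[of s] that t by (auto simp: \<psi>_def)
    show "continuous_on {0..t} \<phi>"
      using d\<phi> by (meson DERIV_isCont continuous_at_imp_continuous_on)
  qed
  moreover have "\<phi> 0 \<le> \<phi> t"
  proof -
    have i: "integrable lborel (\<lambda>w. z (x - w) * bump 3 0 \<epsilon> w)" "integrable lborel (\<lambda>w. z (x + t *\<^sub>R v - w) * bump 3 0 \<epsilon> w)"
      "integrable lborel (\<lambda>w. z (x - t *\<^sub>R v - w) * bump 3 0 \<epsilon> w)"
      using mol_eq(2)[OF \<epsilon>, of _ K] x t by auto
    have "\<phi> 0 = (\<integral>w. 2 * (z (x - w) * bump 3 0 \<epsilon> w) \<partial>lborel)"
      using mol_eq(1)[OF \<epsilon>, of x K] x i(1) by (simp add: \<phi>_def)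
    also have "\<dots> \<le> (\<integral>w. z (x + t *\<^sub>R v - w) * bump 3 0 \<epsilon> w + z (x - t *\<^sub>R v - w) * bump 3 0 \<epsilon> w \<partial>lborel)"
    proof (rule integral_mono)
      fix w
      have "2 * z (x - w) \<le> z (x + t *\<^sub>R v - w) + z (x - t *\<^sub>R v - w)"
        using second_difference[of "x - w" "t *\<^sub>R v"] by (simp add: algebra_simps)
      then have "2 * z (x - w) * bump 3 0 \<epsilon> w \<le> (z (x + t *\<^sub>R v - w) + z (x - t *\<^sub>R v - w)) * bump 3 0 \<epsilon> w"
        by (rule mult_right_mono) simp
      then show "2 * (z (x - w) * bump 3 0 \<epsilon> w) \<le> z (x + t *\<^sub>R v - w) * bump 3 0 \<epsilon> w + z (x - t *\<^sub>R v - w) * bump 3 0 \<epsilon> w"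
        by (simp add: algebra_simps)
    qed (use i in auto)
    also have "\<dots> = \<phi> t" using mol_eq(1)[OF \<epsilon>, of _ K] t i by (simp add: \<phi>_def)
    finally show ?thesis .
  qed
  ultimately show False by simp
qed


lemma bump2_cont:
  fixes g :: "'b :: topological_space \<Rightarrow> real ^ 'n"
  assumes "0 < \<epsilon>" "continuous_on S g"
  shows "continuous_on S (\<lambda>y. bump 2 0 \<epsilon> (g y))"
  unfolding bump_def
  by (rule continuous_on_compose2[OF pospow_cont]) (use assms in \<open>auto intro!: continuous_intros\<close>)

lemma bump2_integrable:
  assumes \<epsilon>: "0 < \<epsilon>" and g: "continuous_on UNIV g"
  shows "integrable lborel (\<lambda>v :: real ^ 'n. g v * bump 2 0 \<epsilon> v)"
proof (rule integrable_continuous_compact_support[where S = "cball 0 \<epsilon>"])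
  show "continuous_on UNIV (\<lambda>v :: real ^ 'n. g v * bump 2 0 \<epsilon> v)"
    by (intro continuous_intros bump2_cont \<epsilon> g)
  fix v :: "real ^ 'n" assume "v \<notin> cball 0 \<epsilon>"
  then show "g v * bump 2 0 \<epsilon> v = 0" using \<epsilon> by (simp add: bump_zero)
qed simp

text \<open>Up to the factor \<open>- 6 / \<epsilon>\<^sup>2\<close> the Laplacian of \<open>bump 3 0 \<epsilon>\<close> is the derivative at \<open>w = 1\<close> of the dilations
  \<open>w ^ n * bump 2 0 \<epsilon> (w v)\<close>, and by convexity averages over growing dilations increase at least linearly.\<close>

lemma mol_laplacian_ge:
  assumes \<epsilon>: "0 < \<epsilon>" and x: "norm x + \<epsilon> \<le> K"
  shows "6 / \<epsilon>\<^sup>2 * (\<integral>v. (z (x - v) - z x) * bump 2 0 \<epsilon> v \<partial>lborel) \<le> (\<Sum>i\<in>UNIV. mol_hess \<epsilon> K x $ i $ i)"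
proof -
  define s where "s v = (norm v)\<^sup>2 / \<epsilon>\<^sup>2" for v :: "real ^ 'n"
  define P where "P w v = w ^ CARD('n) * pospow 2 (1 - s v * w\<^sup>2)" for w :: real and v :: "real ^ 'n"
  define DP where "DP w v = CARD('n) * w ^ (CARD('n) - 1) * pospow 2 (1 - s v * w\<^sup>2) - 4 * s v * w * w ^ CARD('n) * pospow 1 (1 - s v * w\<^sup>2)" for w :: real and v :: "real ^ 'n"
  have DP: "((\<lambda>w. P w v) has_real_derivative DP w v) (at w)" for w v
  proof -
    have "((\<lambda>w. 1 - s v * w\<^sup>2) has_real_derivative (- 2 * s v * w)) (at w)" by (auto intro!: derivative_eq_intros)
    from DERIV_chain2[OF pospow_deriv this, of 2]
    have *: "((\<lambda>w. pospow 2 (1 - s v * w\<^sup>2)) has_real_derivative (2 * pospow 1 (1 - s v * w\<^sup>2) * (- 2 * s v * w))) (at w)"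
      by simp
    show ?thesis unfolding P_def DP_def by (rule derivative_eq_intros refl *)+ (simp add: algebra_simps)
  qed
  have sc: "continuous_on S g \<Longrightarrow> continuous_on S (\<lambda>y. s (g y))" for S :: "'b :: topological_space set" and g
    unfolding s_def using \<epsilon> by (intro continuous_intros) auto
  have pc: "continuous_on S g \<Longrightarrow> continuous_on S (\<lambda>y. pospow j (g y))" for S :: "'b :: topological_space set" and g j
    by (rule continuous_on_compose2[OF pospow_cont[of UNIV]]) auto
  define M where "M w = integral (cube 0 (2 * \<epsilon>)) (\<lambda>v. z (x - v) * P w v)" for w
  have M_deriv: "(M has_field_derivative integral (cube 0 (2 * \<epsilon>)) (\<lambda>v. z (x - v) * DP 1 v)) (at 1 within {1/2..1})"
    unfolding M_def[abs_def] cube_def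
  proof (rule leibniz_rule_field_derivative)
    show "((\<lambda>w. z (x - v) * P w v) has_field_derivative z (x - v) * DP w v) (at w within {1/2..1})" for w v
      by (rule DERIV_cmult[OF has_field_derivative_at_within[OF DP]])
    show "(\<lambda>v. z (x - v) * P w v) integrable_on cbox a b" for w a b
      unfolding P_def by (intro integrable_continuous continuous_intros z_cont_compose sc pc)
    show "continuous_on ({1/2..1} \<times> cbox a b) (\<lambda>(w, v). z (x - v) * DP w v)" for a b
      unfolding DP_def split_beta by (intro continuous_intros z_cont_compose sc pc)
  qed auto
  \<comment> \<open>For \<open>w \<ge> 1/2\<close> the dilated bump vanishes off the ball of radius
    \<open>2 \<epsilon>\<close>, so a single cube carries all the integrals.\<close>
  have s_ge: "1 \<le> s v * w\<^sup>2" if "v \<notin> cube 0 (2 * \<epsilon>)" "1/2 \<le> w" for v w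
  proof -
    have "v \<notin> cball 0 (2 * \<epsilon>)" using that cball_subset_cube by blast
    then have "2 * \<epsilon> \<le> norm v" by simp
    then have "\<epsilon> \<le> norm v * w" using that(2) \<epsilon> mult_mono[of "2 * \<epsilon>" "norm v" "1/2" w] by simp
    then have "\<epsilon>\<^sup>2 \<le> (norm v * w)\<^sup>2" using \<epsilon> by (intro power_mono) auto
    then show ?thesis using \<epsilon> by (simp add: s_def power_mult_distrib)
  qed
  have pz: "pospow j (1 - a) = 0" if "1 \<le> a" "j \<ge> 1" for a j
    using that by (simp add: pospow_def max_def power_0_left)
  have M_eq: "M w = (\<integral>u. z (x - (1 / w) *\<^sub>R u) * bump 2 0 \<epsilon> u \<partial>lborel)" if w: "1/2 \<le> w" for w
  proof -
    have c: "continuous_on UNIV (\<lambda>v. z (x - v) * P w v)"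
      unfolding P_def by (intro continuous_intros z_cont_compose sc pc)
    have "M w = (\<integral>v. z (x - v) * P w v \<partial>lborel)"
      unfolding M_def cube_def
      by (rule integral_cbox_eq_lborel[OF c]) (use s_ge[OF _ w] pz in \<open>auto simp: P_def cube_def\<close>)
    also have "\<dots> = \<bar>1 / w\<bar> ^ CARD('n) * (\<integral>u. z (x - (0 + (1 / w) *\<^sub>R u)) * P w (0 + (1 / w) *\<^sub>R u) \<partial>lborel)"
      using w by (intro lborel_integral_affine borel_measurable_continuous_onI[OF c]) auto
    also have "\<dots> = (\<integral>u. \<bar>1 / w\<bar> ^ CARD('n) * (z (x - (0 + (1 / w) *\<^sub>R u)) * P w (0 + (1 / w) *\<^sub>R u)) \<partial>lborel)"
      by simp
    also have "\<dots> = (\<integral>u. z (x - (1 / w) *\<^sub>R u) * bump 2 0 \<epsilon> u \<partial>lborel)"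
    proof (rule Bochner_Integration.integral_cong[OF refl])
      fix u :: "real ^ 'n"
      have "s ((1 / w) *\<^sub>R u) * w\<^sup>2 = (norm u)\<^sup>2 / \<epsilon>\<^sup>2" using w by (simp add: s_def power_divide power_mult_distrib)
      then show "\<bar>1 / w\<bar> ^ CARD('n) * (z (x - (0 + (1 / w) *\<^sub>R u)) * P w (0 + (1 / w) *\<^sub>R u)) = z (x - (1 / w) *\<^sub>R u) * bump 2 0 \<epsilon> u"
        using w by (simp add: P_def bump_def power_divide)
    qed
    finally show ?thesis .
  qed
  define c where "c = (\<integral>v. (z (x - v) - z x) * bump 2 0 \<epsilon> v \<partial>lborel)"
  \<comment> \<open>The factor in \<open>dilation_difference\<close> is \<open>1 / w\<close>, which
    exceeds 1; division by the negative \<open>w - 1\<close> reverses the inequality.\<close>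
  have quot: "(M w - M 1) / (w - 1) \<le> - (c / w)" if w: "1/2 \<le> w" "w < 1" for w
  proof -
    have i1: "integrable lborel (\<lambda>u. z (x - (1 / w) *\<^sub>R u) * bump 2 0 \<epsilon> u)" "integrable lborel (\<lambda>u. z (x - u) * bump 2 0 \<epsilon> u)"
      "integrable lborel (\<lambda>u. (z (x - u) - z x) * bump 2 0 \<epsilon> u)"
      by (intro bump2_integrable \<epsilon> continuous_intros z_cont_compose)+
    have "(1 / w - 1) * c = (\<integral>u. (1 / w - 1) * ((z (x - u) - z x) * bump 2 0 \<epsilon> u) \<partial>lborel)" by (simp add: c_def)
    also have "\<dots> \<le> (\<integral>u. z (x - (1 / w) *\<^sub>R u) * bump 2 0 \<epsilon> u - z (x - u) * bump 2 0 \<epsilon> u \<partial>lborel)"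
    proof (rule integral_mono)
      fix u :: "real ^ 'n"
      have "(1 / w - 1) * (z (x - u) - z x) \<le> z (x - (1 / w) *\<^sub>R u) - z (x - u)"
        using w by (intro dilation_difference) (auto simp: le_divide_eq)
      then have "(1 / w - 1) * (z (x - u) - z x) * bump 2 0 \<epsilon> u \<le> (z (x - (1 / w) *\<^sub>R u) - z (x - u)) * bump 2 0 \<epsilon> u"
        by (rule mult_right_mono) simp
      then show "(1 / w - 1) * ((z (x - u) - z x) * bump 2 0 \<epsilon> u) \<le> z (x - (1 / w) *\<^sub>R u) * bump 2 0 \<epsilon> u - z (x - u) * bump 2 0 \<epsilon> u"
        by (simp add: algebra_simps)
    qed (use i1 in auto)
    also have "\<dots> = M w - M 1" using i1 w M_eq[of w] M_eq[of 1] by simp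
    finally have "(1 / w - 1) * c \<le> M w - M 1" .
    moreover have "(1 / w - 1) * c = - (c / w) * (w - 1)" using w by (simp add: field_simps)
    ultimately show ?thesis using w by (simp add: divide_le_eq neg_divide_le_eq)
  qed
  have "integral (cube 0 (2 * \<epsilon>)) (\<lambda>v. z (x - v) * DP 1 v) \<le> - (c / 1)"
  proof (rule tendsto_le)
    show "((\<lambda>w. (M w - M 1) / (w - 1)) \<longlongrightarrow> integral (cube 0 (2 * \<epsilon>)) (\<lambda>v. z (x - v) * DP 1 v)) (at 1 within {1/2..1})"
      using M_deriv by (simp add: has_field_derivative_iff)
    show "((\<lambda>w. - (c / w)) \<longlongrightarrow> - (c / 1)) (at 1 within {1/2..1})" by (intro tendsto_intros) auto
    show "eventually (\<lambda>w. (M w - M 1) / (w - 1) \<le> - (c / w)) (at 1 within {1/2..1})"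
      unfolding eventually_at_filter by (rule always_eventually) (use quot in auto)
    show "at (1::real) within {1/2..1} \<noteq> bot" by (simp add: at_within_Icc_at_left)
  qed
  also have "integral (cube 0 (2 * \<epsilon>)) (\<lambda>v. z (x - v) * DP 1 v) = (\<integral>v. z (x - v) * DP 1 v \<partial>lborel)"
    unfolding cube_def
  proof (rule integral_cbox_eq_lborel)
    show "continuous_on UNIV (\<lambda>v. z (x - v) * DP 1 v)"
      unfolding DP_def by (intro continuous_intros z_cont_compose sc pc)
  qed (use s_ge[of _ 1] pz in \<open>auto simp: DP_def cube_def\<close>)
  finally have D: "(\<integral>v. z (x - v) * DP 1 v \<partial>lborel) \<le> - c" by simp
  \<comment> \<open>The trace of the Hessian of the mollifier is a multiple of the dilation
    derivative at 1, so the bound \<open>D\<close> for the latter becomes the bound for the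
    Laplacian.\<close>
  have tr: "(\<Sum>i\<in>UNIV. bump_hess 3 0 \<epsilon> v $ i $ i) = - (6 / \<epsilon>\<^sup>2) * DP 1 v" for v :: "real ^ 'n"
    unfolding bump_hess_trace DP_def s_def by (simp add: algebra_simps)
  have hz: "bump_hess 3 0 \<epsilon> v $ i $ j = 0" if "\<epsilon> \<le> norm v" for v :: "real ^ 'n" and i j
  proof -
    have "\<epsilon>\<^sup>2 \<le> (norm v)\<^sup>2" using that \<epsilon> by (intro power_mono) auto
    then have "1 \<le> (norm v)\<^sup>2 / \<epsilon>\<^sup>2" using \<epsilon> by simp
    then show ?thesis by (simp add: bump_hess_def pz)
  qed
  have conv: "mol_hess \<epsilon> K x $ i $ i = (\<integral>v. z (x - v) * bump_hess 3 0 \<epsilon> v $ i $ i \<partial>lborel)"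
    "integrable lborel (\<lambda>v. z (x - v) * bump_hess 3 0 \<epsilon> v $ i $ i)" for i
    unfolding mol_hess_nth[OF \<epsilon>]
    by (rule conv_eq[where \<epsilon> = \<epsilon> and K = K];
        use hz x bump_cont(3)[OF \<epsilon>, of UNIV "\<lambda>v. v"] in \<open>auto intro!: continuous_intros\<close>)+
  have "(\<Sum>i\<in>UNIV. mol_hess \<epsilon> K x $ i $ i) = (\<integral>v. (\<Sum>i\<in>UNIV. z (x - v) * bump_hess 3 0 \<epsilon> v $ i $ i) \<partial>lborel)"
    by (subst Bochner_Integration.integral_sum) (auto simp: conv)
  also have "\<dots> = (\<integral>v. - (6 / \<epsilon>\<^sup>2) * (z (x - v) * DP 1 v) \<partial>lborel)"
    by (simp add: sum_distrib_left[symmetric] tr mult_ac)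
  also have "\<dots> = - (6 / \<epsilon>\<^sup>2) * (\<integral>v. z (x - v) * DP 1 v \<partial>lborel)"
    by (rule integral_mult_right_zero)
  finally have eq: "(\<Sum>i\<in>UNIV. mol_hess \<epsilon> K x $ i $ i) = - (6 / \<epsilon>\<^sup>2) * (\<integral>v. z (x - v) * DP 1 v \<partial>lborel)" .
  have "6 / \<epsilon>\<^sup>2 * c \<le> 6 / \<epsilon>\<^sup>2 * (- (\<integral>v. z (x - v) * DP 1 v \<partial>lborel))"
    using D by (intro mult_left_mono) auto
  then show ?thesis unfolding eq c_def by simp
qed

text \<open>One of the two subgradients at \<open>a\<close> differs from a subgradient
  \<open>s\<close> at \<open>x\<close> by at least half of \<open>p - q\<close>. Along that
  direction \<open>z\<close> exceeds its tangent plane at \<open>x\<close> by a fixed multiple of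
  the distance of the slopes, on a cube of size comparable to \<open>\<epsilon>\<close>.\<close>

lemma bump2_average_ge:
  fixes a p q :: "real ^ 'n"
  assumes \<epsilon>: "0 < \<epsilon>" and xa: "norm (x - a) \<le> \<epsilon> / 8"
    and p: "\<And>y. z a + p \<bullet> (y - a) \<le> z y" and q: "\<And>y. z a + q \<bullet> (y - a) \<le> z y"
  shows "norm (p - q) / 2 * \<epsilon> / 40 * (\<epsilon> / (4 * sqrt CARD('n))) ^ CARD('n) \<le> (\<integral>v. (z (x - v) - z x) * bump 2 0 \<epsilon> v \<partial>lborel)"
proof -
  define B where "B = (\<epsilon> / (4 * sqrt CARD('n))) ^ CARD('n)"
  have B0: "0 \<le> B" using \<epsilon> by (simp add: B_def)
  obtain s where s: "\<And>y. z x + s \<bullet> (y - x) \<le> z y" using subgradient by blast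
  \<comment> \<open>The bump is even, so a linear term may be added for free; with it the integrand
    becomes nonnegative.\<close>
  have odd: "(\<integral>v. (s \<bullet> v) * bump 2 0 \<epsilon> v \<partial>lborel) = 0"
  proof -
    have c: "continuous_on UNIV (\<lambda>v. (s \<bullet> v) * bump 2 0 \<epsilon> v)" by (intro continuous_intros bump2_cont \<epsilon>)
    have "(\<integral>v. (s \<bullet> v) * bump 2 0 \<epsilon> v \<partial>lborel) = (\<integral>v. - ((s \<bullet> v) * bump 2 0 \<epsilon> v) \<partial>lborel)"
      using lborel_integral_affine[of "-1" "\<lambda>v. (s \<bullet> v) * bump 2 0 \<epsilon> v" 0] borel_measurable_continuous_onI[OF c]
      by (simp add: bump_def)
    then show ?thesis by simp
  qed
  have i1: "integrable lborel (\<lambda>v. (z (x - v) - z x) * bump 2 0 \<epsilon> v)" "integrable lborel (\<lambda>v. (s \<bullet> v) * bump 2 0 \<epsilon> v)"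
    by (intro bump2_integrable \<epsilon> continuous_intros z_cont_compose)+
  have eq: "(\<integral>v. (z (x - v) - z x) * bump 2 0 \<epsilon> v \<partial>lborel) = (\<integral>v. (z (x - v) - z x + s \<bullet> v) * bump 2 0 \<epsilon> v \<partial>lborel)"
    using i1 odd by (simp add: distrib_right)
  have nn: "0 \<le> z (x - v) - z x + s \<bullet> v" for v using s[of "x - v"] by simp
  have main: "norm (p - s) * \<epsilon> / 40 * B \<le> (\<integral>v. (z (x - v) - z x) * bump 2 0 \<epsilon> v \<partial>lborel)"
    if p: "\<And>y. z a + p \<bullet> (y - a) \<le> z y" for p
  proof (cases "p = s")
    case True
    have "0 \<le> (\<integral>v. (z (x - v) - z x + s \<bullet> v) * bump 2 0 \<epsilon> v \<partial>lborel)"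
      by (intro Bochner_Integration.integral_nonneg) (simp add: nn)
    then show ?thesis using True eq by simp
  next
    case False
    define e where "e = (p - s) /\<^sub>R norm (p - s)"
    have ne: "norm e = 1" using False by (simp add: e_def)
    have pe: "(p - s) \<bullet> e = norm (p - s)"
      using False by (simp add: e_def power2_norm_eq_inner[symmetric] power2_eq_square)
    define r where "r = \<epsilon> / (8 * sqrt CARD('n))"
    have r: "0 < r" "sqrt CARD('n) * r = \<epsilon> / 8" using \<epsilon> by (auto simp: r_def)
    \<comment> \<open>\<open>r\<close> places \<open>E\<close> within \<open>\<epsilon> / 8\<close>
      of its centre, hence in the ball of radius \<open>7/8 \<epsilon>\<close>, where the bump is at
      least \<open>(15/64)^2 \<ge> 1/20\<close>. On \<open>E\<close> the excess over the tangent
      plane is at least \<open>3/4 - 1/8 - 1/8 = 1/2\<close> times \<open>\<epsilon>\<close> times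
      the distance of the slopes.\<close>
    define E where "E = cube (- (3 / 4 * \<epsilon>) *\<^sub>R e) r"
    have mE: "vol E = B"
    proof -
      have "2 * r = \<epsilon> / (4 * sqrt CARD('n))" by (simp add: r_def)
      then show ?thesis using r unfolding E_def B_def by (subst measure_cube) auto
    qed
    have iE: "integrable lborel (indicator E :: _ \<Rightarrow> real)"
      unfolding E_def using emeasure_cube[of r "- (3 / 4 * \<epsilon>) *\<^sub>R e"] r
      by (intro integrable_real_indicator) (auto simp: compact_imp_closed borel_closed)
    have "norm (p - s) * \<epsilon> / 40 * B = (\<integral>v. (norm (p - s) * \<epsilon> / 40) * indicator E v \<partial>lborel)"
      using mE iE by (simp add: E_def compact_imp_closed borel_closed)
    also have "\<dots> \<le> (\<integral>v. (z (x - v) - z x + s \<bullet> v) * bump 2 0 \<epsilon> v \<partial>lborel)"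
    proof (rule integral_mono)
      show "integrable lborel (\<lambda>v. norm (p - s) * \<epsilon> / 40 * indicator E v)" using iE by simp
      show "integrable lborel (\<lambda>v. (z (x - v) - z x + s \<bullet> v) * bump 2 0 \<epsilon> v)"
        by (intro bump2_integrable \<epsilon> continuous_intros z_cont_compose)
      fix v
      show "norm (p - s) * \<epsilon> / 40 * indicator E v \<le> (z (x - v) - z x + s \<bullet> v) * bump 2 0 \<epsilon> v"
      proof (cases "v \<in> E")
        case True
        define u where "u = v + (3 / 4 * \<epsilon>) *\<^sub>R e"
        have u: "norm u \<le> \<epsilon> / 8" using cube_norm_le[OF True[unfolded E_def]] r by (simp add: u_def)
        have v: "v = u - (3 / 4 * \<epsilon>) *\<^sub>R e" by (simp add: u_def)
        have nv: "norm v \<le> 7 / 8 * \<epsilon>"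
          unfolding v using norm_triangle_ineq4[of u "(3 / 4 * \<epsilon>) *\<^sub>R e"] u ne \<epsilon> by simp
        have "(norm v)\<^sup>2 \<le> (7 / 8 * \<epsilon>)\<^sup>2" using nv by (intro power_mono) auto
        then have "(norm v)\<^sup>2 / \<epsilon>\<^sup>2 \<le> 49 / 64" using \<epsilon> by (simp add: divide_le_eq power_mult_distrib power_divide)
        then have "15 / 64 \<le> max 0 (1 - (norm v)\<^sup>2 / \<epsilon>\<^sup>2)" by linarith
        then have "(15 / 64)\<^sup>2 \<le> (max 0 (1 - (norm v)\<^sup>2 / \<epsilon>\<^sup>2))\<^sup>2" by (rule power_mono) simp
        then have b: "1 / 20 \<le> bump 2 0 \<epsilon> v" unfolding bump_def pospow_def by (simp add: power2_eq_square)
        have "\<bar>(p - s) \<bullet> u\<bar> \<le> norm (p - s) * (\<epsilon> / 8)"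
          using Cauchy_Schwarz_ineq2[of "p - s" u] u by (meson mult_left_mono norm_ge_zero order_trans)
        moreover have "\<bar>(p - s) \<bullet> (x - a)\<bar> \<le> norm (p - s) * (\<epsilon> / 8)"
          using Cauchy_Schwarz_ineq2[of "p - s" "x - a"] xa by (meson mult_left_mono norm_ge_zero order_trans)
        moreover have "(p - s) \<bullet> v = (p - s) \<bullet> u - (3 / 4 * \<epsilon>) * norm (p - s)"
          unfolding v by (simp add: inner_diff_right pe)
        moreover have "(p - s) \<bullet> (x - a) - (p - s) \<bullet> v \<le> z (x - v) - z x + s \<bullet> v"
          using p[of "x - v"] s[of a] by (simp add: inner_diff_right inner_diff_left algebra_simps)
        moreover have "norm (p - s) * (\<epsilon> / 2) = (3 / 4 * \<epsilon>) * norm (p - s) - 2 * (norm (p - s) * (\<epsilon> / 8))"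
          by (simp add: algebra_simps)
        ultimately have "norm (p - s) * (\<epsilon> / 2) \<le> z (x - v) - z x + s \<bullet> v" unfolding abs_le_iff by linarith
        then have "norm (p - s) * (\<epsilon> / 2) * (1 / 20) \<le> (z (x - v) - z x + s \<bullet> v) * bump 2 0 \<epsilon> v"
          using b nn[of v] by (intro mult_mono) auto
        then show ?thesis using True by simp
      qed (simp add: nn)
    qed
    finally show ?thesis by (simp add: eq)
  qed
  have "norm (p - q) \<le> norm (p - s) + norm (q - s)" using norm_triangle_ineq4[of "p - s" "q - s"] by simp
  then have "norm (p - q) / 2 \<le> norm (p - s) \<or> norm (p - q) / 2 \<le> norm (q - s)" by linarith
  then obtain r where r: "norm (p - q) / 2 \<le> norm (r - s)" "\<And>y. z a + r \<bullet> (y - a) \<le> z y" using p q by blast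
  have "norm (p - q) / 2 * (\<epsilon> / 40 * B) \<le> norm (r - s) * (\<epsilon> / 40 * B)"
    using r(1) \<epsilon> B0 by (intro mult_right_mono) auto
  moreover have "norm (p - q) / 2 * \<epsilon> / 40 * B = norm (p - q) / 2 * (\<epsilon> / 40 * B)"
    "norm (r - s) * \<epsilon> / 40 * B = norm (r - s) * (\<epsilon> / 40 * B)" by simp_all
  ultimately show ?thesis using main[OF r(2)] unfolding B_def[symmetric] by linarith
qed

end

text \<open>The mollified convex function for prescribed data \<open>f\<close> on a grid of mesh
  \<open>h\<close>. The radius \<open>\<epsilon>\<close> is chosen so that every point of a grid
  cell is within \<open>\<epsilon> / 8\<close> of its centre, as \<open>bump2_average_ge\<close>
  requires. The bounds are uniform in \<open>h\<close> apart from the term \<open>\<epsilon>\<close>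
  in the bound for \<open>Z\<close>.\<close>

lemma test_function_exists:
  fixes I :: "(real ^ 'n) set" and f :: "real ^ 'n \<Rightarrow> real" and h F R :: real and y :: "real ^ 'n"
  defines "\<epsilon> \<equiv> 4 * sqrt CARD('n) * h"
  assumes I: "finite I" "I \<noteq> {}" and f: "\<And>x. x \<in> I \<Longrightarrow> 0 < f x" and h: "0 < h"
    and F: "0 < F" "F ^ CARD('n) = (\<Sum>x\<in>I. (h * f x) ^ CARD('n))"
  shows "\<exists>Z G H. C2_data Z G H \<and> (\<forall>x. norm (x - y) \<le> R \<longrightarrow>
     norm (G x) \<le> CARD('n) * 2 ^ CARD('n) * F \<and> \<bar>Z x\<bar> \<le> CARD('n) * 2 ^ CARD('n) * F * (R + \<epsilon>) \<and>
     (\<forall>v. 0 \<le> v \<bullet> (H x *v v)) \<and>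
     (\<forall>i\<in>I. norm (x - i) \<le> sqrt CARD('n) * h / 2 \<longrightarrow>
        3 / 160 / (4 * sqrt CARD('n)) ^ (CARD('n) + 1) * f i \<le> (\<Sum>j\<in>UNIV. H x $ j $ j)))"
proof -
  have \<epsilon>: "0 < \<epsilon>" using h by (simp add: \<epsilon>_def)
  obtain z0 where z0: "\<And>x. \<exists>s. \<forall>y. z0 x + s \<bullet> (y - x) \<le> z0 y"
     "\<And>x y. \<bar>z0 x - z0 y\<bar> \<le> CARD('n) * F * norm (x - y)"
     "\<And>x. x \<in> I \<Longrightarrow> \<exists>p q. h * f x / 4 \<le> norm (p - q) \<and> (\<forall>y. z0 x + p \<bullet> (y - x) \<le> z0 y) \<and> (\<forall>y. z0 x + q \<bullet> (y - x) \<le> z0 y)"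
    using convex_function_with_slopes[OF I f h F] by blast
  \<comment> \<open>The division makes up for the kernel without normalisation, and vanishing at
    \<open>y\<close> turns the Lipschitz bound into a bound for the values near
    \<open>y\<close>.\<close>
  define z where "z x = (z0 x - z0 y) / \<epsilon> ^ CARD('n)" for x
  define L where "L = CARD('n) * F / \<epsilon> ^ CARD('n)"
  have \<epsilon>p: "0 < \<epsilon> ^ CARD('n)" using \<epsilon> by simp
  have scale: "z x + (s /\<^sub>R \<epsilon> ^ CARD('n)) \<bullet> (u - x) \<le> z u" if "z0 x + s \<bullet> (u - x) \<le> z0 u" for x s u
  proof -
    have "z x + (s /\<^sub>R \<epsilon> ^ CARD('n)) \<bullet> (u - x) = (z0 x + s \<bullet> (u - x) - z0 y) / \<epsilon> ^ CARD('n)"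
      unfolding z_def by (simp add: divide_inverse algebra_simps)
    also have "\<dots> \<le> z u" unfolding z_def using that \<epsilon>p by (intro divide_right_mono) auto
    finally show ?thesis .
  qed
  interpret convex_lipschitz z L
  proof
    fix x u
    show "\<exists>s. \<forall>u. z x + s \<bullet> (u - x) \<le> z u" using z0(1)[of x] scale by blast
    have "\<bar>z x - z u\<bar> = \<bar>z0 x - z0 u\<bar> / \<epsilon> ^ CARD('n)"
      using \<epsilon>p by (simp add: z_def diff_divide_distrib[symmetric])
    also have "\<dots> \<le> CARD('n) * F * norm (x - u) / \<epsilon> ^ CARD('n)"
      using z0(2) \<epsilon>p by (intro divide_right_mono) auto
    finally show "\<bar>z x - z u\<bar> \<le> L * norm (x - u)" by (simp add: L_def)
  qed
  define K where "K = norm y + R + \<epsilon> + 1"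
  have Leps: "L * (2 * \<epsilon>) ^ CARD('n) = CARD('n) * 2 ^ CARD('n) * F"
    using \<epsilon> by (simp add: L_def power_mult_distrib)
  have xK: "norm x + \<epsilon> < K" if "norm (x - y) \<le> R" for x
    using that norm_triangle_ineq2[of x y] by (simp add: K_def)
  show ?thesis
  proof (intro exI[of _ "mol \<epsilon> K"] exI[of _ "mol_grad \<epsilon> K"] exI[of _ "mol_hess \<epsilon> K"] conjI allI impI ballI)
    show "C2_data (mol \<epsilon> K) (mol_grad \<epsilon> K) (mol_hess \<epsilon> K)" by (rule mol_C2_data[OF \<epsilon>])
    fix x assume x: "norm (x - y) \<le> R"
    show "norm (mol_grad \<epsilon> K x) \<le> CARD('n) * 2 ^ CARD('n) * F" using mol_grad_le[OF \<epsilon> xK[OF x]] unfolding Leps .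
    show "0 \<le> v \<bullet> (mol_hess \<epsilon> K x *v v)" for v by (rule mol_hess_nonneg[OF \<epsilon> xK[OF x]])
    have xK': "norm x + \<epsilon> \<le> K" using xK[OF x] by simp
    show "\<bar>mol \<epsilon> K x\<bar> \<le> CARD('n) * 2 ^ CARD('n) * F * (R + \<epsilon>)"
    proof -
      have R: "0 \<le> R" using x norm_ge_zero order_trans by blast
      have "\<bar>mol \<epsilon> K x\<bar> \<le> (\<integral>v. \<bar>z (x - v) * bump 3 0 \<epsilon> v\<bar> \<partial>lborel)"
        unfolding mol_eq(1)[OF \<epsilon> xK'] using integral_norm_bound[of lborel "\<lambda>v. z (x - v) * bump 3 0 \<epsilon> v"] by simp
      also have "\<dots> \<le> (\<integral>v. L * (R + \<epsilon>) * bump 3 (0 :: real ^ 'n) \<epsilon> v \<partial>lborel)"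
      proof (rule integral_mono)
        show "integrable lborel (\<lambda>v. \<bar>z (x - v) * bump 3 0 \<epsilon> v\<bar>)" using mol_eq(2)[OF \<epsilon> xK'] by simp
        show "integrable lborel (\<lambda>v. L * (R + \<epsilon>) * bump 3 (0 :: real ^ 'n) \<epsilon> v)" using bump_integral_le(1)[OF \<epsilon>] by simp
        fix v
        show "\<bar>z (x - v) * bump 3 0 \<epsilon> v\<bar> \<le> L * (R + \<epsilon>) * bump 3 0 \<epsilon> v"
        proof (cases "\<epsilon> \<le> norm v")
          case True then show ?thesis using \<epsilon> by (simp add: bump_zero)
        next
          case False
          have "\<bar>z (x - v)\<bar> \<le> L * norm (x - v - y)" using lipschitz[of "x - v" y] by (simp add: z_def)
          also have "\<dots> \<le> L * (R + \<epsilon>)"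
            using norm_triangle_ineq4[of "x - y" v] x False L_nonneg by (intro mult_left_mono) (auto simp: algebra_simps)
          finally show ?thesis unfolding abs_mult by (simp add: mult_right_mono)
        qed
      qed
      also have "\<dots> = L * (R + \<epsilon>) * (\<integral>v. bump 3 (0 :: real ^ 'n) \<epsilon> v \<partial>lborel)" by simp
      also have "\<dots> \<le> L * (R + \<epsilon>) * (2 * \<epsilon>) ^ CARD('n)"
        using bump_integral_le(2)[OF \<epsilon>] L_nonneg R \<epsilon> by (intro mult_left_mono) auto
      also have "\<dots> = L * (2 * \<epsilon>) ^ CARD('n) * (R + \<epsilon>)" by (simp add: mult_ac)
      finally show ?thesis unfolding Leps .
    qed
    fix i assume i: "i \<in> I" "norm (x - i) \<le> sqrt CARD('n) * h / 2"
    obtain p q where pq: "h * f i / 4 \<le> norm (p - q)" "\<And>y. z0 i + p \<bullet> (y - i) \<le> z0 y" "\<And>y. z0 i + q \<bullet> (y - i) \<le> z0 y"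
      using z0(3)[OF i(1)] by blast
    define p' q' where "p' = p /\<^sub>R \<epsilon> ^ CARD('n)" and "q' = q /\<^sub>R \<epsilon> ^ CARD('n)"
    have npq: "h * f i / 4 / \<epsilon> ^ CARD('n) \<le> norm (p' - q')"
    proof -
      have "norm (p' - q') = norm (p - q) / \<epsilon> ^ CARD('n)"
        unfolding p'_def q'_def scaleR_diff_right[symmetric] using \<epsilon> by (simp add: divide_inverse mult.commute)
      moreover have "h * f i / 4 / \<epsilon> ^ CARD('n) \<le> norm (p - q) / \<epsilon> ^ CARD('n)"
        using pq(1) \<epsilon>p by (intro divide_right_mono) auto
      ultimately show ?thesis by simp
    qed
    define S where "S = 4 * sqrt (real CARD('n))"
    have S: "0 < S" by (simp add: S_def)
    have \<epsilon>S: "\<epsilon> = S * h" by (simp add: \<epsilon>_def S_def)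
    \<comment> \<open>All powers of \<open>h\<close> cancel because \<open>\<epsilon> = S h\<close>:
      this is what makes the lower bound for the Laplacian independent of the mesh.\<close>
    have "3 / 160 / S ^ (CARD('n) + 1) * f i = 6 / \<epsilon>\<^sup>2 * ((h * f i / 4 / \<epsilon> ^ CARD('n)) / 2 * \<epsilon> / 40 * (\<epsilon> / S) ^ CARD('n))"
      using S h unfolding \<epsilon>S by (simp add: field_simps power2_eq_square power_divide power_mult_distrib)
    also have "\<dots> \<le> 6 / \<epsilon>\<^sup>2 * (norm (p' - q') / 2 * \<epsilon> / 40 * (\<epsilon> / S) ^ CARD('n))"
      using npq \<epsilon> S by (intro mult_left_mono mult_right_mono divide_right_mono) auto
    also have "\<dots> \<le> 6 / \<epsilon>\<^sup>2 * (\<integral>v. (z (x - v) - z x) * bump 2 0 \<epsilon> v \<partial>lborel)"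
      unfolding S_def
    proof (intro mult_left_mono bump2_average_ge[OF \<epsilon>])
      show "norm (x - i) \<le> \<epsilon> / 8" using i(2) by (simp add: \<epsilon>_def mult.commute)
      show "z i + p' \<bullet> (u - i) \<le> z u" for u unfolding p'_def by (rule scale[OF pq(2)])
      show "z i + q' \<bullet> (u - i) \<le> z u" for u unfolding q'_def by (rule scale[OF pq(3)])
    qed simp
    also have "\<dots> \<le> (\<Sum>j\<in>UNIV. mol_hess \<epsilon> K x $ j $ j)" by (rule mol_laplacian_ge[OF \<epsilon> xK'])
    finally show "3 / 160 / (4 * sqrt CARD('n)) ^ (CARD('n) + 1) * f i \<le> (\<Sum>j\<in>UNIV. mol_hess \<epsilon> K x $ j $ j)"
      by (simp add: S_def)
  qed
qed

section \<open>From cells to Borel functions\<close>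

definition grid :: "real ^ 'n \<Rightarrow> real \<Rightarrow> real ^ 'n \<Rightarrow> int ^ 'n" where
  "grid p s x = (\<chi> k. \<lfloor>(x $ k - p $ k) / s\<rfloor>)"

text \<open>Cells are half-open, so that those of one mesh partition the space; the closed cubes
  around them are used where compactness matters.\<close>

definition gcell :: "real ^ 'n \<Rightarrow> real \<Rightarrow> int ^ 'n \<Rightarrow> (real ^ 'n) set" where
  "gcell p s m = {x. grid p s x = m}"

definition gcentre :: "real ^ 'n \<Rightarrow> real \<Rightarrow> int ^ 'n \<Rightarrow> real ^ 'n" where
  "gcentre p s m = (\<chi> k. p $ k + s * (real_of_int (m $ k) + 1 / 2))"

lemma countable_UNIV_int_vec: "countable (UNIV :: (int ^ 'n) set)"
proof -
  have "countable (Pi\<^sub>E (UNIV :: 'n set) (\<lambda>_. UNIV :: int set))" by (intro countable_PiE) auto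
  then have "countable (UNIV :: ('n \<Rightarrow> int) set)" by (simp add: PiE_UNIV_domain)
  then have "countable (range (vec_lambda :: ('n \<Rightarrow> int) \<Rightarrow> int ^ 'n))" by (rule countable_image)
  moreover have "range (vec_lambda :: ('n \<Rightarrow> int) \<Rightarrow> int ^ 'n) = UNIV" by (metis surj_def vec_nth_inverse)
  ultimately show ?thesis by simp
qed

lemma mem_gcell:
  assumes "0 < s"
  shows "x \<in> gcell p s m \<longleftrightarrow> (\<forall>k. p $ k + s * real_of_int (m $ k) \<le> x $ k \<and> x $ k < p $ k + s * (real_of_int (m $ k) + 1))"
proof -
  have "\<lfloor>(x $ k - p $ k) / s\<rfloor> = m $ k \<longleftrightarrow> p $ k + s * real_of_int (m $ k) \<le> x $ k \<and> x $ k < p $ k + s * (real_of_int (m $ k) + 1)" for k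
    using assms by (simp add: floor_eq_iff le_divide_eq divide_less_eq algebra_simps)
  then show ?thesis by (simp add: gcell_def grid_def vec_eq_iff)
qed

lemma gcell_subset_cube:
  assumes "0 < s" shows "gcell p s m \<subseteq> cube (gcentre p s m) (s / 2)"
proof
  fix x assume x: "x \<in> gcell p s m"
  have "\<bar>x $ k - gcentre p s m $ k\<bar> \<le> s / 2" for k
  proof -
    have "s * (real_of_int (m $ k) + 1) = s * real_of_int (m $ k) + s"
      "s * (real_of_int (m $ k) + 1 / 2) = s * real_of_int (m $ k) + s / 2" by (simp_all add: algebra_simps)
    then show ?thesis
      using x[unfolded mem_gcell[OF assms], rule_format, of k] unfolding gcentre_def vec_lambda_beta by linarith
  qed
  then show "x \<in> cube (gcentre p s m) (s / 2)" by (simp add: mem_cube)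
qed

lemma box_subset_gcell:
  assumes "0 < s"
  shows "box (\<chi> k. gcentre p s m $ k - s / 2) (\<chi> k. gcentre p s m $ k + s / 2) \<subseteq> gcell p s m"
  unfolding subset_iff mem_gcell[OF assms] mem_box_cart by (auto simp: gcentre_def algebra_simps less_imp_le)

lemma gcell_borel: "0 < s \<Longrightarrow> gcell p s m \<in> sets borel"
proof -
  assume s: "0 < s"
  have "gcell p s m = (\<Inter>k. {x. p $ k + s * real_of_int (m $ k) \<le> x $ k} \<inter> {x. x $ k < p $ k + s * (real_of_int (m $ k) + 1)})"
    by (auto simp: mem_gcell[OF s])
  also have "\<dots> \<in> sets borel"
    by (intro sets.finite_INT sets.Int borel_closed borel_open closed_Collect_le open_Collect_less continuous_intros) auto
  finally show ?thesis .
qed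

lemma measure_gcell:
  fixes p :: "real ^ 'n"
  assumes s: "0 < s"
  shows "emeasure lborel (gcell p s m) = ennreal (s ^ CARD('n))" "vol (gcell p s m) = s ^ CARD('n)"
proof -
  define c where "c = gcentre p s m"
  have e1: "emeasure lborel (cube c (s / 2)) = ennreal (s ^ CARD('n))"
    using emeasure_cube[of "s / 2" c] s by simp
  have "emeasure lborel (box (\<chi> k. c $ k - s / 2) (\<chi> k. c $ k + s / 2)) = emeasure lborel (cube c (s / 2))"
    unfolding cube_def by (simp add: emeasure_lborel_box_eq emeasure_lborel_cbox_eq)
  moreover have "emeasure lborel (box (\<chi> k. c $ k - s / 2) (\<chi> k. c $ k + s / 2)) \<le> emeasure lborel (gcell p s m)"
    unfolding c_def using s by (intro emeasure_mono box_subset_gcell) (auto simp: gcell_borel)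
  moreover have "emeasure lborel (gcell p s m) \<le> emeasure lborel (cube c (s / 2))"
    unfolding c_def using s by (intro emeasure_mono gcell_subset_cube) (auto simp: compact_imp_closed borel_closed)
  ultimately show "emeasure lborel (gcell p s m) = ennreal (s ^ CARD('n))" using e1 by auto
  then show "vol (gcell p s m) = s ^ CARD('n)" using s by (simp add: measure_def)
qed

lemma grid_measurable_comp:
  fixes g :: "int ^ 'n \<Rightarrow> 'c"
  assumes "0 < s" and g: "range g \<subseteq> space N"
  shows "(\<lambda>x. g (grid p s x)) \<in> measurable borel N"
proof (rule measurable_compose[where f = "grid p s" and N = "count_space UNIV"])
  show "grid p s \<in> measurable borel (count_space UNIV)"
    unfolding measurable_count_space_eq_countable[OF countable_UNIV_int_vec]
    using gcell_borel[OF assms(1), of p] by (auto simp: gcell_def vimage_def)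
  show "g \<in> measurable (count_space UNIV) N" using g by auto
qed

lemma mem_gcell_grid: "x \<in> gcell p s (grid p s x)"
  by (simp add: gcell_def)

lemma gcentre_inj:
  assumes "0 < s" "gcentre p s m = gcentre p s m'" shows "m = m'"
  using assms by (simp add: gcentre_def vec_eq_iff)

lemma dist_gcell_le:
  fixes x y :: "real ^ 'n"
  assumes s: "0 < s" and "x \<in> gcell p s m" "y \<in> cube (gcentre p s m) (s / 2)"
  shows "norm (y - x) \<le> sqrt CARD('n) * s"
proof -
  have "x \<in> cube (gcentre p s m) (s / 2)" using gcell_subset_cube[OF s] assms(2) by blast
  then have "norm (x - gcentre p s m) \<le> sqrt CARD('n) * (s / 2)" by (rule cube_norm_le)
  moreover have "norm (y - gcentre p s m) \<le> sqrt CARD('n) * (s / 2)" using assms(3) by (rule cube_norm_le)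
  ultimately show ?thesis
    using norm_triangle_ineq4[of "y - gcentre p s m" "x - gcentre p s m"] by simp
qed

lemma finite_gcell_bounded:
  fixes S :: "(real ^ 'n) set"
  assumes s: "0 < s" and S: "bounded S"
  shows "finite {m. gcell p s m \<inter> S \<noteq> {}}"
proof -
  obtain B where B: "\<And>x. x \<in> S \<Longrightarrow> norm x \<le> B" using S by (auto simp: bounded_iff)
  define N where "N = (\<lambda>k. {\<lfloor>(- \<bar>B\<bar> - p $ k) / s\<rfloor> .. \<lfloor>(\<bar>B\<bar> - p $ k) / s\<rfloor>})"
  have "{m. gcell p s m \<inter> S \<noteq> {}} \<subseteq> vec_lambda ` (Pi\<^sub>E UNIV N)"
  proof
    fix m assume "m \<in> {m. gcell p s m \<inter> S \<noteq> {}}"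
    then obtain x where x: "x \<in> S" "grid p s x = m" by (auto simp: gcell_def)
    have "m $ k \<in> N k" for k
    proof -
      have "\<bar>x $ k\<bar> \<le> \<bar>B\<bar>" using component_le_norm_cart[of x k] B[OF x(1)] by simp
      then have "- \<bar>B\<bar> \<le> x $ k" "x $ k \<le> \<bar>B\<bar>" by auto
      then show ?thesis using s unfolding x(2)[symmetric] N_def grid_def
        by (auto intro!: floor_mono divide_right_mono)
    qed
    then have "vec_nth m \<in> Pi\<^sub>E UNIV N" by auto
    then show "m \<in> vec_lambda ` (Pi\<^sub>E UNIV N)" by (metis image_eqI vec_nth_inverse)
  qed
  moreover have "finite (Pi\<^sub>E UNIV N)" unfolding N_def by (intro finite_PiE) auto
  ultimately show ?thesis by (meson finite_imageI finite_subset)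
qed

section \<open>Extension of an \<open>L_n\<close> bound from step functions to Borel
  functions\<close>

abbreviation Ln_norm :: "(real ^ 'n \<Rightarrow> real) \<Rightarrow> real" where
  "Ln_norm f \<equiv> root CARD('n) (\<integral>x. f x ^ CARD('n) \<partial>lborel)"

text \<open>The root is the \<open>L_n\<close> norm of the step function, whose cells have volume
  \<open>s^n\<close>. The constant must not depend on the mesh, which is only required to be
  small.\<close>

definition step_Ln_bound :: "(real ^ 'n) measure \<Rightarrow> real \<Rightarrow> (real ^ 'n) set \<Rightarrow> real \<Rightarrow> bool" where
  "step_Ln_bound V W S s0 \<longleftrightarrow> (\<forall>s J f. 0 < s \<longrightarrow> s < s0 \<longrightarrow> finite J \<longrightarrow> J \<noteq> {} \<longrightarrow> (\<forall>m\<in>J. 0 < f m \<and> gcell 0 s m \<subseteq> S) \<longrightarrow>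
     (\<integral>x. (if grid 0 s x \<in> J then f (grid 0 s x) else 0) \<partial>V) \<le> W * root CARD('n) (\<Sum>m\<in>J. (s * f m) ^ CARD('n)))"

text \<open>\<open>g\<close> is approximated from below by its minima over the cells: then the norms
  do not exceed that of \<open>g\<close>, and a cell with a positive minimum lies in
  \<open>S\<close> automatically.\<close>

lemma Ln_bound_continuous:
  fixes V :: "(real ^ 'n) measure" and g :: "real ^ 'n \<Rightarrow> real"
  assumes V: "finite_measure V" "sets V = sets borel" and W: "0 \<le> W" and s0: "0 < s0"
    and step: "step_Ln_bound V W S s0" and S: "open S" "bounded S"
    and g: "continuous_on UNIV g" "\<And>x. 0 \<le> g x" "\<And>x. g x \<le> M" "\<And>x. x \<notin> S \<Longrightarrow> g x = 0"
  shows "(\<integral>x. g x \<partial>V) \<le> W * Ln_norm g"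
proof -
  interpret V: finite_measure V by fact
  have gm [measurable]: "g \<in> borel_measurable borel" by (rule borel_measurable_continuous_onI[OF g(1)])
  define C where "C s m = cube (gcentre 0 s m) (s / 2)" for s :: real and m :: "int ^ 'n"
  define f where "f s m = Inf (g ` C s m)" for s m
  define J where "J s = {m. 0 < f s m}" for s
  have f: "\<exists>y\<in>C s m. f s m = g y" "\<And>y. y \<in> C s m \<Longrightarrow> f s m \<le> g y" if "0 < s" for s m
  proof -
    have "gcentre 0 s m \<in> C s m" using that by (simp add: C_def mem_cube)
    then obtain y where y: "y \<in> C s m" "\<And>u. u \<in> C s m \<Longrightarrow> g y \<le> g u"
      using continuous_attains_inf[of "C s m" g] g(1) by (metis C_def compact_cube continuous_on_subset empty_iff subset_UNIV)
    then have "f s m = g y" unfolding f_def by (intro cInf_eq_minimum) auto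
    then show "\<exists>y\<in>C s m. f s m = g y" "\<And>y. y \<in> C s m \<Longrightarrow> f s m \<le> g y" using y by auto
  qed
  have f0: "0 \<le> f s m" if "0 < s" for s m using f(1)[OF that, of m] g(2) by auto
  have f_le_g: "f s m \<le> g x" if "0 < s" "x \<in> gcell 0 s m" for s m x
    by (rule f(2)[OF that(1)]) (use gcell_subset_cube[OF that(1)] that(2) in \<open>auto simp: C_def\<close>)
  have Jsub: "gcell 0 s m \<subseteq> S" if "0 < s" "m \<in> J s" for s m
    using f_le_g[OF that(1), of _ m] that(2) g(4) by (force simp: J_def)
  have finJ: "finite (J s)" if "0 < s" for s
  proof (rule finite_subset[OF _ finite_gcell_bounded[OF that S(2)]])
    have "gcell 0 s m \<noteq> {}" for m :: "int ^ 'n"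
      using measure_gcell(2)[OF that, of 0 m] that by (metis measure_empty power_eq_0_iff less_irrefl)
    then show "J s \<subseteq> {m. gcell 0 s m \<inter> S \<noteq> {}}" using Jsub[OF that] by blast
  qed
  have ig: "integrable lborel (\<lambda>x. g x ^ CARD('n))"
  proof (rule Bochner_Integration.integrable_bound)
    show "integrable lborel (\<lambda>x. M ^ CARD('n) * indicator S x)"
      using S by (intro integrable_mult_right integrable_real_indicator emeasure_bounded_finite) auto
    have "g x ^ CARD('n) \<le> M ^ CARD('n) * indicator S x" for x
      using g(2-4)[of x] by (cases "x \<in> S") (auto simp: power_mono power_0_left)
    then show "AE x in lborel. norm (g x ^ CARD('n)) \<le> norm (M ^ CARD('n) * indicator S x)"
      using g(2) by (intro AE_I2) (auto intro: order_trans[OF _ abs_ge_self])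
  qed simp
  have cell_int: "integrable lborel (\<lambda>x. c * indicator (gcell 0 s m) x)" if "0 < s" for c s :: real and m :: "int ^ 'n"
    using measure_gcell(1)[OF that, of 0 m] gcell_borel[OF that, of 0 m] by (intro integrable_mult_right integrable_real_indicator) auto
  have F_le: "(\<Sum>m\<in>J s. (s * f s m) ^ CARD('n)) \<le> (\<integral>x. g x ^ CARD('n) \<partial>lborel)" if s: "0 < s" for s
  proof -
    have "(\<Sum>m\<in>J s. (s * f s m) ^ CARD('n)) = (\<Sum>m\<in>J s. \<integral>x. f s m ^ CARD('n) * indicator (gcell 0 s m) x \<partial>lborel)"
      using s by (intro sum.cong refl) (simp add: measure_gcell gcell_borel power_mult_distrib)
    also have "\<dots> = (\<integral>x. (\<Sum>m\<in>J s. f s m ^ CARD('n) * indicator (gcell 0 s m) x) \<partial>lborel)"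
      by (rule Bochner_Integration.integral_sum[symmetric]) (rule cell_int[OF s])
    also have "\<dots> \<le> (\<integral>x. g x ^ CARD('n) \<partial>lborel)"
    proof (rule integral_mono[OF _ ig])
      show "integrable lborel (\<lambda>x. \<Sum>m\<in>J s. f s m ^ CARD('n) * indicator (gcell 0 s m) x)"
        by (rule Bochner_Integration.integrable_sum) (rule cell_int[OF s])
      fix x
      have "(\<Sum>m\<in>J s. f s m ^ CARD('n) * indicator (gcell 0 s m) x)
          = (\<Sum>m\<in>J s. if m = grid 0 s x then f s m ^ CARD('n) else 0)"
        by (intro sum.cong) (auto simp: gcell_def)
      also have "\<dots> \<le> f s (grid 0 s x) ^ CARD('n)" using finJ[OF s] f0[OF s] by simp
      also have "\<dots> \<le> g x ^ CARD('n)" using f_le_g[OF s mem_gcell_grid] f0[OF s] by (intro power_mono)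
      finally show "(\<Sum>m\<in>J s. f s m ^ CARD('n) * indicator (gcell 0 s m) x) \<le> g x ^ CARD('n)" .
    qed
    finally show ?thesis .
  qed
  \<comment> \<open>The shift by two keeps every mesh strictly below \<open>s0\<close>.\<close>
  define s where "s n = s0 * inverse (real (Suc (Suc n)))" for n
  have s: "0 < s n" "s n < s0" for n
    using s0 by (auto simp: s_def field_simps intro: add_pos_nonneg)
  define gn where "gn n x = f (s n) (grid 0 (s n) x)" for n and x :: "real ^ 'n"
  have gn: "0 \<le> gn n x" "gn n x \<le> g x" for n x
    unfolding gn_def using f0[OF s(1)] f_le_g[OF s(1) mem_gcell_grid] by auto
  have gn_le: "(\<integral>x. gn n x \<partial>V) \<le> W * Ln_norm g" for n
  proof -
    have eq: "gn n x = (if grid 0 (s n) x \<in> J (s n) then f (s n) (grid 0 (s n) x) else 0)" for x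
      unfolding gn_def J_def using f0[OF s(1)[of n], of "grid 0 (s n) x"] by (simp add: less_le)
    have rp: "0 \<le> (\<integral>x. g x ^ CARD('n) \<partial>lborel)" using g(2) by (intro Bochner_Integration.integral_nonneg) simp
    show ?thesis
    proof (cases "J (s n) = {}")
      case True
      then show ?thesis using W rp by (simp add: eq)
    next
      case False
      have "(\<integral>x. gn n x \<partial>V) \<le> W * root CARD('n) (\<Sum>m\<in>J (s n). (s n * f (s n) m) ^ CARD('n))"
        unfolding eq by (rule step[unfolded step_Ln_bound_def, rule_format, OF s finJ[OF s(1)] False])
          (use Jsub[OF s(1)[of n]] in \<open>auto simp: J_def\<close>)
      also have "\<dots> \<le> W * Ln_norm g"
        using W F_le[OF s(1)] by (intro mult_left_mono) auto
      finally show ?thesis .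
    qed
  qed
  have "(\<lambda>n. \<integral>x. gn n x \<partial>V) \<longlonglongrightarrow> (\<integral>x. g x \<partial>V)"
  proof (rule integral_dominated_convergence[where w = "\<lambda>_. M"])
    show "g \<in> borel_measurable V" using gm V(2) by (simp cong: measurable_cong_sets)
    show "gn n \<in> borel_measurable V" for n
    proof -
      have "gn n \<in> borel_measurable borel" unfolding gn_def by (rule grid_measurable_comp[OF s(1)]) simp
      then show ?thesis using V(2) by (simp cong: measurable_cong_sets)
    qed
    show "AE x in V. norm (gn n x) \<le> M" for n
      using gn(1) order_trans[OF gn(2) g(3)] by (intro AE_I2) simp
    show "AE x in V. (\<lambda>n. gn n x) \<longlonglongrightarrow> g x"
    proof (rule AE_I2)
      fix x
      obtain y where y: "\<And>n. y n \<in> C (s n) (grid 0 (s n) x)" "\<And>n. gn n x = g (y n)"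
        using bchoice[of UNIV "\<lambda>n y. y \<in> C (s n) (grid 0 (s n) x) \<and> gn n x = g y"] f(1)[OF s(1)] unfolding gn_def by blast
      have "(\<lambda>n. sqrt CARD('n) * s n) \<longlonglongrightarrow> sqrt CARD('n) * (s0 * 0)"
        unfolding s_def by (intro tendsto_intros LIMSEQ_Suc[OF LIMSEQ_inverse_real_of_nat])
      then have s0: "(\<lambda>n. sqrt CARD('n) * s n) \<longlonglongrightarrow> 0" by simp
      have "norm (y n - x) \<le> sqrt CARD('n) * s n" for n by (rule dist_gcell_le[OF s(1) mem_gcell_grid y(1)[unfolded C_def]])
      then have "(\<lambda>n. y n - x) \<longlonglongrightarrow> 0" by (intro Lim_null_comparison[OF _ s0] always_eventually allI)
      then have "y \<longlonglongrightarrow> x" by (rule LIM_zero_cancel)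
      moreover have "isCont g x" using g(1) by (simp add: continuous_on_eq_continuous_at)
      ultimately show "(\<lambda>n. gn n x) \<longlonglongrightarrow> g x" unfolding y(2) by (intro isCont_tendsto_compose[of x g])
    qed
  qed simp
  then show ?thesis by (rule LIMSEQ_le_const2) (use gn_le in auto)
qed

text \<open>Multiples of the distance to the complement, cut at 1.\<close>

lemma open_indicator_limit:
  fixes U :: "'b :: metric_space set"
  assumes "open U"
  obtains f :: "nat \<Rightarrow> 'b \<Rightarrow> real" where "\<And>k. continuous_on UNIV (f k)" "\<And>k y. 0 \<le> f k y" "\<And>k y. f k y \<le> 1" "\<And>y. (\<lambda>k. f k y) \<longlonglongrightarrow> indicator U y" "\<And>k y. y \<notin> U \<Longrightarrow> f k y = 0"
proof (cases "U = UNIV")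
  case True
  \<comment> \<open>The distance to the empty complement is 0 by convention, so the whole space is
    treated apart.\<close>
  show ?thesis by (rule that[of "\<lambda>_ _. 1"]) (use True in auto)
next
  case False
  define f where "f k y = min 1 (real k * infdist y (- U))" for k y
  show ?thesis
  proof (rule that[of f])
    show "continuous_on UNIV (f k)" for k unfolding f_def by (intro continuous_intros)
    show "0 \<le> f k y" "f k y \<le> 1" for k y by (auto simp: f_def infdist_nonneg)
    show "f k y = 0" if "y \<notin> U" for k y using that by (simp add: f_def)
    fix y
    show "(\<lambda>k. f k y) \<longlonglongrightarrow> indicator U y"
    proof (cases "y \<in> U")
      case True
      have "infdist y (- U) \<noteq> 0" using in_closed_iff_infdist_zero[of "- U" y] assms True False by (auto simp: closed_def)
      then have d: "0 < infdist y (- U)" using infdist_nonneg[of y "- U"] by linarith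
      obtain k0 where k0: "1 < real k0 * infdist y (- U)" using reals_Archimedean3[OF d] by blast
      have "eventually (\<lambda>k. f k y = 1) sequentially"
        using eventually_ge_at_top[of k0]
      proof eventually_elim
        case (elim k)
        have "real k0 * infdist y (- U) \<le> real k * infdist y (- U)" using elim d by (intro mult_right_mono) auto
        then show ?case using k0 by (simp add: f_def)
      qed
      then show ?thesis using True by (simp add: tendsto_eventually)
    next
      case False
      then have "infdist y (- U) = 0" by (intro infdist_zero) auto
      then show ?thesis using False by (simp add: f_def)
    qed
  qed
qed

text \<open>Absolute continuity on \<open>S\<close>. It is wanted because Borel functions are limits
  of continuous ones only Lebesgue almost everywhere, while the left side of the bound is an
  integral for \<open>V\<close>. The bound is applied to indicators of open sets of small volume
  that contain \<open>N\<close>.\<close>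

lemma Ln_bound_null:
  fixes V :: "(real ^ 'n) measure" and S N :: "(real ^ 'n) set"
  assumes V: "finite_measure V" "sets V = sets borel" and W: "0 \<le> W" and s0: "0 < s0"
    and step: "step_Ln_bound V W S s0" and S: "open S" "bounded S"
    and N: "N \<in> null_sets lborel" "N \<subseteq> S"
  shows "N \<in> null_sets V"
proof -
  interpret V: finite_measure V by fact
  have Nb: "N \<in> sets borel" using N(1) by auto
  have "measure V N \<le> W * root CARD('n) (inverse (real (Suc k)))" for k
  proof -
    obtain U0 where U0: "open U0" "N \<subseteq> U0" "emeasure lborel (U0 - N) < ennreal (inverse (real (Suc k)))"
      using outer_regular_lborel[OF Nb, of "inverse (real (Suc k))"] by auto
    define U where "U = U0 \<inter> S"
    have U: "open U" "N \<subseteq> U" "U \<subseteq> S" using U0 S N by (auto simp: U_def)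
    have "emeasure lborel U \<le> emeasure lborel ((U0 - N) \<union> N)" using U0(1) Nb by (intro emeasure_mono) (auto simp: U_def)
    also have "\<dots> = emeasure lborel (U0 - N)" using U0(1) N(1) by (intro emeasure_Un_null_set) auto
    finally have mU: "vol U \<le> inverse (real (Suc k))"
      unfolding measure_def using U0(3) by (intro enn2real_leI) auto
    obtain f :: "nat \<Rightarrow> real ^ 'n \<Rightarrow> real" where f: "\<And>j. continuous_on UNIV (f j)" "\<And>j y. 0 \<le> f j y" "\<And>j y. f j y \<le> 1"
        "\<And>y. (\<lambda>j. f j y) \<longlonglongrightarrow> indicator U y" "\<And>j y. y \<notin> U \<Longrightarrow> f j y = 0"
      using open_indicator_limit[OF U(1)] by blast
    have [measurable]: "f j \<in> borel_measurable borel" for j by (rule borel_measurable_continuous_onI[OF f(1)])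
    have [measurable]: "U \<in> sets borel" using U(1) by simp
    have "(\<lambda>j. \<integral>y. f j y \<partial>V) \<longlonglongrightarrow> (\<integral>y. indicator U y \<partial>V)"
      by (rule integral_dominated_convergence[where w = "\<lambda>_. 1"]) (use f V(2) in \<open>auto cong: measurable_cong_sets\<close>)
    moreover have "(\<integral>y. f j y \<partial>V) \<le> W * root CARD('n) (inverse (real (Suc k)))" for j
    proof -
      have iU: "integrable lborel (indicator U :: _ \<Rightarrow> real)"
        using bounded_subset[OF S(2) U(3)] by (intro integrable_real_indicator emeasure_bounded_finite) auto
      have pw: "f j y ^ CARD('n) \<le> indicator U y" for y
        using f(2,3)[of j y] f(5)[of y j] by (cases "y \<in> U") (auto simp: power_le_one power_0_left)
      have "(\<integral>y. f j y \<partial>V) \<le> W * root CARD('n) (\<integral>y. f j y ^ CARD('n) \<partial>lborel)"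
        by (rule Ln_bound_continuous[OF V W s0 step S f(1-3)]) (use f(5) U(3) in blast)
      also have "(\<integral>y. f j y ^ CARD('n) \<partial>lborel) \<le> (\<integral>y. indicator U y \<partial>lborel)"
      proof (rule integral_mono[OF _ iU pw])
        show "integrable lborel (\<lambda>y. f j y ^ CARD('n))"
          by (rule Bochner_Integration.integrable_bound[OF iU]) (use pw f(2) in auto)
      qed
      also have "\<dots> \<le> inverse (real (Suc k))" using mU by simp
      finally show ?thesis using W by (simp add: mult_left_mono)
    qed
    ultimately have "(\<integral>y. indicator U y \<partial>V) \<le> W * root CARD('n) (inverse (real (Suc k)))"
      by (intro LIMSEQ_le_const2) auto
    moreover have "measure V N \<le> measure V U" using U V(2) by (intro V.finite_measure_mono) auto
    ultimately show ?thesis using V(2) sets_eq_imp_space_eq[OF V(2)] by simp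
  qed
  moreover have "(\<lambda>k. W * root CARD('n) (inverse (real (Suc k)))) \<longlonglongrightarrow> W * root CARD('n) 0"
    by (intro tendsto_intros LIMSEQ_inverse_real_of_nat)
  ultimately have "measure V N \<le> 0" by (intro LIMSEQ_le_const[where X = "\<lambda>k. W * root CARD('n) (inverse (real (Suc k)))"]) auto
  then show ?thesis using Nb V(2) by (simp add: null_sets_def V.emeasure_eq_measure measure_le_0_iff)
qed

text \<open>Continuous functions converging to \<open>f\<close> almost everywhere are truncated to
  \<open>[0, M]\<close> and cut off inside \<open>S\<close>, so that both sides converge by
  domination.\<close>

lemma Ln_bound_bounded:
  fixes V :: "(real ^ 'n) measure" and S :: "(real ^ 'n) set"
  assumes V: "finite_measure V" "sets V = sets borel" and W: "0 \<le> W" and s0: "0 < s0"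
    and step: "step_Ln_bound V W S s0" and S: "open S" "bounded S"
    and f: "f \<in> borel_measurable borel" "\<And>x. 0 \<le> f x" "\<And>x. f x \<le> M" "\<And>x. x \<notin> S \<Longrightarrow> f x = 0"
  shows "(\<integral>x. f x \<partial>V) \<le> W * Ln_norm f"
proof -
  interpret V: finite_measure V by fact
  have M: "0 \<le> M" using f(2,3) order_trans by blast
  have "f measurable_on UNIV"
    by (intro lebesgue_measurable_imp_measurable_on_real measurable_completion) (use f(1) in simp_all)
  then obtain N0 g where N0: "negligible N0" and g: "\<And>k. continuous_on UNIV (g k)" "\<And>x. x \<notin> N0 \<Longrightarrow> (\<lambda>k. g k x) \<longlonglongrightarrow> f x"
    unfolding measurable_on_def by auto
  obtain N where N: "N \<in> null_sets lborel" "N0 \<subseteq> N"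
    using N0 unfolding negligible_iff_null_sets null_sets_completion_iff2 by blast
  obtain \<phi> :: "nat \<Rightarrow> real ^ 'n \<Rightarrow> real" where \<phi>: "\<And>k. continuous_on UNIV (\<phi> k)" "\<And>k y. 0 \<le> \<phi> k y" "\<And>k y. \<phi> k y \<le> 1"
      "\<And>y. (\<lambda>k. \<phi> k y) \<longlonglongrightarrow> indicator S y" "\<And>k y. y \<notin> S \<Longrightarrow> \<phi> k y = 0"
    using open_indicator_limit[OF S(1)] by blast
  define h where "h k x = max 0 (min M (g k x)) * \<phi> k x" for k x
  have h: "continuous_on UNIV (h k)" "0 \<le> h k x" "h k x \<le> M" "x \<notin> S \<Longrightarrow> h k x = 0" for k x
  proof -
    show "continuous_on UNIV (h k)" unfolding h_def by (intro continuous_intros g(1) \<phi>(1))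
    show "0 \<le> h k x" unfolding h_def using \<phi>(2) by simp
    have "h k x \<le> M * 1" unfolding h_def using \<phi>(2,3) M by (intro mult_mono) auto
    then show "h k x \<le> M" by simp
    show "x \<notin> S \<Longrightarrow> h k x = 0" using \<phi>(5) by (simp add: h_def)
  qed
  have hm [measurable]: "h k \<in> borel_measurable borel" for k by (rule borel_measurable_continuous_onI[OF h(1)])
  have lim: "(\<lambda>k. h k x) \<longlonglongrightarrow> f x" if "x \<notin> N \<inter> S" for x
  proof (cases "x \<in> S")
    case True
    then have "(\<lambda>k. h k x) \<longlonglongrightarrow> max 0 (min M (f x)) * indicator S x"
      unfolding h_def using that N(2) by (intro tendsto_intros g(2) \<phi>(4)) auto
    then show ?thesis using True f(2,3)[of x] by simp
  next
    case False
    then show ?thesis using h(4) f(4) by simp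
  qed
  have NS: "N \<inter> S \<in> null_sets lborel" using N(1) S(1) by (intro null_set_Int2) auto
  have 1: "(\<lambda>k. \<integral>x. h k x \<partial>V) \<longlonglongrightarrow> (\<integral>x. f x \<partial>V)"
  proof (rule integral_dominated_convergence[where w = "\<lambda>_. M"])
    show "AE x in V. (\<lambda>k. h k x) \<longlonglongrightarrow> f x"
      using AE_not_in[OF Ln_bound_null[OF V W s0 step S NS Int_lower2]] by eventually_elim (rule lim)
  qed (use h f(1) V(2) in \<open>auto cong: measurable_cong_sets\<close>)
  have "(\<lambda>k. \<integral>x. h k x ^ CARD('n) \<partial>lborel) \<longlonglongrightarrow> (\<integral>x. f x ^ CARD('n) \<partial>lborel)"
  proof (rule integral_dominated_convergence[where w = "\<lambda>x. M ^ CARD('n) * indicator S x"])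
    show "integrable lborel (\<lambda>x. M ^ CARD('n) * indicator S x)"
      using S by (intro integrable_mult_right integrable_real_indicator emeasure_bounded_finite) auto
    show "AE x in lborel. (\<lambda>k. h k x ^ CARD('n)) \<longlonglongrightarrow> f x ^ CARD('n)"
      using AE_not_in[OF NS] by eventually_elim (intro tendsto_power lim)
    show "AE x in lborel. norm (h k x ^ CARD('n)) \<le> M ^ CARD('n) * indicator S x" for k
      using h(2,3)[of k] h(4)[of _ k] by (intro AE_I2) (auto simp: indicator_def power_mono power_0_left)
  qed (use f(1) in measurable)
  then have 2: "(\<lambda>k. W * root CARD('n) (\<integral>x. h k x ^ CARD('n) \<partial>lborel)) \<longlonglongrightarrow> W * Ln_norm f"
    by (intro tendsto_intros)
  show ?thesis
    by (rule LIMSEQ_le[OF 1 2]) (use Ln_bound_continuous[OF V W s0 step S h] in blast)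
qed

text \<open>Monotone convergence along the truncations of \<open>f\<close>. Integrability for
  \<open>V\<close> is part of the conclusion, since \<open>f\<close> may be unbounded like the
  drift.\<close>

lemma Ln_bound_borel:
  fixes V :: "(real ^ 'n) measure" and S Q :: "(real ^ 'n) set"
  assumes V: "finite_measure V" "sets V = sets borel" and W: "0 \<le> W" and s0: "0 < s0"
    and step: "step_Ln_bound V W S s0" and S: "open S" "bounded S"
    and Q: "Q \<in> sets borel" "Q \<subseteq> S"
    and f: "f \<in> borel_measurable borel" "\<And>x. 0 \<le> f x" "\<And>x. x \<notin> Q \<Longrightarrow> f x = 0"
    and fi: "integrable lborel (\<lambda>x. f x ^ CARD('n))"
  shows "integrable V f" "(\<integral>x. f x \<partial>V) \<le> W * Ln_norm f"
proof -
  interpret V: finite_measure V by fact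
  note [measurable] = f(1)
  define c where "c = W * Ln_norm f"
  have fn: "(\<integral>x. min (f x) (real n) \<partial>V) \<le> c" for n
  proof -
    have "(\<integral>x. min (f x) (real n) \<partial>V) \<le> W * root CARD('n) (\<integral>x. min (f x) (real n) ^ CARD('n) \<partial>lborel)"
      by (rule Ln_bound_bounded[OF V W s0 step S, where M = "real n"]) (use f f(3)[OF contra_subsetD[OF Q(2)]] in auto)
    also have "\<dots> \<le> c"
      unfolding c_def
    proof (intro mult_left_mono W, simp, rule integral_mono[OF _ fi])
      show "integrable lborel (\<lambda>x. min (f x) (real n) ^ CARD('n))"
        by (rule Bochner_Integration.integrable_bound[OF fi]) (use f(2) in \<open>auto intro!: power_mono\<close>)
      show "min (f x) (real n) ^ CARD('n) \<le> f x ^ CARD('n)" for x using f(2) by (intro power_mono) auto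
    qed
    finally show ?thesis .
  qed
  have fV: "f \<in> borel_measurable V" using f(1) V(2) by (simp cong: measurable_cong_sets)
  have nn: "(\<integral>\<^sup>+x. ennreal (f x) \<partial>V) \<le> ennreal c"
  proof -
    have "(\<integral>\<^sup>+x. ennreal (f x) \<partial>V) = (\<integral>\<^sup>+x. (SUP n. ennreal (min (f x) (real n))) \<partial>V)"
    proof (rule nn_integral_cong)
      fix x
      obtain n where n: "f x \<le> real n" using real_arch_simple by blast
      show "ennreal (f x) = (SUP n. ennreal (min (f x) (real n)))"
      proof (rule antisym)
        have "ennreal (f x) = ennreal (min (f x) (real n))" using n by (simp add: min_def)
        also have "\<dots> \<le> (SUP n. ennreal (min (f x) (real n)))" by (rule SUP_upper) simp
        finally show "ennreal (f x) \<le> (SUP n. ennreal (min (f x) (real n)))" .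
      qed (intro SUP_least ennreal_leI, simp)
    qed
    also have "\<dots> = (SUP n. \<integral>\<^sup>+x. ennreal (min (f x) (real n)) \<partial>V)"
      by (rule nn_integral_monotone_convergence_SUP)
        (use fV in \<open>auto simp: incseq_def le_fun_def intro!: ennreal_leI min.mono\<close>)
    also have "\<dots> \<le> ennreal c"
    proof (rule SUP_least)
      fix n
      have "integrable V (\<lambda>x. min (f x) (real n))"
        by (rule V.integrable_const_bound[where B = "real n"]) (use fV f(2) in auto)
      then have "(\<integral>\<^sup>+x. ennreal (min (f x) (real n)) \<partial>V) = ennreal (\<integral>x. min (f x) (real n) \<partial>V)"
        using f(2) by (intro nn_integral_eq_integral) auto
      also have "\<dots> \<le> ennreal c" using fn by (intro ennreal_leI)
      finally show "(\<integral>\<^sup>+x. ennreal (min (f x) (real n)) \<partial>V) \<le> ennreal c" .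
    qed
    finally show ?thesis .
  qed
  show i: "integrable V f"
    by (rule integrableI_nonneg) (use fV f(2) nn in \<open>auto intro: le_less_trans\<close>)
  have "ennreal (\<integral>x. f x \<partial>V) \<le> ennreal c"
    using nn nn_integral_eq_integral[OF i] f(2) by simp
  moreover have "0 \<le> c"
    unfolding c_def using W f(2) by (intro mult_nonneg_nonneg real_root_ge_zero Bochner_Integration.integral_nonneg) auto
  ultimately show "(\<integral>x. f x \<partial>V) \<le> W * Ln_norm f"
    unfolding c_def by (simp add: ennreal_le_iff)
qed

section \<open>The Krylov estimate\<close>

lemma C2_data_zero_outside:
  fixes u :: "real ^ 'n \<Rightarrow> real"
  assumes C: "C2_data u g H" and z: "\<And>x. x \<notin> cball c r \<Longrightarrow> u x = 0" and x: "x \<notin> cball c r"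
  shows "g x = 0" "H x = 0"
proof -
  have op: "open (- cball c r)" by (intro open_Compl closed_cball)
  have g0: "g x = 0" if x: "x \<notin> cball c r" for x
  proof -
    have "(u has_derivative (\<lambda>v. g x \<bullet> v)) (at x)" using C by (simp add: C2_data_def)
    then have "((\<lambda>_. 0) has_derivative (\<lambda>v. g x \<bullet> v)) (at x)"
      by (rule has_derivative_transform_within_open[OF _ op]) (use x z in auto)
    then have "(\<lambda>v. g x \<bullet> v) = (\<lambda>_. 0)" by (rule has_derivative_unique) simp
    then have "g x \<bullet> g x = 0" by (simp add: fun_eq_iff)
    then show ?thesis by simp
  qed
  then show "g x = 0" using x .
  have "(g has_derivative (\<lambda>v. H x *v v)) (at x)" using C by (simp add: C2_data_def)
  then have "((\<lambda>_. 0) has_derivative (\<lambda>v. H x *v v)) (at x)"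
    by (rule has_derivative_transform_within_open[OF _ op]) (use x g0 in auto)
  then have "(\<lambda>v. H x *v v) = (\<lambda>_. 0)" by (rule has_derivative_unique) simp
  then have "\<forall>v. H x *v v = 0" by (simp add: fun_eq_iff)
  then show "H x = 0" by (simp add: matrix_eq)
qed

locale elliptic_operator =
  fixes a :: "real ^ 'n \<Rightarrow> real ^ 'n ^ 'n" and b :: "real ^ 'n \<Rightarrow> real ^ 'n" and \<delta> :: real
  assumes \<delta>: "0 < \<delta>" "\<delta> < 1"
    and a_meas [measurable]: "a \<in> borel_measurable borel" and a: "\<And>x. a x \<in> sym_elliptic \<delta>"
    and b_meas [measurable]: "b \<in> borel_measurable borel"
begin

abbreviation "drift_on A x \<equiv> norm (b x) * indicator A x"

lemma second_order_bound:
  assumes "\<And>i j. \<bar>A $ i $ j\<bar> \<le> B"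
  shows "\<bar>\<Sum>i\<in>UNIV. \<Sum>j\<in>UNIV. a x $ i $ j * A $ j $ i\<bar> \<le> (real CARD('n))\<^sup>2 * B / \<delta>"
proof -
  have "\<bar>\<Sum>i\<in>UNIV. \<Sum>j\<in>UNIV. a x $ i $ j * A $ j $ i\<bar> \<le> (\<Sum>i\<in>(UNIV :: 'n set). \<Sum>j\<in>(UNIV :: 'n set). 1 / \<delta> * B)"
  proof (rule order_trans[OF sum_abs sum_mono], rule order_trans[OF sum_abs sum_mono])
    fix i j
    show "\<bar>a x $ i $ j * A $ j $ i\<bar> \<le> 1 / \<delta> * B"
      unfolding abs_mult using sym_elliptic_entry_le[OF a \<delta>(1), of x i j] assms[of j i] \<delta> by (intro mult_mono) auto
  qed
  also have "\<dots> = (real CARD('n))\<^sup>2 * B / \<delta>" by (simp add: power2_eq_square)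
  finally show ?thesis .
qed

lemma Lop_measurable:
  assumes "C2_data u g H"
  shows "Lop a b u \<in> borel_measurable borel"
proof -
  have [measurable]: "g \<in> borel_measurable borel" "H \<in> borel_measurable borel"
    using C2_data_continuous[OF assms, of UNIV] by (auto intro: borel_measurable_continuous_onI)
  have m: "(\<lambda>A :: real ^ 'n ^ 'n. A $ i $ j) \<in> borel_measurable borel" for i j
    by (intro borel_measurable_continuous_onI continuous_intros)
  have [measurable]: "(\<lambda>x. a x $ i $ j) \<in> borel_measurable borel" "(\<lambda>x. H x $ i $ j) \<in> borel_measurable borel" for i j
    using measurable_compose[OF a_meas m] measurable_compose[OF \<open>H \<in> _\<close> m] by auto
  show ?thesis unfolding Lop_C2_data[OF assms, abs_def] by measurable
qed

text \<open>The growth at most like \<open>1 + norm (b x)\<close> is what makes \<open>Lop\<close>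
  of a test function integrable for an occupation measure.\<close>

lemma Lop_bounded:
  assumes C: "C2_data u g H" and z: "\<And>x. x \<notin> cball c r \<Longrightarrow> u x = 0"
  shows "\<exists>B. 0 \<le> B \<and> (\<forall>x. \<bar>Lop a b u x\<bar> \<le> B * (1 + norm (b x)))"
proof -
  have bg: "bounded (g ` cball c r)" "bounded (H ` cball c r)"
    using C2_data_continuous[OF C, of "cball c r"] by (auto intro!: compact_imp_bounded compact_continuous_image)
  obtain B1 where "\<forall>w\<in>g ` cball c r. norm w \<le> B1" using bg(1) unfolding bounded_iff by blast
  moreover obtain B2 where "\<forall>w\<in>H ` cball c r. norm w \<le> B2" using bg(2) unfolding bounded_iff by blast
  ultimately have B: "x \<in> cball c r \<Longrightarrow> norm (g x) \<le> B1" "x \<in> cball c r \<Longrightarrow> norm (H x) \<le> B2" for x by blast+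
  define D where "D = max 0 (max B1 B2)"
  have D: "norm (g x) \<le> D" "norm (H x) \<le> D" for x
  proof -
    have "norm (g x) \<le> D \<and> norm (H x) \<le> D"
    proof (cases "x \<in> cball c r")
      case True
      show ?thesis using B[OF True] unfolding D_def by linarith
    next
      case False
      show ?thesis using C2_data_zero_outside[OF C z False] by (simp add: D_def)
    qed
    then show "norm (g x) \<le> D" "norm (H x) \<le> D" by blast+
  qed
  have D0: "0 \<le> D" by (simp add: D_def)
  define E where "E = (real CARD('n))\<^sup>2 * D / \<delta> + D"
  have "\<bar>Lop a b u x\<bar> \<le> E * (1 + norm (b x))" for x
  proof -
    have "\<bar>H x $ i $ j\<bar> \<le> D" for i j
      using component_le_norm_cart[of "H x $ i" j] Finite_Cartesian_Product.norm_nth_le[of "H x" i] D(2)[of x] by linarith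
    then have "\<bar>\<Sum>i\<in>UNIV. \<Sum>j\<in>UNIV. a x $ i $ j * H x $ j $ i\<bar> \<le> (real CARD('n))\<^sup>2 * D / \<delta>"
      by (rule second_order_bound)
    moreover have "\<bar>b x \<bullet> g x\<bar> \<le> norm (b x) * D"
      using Cauchy_Schwarz_ineq2[of "b x" "g x"] D(1)[of x] by (meson mult_left_mono norm_ge_zero order_trans)
    moreover have "0 \<le> (real CARD('n))\<^sup>2 * D / \<delta>" "0 \<le> (real CARD('n))\<^sup>2 * D / \<delta> * norm (b x)" using D0 \<delta> by simp_all
    moreover have "E * (1 + norm (b x)) = (real CARD('n))\<^sup>2 * D / \<delta> + (real CARD('n))\<^sup>2 * D / \<delta> * norm (b x) + D + norm (b x) * D"
      by (simp add: E_def algebra_simps add_divide_distrib)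
    ultimately show ?thesis unfolding Lop_C2_data[OF C] using D0 by linarith
  qed
  moreover have "0 \<le> E" using D0 \<delta> by (simp add: E_def)
  ultimately show ?thesis by blast
qed

lemma bump_grad_le:
  assumes R: "0 < R" and x: "norm (x - y) \<le> R"
  shows "norm (bump_grad k y R x) \<le> 2 * real k / R"
proof -
  have p: "pospow (k - 1) (1 - (norm (x - y))\<^sup>2 / R\<^sup>2) \<le> 1" by (rule pospow_le1) simp
  have "norm (bump_grad k y R x) = 2 * real k / R\<^sup>2 * pospow (k - 1) (1 - (norm (x - y))\<^sup>2 / R\<^sup>2) * norm (x - y)"
    using R by (simp add: bump_grad_def abs_mult)
  also have "\<dots> \<le> 2 * real k / R\<^sup>2 * 1 * R" using p x R by (intro mult_mono) auto
  also have "\<dots> = 2 * real k / R" using R by (simp add: power2_eq_square)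
  finally show ?thesis .
qed

lemma bump_hess_le:
  assumes R: "0 < R" and x: "norm (x - y) \<le> R"
  shows "\<bar>bump_hess k y R x $ i $ j\<bar> \<le> (4 * real k * real (k - 1) + 2 * real k) / R\<^sup>2"
proof -
  define P1 P2 where "P1 = pospow (k - 2) (1 - (norm (x - y))\<^sup>2 / R\<^sup>2)" and "P2 = pospow (k - 1) (1 - (norm (x - y))\<^sup>2 / R\<^sup>2)"
  have p: "P1 \<le> 1" "P2 \<le> 1" "0 \<le> P1" "0 \<le> P2" unfolding P1_def P2_def by (auto intro!: pospow_le1)
  have c: "\<bar>(x - y) $ i\<bar> \<le> R" for i using component_le_norm_cart[of "x - y" i] x by simp
  have "\<bar>4 * real k * real (k - 1) / R ^ 4 * P1 * (x - y) $ i * (x - y) $ j\<bar> = 4 * real k * real (k - 1) / R ^ 4 * P1 * (\<bar>(x - y) $ i\<bar> * \<bar>(x - y) $ j\<bar>)"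
    using p R by (simp add: abs_mult)
  also have "\<dots> \<le> 4 * real k * real (k - 1) / R ^ 4 * 1 * (R * R)"
    using p R c by (intro mult_mono) auto
  also have "\<dots> = 4 * real k * real (k - 1) / R\<^sup>2" using R by (simp add: power4_eq_xxxx power2_eq_square)
  finally have 1: "\<bar>4 * real k * real (k - 1) / R ^ 4 * P1 * (x - y) $ i * (x - y) $ j\<bar> \<le> 4 * real k * real (k - 1) / R\<^sup>2" .
  have "2 * real k / R\<^sup>2 * P2 \<le> 2 * real k / R\<^sup>2 * 1" using p by (intro mult_left_mono) auto
  moreover have "0 \<le> 2 * real k / R\<^sup>2 * P2" using p by simp
  ultimately have 2: "\<bar>if i = j then 2 * real k / R\<^sup>2 * P2 else 0\<bar> \<le> 2 * real k / R\<^sup>2" by simp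
  show ?thesis
    unfolding bump_hess_def P1_def[symmetric] P2_def[symmetric] vec_lambda_beta add_divide_distrib
    using 1 2 by linarith
qed

text \<open>The cutoff localises the convex function. Its Hessian contributes the Laplacian with the
  factor \<open>\<delta> / 2\<close>; the constant 36 is half of 60, from \<open>Z\<close> times the
  Hessian of the cutoff, plus 12, from the mixed gradient terms; and \<open>13 = 1 + 12\<close>
  bounds the gradient of the product.\<close>

lemma Lop_product_ge:
  assumes Z: "C2_data Z G H" and R: "0 < R" and A: "0 \<le> A" and x: "norm (x - y) \<le> R"
    and G: "norm (G x) \<le> A" and Zx: "\<bar>Z x\<bar> \<le> 2 * A * R" and H: "\<And>v. 0 \<le> v \<bullet> (H x *v v)"
  shows "\<delta> / 2 * bump 3 y R x * (\<Sum>i\<in>UNIV. H x $ i $ i) - (36 * (real CARD('n))\<^sup>2 / \<delta> * A / R + 13 * A * norm (b x))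
     \<le> Lop a b (\<lambda>x. bump 3 y R x * Z x) x"
proof -
  define \<eta> g E where "\<eta> = bump 3 y R x" and "g = bump_grad 3 y R x" and "E = bump_hess 3 y R x"
  have \<eta>: "0 \<le> \<eta>" "\<eta> \<le> 1" by (auto simp: \<eta>_def bump_le1)
  have g: "norm g \<le> 6 / R" using bump_grad_le[OF R x, of 3] by (simp add: g_def)
  have E: "\<bar>E $ i $ j\<bar> \<le> 30 / R\<^sup>2" for i j using bump_hess_le[OF R x, of 3 i j] by (simp add: E_def)
  have L: "Lop a b (\<lambda>x. bump 3 y R x * Z x) x =
     1 / 2 * (\<Sum>i\<in>UNIV. \<Sum>j\<in>UNIV. a x $ i $ j * (\<eta> *\<^sub>R H x + Z x *\<^sub>R E + (\<chi> i j. g $ i * G x $ j + G x $ i * g $ j)) $ j $ i)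
     + b x \<bullet> (\<eta> *\<^sub>R G x + Z x *\<^sub>R g)"
    using Lop_C2_data[OF C2_data_mult[OF bump_C2_data[of 3 R y] Z]] R by (simp add: \<eta>_def g_def E_def)
  have tr: "(\<Sum>i\<in>UNIV. \<Sum>j\<in>UNIV. a x $ i $ j * (\<eta> *\<^sub>R H x + Z x *\<^sub>R E + (\<chi> i j. g $ i * G x $ j + G x $ i * g $ j)) $ j $ i)
    = \<eta> * (\<Sum>i\<in>UNIV. \<Sum>j\<in>UNIV. a x $ i $ j * transpose (H x) $ i $ j)
     + (\<Sum>i\<in>UNIV. \<Sum>j\<in>UNIV. a x $ i $ j * (Z x *\<^sub>R E) $ j $ i)
     + (\<Sum>i\<in>UNIV. \<Sum>j\<in>UNIV. a x $ i $ j * (\<chi> i j. g $ i * G x $ j + G x $ i * g $ j) $ j $ i)"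
  proof -
    have "a x $ i $ j * (\<eta> *\<^sub>R H x + Z x *\<^sub>R E + (\<chi> i j. g $ i * G x $ j + G x $ i * g $ j)) $ j $ i
      = \<eta> * (a x $ i $ j * transpose (H x) $ i $ j) + a x $ i $ j * (Z x *\<^sub>R E) $ j $ i
        + a x $ i $ j * (\<chi> i j. g $ i * G x $ j + G x $ i * g $ j) $ j $ i" for i j
      by (simp add: transpose_def algebra_simps)
    then show ?thesis by (simp only: sum.distrib sum_distrib_left)
  qed
  \<comment> \<open>The second order term pairs \<open>a\<close> with the transposed Hessian; the
    quadratic form does not see the transposition.\<close>
  have "v \<bullet> (transpose (H x) *v v) = v \<bullet> (H x *v v)" for v
    by (metis dot_lmul_matrix inner_commute transpose_matrix_vector)
  then have t1: "\<delta> * (\<Sum>i\<in>UNIV. transpose (H x) $ i $ i) \<le> (\<Sum>i\<in>UNIV. \<Sum>j\<in>UNIV. a x $ i $ j * transpose (H x) $ i $ j)"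
    using H by (intro sym_elliptic_trace_ge[OF a]) simp
  have t1': "\<eta> * (\<delta> * (\<Sum>i\<in>UNIV. H x $ i $ i)) \<le> \<eta> * (\<Sum>i\<in>UNIV. \<Sum>j\<in>UNIV. a x $ i $ j * transpose (H x) $ i $ j)"
    using t1 \<eta> by (intro mult_left_mono) (auto simp: transpose_def)
  have e2: "\<bar>(Z x *\<^sub>R E) $ i $ j\<bar> \<le> 60 * A / R" for i j
  proof -
    have "\<bar>(Z x *\<^sub>R E) $ i $ j\<bar> \<le> (2 * A * R) * (30 / R\<^sup>2)"
      using Zx E[of i j] A R by (simp only: vector_scaleR_component real_scaleR_def abs_mult, intro mult_mono) auto
    then show ?thesis using R by (simp add: power2_eq_square)
  qed
  have t2: "\<bar>\<Sum>i\<in>UNIV. \<Sum>j\<in>UNIV. a x $ i $ j * (Z x *\<^sub>R E) $ j $ i\<bar> \<le> (real CARD('n))\<^sup>2 * (60 * A / R) / \<delta>"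
    by (rule second_order_bound[OF e2])
  have e3: "\<bar>(\<chi> i j. g $ i * G x $ j + G x $ i * g $ j) $ i $ j\<bar> \<le> 12 * A / R" for i j
  proof -
    have c: "\<bar>g $ i\<bar> \<le> 6 / R" "\<bar>G x $ i\<bar> \<le> A" for i
      using component_le_norm_cart[of g i] component_le_norm_cart[of "G x" i] g G by auto
    have "\<bar>g $ i * G x $ j\<bar> \<le> 6 / R * A" "\<bar>G x $ i * g $ j\<bar> \<le> A * (6 / R)"
      unfolding abs_mult using c A R by (intro mult_mono; simp)+
    then show ?thesis by (simp add: abs_le_iff)
  qed
  have t3: "\<bar>\<Sum>i\<in>UNIV. \<Sum>j\<in>UNIV. a x $ i $ j * (\<chi> i j. g $ i * G x $ j + G x $ i * g $ j) $ j $ i\<bar> \<le> (real CARD('n))\<^sup>2 * (12 * A / R) / \<delta>"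
    by (rule second_order_bound[OF e3])
  have "norm (\<eta> *\<^sub>R G x + Z x *\<^sub>R g) \<le> \<eta> * norm (G x) + \<bar>Z x\<bar> * norm g"
    using norm_triangle_ineq[of "\<eta> *\<^sub>R G x" "Z x *\<^sub>R g"] \<eta> by simp
  also have "\<dots> \<le> 1 * A + (2 * A * R) * (6 / R)"
    using \<eta> G Zx g A R by (intro add_mono mult_mono) auto
  also have "\<dots> = 13 * A" using R by simp
  finally have "norm (b x) * norm (\<eta> *\<^sub>R G x + Z x *\<^sub>R g) \<le> norm (b x) * (13 * A)" by (rule mult_left_mono) simp
  then have t4: "\<bar>b x \<bullet> (\<eta> *\<^sub>R G x + Z x *\<^sub>R g)\<bar> \<le> 13 * A * norm (b x)"
    using Cauchy_Schwarz_ineq2[of "b x" "\<eta> *\<^sub>R G x + Z x *\<^sub>R g"] by (simp add: mult_ac)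
  have e: "36 * (real CARD('n))\<^sup>2 / \<delta> * A / R = 1 / 2 * ((real CARD('n))\<^sup>2 * (60 * A / R) / \<delta> + (real CARD('n))\<^sup>2 * (12 * A / R) / \<delta>)"
    using R \<delta> by (simp add: field_simps)
  have e': "\<delta> / 2 * bump 3 y R x * (\<Sum>i\<in>UNIV. H x $ i $ i) = 1 / 2 * (\<eta> * (\<delta> * (\<Sum>i\<in>UNIV. H x $ i $ i)))"
    by (simp add: \<eta>_def)
  have arith: "1 / 2 * p - (1 / 2 * (e2 + e3) + e4) \<le> 1 / 2 * (q + s2 + s3) + s4"
    if "p \<le> q" "\<bar>s2\<bar> \<le> e2" "\<bar>s3\<bar> \<le> e3" "\<bar>s4\<bar> \<le> e4" for p q s2 s3 s4 e2 e3 e4 :: real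
  proof -
    have "- e2 \<le> s2" "- e3 \<le> s3" "- e4 \<le> s4" using that(2-4) by (auto simp: abs_le_iff)
    then show ?thesis using that(1) by (simp add: field_simps)
  qed
  show ?thesis unfolding L tr e e' by (rule arith[OF t1' t2 t3 t4])
qed

end

text \<open>Compactness at scale 1, then scaling and translation: the number of cubes depends on
  \<open>K\<close> and the dimension only.\<close>

lemma cover_by_cubes:
  fixes K :: real
  shows "\<exists>N0. \<forall>(y :: real ^ 'n) \<rho>. 0 < \<rho> \<longrightarrow> (\<exists>Y. finite Y \<and> card Y \<le> N0 \<and> cball y (K * \<rho>) \<subseteq> (\<Union>c\<in>Y. cube c \<rho>))"
proof -
  have "cball (0 :: real ^ 'n) K \<subseteq> (\<Union>c\<in>cball 0 K. ball c 1)" by force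
  then obtain Z where Z: "Z \<subseteq> cball 0 K" "finite Z" "cball (0 :: real ^ 'n) K \<subseteq> (\<Union>c\<in>Z. ball c 1)"
    using compactE_image[OF compact_cball[of "0 :: real ^ 'n" K], of "cball 0 K" "\<lambda>c. ball c 1"] by (metis open_ball)
  show ?thesis
  proof (intro exI[of _ "card Z"] allI impI)
    fix y :: "real ^ 'n" and \<rho> :: real assume \<rho>: "0 < \<rho>"
    show "\<exists>Y. finite Y \<and> card Y \<le> card Z \<and> cball y (K * \<rho>) \<subseteq> (\<Union>c\<in>Y. cube c \<rho>)"
    proof (intro exI[of _ "(\<lambda>c. y + \<rho> *\<^sub>R c) ` Z"] conjI subsetI)
      show "finite ((\<lambda>c. y + \<rho> *\<^sub>R c) ` Z)" using Z by simp
      show "card ((\<lambda>c. y + \<rho> *\<^sub>R c) ` Z) \<le> card Z" using Z by (intro card_image_le)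
      fix x assume "x \<in> cball y (K * \<rho>)"
      then have "norm ((x - y) /\<^sub>R \<rho>) \<le> K"
        using \<rho> by (simp add: dist_norm norm_minus_commute divide_inverse_commute[symmetric] divide_le_eq mult.commute)
      then have "(x - y) /\<^sub>R \<rho> \<in> cball 0 K" by (simp only: mem_cball_0)
      then have "(x - y) /\<^sub>R \<rho> \<in> (\<Union>c\<in>Z. ball c 1)" by (rule subsetD[OF Z(3)])
      then obtain c where c: "c \<in> Z" "norm (c - (x - y) /\<^sub>R \<rho>) < 1" unfolding UN_iff mem_ball dist_norm by blast
      have "x - (y + \<rho> *\<^sub>R c) = - (\<rho> *\<^sub>R (c - (x - y) /\<^sub>R \<rho>))" using \<rho> by (simp add: algebra_simps)
      then have "norm (x - (y + \<rho> *\<^sub>R c)) = \<rho> * norm (c - (x - y) /\<^sub>R \<rho>)" using \<rho> by simp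
      also have "\<dots> \<le> \<rho> * 1" using c \<rho> by (intro mult_left_mono) auto
      finally have "x \<in> cball (y + \<rho> *\<^sub>R c) \<rho>" by (simp add: dist_norm norm_minus_commute)
      then show "x \<in> (\<Union>c\<in>(\<lambda>c. y + \<rho> *\<^sub>R c) ` Z. cube c \<rho>)" using c(1) cball_subset_cube by blast
    qed
  qed
qed

section \<open>Abstract occupation measures and their estimates\<close>

definition C2_compact :: "(real ^ 'n \<Rightarrow> real) \<Rightarrow> bool" where
  "C2_compact u \<longleftrightarrow> (\<exists>g H c r. C2_data u g H \<and> (\<forall>x. x \<notin> cball c r \<longrightarrow> u x = 0))"

lemma C2_compactI: "C2_data u g H \<Longrightarrow> (\<And>x. x \<notin> cball c r \<Longrightarrow> u x = 0) \<Longrightarrow> C2_compact u"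
  unfolding C2_compact_def by blast

context elliptic_operator
begin

text \<open>All that the Krylov estimate sees of the process up to time \<open>t\<close>. By
  Dynkin's formula the integral of \<open>Lop a b u\<close> is an expectation of \<open>u\<close>
  minus its initial value, hence at most \<open>2 M\<close> in absolute value.\<close>

definition occupation :: "(real ^ 'n) measure \<Rightarrow> real \<Rightarrow> bool" where
  "occupation V t \<longleftrightarrow> finite_measure V \<and> sets V = sets borel \<and> measure V UNIV \<le> t \<and>
     integrable V (\<lambda>x. norm (b x)) \<and>
     (\<forall>u M. C2_compact u \<longrightarrow> (\<forall>x. \<bar>u x\<bar> \<le> M) \<longrightarrow> \<bar>\<integral>x. Lop a b u x \<partial>V\<bar> \<le> 2 * M)"

lemma occupation_integrable_Lop:
  assumes V: "occupation V t" and C: "C2_data u g H" and z: "\<And>x. x \<notin> cball c r \<Longrightarrow> u x = 0"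
  shows "integrable V (Lop a b u)"
proof -
  interpret V: finite_measure V using V by (simp add: occupation_def)
  obtain B where B: "0 \<le> B" "\<And>x. \<bar>Lop a b u x\<bar> \<le> B * (1 + norm (b x))" using Lop_bounded[OF C z] by blast
  show ?thesis
  proof (rule Bochner_Integration.integrable_bound[where f = "\<lambda>x. B * (1 + norm (b x))"])
    show "integrable V (\<lambda>x. B * (1 + norm (b x)))" using V by (simp add: occupation_def)
    show "Lop a b u \<in> borel_measurable V"
      using Lop_measurable[OF C] V by (simp add: occupation_def cong: measurable_cong_sets)
    show "AE x in V. norm (Lop a b u x) \<le> norm (B * (1 + norm (b x)))" using B by (intro AE_I2) (auto simp: abs_mult)
  qed
qed

text \<open>\<open>Cgrad\<close> and \<open>Clap\<close> are the constants of
  \<open>test_function_exists\<close>, \<open>Cerr\<close> that of \<open>Lop_product_ge\<close>. In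
  \<open>Clow\<close> the factor \<open>27/64 = (3/4)^3\<close> is the least value of the cutoff on
  the half ball; in \<open>Ckry\<close> the number 17 collects 4 from Dynkin's formula and 13 from
  the drift.\<close>

definition Cgrad :: real where "Cgrad = CARD('n) * 2 ^ CARD('n)"
definition Clap :: real where "Clap = 3 / 160 / (4 * sqrt CARD('n)) ^ (CARD('n) + 1)"
definition Cerr :: real where "Cerr = 36 * (real CARD('n))\<^sup>2 / \<delta>"
definition Clow :: real where "Clow = \<delta> / 2 * (27 / 64) * Clap"
definition Ckry :: real where "Ckry = Cgrad * (17 + Cerr) / Clow"

lemma constants_pos: "0 < Cgrad" "0 < Clap" "0 < Cerr" "0 < Clow" "0 < Ckry"
proof -
  show 1: "0 < Cgrad" "0 < Clap" "0 < Cerr" using \<delta> by (simp_all add: Cgrad_def Clap_def Cerr_def)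
  then show 2: "0 < Clow" using \<delta> by (simp add: Clow_def)
  show "0 < Ckry" using 1 2 by (simp add: Ckry_def)
qed

text \<open>Integrate the lower bound for \<open>Lop\<close> of the localised test function: on the
  cells it dominates \<open>Clow\<close> times the step function. Dynkin gives the upper bound
  \<open>4 A R\<close>, and \<open>t \<le> R\<^sup>2\<close> reduces the error of the cutoff to a
  multiple of \<open>A R\<close> as well. The restriction on the mesh ensures
  \<open>\<epsilon> \<le> R\<close>.\<close>

lemma krylov_step:
  assumes V: "occupation V t" and R: "0 < R" and t: "t \<le> R\<^sup>2"
  shows "step_Ln_bound V (Ckry * (R + (\<integral>x. drift_on (cball y R) x \<partial>V))) (ball y (R / 2)) (R / (4 * sqrt CARD('n)))"
  unfolding step_Ln_bound_def
proof (intro allI impI)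
  interpret V: finite_measure V using V by (simp add: occupation_def)
  have sV: "sets V = sets borel" using V by (simp add: occupation_def)
  have spV: "space V = UNIV" using sets_eq_imp_space_eq[OF sV] by simp
  define Bd where "Bd = (\<integral>x. drift_on (cball y R) x \<partial>V)"
  fix s :: real and J :: "(int ^ 'n) set" and f :: "int ^ 'n \<Rightarrow> real"
  assume s: "0 < s" "s < R / (4 * sqrt CARD('n))" and J: "finite J" "J \<noteq> {}"
    and f: "\<forall>m\<in>J. 0 < f m \<and> gcell 0 s m \<subseteq> ball y (R / 2)"
  define ctr where "ctr = gcentre (0 :: real ^ 'n) s"
  have inj: "inj_on ctr J" unfolding ctr_def by (rule inj_onI) (rule gcentre_inj[OF s(1)])
  define F where "F = root CARD('n) (\<Sum>m\<in>J. (s * f m) ^ CARD('n))"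
  have sumpos: "0 < (\<Sum>m\<in>J. (s * f m) ^ CARD('n))" using J f s by (intro sum_pos) auto
  have F: "0 < F" "F ^ CARD('n) = (\<Sum>m\<in>J. (s * f m) ^ CARD('n))"
    using sumpos by (auto simp: F_def real_root_pow_pos2)
  define fI where "fI = f \<circ> the_inv_into J ctr"
  have fI: "fI (ctr m) = f m" if "m \<in> J" for m using the_inv_into_f_f[OF inj that] by (simp add: fI_def)
  define \<epsilon> where "\<epsilon> = 4 * sqrt CARD('n) * s"
  have \<epsilon>: "0 < \<epsilon>" "\<epsilon> \<le> R" using s by (auto simp: \<epsilon>_def field_simps)
  have F': "F ^ CARD('n) = (\<Sum>x\<in>ctr ` J. (s * fI x) ^ CARD('n))"
    unfolding F(2) by (simp add: sum.reindex[OF inj] fI)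
  have fI0: "0 < fI x" if "x \<in> ctr ` J" for x using that f by (auto simp: fI)
  have J': "finite (ctr ` J)" "ctr ` J \<noteq> {}" using J by auto
  obtain Z G H where Z: "C2_data Z G H"
    and all: "\<forall>x. norm (x - y) \<le> R \<longrightarrow> norm (G x) \<le> Cgrad * F \<and> \<bar>Z x\<bar> \<le> Cgrad * F * (R + \<epsilon>) \<and>
       (\<forall>v. 0 \<le> v \<bullet> (H x *v v)) \<and> (\<forall>i\<in>ctr ` J. norm (x - i) \<le> sqrt CARD('n) * s / 2 \<longrightarrow> Clap * fI i \<le> (\<Sum>j\<in>UNIV. H x $ j $ j))"
    using test_function_exists[OF J' fI0 s(1) F(1) F', of y R]
    unfolding Cgrad_def[symmetric] Clap_def[symmetric] \<epsilon>_def[symmetric] by blast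
  have est: "norm (G x) \<le> Cgrad * F" "\<bar>Z x\<bar> \<le> Cgrad * F * (R + \<epsilon>)" "0 \<le> v \<bullet> (H x *v v)" if "norm (x - y) \<le> R" for x v
    using all that by blast+
  have lap: "Clap * f m \<le> (\<Sum>j\<in>UNIV. H x $ j $ j)"
    if "norm (x - y) \<le> R" "m \<in> J" "norm (x - ctr m) \<le> sqrt CARD('n) * s / 2" for x m
    using all that fI[OF that(2)] by force
  \<comment> \<open>Every bound is proportional to \<open>A\<close>, hence to the \<open>L_n\<close>
    norm \<open>F\<close> of the step function.\<close>
  define A where "A = Cgrad * F"
  have A: "0 < A" using constants_pos F by (simp add: A_def)
  have Zle: "\<bar>Z x\<bar> \<le> 2 * A * R" if "norm (x - y) \<le> R" for x
  proof -
    have "\<bar>Z x\<bar> \<le> A * (R + \<epsilon>)" using est(2)[OF that] by (simp add: A_def)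
    also have "\<dots> \<le> A * (R + R)" using A \<epsilon> by (intro mult_left_mono) auto
    finally show ?thesis by simp
  qed
  define u where "u x = bump 3 y R x * Z x" for x
  have u0: "u x = 0" if "R \<le> norm (x - y)" for x using bump_zero[OF R that, of 3] by (simp add: u_def)
  have u0': "u x = 0" if "x \<notin> cball y R" for x using that by (intro u0) (auto simp: dist_norm norm_minus_commute)
  note uC = C2_data_mult[OF bump_C2_data[of 3 R y, OF _ R] Z, folded u_def]
  have uC2: "C2_compact u" using C2_compactI[OF uC u0'] by simp
  have uM: "\<bar>u x\<bar> \<le> 2 * A * R" for x
  proof (cases "R \<le> norm (x - y)")
    case True then show ?thesis using A R u0 by simp
  next
    case False
    have "\<bar>u x\<bar> = bump 3 y R x * \<bar>Z x\<bar>" by (simp add: u_def abs_mult)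
    also have "\<dots> \<le> 1 * (2 * A * R)" using False Zle[of x] bump_le1[of 3 y R x] by (intro mult_mono) auto
    finally show ?thesis by simp
  qed
  define g where "g x = (if grid 0 s x \<in> J then f (grid 0 s x) else 0)" for x :: "real ^ 'n"
  have g0: "0 \<le> g x" for x using f by (auto simp: g_def less_imp_le)
  have gm: "g \<in> borel_measurable V"
  proof -
    have "g \<in> borel_measurable borel"
      using grid_measurable_comp[OF s(1), of "\<lambda>m. if m \<in> J then f m else 0" borel "0 :: real ^ 'n"]
      unfolding g_def[abs_def] by simp
    then show ?thesis using sV by (simp cong: measurable_cong_sets)
  qed
  have gi: "integrable V g"
  proof (rule V.integrable_const_bound[where B = "\<Sum>m\<in>J. f m"])
    have "g x \<le> (\<Sum>m\<in>J. f m)" for x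
    proof (cases "grid 0 s x \<in> J")
      case True
      have "f (grid 0 s x) \<le> sum f J" using J f True by (intro member_le_sum) (simp_all add: less_imp_le)
      then show ?thesis unfolding g_def using True by simp
    next
      case False
      then show ?thesis unfolding g_def using f by (simp add: sum_nonneg less_imp_le)
    qed
    then show "AE x in V. norm (g x) \<le> (\<Sum>m\<in>J. f m)" using g0 by (intro AE_I2) simp
  qed (rule gm)
  have low: "Clow * g x - (Cerr * A / R * indicator (cball y R) x + 13 * A * (drift_on (cball y R) x)) \<le> Lop a b u x" for x
  proof (cases "norm (x - y) \<le> R")
    case True
    have tr0: "0 \<le> (\<Sum>j\<in>UNIV. H x $ j $ j)"
    proof (rule sum_nonneg)
      fix j
      have "0 \<le> axis j 1 \<bullet> (H x *v axis j 1)" by (rule est(3)[OF True])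
      then show "0 \<le> H x $ j $ j" by (simp add: matrix_vector_mul_component inner_axis' inner_axis)
    qed
    have "Clow * g x \<le> \<delta> / 2 * bump 3 y R x * (\<Sum>j\<in>UNIV. H x $ j $ j)"
    proof (cases "grid 0 s x \<in> J")
      case gJ: True
      have x: "x \<in> gcell 0 s (grid 0 s x)" by (rule mem_gcell_grid)
      then have "x \<in> ball y (R / 2)" using f gJ by blast
      then have "norm (x - y) \<le> R / 2" by (simp add: dist_norm norm_minus_commute)
      then have "(norm (x - y))\<^sup>2 \<le> (R / 2)\<^sup>2" by (intro power_mono) auto
      then have "(norm (x - y))\<^sup>2 / R\<^sup>2 \<le> 1 / 4" using R by (simp add: divide_le_eq power_divide)
      then have "3 / 4 \<le> max 0 (1 - (norm (x - y))\<^sup>2 / R\<^sup>2)" by linarith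
      then have "(3 / 4) ^ 3 \<le> (max 0 (1 - (norm (x - y))\<^sup>2 / R\<^sup>2)) ^ 3" by (rule power_mono) simp
      then have bl: "27 / 64 \<le> bump 3 y R x" by (simp add: bump_def pospow_def power_divide)
      have "x \<in> cube (ctr (grid 0 s x)) (s / 2)" using gcell_subset_cube[OF s(1)] x by (auto simp: ctr_def)
      then have "norm (x - ctr (grid 0 s x)) \<le> sqrt CARD('n) * (s / 2)" by (rule cube_norm_le)
      then have "Clap * g x \<le> (\<Sum>j\<in>UNIV. H x $ j $ j)" using lap[OF True gJ] gJ by (simp add: g_def)
      then have "(\<delta> / 2 * (27 / 64)) * (Clap * g x) \<le> (\<delta> / 2 * bump 3 y R x) * (\<Sum>j\<in>UNIV. H x $ j $ j)"
        using \<delta> bl g0[of x] constants_pos by (intro mult_mono) auto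
      then show ?thesis by (simp add: Clow_def mult_ac)
    next
      case False then show ?thesis using \<delta> tr0 by (simp add: g_def)
    qed
    moreover have "\<delta> / 2 * bump 3 y R x * (\<Sum>i\<in>UNIV. H x $ i $ i) - (36 * (real CARD('n))\<^sup>2 / \<delta> * A / R + 13 * A * norm (b x)) \<le> Lop a b u x"
      unfolding u_def by (rule Lop_product_ge[OF Z R _ True]) (use A est True Zle in \<open>auto simp: A_def\<close>)
    moreover have "x \<in> cball y R" using True by (simp add: dist_norm norm_minus_commute)
    ultimately show ?thesis by (simp add: Cerr_def)
  next
    case False
    have xn: "x \<notin> cball y R" using False by (simp add: dist_norm norm_minus_commute)
    have "grid 0 s x \<notin> J"
    proof
      assume "grid 0 s x \<in> J"
      then have "x \<in> ball y (R / 2)" using f mem_gcell_grid by blast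
      then show False using False R by (simp add: dist_norm norm_minus_commute)
    qed
    moreover have "Lop a b u x = 0"
      using C2_data_zero_outside[OF uC u0' xn] by (simp add: Lop_C2_data[OF uC])
    ultimately show ?thesis using xn by (simp add: g_def)
  qed
  have cb: "cball y R \<in> sets V" using sV by (simp add: borel_closed)
  have ib: "integrable V (\<lambda>x. drift_on (cball y R) x)"
    using V cb by (intro integrable_real_mult_indicator) (auto simp: occupation_def)
  have ii: "integrable V (\<lambda>x. indicator (cball y R) x :: real)"
    using cb V.emeasure_finite[of "cball y R"] by (intro integrable_real_indicator) (auto simp: V.emeasure_eq_measure)
  have "Clow * (\<integral>x. g x \<partial>V) - (Cerr * A / R * measure V (cball y R) + 13 * A * Bd)
     = (\<integral>x. Clow * g x - (Cerr * A / R * indicator (cball y R) x + 13 * A * (drift_on (cball y R) x)) \<partial>V)"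
    using gi ib ii cb spV by (simp add: Bd_def)
  also have "\<dots> \<le> (\<integral>x. Lop a b u x \<partial>V)"
    by (rule integral_mono[OF _ occupation_integrable_Lop[OF V uC u0'] low]) (use gi ib ii in auto)
  also have "\<dots> \<le> 2 * (2 * A * R)"
    using V uC2 uM unfolding occupation_def by (meson abs_le_D1)
  finally have 1: "Clow * (\<integral>x. g x \<partial>V) \<le> 4 * A * R + (Cerr * A / R * measure V (cball y R) + 13 * A * Bd)" by simp
  have "measure V (cball y R) \<le> measure V UNIV" using cb spV by (intro V.finite_measure_mono) (auto simp: sV)
  also have "\<dots> \<le> R\<^sup>2" using V t by (simp add: occupation_def)
  finally have "Cerr * A / R * measure V (cball y R) \<le> Cerr * A / R * R\<^sup>2"
    using constants_pos A R by (intro mult_left_mono) auto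
  then have "Cerr * A / R * measure V (cball y R) \<le> Cerr * A * R" using R by (simp add: power2_eq_square)
  moreover have Bd0: "0 \<le> Bd" unfolding Bd_def by (intro Bochner_Integration.integral_nonneg) simp
  moreover have "0 \<le> A * Bd" "0 \<le> A * R" "0 \<le> Cerr * (A * Bd)" using A R Bd0 constants_pos by simp_all
  ultimately have "Clow * (\<integral>x. g x \<partial>V) \<le> A * (17 + Cerr) * (R + Bd)" using 1 by (simp add: algebra_simps)
  then have "(\<integral>x. g x \<partial>V) \<le> A * (17 + Cerr) * (R + Bd) / Clow" using constants_pos by (simp add: le_divide_eq mult.commute)
  also have "\<dots> = Ckry * (R + Bd) * F" by (simp add: A_def Ckry_def)
  finally show "(\<integral>x. (if grid 0 s x \<in> J then f (grid 0 s x) else 0) \<partial>V)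
     \<le> Ckry * (R + (\<integral>x. drift_on (cball y R) x \<partial>V)) * root CARD('n) (\<Sum>m\<in>J. (s * f m) ^ CARD('n))"
    by (simp add: g_def F_def Bd_def)
qed

lemma krylov_estimate:
  assumes V: "occupation V t" and R: "0 < R" and t: "t \<le> R\<^sup>2" and Q: "Q \<in> sets borel" "Q \<subseteq> ball y (R / 2)"
    and f: "f \<in> borel_measurable borel" "\<And>x. 0 \<le> f x" "\<And>x. x \<notin> Q \<Longrightarrow> f x = 0" "integrable lborel (\<lambda>x. f x ^ CARD('n))"
  shows "integrable V f"
    "(\<integral>x. f x \<partial>V) \<le> Ckry * (R + (\<integral>x. drift_on (cball y R) x \<partial>V)) * Ln_norm f"
proof -
  define W where "W = Ckry * (R + (\<integral>x. drift_on (cball y R) x \<partial>V))"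
  have fm: "finite_measure V" "sets V = sets borel" using V by (auto simp: occupation_def)
  have W: "0 \<le> W" unfolding W_def using constants_pos R
    by (intro mult_nonneg_nonneg add_nonneg_nonneg Bochner_Integration.integral_nonneg) auto
  have s0: "0 < R / (4 * sqrt CARD('n))" using R by simp
  note * = Ln_bound_borel[OF fm W s0 krylov_step[OF V R t, of y, folded W_def] open_ball bounded_ball Q f]
  show "integrable V f" by (rule *(1))
  show "(\<integral>x. f x \<partial>V) \<le> Ckry * (R + (\<integral>x. drift_on (cball y R) x \<partial>V)) * Ln_norm f"
    using *(2) by (simp add: W_def)
qed

text \<open>The time horizon \<open>\<rho>\<^sup>2\<close> makes the bounds consistent with scaling:
  for \<open>E\<close> the whole cube the last one is of order \<open>\<rho>\<^sup>2\<close>. The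
  drift bound carries the additional small factor \<open>e\<close>.\<close>

definition krylov_bound :: "real \<Rightarrow> real \<Rightarrow> bool" where
  "krylov_bound C e0 \<longleftrightarrow> (\<forall>V \<rho> e. occupation V (\<rho>\<^sup>2) \<longrightarrow> 0 < \<rho> \<longrightarrow> 0 \<le> e \<longrightarrow> e \<le> e0 \<longrightarrow>
     integrable lborel (\<lambda>x. norm (b x) ^ CARD('n)) \<longrightarrow>
     (\<forall>c. (\<integral>x. (drift_on (cube c \<rho>) x) ^ CARD('n) \<partial>lborel) \<le> e ^ CARD('n)) \<longrightarrow>
     (\<forall>c. (\<integral>x. drift_on (cube c \<rho>) x \<partial>V) \<le> C * e * \<rho>) \<and>
     (\<forall>c E. E \<in> sets borel \<longrightarrow> E \<subseteq> cube c \<rho> \<longrightarrow> measure V E \<le> C * \<rho> * root CARD('n) (vol E)))"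

text \<open>The occupation integral of the drift satisfies the estimate with itself on the right-hand side, with a
  small factor, so that it can be absorbed because it is known to be finite.\<close>

lemma krylov_local: "\<exists>C e0. 0 < C \<and> 0 < e0 \<and> krylov_bound C e0"
proof -
  \<comment> \<open>With \<open>R = S * \<rho>\<close> the cube of half side \<open>\<rho>\<close>
    lies in the ball of radius \<open>R / 2\<close>, where \<open>krylov_estimate\<close>
    applies.\<close>
  define S where "S = 4 * sqrt CARD('n)"
  have S: "4 \<le> S" by (simp add: S_def)
  obtain N0 where N0: "\<And>(y :: real ^ 'n) \<rho>. 0 < \<rho> \<Longrightarrow> \<exists>Y. finite Y \<and> card Y \<le> N0 \<and> cball y (S * \<rho>) \<subseteq> (\<Union>c\<in>Y. cube c \<rho>)"
    using cover_by_cubes[of S] by blast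
  define C where "C = 2 * S * Ckry"
  \<comment> \<open>Chosen so that \<open>Ckry * N0 * e \<le> 1/2\<close>, the factor with which the
    drift integral reappears on the right.\<close>
  define e0 where "e0 = 1 / (2 * Ckry * (real N0 + 1))"
  have C: "0 < C" using S constants_pos by (simp add: C_def)
  have e0: "0 < e0" using constants_pos by (simp add: e0_def)
  show ?thesis
  proof (rule exI[of _ C], rule exI[of _ e0], rule conjI[OF C], rule conjI[OF e0], unfold krylov_bound_def, intro allI impI)
    fix V :: "(real ^ 'n) measure" and \<rho> e :: real
    assume V: "occupation V (\<rho>\<^sup>2)" and \<rho>: "0 < \<rho>" and e: "0 \<le> e" "e \<le> e0"
      and bi: "integrable lborel (\<lambda>x. norm (b x) ^ CARD('n))"
      and be: "\<forall>c. (\<integral>x. (drift_on (cube c \<rho>) x) ^ CARD('n) \<partial>lborel) \<le> e ^ CARD('n)"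
    have sV: "sets V = sets borel" and ibV: "integrable V (\<lambda>x. norm (b x))" using V by (auto simp: occupation_def)
    define R where "R = S * \<rho>"
    have R: "0 < R" using S \<rho> by (simp add: R_def)
    have tR: "\<rho>\<^sup>2 \<le> R\<^sup>2" using S \<rho> unfolding R_def by (intro power_mono) auto
    have cs: "cube c \<rho> \<subseteq> ball c (R / 2)" for c :: "real ^ 'n"
    proof
      fix x assume "x \<in> cube c \<rho>"
      then have "norm (x - c) \<le> sqrt CARD('n) * \<rho>" by (rule cube_norm_le)
      also have "\<dots> < R / 2" using \<rho> by (simp add: R_def S_def)
      finally show "x \<in> ball c (R / 2)" by (simp add: dist_norm norm_minus_commute)
    qed
    have cb: "cube c \<rho> \<in> sets borel" for c :: "real ^ 'n" by (simp add: compact_imp_closed borel_closed)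
    have icV: "integrable V (\<lambda>x. drift_on (cube c \<rho>) x)" for c
      using ibV cb[of c] sV by (intro integrable_real_mult_indicator) auto
    define m where "m c = (\<integral>x. drift_on (cube c \<rho>) x \<partial>V)" for c
    \<comment> \<open>The estimate on a cube involves the drift in a larger ball, covered by
      \<open>N0\<close> cubes of the same size. Only the supremum over all centres closes the
      inequality.\<close>
    define A where "A = (SUP c. m c)"
    have m_le: "m c \<le> (\<integral>x. norm (b x) \<partial>V)" for c
      unfolding m_def by (rule integral_mono[OF icV ibV]) (simp add: indicator_def)
    have bdd: "bdd_above (range m)" using m_le by (auto intro!: bdd_aboveI2)
    have mA: "m c \<le> A" for c unfolding A_def using bdd by (intro cSUP_upper) auto
    have m0: "0 \<le> m c" for c unfolding m_def by (intro Bochner_Integration.integral_nonneg) simp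
    have A0: "0 \<le> A" using m0[of 0] mA[of 0] by simp
    have ball_le: "(\<integral>x. drift_on (cball y R) x \<partial>V) \<le> real N0 * A" for y
    proof -
      obtain Y where Y: "finite Y" "card Y \<le> N0" "cball y R \<subseteq> (\<Union>c\<in>Y. cube c \<rho>)" using N0[OF \<rho>, of y] by (auto simp: R_def)
      have "(\<integral>x. drift_on (cball y R) x \<partial>V) \<le> (\<integral>x. (\<Sum>c\<in>Y. drift_on (cube c \<rho>) x) \<partial>V)"
      proof (rule integral_mono)
        show "integrable V (\<lambda>x. drift_on (cball y R) x)"
          using ibV sV by (intro integrable_real_mult_indicator) (auto simp: borel_closed)
        show "integrable V (\<lambda>x. \<Sum>c\<in>Y. drift_on (cube c \<rho>) x)" by (intro Bochner_Integration.integrable_sum icV)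
        fix x
        show "drift_on (cball y R) x \<le> (\<Sum>c\<in>Y. drift_on (cube c \<rho>) x)"
        proof (cases "x \<in> cball y R")
          case True
          then obtain c where c: "c \<in> Y" "x \<in> cube c \<rho>" using Y(3) by auto
          have "drift_on (cball y R) x = drift_on (cube c \<rho>) x" using c True by simp
          also have "\<dots> \<le> (\<Sum>c\<in>Y. drift_on (cube c \<rho>) x)" using Y c by (intro member_le_sum) auto
          finally show ?thesis .
        qed (simp add: sum_nonneg)
      qed
      also have "\<dots> = (\<Sum>c\<in>Y. m c)" unfolding m_def by (rule Bochner_Integration.integral_sum[OF icV])
      also have "\<dots> \<le> real (card Y) * A" using mA by (rule sum_bounded_above)
      also have "\<dots> \<le> real N0 * A" using Y A0 by (intro mult_right_mono) auto
      finally show ?thesis .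
    qed
    have est: "integrable V f \<and> (\<integral>x. f x \<partial>V) \<le> Ckry * (R + real N0 * A) * Ln_norm f"
      if f: "f \<in> borel_measurable borel" "\<And>x. 0 \<le> f x" "\<And>x. x \<notin> cube c \<rho> \<Longrightarrow> f x = 0" "integrable lborel (\<lambda>x. f x ^ CARD('n))" for f c
    proof
      show "integrable V f" by (rule krylov_estimate(1)[OF V R tR cb cs f])
      have "0 \<le> Ln_norm f"
        using f(2) by (intro real_root_ge_zero Bochner_Integration.integral_nonneg) auto
      then have "Ckry * (R + (\<integral>x. drift_on (cball c R) x \<partial>V)) * Ln_norm f
        \<le> Ckry * (R + real N0 * A) * Ln_norm f"
        using ball_le[of c] constants_pos by (intro mult_right_mono mult_left_mono add_left_mono) auto
      then show "(\<integral>x. f x \<partial>V) \<le> Ckry * (R + real N0 * A) * Ln_norm f"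
        using krylov_estimate(2)[OF V R tR cb cs f] by (rule order_trans[rotated])
    qed
    have bci: "integrable lborel (\<lambda>x. (drift_on (cube c \<rho>) x) ^ CARD('n))" for c
    proof (rule Bochner_Integration.integrable_bound[OF bi])
      show "(\<lambda>x. (drift_on (cube c \<rho>) x) ^ CARD('n)) \<in> borel_measurable lborel" using cb[of c] by simp
    qed (auto simp: indicator_def power_0_left)
    have m_bound: "m c \<le> Ckry * (R + real N0 * A) * e" for c
    proof -
      have "m c \<le> Ckry * (R + real N0 * A) * root CARD('n) (\<integral>x. (drift_on (cube c \<rho>) x) ^ CARD('n) \<partial>lborel)"
        unfolding m_def using cb[of c] by (intro conjunct2[OF est[where c = c]] bci) auto
      also have "root CARD('n) (\<integral>x. (drift_on (cube c \<rho>) x) ^ CARD('n) \<partial>lborel) \<le> root CARD('n) (e ^ CARD('n))"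
        using be by (intro real_root_le_mono) auto
      also have "root CARD('n) (e ^ CARD('n)) = e" using e by (intro real_root_power_cancel) auto
      finally show ?thesis using constants_pos R A0 by (simp add: mult_left_mono)
    qed
    have small: "Ckry * real N0 * e \<le> 1 / 2"
    proof -
      have "Ckry * real N0 * e \<le> Ckry * (real N0 + 1) * e0" using constants_pos e by (intro mult_mono) auto
      also have "\<dots> = 1 / 2" using constants_pos by (simp add: e0_def)
      finally show ?thesis .
    qed
    have "A \<le> Ckry * (R + real N0 * A) * e" unfolding A_def by (rule cSUP_least) (auto simp: m_bound A_def[symmetric])
    also have "\<dots> = Ckry * R * e + (Ckry * real N0 * e) * A" by (simp add: algebra_simps)
    also have "\<dots> \<le> Ckry * R * e + 1 / 2 * A" using small A0 by (intro add_left_mono mult_right_mono)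
    finally have A_le: "A \<le> 2 * Ckry * R * e" by simp
    have drift: "(\<integral>x. drift_on (cube c \<rho>) x \<partial>V) \<le> C * e * \<rho>" for c
      using mA[of c] A_le by (simp add: m_def C_def R_def mult_ac)
    have "real N0 * A \<le> real N0 * (2 * Ckry * R * e)" using A_le by (intro mult_left_mono) auto
    also have "\<dots> = 2 * (Ckry * real N0 * e) * R" by simp
    also have "\<dots> \<le> 2 * (1 / 2) * R" using small R by (intro mult_right_mono) auto
    finally have NA: "real N0 * A \<le> R" by simp
    have "measure V E \<le> C * \<rho> * root CARD('n) (vol E)" if E: "E \<in> sets borel" "E \<subseteq> cube c \<rho>" for c E
    proof -
      have p: "(indicator E x :: real) ^ CARD('n) = indicator E x" for x by (simp add: indicator_def power_0_left)
      have "emeasure lborel E \<le> emeasure lborel (cube c \<rho>)" using E cb by (intro emeasure_mono) auto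
      then have "emeasure lborel E < \<infinity>" using emeasure_cube[of \<rho> c] \<rho> by (simp add: le_less_trans)
      then have "integrable lborel (\<lambda>x. (indicator E x :: real) ^ CARD('n))"
        unfolding p using E by (intro integrable_real_indicator) auto
      then have "(\<integral>x. indicator E x \<partial>V) \<le> Ckry * (R + real N0 * A) * Ln_norm (indicator E)"
        using E by (intro conjunct2[OF est[of _ c]]) (auto simp: indicator_def)
      also have "\<dots> \<le> Ckry * (R + R) * Ln_norm (indicator E)"
        using NA constants_pos by (intro mult_right_mono mult_left_mono add_left_mono) (auto simp: p)
      also have "\<dots> = C * \<rho> * root CARD('n) (vol E)" using E by (simp add: p C_def R_def)
      finally show ?thesis using E sV sets_eq_imp_space_eq[OF sV] by simp
    qed
    then show "(\<forall>c. (\<integral>x. drift_on (cube c \<rho>) x \<partial>V) \<le> C * e * \<rho>) \<and>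
     (\<forall>c E. E \<in> sets borel \<longrightarrow> E \<subseteq> cube c \<rho> \<longrightarrow> measure V E \<le> C * \<rho> * root CARD('n) (vol E))"
      using drift by blast
  qed
qed

end

section \<open>Occupation measures and visits to cubes\<close>

locale markov_kernels =
  fixes T :: "real \<Rightarrow> real ^ 'n \<Rightarrow> (real ^ 'n) measure"
  assumes T_kernel [measurable]: "(\<lambda>(t, x). T t x) \<in> borel \<Otimes>\<^sub>M borel \<rightarrow>\<^sub>M subprob_algebra borel"
    and T_prob: "prob_space (T t x)"
    and Chapman_Kolmogorov: "\<And>f :: real ^ 'n \<Rightarrow> ennreal. 0 \<le> s \<Longrightarrow> 0 \<le> t \<Longrightarrow> f \<in> borel_measurable borel \<Longrightarrow>
      (\<integral>\<^sup>+y. f y \<partial>T (s + t) x) = (\<integral>\<^sup>+y. (\<integral>\<^sup>+w. f w \<partial>T t y) \<partial>T s x)"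
begin

lemma T_kernel_x [measurable]: "T t \<in> borel \<rightarrow>\<^sub>M subprob_algebra borel"
  using measurable_compose[OF measurable_Pair1'[of t] T_kernel] by simp

lemma sets_T [simp, measurable_cong]: "sets (T t x) = sets borel"
  using measurable_space[OF T_kernel_x[of t], of x] by (simp add: space_subprob_algebra)

lemma space_T [simp]: "space (T t x) = UNIV"
  using sets_eq_imp_space_eq[OF sets_T[of t x]] by simp

lemma emeasure_T_UNIV [simp]: "emeasure (T t x) UNIV = 1"
  using prob_space.emeasure_space_1[OF T_prob[of t x]] by simp

text \<open>The expected time spent in a set up to time \<open>t\<close>, as a mixture of the
  one-time laws; its total mass is \<open>t\<close>.\<close>

definition V :: "real \<Rightarrow> real ^ 'n \<Rightarrow> (real ^ 'n) measure" where
  "V t x = density lborel (indicator {0..t}) \<bind> (\<lambda>s. T s x)"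

lemma sets_V [simp, measurable_cong]: "sets (V t x) = sets borel"
  unfolding V_def by (rule sets_bind) auto

lemma space_V [simp]: "space (V t x) = UNIV"
  using sets_eq_imp_space_eq[OF sets_V[of t x]] by simp

lemma nn_integral_V:
  fixes f :: "real ^ 'n \<Rightarrow> ennreal"
  assumes [measurable]: "f \<in> borel_measurable borel"
  shows "(\<integral>\<^sup>+y. f y \<partial>V t x) = (\<integral>\<^sup>+s. indicator {0..t} s * (\<integral>\<^sup>+y. f y \<partial>T s x) \<partial>lborel)"
proof -
  have k: "(\<lambda>s. T s x) \<in> density lborel (indicator {0..t}) \<rightarrow>\<^sub>M subprob_algebra borel"
    by (simp cong: measurable_cong_sets)
  have "(\<integral>\<^sup>+y. f y \<partial>V t x) = (\<integral>\<^sup>+s. (\<integral>\<^sup>+y. f y \<partial>T s x) \<partial>density lborel (indicator {0..t}))"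
    unfolding V_def by (rule nn_integral_bind[OF assms k])
  also have "\<dots> = (\<integral>\<^sup>+s. indicator {0..t} s * (\<integral>\<^sup>+y. f y \<partial>T s x) \<partial>lborel)"
    by (rule nn_integral_density) measurable
  finally show ?thesis .
qed

lemma emeasure_V_UNIV:
  assumes "0 \<le> t" shows "emeasure (V t x) UNIV = ennreal t"
proof -
  have "emeasure (V t x) UNIV = (\<integral>\<^sup>+y. 1 \<partial>V t x)" by simp
  also have "\<dots> = (\<integral>\<^sup>+s. indicator {0..t} s * (\<integral>\<^sup>+y. 1 \<partial>T s x) \<partial>lborel)" by (rule nn_integral_V) simp
  also have "\<dots> = (\<integral>\<^sup>+s. indicator {0..t} s \<partial>lborel)" by simp
  also have "\<dots> = ennreal t" using assms by simp
  finally show ?thesis .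
qed

lemma finite_measure_V: "0 \<le> t \<Longrightarrow> finite_measure (V t x)"
  by (rule finite_measureI) (simp add: emeasure_V_UNIV)

lemma measure_V_UNIV: "0 \<le> t \<Longrightarrow> measure (V t x) UNIV = t"
  by (simp add: measure_def emeasure_V_UNIV)

lemma V_measurable [measurable]:
  fixes f :: "real ^ 'n \<Rightarrow> ennreal"
  assumes [measurable]: "f \<in> borel_measurable borel"
  shows "(\<lambda>x. \<integral>\<^sup>+y. f y \<partial>V t x) \<in> borel_measurable borel"
  unfolding nn_integral_V[OF assms] by measurable

lemma V_mono:
  fixes f :: "real ^ 'n \<Rightarrow> ennreal"
  assumes [measurable]: "f \<in> borel_measurable borel" and "s \<le> t"
  shows "(\<integral>\<^sup>+y. f y \<partial>V s x) \<le> (\<integral>\<^sup>+y. f y \<partial>V t x)"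
  unfolding nn_integral_V[OF assms(1)]
  by (intro nn_integral_mono mult_right_mono) (use assms(2) in \<open>auto simp: indicator_def\<close>)

text \<open>Split the time interval at \<open>s\<close> and apply Chapman-Kolmogorov to the second
  part. This is the Markov property at a deterministic time in the form used for occupation
  measures.\<close>

lemma V_add:
  fixes f :: "real ^ 'n \<Rightarrow> ennreal"
  assumes [measurable]: "f \<in> borel_measurable borel" and s: "0 \<le> s" and t: "0 \<le> t"
  shows "(\<integral>\<^sup>+y. f y \<partial>V (s + t) x) = (\<integral>\<^sup>+y. f y \<partial>V s x) + (\<integral>\<^sup>+y. (\<integral>\<^sup>+w. f w \<partial>V t y) \<partial>T s x)"
proof -
  define h where "h r = (\<integral>\<^sup>+y. f y \<partial>T r x)" for r
  have [measurable]: "h \<in> borel_measurable borel" unfolding h_def by measurable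
  have sf: "sigma_finite_measure (T s x)" by (simp add: T_prob prob_space_imp_sigma_finite)
  have split: "indicator {0..s + t} r = (indicator {0..s} r + indicator {s<..s + t} r :: ennreal)" for r
    using s t by (auto simp: indicator_def)
  have "(\<integral>\<^sup>+y. f y \<partial>V (s + t) x) = (\<integral>\<^sup>+r. indicator {0..s} r * h r + indicator {s<..s + t} r * h r \<partial>lborel)"
    unfolding nn_integral_V[OF assms(1)] h_def[symmetric] split distrib_right ..
  also have "\<dots> = (\<integral>\<^sup>+r. indicator {0..s} r * h r \<partial>lborel) + (\<integral>\<^sup>+r. indicator {s<..s + t} r * h r \<partial>lborel)"
    by (rule nn_integral_add) measurable
  also have "(\<integral>\<^sup>+r. indicator {0..s} r * h r \<partial>lborel) = (\<integral>\<^sup>+y. f y \<partial>V s x)"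
    by (simp add: nn_integral_V h_def)
  also have "(\<integral>\<^sup>+r. indicator {s<..s + t} r * h r \<partial>lborel) = (\<integral>\<^sup>+y. (\<integral>\<^sup>+w. f w \<partial>V t y) \<partial>T s x)"
  proof -
    have "(\<integral>\<^sup>+r. indicator {s<..s + t} r * h r \<partial>lborel) = (\<integral>\<^sup>+r. indicator {s<..s + t} (s + 1 * r) * h (s + 1 * r) \<partial>lborel)"
      using nn_integral_real_affine[of "\<lambda>r. indicator {s<..s + t} r * h r" 1 s] by simp
    also have "\<dots> = (\<integral>\<^sup>+r. indicator {0..t} r * (\<integral>\<^sup>+y. (\<integral>\<^sup>+w. f w \<partial>T r y) \<partial>T s x) \<partial>lborel)"
    proof (rule nn_integral_cong_AE)
      have "AE r in lborel. r \<noteq> (0 :: real)" by (rule AE_lborel_singleton)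
      then show "AE r in lborel. indicator {s<..s + t} (s + 1 * r) * h (s + 1 * r) = indicator {0..t} r * (\<integral>\<^sup>+y. (\<integral>\<^sup>+w. f w \<partial>T r y) \<partial>T s x)"
      proof eventually_elim
        case (elim r)
        show ?case
        proof (cases "0 < r \<and> r \<le> t")
          case True
          then have "h (s + 1 * r) = (\<integral>\<^sup>+y. (\<integral>\<^sup>+w. f w \<partial>T r y) \<partial>T s x)"
            unfolding h_def using Chapman_Kolmogorov[OF s _ assms(1), of r x] by simp
          then show ?thesis using True by simp
        next
          case False
          then show ?thesis using elim by (auto simp: indicator_def)
        qed
      qed
    qed
    also have "\<dots> = (\<integral>\<^sup>+r. (\<integral>\<^sup>+y. indicator {0..t} r * (\<integral>\<^sup>+w. f w \<partial>T r y) \<partial>T s x) \<partial>lborel)"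
      by (intro nn_integral_cong nn_integral_cmult[symmetric]) measurable
    also have "\<dots> = (\<integral>\<^sup>+y. (\<integral>\<^sup>+r. indicator {0..t} r * (\<integral>\<^sup>+w. f w \<partial>T r y) \<partial>lborel) \<partial>T s x)"
    proof -
      interpret pair_sigma_finite "T s x" lborel
        by (intro pair_sigma_finite.intro sf sigma_finite_lborel)
      show ?thesis by (rule Fubini') measurable
    qed
    finally show ?thesis by (simp add: nn_integral_V)
  qed
  finally show ?thesis .
qed

text \<open>A bound that is uniform in the starting point is repeated at the multiples of
  \<open>t\<close>.\<close>

lemma V_mult_le:
  fixes f :: "real ^ 'n \<Rightarrow> ennreal"
  assumes [measurable]: "f \<in> borel_measurable borel" and t: "0 \<le> t" and c: "\<And>x. (\<integral>\<^sup>+y. f y \<partial>V t x) \<le> c"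
  shows "(\<integral>\<^sup>+y. f y \<partial>V (real m * t) x) \<le> of_nat m * c"
proof (induction m arbitrary: x)
  case 0
  have "(\<integral>\<^sup>+y. f y \<partial>V 0 x) = 0"
  proof -
    have "AE s in lborel. indicator {0..0} s * (\<integral>\<^sup>+y. f y \<partial>T s x) = 0"
      using AE_lborel_singleton[of "0 :: real"] by eventually_elim (auto simp: indicator_def)
    then show ?thesis unfolding nn_integral_V[OF assms(1)] by (simp add: nn_integral_cong_AE[where v = "\<lambda>_. 0"])
  qed
  then show ?case by simp
next
  case (Suc m)
  have "(\<integral>\<^sup>+y. f y \<partial>V (real (Suc m) * t) x) = (\<integral>\<^sup>+y. f y \<partial>V (t + real m * t) x)" by (simp add: algebra_simps)
  also have "\<dots> = (\<integral>\<^sup>+y. f y \<partial>V t x) + (\<integral>\<^sup>+y. (\<integral>\<^sup>+w. f w \<partial>V (real m * t) y) \<partial>T t x)"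
    by (rule V_add) (use t in auto)
  also have "\<dots> \<le> c + (\<integral>\<^sup>+y. of_nat m * c \<partial>T t x)"
    by (intro add_mono c nn_integral_mono Suc.IH)
  also have "\<dots> = of_nat (Suc m) * c" by (simp add: distrib_right)
  finally show ?case .
qed

end

section \<open>Kernels of a diffusion with drift in \<open>L_n\<close>\<close>

text \<open>This is everything that enters the continuity of potentials; neither paths nor
  filtrations appear until the stopping time is treated.\<close>

locale diffusion_kernels = elliptic_operator a b \<delta> + markov_kernels T
  for a :: "real ^ 'n \<Rightarrow> real ^ 'n ^ 'n" and b :: "real ^ 'n \<Rightarrow> real ^ 'n" and \<delta> :: real
    and T :: "real \<Rightarrow> real ^ 'n \<Rightarrow> (real ^ 'n) measure" +
  assumes drift_finite: "0 \<le> t \<Longrightarrow> (\<integral>\<^sup>+y. ennreal (norm (b y)) \<partial>V t x) < \<infinity>"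
    and Dynkin: "0 \<le> t \<Longrightarrow> C2_compact u \<Longrightarrow> (\<integral>y. u y \<partial>T t x) = u x + (\<integral>y. Lop a b u y \<partial>V t x)"
    and drift_Ln: "integrable lborel (\<lambda>x. norm (b x) ^ CARD('n))"
begin

lemma occupation_V:
  assumes t: "0 \<le> t" shows "occupation (V t x) t"
  unfolding occupation_def
proof (intro conjI allI impI)
  show "finite_measure (V t x)" by (rule finite_measure_V[OF t])
  show "sets (V t x) = sets borel" by simp
  show "measure (V t x) UNIV \<le> t" using t by (simp add: measure_V_UNIV)
  show "integrable (V t x) (\<lambda>x. norm (b x))"
    using drift_finite[OF t, of x] by (intro integrableI_bounded) (auto cong: measurable_cong_sets)
  fix u :: "real ^ 'n \<Rightarrow> real" and M assume u: "C2_compact u" and M: "\<forall>x. \<bar>u x\<bar> \<le> M"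
  have "\<bar>\<integral>y. u y \<partial>T t x\<bar> \<le> M"
  proof -
    interpret prob_space "T t x" by (rule T_prob)
    have "\<bar>\<integral>y. u y \<partial>T t x\<bar> \<le> (\<integral>y. \<bar>u y\<bar> \<partial>T t x)" using integral_norm_bound[of "T t x" u] by simp
    also have "\<dots> \<le> (\<integral>y. M \<partial>T t x)"
    proof (cases "integrable (T t x) (\<lambda>y. \<bar>u y\<bar>)")
      case True then show ?thesis by (rule integral_mono) (use M in auto)
    next
      case False
      \<comment> \<open>The Bochner integral of a function that is not integrable is 0, so
        nonnegativity of \<open>M\<close> suffices.\<close>
      have "0 \<le> M" using M by (metis abs_ge_zero order_trans)
      then show ?thesis using False by (simp add: not_integrable_integral_eq)
    qed
    also have "\<dots> = M" using prob_space by simp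
    finally show ?thesis .
  qed
  moreover have "\<bar>u x\<bar> \<le> M" using M by blast
  ultimately show "\<bar>\<integral>y. Lop a b u y \<partial>V t x\<bar> \<le> 2 * M" using Dynkin[OF t u, of x] by linarith
qed

definition small_drift :: "real \<Rightarrow> real \<Rightarrow> bool" where
  "small_drift \<rho> e \<longleftrightarrow> (\<forall>c. (\<integral>x. (drift_on (cube c \<rho>) x) ^ CARD('n) \<partial>lborel) \<le> e ^ CARD('n))"

lemma cube_borel: "cube c r \<in> sets borel" for c :: "real ^ 'n"
  by (simp add: compact_imp_closed borel_closed)

text \<open>Uniformity in the centre comes from truncation: the part of the density above a level
  \<open>m\<close> has a small integral over the whole space, and the part below contributes at most
  \<open>m\<close> times the volume of the cube.\<close>

lemma small_drift_exists:
  assumes e: "0 < e"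
  shows "\<exists>\<rho>0>0. \<forall>\<rho>. 0 < \<rho> \<longrightarrow> \<rho> \<le> \<rho>0 \<longrightarrow> small_drift \<rho> e"
proof -
  define B where "B x = norm (b x) ^ CARD('n)" for x
  have Bi: "integrable lborel B" unfolding B_def by (rule drift_Ln)
  have Bm[measurable]: "B \<in> borel_measurable borel" unfolding B_def by measurable
  have B0: "0 \<le> B x" for x by (simp add: B_def)
  have "(\<lambda>m. \<integral>x. B x * indicator {x. real m < B x} x \<partial>lborel) \<longlonglongrightarrow> (\<integral>x. 0 \<partial>(lborel :: (real ^ 'n) measure))"
  proof (rule integral_dominated_convergence[where w = B])
    show "AE x in lborel. (\<lambda>m. B x * indicator {x. real m < B x} x) \<longlonglongrightarrow> 0"
    proof (rule AE_I2)
      fix x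
      obtain m0 where m0: "B x \<le> real m0" using real_arch_simple by blast
      have "eventually (\<lambda>m. B x * indicator {x. real m < B x} x = 0) sequentially"
        using eventually_ge_at_top[of m0] by eventually_elim (use m0 in \<open>auto simp: indicator_def\<close>)
      then show "(\<lambda>m. B x * indicator {x. real m < B x} x) \<longlonglongrightarrow> 0" by (rule tendsto_eventually)
    qed
    show "AE x in lborel. norm (B x * indicator {x. real m < B x} x) \<le> B x" for m
      using B0 by (intro AE_I2) (auto simp: indicator_def)
  qed (use Bi in measurable)
  moreover have ep: "0 < e ^ CARD('n) / 2" using e by simp
  ultimately have "eventually (\<lambda>m. (\<integral>x. B x * indicator {x. real m < B x} x \<partial>lborel) < e ^ CARD('n) / 2) sequentially"
    by (intro order_tendstoD(2)) auto
  then obtain m where m: "(\<integral>x. B x * indicator {x. real m < B x} x \<partial>lborel) < e ^ CARD('n) / 2"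
    by (auto simp: eventually_sequentially)
  define \<rho>0 where "\<rho>0 = min 1 (e ^ CARD('n) / 2 / ((real m + 1) * 2 ^ CARD('n)))"
  have \<rho>0: "0 < \<rho>0" "\<rho>0 \<le> 1" "real m * (2 * \<rho>0) ^ CARD('n) \<le> e ^ CARD('n) / 2"
  proof -
    show 1: "0 < \<rho>0" "\<rho>0 \<le> 1" using ep by (auto simp: \<rho>0_def)
    have "\<rho>0 ^ CARD('n) \<le> \<rho>0 ^ 1" using 1 by (intro power_decreasing) (auto simp: Suc_le_eq)
    then have "real m * (2 * \<rho>0) ^ CARD('n) \<le> (real m + 1) * (2 ^ CARD('n) * \<rho>0)"
      using 1 by (simp add: power_mult_distrib) (intro mult_mono, auto)
    also have "\<dots> \<le> (real m + 1) * (2 ^ CARD('n) * (e ^ CARD('n) / 2 / ((real m + 1) * 2 ^ CARD('n))))"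
      by (intro mult_left_mono) (auto simp: \<rho>0_def)
    also have "\<dots> = e ^ CARD('n) / 2"
    proof -
      define K where "K = (real m + 1) * 2 ^ CARD('n)"
      have "0 < K" by (simp add: K_def)
      then have "K * (e ^ CARD('n) / 2 / K) = e ^ CARD('n) / 2" by simp
      then show ?thesis unfolding K_def by (simp only: mult.assoc)
    qed
    finally show "real m * (2 * \<rho>0) ^ CARD('n) \<le> e ^ CARD('n) / 2" .
  qed
  show ?thesis
  proof (intro exI[of _ \<rho>0] conjI \<rho>0(1) allI impI)
    fix \<rho> :: real assume \<rho>: "0 < \<rho>" "\<rho> \<le> \<rho>0"
    show "small_drift \<rho> e"
      unfolding small_drift_def
    proof
      fix c :: "real ^ 'n"
      have cm: "cube c \<rho> \<in> sets lborel" using cube_borel by simp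
      have ic: "integrable lborel (\<lambda>x. real m * indicator (cube c \<rho>) x)"
        using emeasure_cube[of \<rho> c] \<rho> cm by (intro integrable_mult_right integrable_real_indicator) auto
      have ib: "integrable lborel (\<lambda>x. B x * indicator {x. real m < B x} x)"
        by (rule integrable_real_mult_indicator[OF _ Bi]) measurable
      have "(\<integral>x. (drift_on (cube c \<rho>) x) ^ CARD('n) \<partial>lborel) \<le> (\<integral>x. B x * indicator {x. real m < B x} x + real m * indicator (cube c \<rho>) x \<partial>lborel)"
      proof (rule integral_mono)
        show "integrable lborel (\<lambda>x. (drift_on (cube c \<rho>) x) ^ CARD('n))"
          by (rule Bochner_Integration.integrable_bound[OF drift_Ln]) (use cm in \<open>auto simp: indicator_def power_0_left\<close>)
        show "integrable lborel (\<lambda>x. B x * indicator {x. real m < B x} x + real m * indicator (cube c \<rho>) x)"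
          by (rule Bochner_Integration.integrable_add[OF ib ic])
        show "(drift_on (cube c \<rho>) x) ^ CARD('n) \<le> B x * indicator {x. real m < B x} x + real m * indicator (cube c \<rho>) x" for x
          using B0[of x] by (auto simp: indicator_def B_def power_0_left)
      qed
      also have "\<dots> = (\<integral>x. B x * indicator {x. real m < B x} x \<partial>lborel) + real m * (2 * \<rho>) ^ CARD('n)"
        using ib ic cm measure_cube[of \<rho> c] \<rho> by simp
      also have "\<dots> \<le> e ^ CARD('n) / 2 + real m * (2 * \<rho>0) ^ CARD('n)"
        using m \<rho> by (intro add_mono mult_left_mono power_mono) auto
      also have "\<dots> \<le> e ^ CARD('n)" using \<rho>0(3) by simp
      finally show "(\<integral>x. (drift_on (cube c \<rho>) x) ^ CARD('n) \<partial>lborel) \<le> e ^ CARD('n)" .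
    qed
  qed
qed

end

section \<open>Barrier and visits to nearly full sets\<close>

context elliptic_operator
begin

text \<open>Outside the ball where the squared norm is below \<open>s0 * R\<^sup>2\<close> the
  radial part of the Hessian, of order \<open>(k - 1) * \<delta> * s0\<close>, beats the trace term
  \<open>n / \<delta>\<close> with 1 to spare; the surplus pays for \<open>bump / R\<^sup>2\<close>.
  In the inner ball only a bounded loss is claimed.\<close>

lemma bump_Lop_ge:
  assumes R: "0 < R" and k: "3 \<le> k" and s0: "0 < s0" "CARD('n) / \<delta> + 1 \<le> 2 * real (k - 1) * \<delta> * s0"
  shows "bump k y R x / R\<^sup>2 - (real k * CARD('n) / \<delta> + 1) / R\<^sup>2 * indicator {x. (norm (x - y))\<^sup>2 < s0 * R\<^sup>2} x
      - 2 * real k / R * (drift_on (cball y R) x) \<le> Lop a b (bump k y R) x"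
proof (cases "x \<in> cball y R")
  case False
  have z: "\<And>x. x \<notin> cball y R \<Longrightarrow> bump k y R x = 0"
    using R k by (intro bump_zero) (auto simp: dist_norm norm_minus_commute)
  note C = bump_C2_data[OF k R, of y]
  have "Lop a b (bump k y R) x = 0" using C2_data_zero_outside[OF C z False] by (simp add: Lop_C2_data[OF C])
  moreover have "0 \<le> (real k * CARD('n) / \<delta> + 1) / R\<^sup>2 * indicator {x. (norm (x - y))\<^sup>2 < s0 * R\<^sup>2} x"
    using \<delta> by (simp add: indicator_def)
  ultimately show ?thesis using False z[OF False] by simp
next
  case True
  define v where "v = x - y"
  define s where "s = (norm v)\<^sup>2 / R\<^sup>2"
  define p where "p = 1 - s"
  define d where "d = real CARD('n)"
  have v: "norm v \<le> R" using True by (simp add: v_def dist_norm norm_minus_commute)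
  have "(norm v)\<^sup>2 \<le> R\<^sup>2" using v by (intro power_mono) auto
  then have s: "0 \<le> s" "s \<le> 1" using R by (auto simp: s_def divide_le_eq)
  have p: "0 \<le> p" "p \<le> 1" using s by (auto simp: p_def)
  have P: "pospow j (1 - (norm (x - y))\<^sup>2 / R\<^sup>2) = p ^ j" for j
    using p by (simp add: pospow_def p_def s_def v_def max_def)
  have tr: "(\<Sum>i\<in>UNIV. a x $ i $ i) \<le> d / \<delta>"
  proof -
    have "(\<Sum>i\<in>UNIV. a x $ i $ i) \<le> (\<Sum>i\<in>(UNIV :: 'n set). 1 / \<delta>)"
    proof (rule sum_mono)
      fix i show "a x $ i $ i \<le> 1 / \<delta>" using sym_elliptic_entry_le[OF a \<delta>(1), of x i i] by simp
    qed
    then show ?thesis by (simp add: d_def)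
  qed
  have S: "(\<Sum>i\<in>UNIV. \<Sum>j\<in>UNIV. a x $ i $ j * bump_hess k y R x $ j $ i)
     = 4 * real k * real (k - 1) / R ^ 4 * p ^ (k - 2) * (v \<bullet> (a x *v v)) - 2 * real k / R\<^sup>2 * p ^ (k - 1) * (\<Sum>i\<in>UNIV. a x $ i $ i)"
  proof -
    have "a x $ i $ j * bump_hess k y R x $ j $ i = 4 * real k * real (k - 1) / R ^ 4 * p ^ (k - 2) * (v $ i * (a x $ i $ j * v $ j))
       - (if j = i then 2 * real k / R\<^sup>2 * p ^ (k - 1) * a x $ i $ i else 0)" for i j
      unfolding bump_hess_def vec_lambda_beta v_def[symmetric] P[folded v_def] right_diff_distrib
      by (cases "j = i") (simp_all only: mult_ac if_True if_False mult_zero_right mult_zero_left simp_thms)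
    moreover have "(\<Sum>i\<in>UNIV. \<Sum>j\<in>UNIV. \<alpha> * (v $ i * (a x $ i $ j * v $ j)) - (if j = i then \<beta> * a x $ i $ i else 0))
      = \<alpha> * (v \<bullet> (a x *v v)) - \<beta> * (\<Sum>i\<in>UNIV. a x $ i $ i)" for \<alpha> \<beta>
      by (simp add: sum_subtractf sum_distrib_left[symmetric] inner_vec_def matrix_vector_mult_def)
    ultimately show ?thesis by (simp only:)
  qed
  have kk: "p ^ (k - 1) = p * p ^ (k - 2)"
  proof -
    have "k - 1 = Suc (k - 2)" using k by simp
    then show ?thesis by simp
  qed
  have vav: "\<delta> * (s * R\<^sup>2) \<le> v \<bullet> (a x *v v)"
    using sym_elliptic_bounds(1)[OF a, of v x] R by (simp add: s_def power2_norm_eq_inner)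
  \<comment> \<open>What remains of the second order part after the common factor
    \<open>k p^(k-2) / R^2\<close> is taken out: radial gain minus trace loss.\<close>
  define Br where "Br = 2 * real (k - 1) * \<delta> * s - p * (d / \<delta>)"
  have half: "real k / R\<^sup>2 * p ^ (k - 2) * Br \<le> 1 / 2 * (\<Sum>i\<in>UNIV. \<Sum>j\<in>UNIV. a x $ i $ j * bump_hess k y R x $ j $ i)"
  proof -
    have "4 * real k * real (k - 1) / R ^ 4 * p ^ (k - 2) * (\<delta> * (s * R\<^sup>2)) \<le> 4 * real k * real (k - 1) / R ^ 4 * p ^ (k - 2) * (v \<bullet> (a x *v v))"
      using vav p R by (intro mult_left_mono) auto
    moreover have "2 * real k / R\<^sup>2 * p ^ (k - 1) * (\<Sum>i\<in>UNIV. a x $ i $ i) \<le> 2 * real k / R\<^sup>2 * p ^ (k - 1) * (d / \<delta>)"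
      using tr p by (intro mult_left_mono) auto
    moreover have "real k / R\<^sup>2 * p ^ (k - 2) * Br = 1 / 2 * (4 * real k * real (k - 1) / R ^ 4 * p ^ (k - 2) * (\<delta> * (s * R\<^sup>2)) - 2 * real k / R\<^sup>2 * p ^ (k - 1) * (d / \<delta>))"
      using R unfolding Br_def kk by (simp add: power4_eq_xxxx power2_eq_square right_diff_distrib mult_ac)
    moreover have "q \<le> 1 / 2 * (x2 - y1)" if "x1 \<le> x2" "y1 \<le> y2" "q = 1 / 2 * (x1 - y2)" for q x1 x2 y1 y2 :: real
      using that by simp
    ultimately show ?thesis unfolding S by blast
  qed
  have "\<bar>b x \<bullet> bump_grad k y R x\<bar> \<le> norm (b x) * (2 * real k / R)"
    using Cauchy_Schwarz_ineq2[of "b x" "bump_grad k y R x"] bump_grad_le[OF R v[unfolded v_def], of k]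
    by (meson mult_left_mono norm_ge_zero order_trans)
  then have drift: "- (2 * real k / R * norm (b x)) \<le> b x \<bullet> bump_grad k y R x" by (simp add: abs_le_iff mult.commute)
  have bk: "bump k y R x = p ^ k" unfolding bump_def P ..
  have main: "p ^ k / R\<^sup>2 - (real k * d / \<delta> + 1) / R\<^sup>2 * indicator {x. (norm (x - y))\<^sup>2 < s0 * R\<^sup>2} x \<le> real k / R\<^sup>2 * p ^ (k - 2) * Br"
  proof (cases "(norm (x - y))\<^sup>2 < s0 * R\<^sup>2")
    case True
    have "p * (d / \<delta>) \<le> 1 * (d / \<delta>)" using p \<delta> by (intro mult_right_mono) (auto simp: d_def)
    moreover have "0 \<le> 2 * real (k - 1) * \<delta> * s" using \<delta> s by simp
    ultimately have "- (d / \<delta>) \<le> Br" unfolding Br_def by linarith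
    then have "real k / R\<^sup>2 * p ^ (k - 2) * (- (d / \<delta>)) \<le> real k / R\<^sup>2 * p ^ (k - 2) * Br"
      using p by (intro mult_left_mono) auto
    then have "- (real k / R\<^sup>2 * p ^ (k - 2) * (d / \<delta>)) \<le> real k / R\<^sup>2 * p ^ (k - 2) * Br" by (simp only: mult_minus_right)
    moreover have "real k / R\<^sup>2 * p ^ (k - 2) * (d / \<delta>) \<le> real k / R\<^sup>2 * 1 * (d / \<delta>)"
      using p \<delta> by (intro mult_right_mono mult_left_mono power_le_one) (auto simp: d_def)
    moreover have "p ^ k / R\<^sup>2 \<le> 1 / R\<^sup>2" using p R by (intro divide_right_mono power_le_one) auto
    moreover have "(real k * d / \<delta> + 1) / R\<^sup>2 = real k / R\<^sup>2 * 1 * (d / \<delta>) + 1 / R\<^sup>2" by (simp add: add_divide_distrib)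
    moreover have "q - w \<le> B" if "- m \<le> B" "m \<le> X" "q \<le> r" "w = X + r" for q w B m X r :: real
      using that by linarith
    ultimately have "p ^ k / R\<^sup>2 - (real k * d / \<delta> + 1) / R\<^sup>2 \<le> real k / R\<^sup>2 * p ^ (k - 2) * Br" by blast
    then show ?thesis using True by simp
  next
    case False
    then have "s0 \<le> s" using R by (simp add: s_def v_def le_divide_eq)
    then have "2 * real (k - 1) * \<delta> * s0 \<le> 2 * real (k - 1) * \<delta> * s" using \<delta> by (intro mult_left_mono) auto
    moreover have "p * (d / \<delta>) \<le> 1 * (d / \<delta>)" using p \<delta> by (intro mult_right_mono) (auto simp: d_def)
    ultimately have Br1: "1 \<le> Br" using s0(2) unfolding Br_def d_def by linarith
    have "p ^ k \<le> p ^ (k - 2)" using p by (intro power_decreasing) auto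
    then have "1 * p ^ k * 1 \<le> real k * p ^ (k - 2) * Br" using k p Br1 by (intro mult_mono) auto
    then have "p ^ k / R\<^sup>2 \<le> real k * p ^ (k - 2) * Br / R\<^sup>2" using R by (intro divide_right_mono) auto
    then show ?thesis using False by simp
  qed
  have L: "Lop a b (bump k y R) x = 1 / 2 * (\<Sum>i\<in>UNIV. \<Sum>j\<in>UNIV. a x $ i $ j * bump_hess k y R x $ j $ i) + b x \<bullet> bump_grad k y R x"
    by (rule Lop_C2_data[OF bump_C2_data[OF k R]])
  have "q - w - z \<le> S + g" if "q - w \<le> h" "h \<le> S" "- z \<le> g" for q w z S g h :: real
    using that by linarith
  from this[OF main half drift] show ?thesis unfolding L bk using True by (simp add: d_def)
qed

end

context diffusion_kernels
begin

definition krylov_V_bound :: "real \<Rightarrow> real \<Rightarrow> bool" where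
  "krylov_V_bound C e0 \<longleftrightarrow> (\<forall>(m :: nat) \<rho> e x c. 0 < \<rho> \<longrightarrow> 0 \<le> e \<longrightarrow> e \<le> e0 \<longrightarrow> small_drift \<rho> e \<longrightarrow>
     (\<integral>\<^sup>+y. ennreal (drift_on (cube c \<rho>) y) \<partial>V (real m * \<rho>\<^sup>2) x) \<le> ennreal (real m * (C * e * \<rho>)) \<and>
     (\<forall>A\<in>sets borel. A \<subseteq> cube c \<rho> \<longrightarrow> measure (V (real m * \<rho>\<^sup>2) x) A \<le> real m * (C * \<rho> * root CARD('n) (vol A))))"

text \<open>The local estimate over time \<open>\<rho>\<^sup>2\<close> holds for every starting
  point with the same constants, so it passes to time \<open>m \<rho>\<^sup>2\<close> with a factor
  \<open>m\<close>.\<close>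

lemma krylov_V: "\<exists>C e0. 0 < C \<and> 0 < e0 \<and> krylov_V_bound C e0"
proof -
  obtain C e0 where C: "0 < C" "0 < e0" and kb: "krylov_bound C e0" using krylov_local by blast
  show ?thesis
  proof (rule exI[of _ C], rule exI[of _ e0], rule conjI[OF C(1)], rule conjI[OF C(2)], unfold krylov_V_bound_def, intro allI impI)
    fix m :: nat and \<rho> e :: real and x c :: "real ^ 'n"
    assume \<rho>: "0 < \<rho>" and e: "0 \<le> e" "e \<le> e0" and sd: "small_drift \<rho> e"
    note est' = kb[unfolded krylov_bound_def, rule_format, OF occupation_V[OF zero_le_power2] \<rho> e drift_Ln sd[unfolded small_drift_def, rule_format]]
    have cm [measurable]: "cube c \<rho> \<in> sets borel" by (rule cube_borel)
    have b1: "(\<integral>\<^sup>+y. ennreal (drift_on (cube c \<rho>) y) \<partial>V (\<rho>\<^sup>2) x) \<le> ennreal (C * e * \<rho>)" for x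
    proof -
      have ib: "integrable (V (\<rho>\<^sup>2) x) (\<lambda>y. norm (b y))" using occupation_V[of "\<rho>\<^sup>2" x] by (simp add: occupation_def)
      have "integrable (V (\<rho>\<^sup>2) x) (\<lambda>y. drift_on (cube c \<rho>) y)"
        by (rule integrable_real_mult_indicator[OF _ ib]) simp
      then have "(\<integral>\<^sup>+y. ennreal (drift_on (cube c \<rho>) y) \<partial>V (\<rho>\<^sup>2) x) = ennreal (\<integral>y. drift_on (cube c \<rho>) y \<partial>V (\<rho>\<^sup>2) x)"
        by (intro nn_integral_eq_integral) auto
      also have "\<dots> \<le> ennreal (C * e * \<rho>)" using conjunct1[OF est', of x] by (intro ennreal_leI) auto
      finally show ?thesis .
    qed
    have "(\<integral>\<^sup>+y. ennreal (drift_on (cube c \<rho>) y) \<partial>V (real m * \<rho>\<^sup>2) x) \<le> of_nat m * ennreal (C * e * \<rho>)"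
      by (rule V_mult_le) (use b1 in auto)
    also have "\<dots> = ennreal (real m * (C * e * \<rho>))"
      using C e \<rho> by (simp add: ennreal_mult ennreal_of_nat_eq_real_of_nat)
    finally have 1: "(\<integral>\<^sup>+y. ennreal (drift_on (cube c \<rho>) y) \<partial>V (real m * \<rho>\<^sup>2) x) \<le> ennreal (real m * (C * e * \<rho>))" .
    have 2: "measure (V (real m * \<rho>\<^sup>2) x) A \<le> real m * (C * \<rho> * root CARD('n) (vol A))"
      if A: "A \<in> sets borel" "A \<subseteq> cube c \<rho>" for A
    proof -
      define r where "r = root CARD('n) (vol A)"
      have r: "0 \<le> r" by (simp add: r_def)
      have "(\<integral>\<^sup>+y. indicator A y \<partial>V (\<rho>\<^sup>2) x) \<le> ennreal (C * \<rho> * r)" for x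
      proof -
        interpret finite_measure "V (\<rho>\<^sup>2) x" by (rule finite_measure_V) simp
        show ?thesis using conjunct2[OF est', of x, rule_format, OF A] A(1) by (simp add: emeasure_eq_measure ennreal_leI r_def)
      qed
      then have "(\<integral>\<^sup>+y. indicator A y \<partial>V (real m * \<rho>\<^sup>2) x) \<le> of_nat m * ennreal (C * \<rho> * r)"
        using A by (intro V_mult_le) auto
      also have "\<dots> = ennreal (real m * (C * \<rho> * r))"
        using C r \<rho> by (simp add: ennreal_mult ennreal_of_nat_eq_real_of_nat)
      finally have "emeasure (V (real m * \<rho>\<^sup>2) x) A \<le> ennreal (real m * (C * \<rho> * r))" using A by simp
      then have "measure (V (real m * \<rho>\<^sup>2) x) A \<le> real m * (C * \<rho> * r)"
        unfolding measure_def using C r \<rho> by (intro enn2real_leI) auto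
      then show ?thesis by (simp add: r_def)
    qed
    show "(\<integral>\<^sup>+y. ennreal (drift_on (cube c \<rho>) y) \<partial>V (real m * \<rho>\<^sup>2) x) \<le> ennreal (real m * (C * e * \<rho>)) \<and>
     (\<forall>A\<in>sets borel. A \<subseteq> cube c \<rho> \<longrightarrow> measure (V (real m * \<rho>\<^sup>2) x) A \<le> real m * (C * \<rho> * root CARD('n) (vol A)))"
      using 1 2 by blast
  qed
qed

text \<open>A ball of radius \<open>K \<rho>\<close> is covered by a number of cubes of half side
  \<open>\<rho>\<close> that depends only on \<open>K\<close> and the dimension.\<close>

lemma drift_ball:
  fixes K :: real
  assumes C: "0 < C" "0 < e0" "krylov_V_bound C e0"
  shows "\<exists>C'>0. \<forall>(m :: nat) \<rho> e x y. 0 < \<rho> \<longrightarrow> 0 \<le> e \<longrightarrow> e \<le> e0 \<longrightarrow> small_drift \<rho> e \<longrightarrow>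
     (\<integral>w. drift_on (cball y (K * \<rho>)) w \<partial>V (real m * \<rho>\<^sup>2) x) \<le> real m * (C' * e * \<rho>)"
proof -
  note est = conjunct1[OF C(3)[unfolded krylov_V_bound_def, rule_format]]
  obtain N0 where N0: "\<And>(y :: real ^ 'n) \<rho>. 0 < \<rho> \<Longrightarrow> \<exists>Y. finite Y \<and> card Y \<le> N0 \<and> cball y (K * \<rho>) \<subseteq> (\<Union>c\<in>Y. cube c \<rho>)"
    using cover_by_cubes[of K] by blast
  have C': "0 < (real N0 + 1) * C" using C by simp
  show ?thesis
  proof (rule exI[of _ "(real N0 + 1) * C"], rule conjI[OF C'], intro allI impI)
    fix m :: nat and \<rho> e :: real and x y :: "real ^ 'n"
    assume \<rho>: "0 < \<rho>" and e: "0 \<le> e" "e \<le> e0" and sd: "small_drift \<rho> e"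
    obtain Y where Y: "finite Y" "card Y \<le> N0" "cball y (K * \<rho>) \<subseteq> (\<Union>c\<in>Y. cube c \<rho>)" using N0[OF \<rho>, of y] by auto
    have [measurable]: "cube c \<rho> \<in> sets borel" for c :: "real ^ 'n" by (rule cube_borel)
    define D where "D = real m * (C * e * \<rho>)"
    have D: "0 \<le> D" using C e \<rho> by (simp add: D_def)
    have "(\<integral>\<^sup>+w. ennreal (drift_on (cball y (K * \<rho>)) w) \<partial>V (real m * \<rho>\<^sup>2) x)
      \<le> (\<integral>\<^sup>+w. (\<Sum>c\<in>Y. ennreal (drift_on (cube c \<rho>) w)) \<partial>V (real m * \<rho>\<^sup>2) x)"
    proof (rule nn_integral_mono)
      fix w
      show "ennreal (drift_on (cball y (K * \<rho>)) w) \<le> (\<Sum>c\<in>Y. ennreal (drift_on (cube c \<rho>) w))"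
      proof (cases "w \<in> cball y (K * \<rho>)")
        case True
        then obtain c where c: "c \<in> Y" "w \<in> cube c \<rho>" using Y(3) by auto
        have "ennreal (drift_on (cball y (K * \<rho>)) w) = ennreal (drift_on (cube c \<rho>) w)"
          using c True by simp
        also have "\<dots> \<le> (\<Sum>c\<in>Y. ennreal (drift_on (cube c \<rho>) w))" using Y c by (intro member_le_sum) auto
        finally show ?thesis .
      qed simp
    qed
    also have "\<dots> = (\<Sum>c\<in>Y. \<integral>\<^sup>+w. ennreal (drift_on (cube c \<rho>) w) \<partial>V (real m * \<rho>\<^sup>2) x)"
      by (rule nn_integral_sum) measurable
    also have "\<dots> \<le> (\<Sum>c\<in>Y. ennreal D)" unfolding D_def by (intro sum_mono est \<rho> e sd)
    also have "\<dots> = ennreal (real (card Y) * D)" using D by (simp add: ennreal_mult ennreal_of_nat_eq_real_of_nat)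
    also have "\<dots> \<le> ennreal ((real N0 + 1) * D)" using Y D by (intro ennreal_leI mult_right_mono) auto
    finally have nn: "(\<integral>\<^sup>+w. ennreal (drift_on (cball y (K * \<rho>)) w) \<partial>V (real m * \<rho>\<^sup>2) x) \<le> ennreal ((real N0 + 1) * D)" .
    have [measurable]: "cball y (K * \<rho>) \<in> sets borel" by (simp add: borel_closed)
    have "(\<lambda>w. drift_on (cball y (K * \<rho>)) w) \<in> borel_measurable borel" by measurable
    then have "(\<integral>w. drift_on (cball y (K * \<rho>)) w \<partial>V (real m * \<rho>\<^sup>2) x) \<le> (real N0 + 1) * D"
      using nn D by (subst integral_eq_nn_integral) (auto intro!: enn2real_leI cong: measurable_cong_sets)
    then show "(\<integral>w. drift_on (cball y (K * \<rho>)) w \<partial>V (real m * \<rho>\<^sup>2) x) \<le> real m * ((real N0 + 1) * C * e * \<rho>)"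
      by (simp add: D_def mult_ac)
  qed
qed


lemma drift_integrable_V:
  assumes "0 \<le> t" and [measurable]: "A \<in> sets borel"
  shows "integrable (V t x) (\<lambda>y. drift_on A y)"
proof -
  have "integrable (V t x) (\<lambda>y. norm (b y))" using occupation_V[OF assms(1), of x] by (simp add: occupation_def)
  then show ?thesis by (intro integrable_real_mult_indicator) simp_all
qed

lemma V_mono_integral:
  fixes f :: "real ^ 'n \<Rightarrow> real"
  assumes f [measurable]: "f \<in> borel_measurable borel" "\<And>y. 0 \<le> f y" and st: "s \<le> t" and i: "integrable (V t x) f"
  shows "(\<integral>y. f y \<partial>V s x) \<le> (\<integral>y. f y \<partial>V t x)"
proof -
  have fV: "f \<in> borel_measurable (V r x)" for r using f(1) by (simp cong: measurable_cong_sets)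
  have "(\<integral>\<^sup>+y. ennreal (f y) \<partial>V s x) \<le> (\<integral>\<^sup>+y. ennreal (f y) \<partial>V t x)" by (rule V_mono[OF _ st]) measurable
  moreover have "(\<integral>\<^sup>+y. ennreal (f y) \<partial>V t x) < \<infinity>" using i f(2) by (simp add: integrable_iff_bounded)
  ultimately have "enn2real (\<integral>\<^sup>+y. ennreal (f y) \<partial>V s x) \<le> enn2real (\<integral>\<^sup>+y. ennreal (f y) \<partial>V t x)"
    by (intro enn2real_mono) (auto simp: top.not_eq_extremum)
  then show ?thesis using fV f(2) by (simp add: integral_eq_nn_integral)
qed

lemma bump_integrable_T:
  assumes "0 < R" "3 \<le> k" shows "integrable (T t x) (bump k y R)"
proof -
  interpret prob_space "T t x" by (rule T_prob)
  have "bump k y R \<in> borel_measurable borel"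
    using C2_data_continuous(1)[OF bump_C2_data[OF assms(2,1), of y], of UNIV] by (rule borel_measurable_continuous_onI)
  then show ?thesis by (intro integrable_const_bound[where B = 1]) (auto simp: bump_le1 cong: measurable_cong_sets)
qed

lemma bump_integrable_V:
  assumes "0 < R" "3 \<le> k" "0 \<le> t" shows "integrable (V t x) (bump k y R)"
proof -
  interpret finite_measure "V t x" by (rule finite_measure_V[OF assms(3)])
  have "bump k y R \<in> borel_measurable borel"
    using C2_data_continuous(1)[OF bump_C2_data[OF assms(2,1), of y], of UNIV] by (rule borel_measurable_continuous_onI)
  then show ?thesis by (intro integrable_const_bound[where B = 1]) (auto simp: bump_le1 cong: measurable_cong_sets)
qed

lemma bump_C2_compact:
  fixes y :: "real ^ 'n"
  assumes "0 < R" "3 \<le> k" shows "C2_compact (bump k y R)"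
  by (rule C2_compactI[OF bump_C2_data[OF assms(2,1)], of y R])
    (use assms in \<open>auto intro!: bump_zero simp: dist_norm norm_minus_commute\<close>)

lemma bump_Lop_integrable_V:
  assumes "0 < R" "3 \<le> k" "0 \<le> t" shows "integrable (V t x) (Lop a b (bump k y R))"
  by (rule occupation_integrable_Lop[OF occupation_V[OF assms(3)] bump_C2_data[OF assms(2,1)], of y R])
    (use assms in \<open>auto intro!: bump_zero simp: dist_norm norm_minus_commute\<close>)

text \<open>The starting point ranges over the cube dilated by 5, since this contains the dyadic
  parent of a cell inscribed in the small cube. The constants do not depend on the scale.\<close>

definition near_full_bound :: "nat \<Rightarrow> real \<Rightarrow> real \<Rightarrow> real \<Rightarrow> bool" where
  "near_full_bound m c \<epsilon>0 e1 \<longleftrightarrow> (\<forall>\<rho> e x y A. 0 < \<rho> \<longrightarrow> 0 \<le> e \<longrightarrow> e \<le> e1 \<longrightarrow> small_drift \<rho> e \<longrightarrow> x \<in> cube y (5 * \<rho>) \<longrightarrow>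
     A \<in> sets borel \<longrightarrow> vol (cube y \<rho> - A) \<le> \<epsilon>0 * (2 * \<rho>) ^ CARD('n) \<longrightarrow>
     c * (real m * \<rho>\<^sup>2) \<le> measure (V (real m * \<rho>\<^sup>2) x) (A \<inter> cube y \<rho>))"

text \<open>The barrier \<open>bump k y R\<close> is a strict subsolution off the cube. If the cube were hardly visited, the expected
  value of the barrier along the process would have to exceed 1 after a long enough time.\<close>

lemma near_full: "\<exists>m c \<epsilon>0 e1. 0 < m \<and> 0 < c \<and> 0 < \<epsilon>0 \<and> \<epsilon>0 < 1 \<and> 0 < e1 \<and> near_full_bound m c \<epsilon>0 e1"
proof -
  obtain C e0 where C: "0 < C" "0 < e0" "krylov_V_bound C e0" using krylov_V by blast
  \<comment> \<open>With \<open>R = S * \<rho>\<close> the dilated cube lies in the ball of radius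
    \<open>5/8 R\<close>, where the barrier is at least \<open>\<phi>0\<close>, because
    \<open>1 - 25/64 = 39/64\<close>.\<close>
  define S where "S = 8 * sqrt CARD('n)"
  have S: "0 < S" by (simp add: S_def)
  obtain C' where C': "0 < C'" and dball: "\<forall>(m :: nat) \<rho> e x y. 0 < \<rho> \<longrightarrow> 0 \<le> e \<longrightarrow> e \<le> e0 \<longrightarrow> small_drift \<rho> e \<longrightarrow>
     (\<integral>w. drift_on (cball y (S * \<rho>)) w \<partial>V (real m * \<rho>\<^sup>2) x) \<le> real m * (C' * e * \<rho>)"
    using drift_ball[OF C, of S] by blast
  \<comment> \<open>Makes the exceptional inner ball of the barrier the ball of radius
    \<open>\<rho>\<close>, which lies in the cube.\<close>
  define s0 where "s0 = 1 / S\<^sup>2"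
  have s0: "0 < s0" using S by (simp add: s0_def)
  obtain k0 :: nat where k0: "(CARD('n) / \<delta> + 1) / (2 * \<delta> * s0) \<le> real k0" using real_arch_simple by blast
  define k where "k = k0 + 3"
  have k3: "3 \<le> k" by (simp add: k_def)
  have k: "CARD('n) / \<delta> + 1 \<le> 2 * real (k - 1) * \<delta> * s0"
  proof -
    have "(CARD('n) / \<delta> + 1) \<le> real k0 * (2 * \<delta> * s0)" using k0 \<delta> s0 by (simp add: divide_le_eq)
    also have "\<dots> \<le> real (k - 1) * (2 * \<delta> * s0)" using \<delta> s0 by (intro mult_right_mono) (auto simp: k_def)
    finally show ?thesis by (simp add: mult_ac)
  qed
  define \<phi>0 where "\<phi>0 = (39 / 64 :: real) ^ k"
  have \<phi>0: "0 < \<phi>0" by (simp add: \<phi>0_def)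
  define K1 where "K1 = real k * CARD('n) / \<delta> + 1"
  have K1: "0 < K1" using \<delta> by (simp add: K1_def add_nonneg_pos)
  \<comment> \<open>The time must be long enough for the growth rate \<open>\<phi>0 / 2\<close>
    divided by \<open>R\<^sup>2\<close> to lift the expectation above 1.\<close>
  obtain m0 :: nat where m0: "2 / \<phi>0 * S\<^sup>2 \<le> real m0" using real_arch_simple by blast
  define m where "m = Suc m0"
  have m: "0 < m" "1 < \<phi>0 / 2 * (1 + real m / S\<^sup>2)"
  proof -
    show "0 < m" by (simp add: m_def)
    have S2: "0 < S\<^sup>2" using S by simp
    have "2 / \<phi>0 * S\<^sup>2 \<le> real m" using m0 by (simp add: m_def)
    then have "2 / \<phi>0 \<le> real m / S\<^sup>2" using S2 by (simp add: le_divide_eq)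
    then have "2 / \<phi>0 < 1 + real m / S\<^sup>2" by simp
    then have "\<phi>0 / 2 * (2 / \<phi>0) < \<phi>0 / 2 * (1 + real m / S\<^sup>2)" using \<phi>0 by (intro mult_strict_left_mono) auto
    then show "1 < \<phi>0 / 2 * (1 + real m / S\<^sup>2)" using \<phi>0 by simp
  qed
  \<comment> \<open>An occupation of the cube below \<open>c3 * \<rho>\<^sup>2\<close> costs the
    barrier at most \<open>\<phi>0 / 4\<close>; \<open>e1\<close> below limits the cost of the drift
    to the same amount, so half of \<open>\<phi>0\<close> survives.\<close>
  define c3 where "c3 = \<phi>0 * S\<^sup>2 / (4 * K1)"
  have c3: "0 < c3" using \<phi>0 S K1 by (simp add: c3_def)
  \<comment> \<open>By the Krylov estimate a set of volume \<open>(2 * \<rho> * \<eta>)^n\<close> in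
    the cube is occupied for at most \<open>c3 / 2 * \<rho>\<^sup>2\<close>, half of the time spent
    in the cube.\<close>
  define \<eta> where "\<eta> = min (1 / 2) (c3 / (4 * real m * C))"
  have \<eta>: "0 < \<eta>" "\<eta> \<le> 1 / 2" "4 * real m * C * \<eta> \<le> c3"
  proof -
    have "0 < 4 * real m * C" using m C by simp
    then show "0 < \<eta>" "\<eta> \<le> 1 / 2" using c3 by (auto simp: \<eta>_def)
    have "4 * real m * C * \<eta> \<le> 4 * real m * C * (c3 / (4 * real m * C))"
      using \<open>0 < 4 * real m * C\<close> by (intro mult_left_mono) (auto simp: \<eta>_def)
    also have "4 * real m * C * (c3 / (4 * real m * C)) = c3"
    proof -
      have "P * (c3 / P) = c3" if "0 < P" for P using that by simp
      then show ?thesis using \<open>0 < 4 * real m * C\<close> .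
    qed
    finally show "4 * real m * C * \<eta> \<le> c3" .
  qed
  define \<epsilon>0 where "\<epsilon>0 = \<eta> ^ CARD('n)"
  have \<epsilon>0: "0 < \<epsilon>0" "\<epsilon>0 < 1" using \<eta> by (auto simp: \<epsilon>0_def power_less_one_iff)
  define e1 where "e1 = min e0 (\<phi>0 * S / (8 * real k * real m * C'))"
  have e1: "0 < e1" "e1 \<le> e0" "2 * real k / S * real m * C' * e1 \<le> \<phi>0 / 4"
  proof -
    have P: "0 < 8 * real k * real m * C'" using k3 m C' by simp
    show "0 < e1" "e1 \<le> e0" using P \<phi>0 S C by (auto simp: e1_def)
    have "2 * real k / S * real m * C' * e1 \<le> 2 * real k / S * real m * C' * (\<phi>0 * S / (8 * real k * real m * C'))"
      using S C' by (intro mult_left_mono) (auto simp: e1_def)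
    also have "\<dots> = \<phi>0 / 4" using k3 m(1) C' S(1) by (simp add: field_simps)
    finally show "2 * real k / S * real m * C' * e1 \<le> \<phi>0 / 4" .
  qed
  define c where "c = c3 / (2 * real m)"
  have c: "0 < c" using c3 m by (simp add: c_def)
  have "near_full_bound m c \<epsilon>0 e1"
    unfolding near_full_bound_def
  proof (intro allI impI)
    fix \<rho> e :: real and x y :: "real ^ 'n" and A
    assume \<rho>: "0 < \<rho>" and e: "0 \<le> e" "e \<le> e1" and sd: "small_drift \<rho> e" and x: "x \<in> cube y (5 * \<rho>)"
      and A [measurable]: "A \<in> sets borel" and small: "vol (cube y \<rho> - A) \<le> \<epsilon>0 * (2 * \<rho>) ^ CARD('n)"
    have e': "e \<le> e0" using e e1 by simp
    have [measurable]: "cube y \<rho> \<in> sets borel" by (rule cube_borel)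
    define t where "t = real m * \<rho>\<^sup>2"
    have t: "0 < t" using m \<rho> by (simp add: t_def)
    interpret Vt: finite_measure "V t x" by (rule finite_measure_V) (use t in simp)
    define R where "R = S * \<rho>"
    have R: "0 < R" using S \<rho> by (simp add: R_def)
    have [measurable]: "cball y R \<in> sets borel" by (simp add: borel_closed)
    define \<phi> where "\<phi> = bump k y R"
    have \<phi>m [measurable]: "\<phi> \<in> borel_measurable borel"
      unfolding \<phi>_def using C2_data_continuous(1)[OF bump_C2_data[OF k3 R, of y], of UNIV] by (rule borel_measurable_continuous_onI)
    define q where "q = measure (V t x) (cube y \<rho>)"
    have \<phi>x: "\<phi>0 \<le> \<phi> x"
    proof -
      have "norm (x - y) \<le> sqrt CARD('n) * (5 * \<rho>)" using x by (rule cube_norm_le)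
      also have "\<dots> = 5 / 8 * R" by (simp add: R_def S_def)
      finally have "(norm (x - y))\<^sup>2 \<le> (5 / 8 * R)\<^sup>2" by (intro power_mono) auto
      then have "(norm (x - y))\<^sup>2 / R\<^sup>2 \<le> 25 / 64" using R by (simp add: divide_le_eq power_mult_distrib power_divide)
      then have "39 / 64 \<le> max 0 (1 - (norm (x - y))\<^sup>2 / R\<^sup>2)" by linarith
      then show ?thesis unfolding \<phi>0_def \<phi>_def bump_def pospow_def by (rule power_mono) simp
    qed
    have sub: "{w. (norm (w - y))\<^sup>2 < s0 * R\<^sup>2} \<subseteq> cube y \<rho>"
    proof
      fix w assume "w \<in> {w. (norm (w - y))\<^sup>2 < s0 * R\<^sup>2}"
      then have "(norm (w - y))\<^sup>2 < \<rho>\<^sup>2" using S by (simp add: s0_def R_def power_mult_distrib)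
      then have "norm (w - y) < \<rho>" using \<rho> by (simp add: power_less_imp_less_base)
      then have "w \<in> cball y \<rho>" by (simp add: dist_norm norm_minus_commute)
      then show "w \<in> cube y \<rho>" using cball_subset_cube by blast
    qed
    have Dr: "(\<integral>w. drift_on (cball y R) w \<partial>V t x) \<le> real m * (C' * e * \<rho>)"
      using dball \<rho> e(1) e' sd unfolding t_def R_def by blast
    have q_ge: "c3 * \<rho>\<^sup>2 \<le> q"
    proof (rule ccontr)
      assume "\<not> ?thesis"
      then have q: "q < c3 * \<rho>\<^sup>2" by simp
      have q': "K1 / R\<^sup>2 * q \<le> \<phi>0 / 4"
      proof -
        have "K1 / R\<^sup>2 * q \<le> K1 / R\<^sup>2 * (c3 * \<rho>\<^sup>2)" using q K1 by (intro mult_left_mono) auto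
        also have "\<dots> = \<phi>0 / 4" using K1 S \<rho> by (simp add: c3_def R_def field_simps power_mult_distrib)
        finally show ?thesis .
      qed
      have d': "2 * real k / R * (real m * (C' * e * \<rho>)) \<le> \<phi>0 / 4"
      proof -
        have "2 * real k / R * (real m * (C' * e * \<rho>)) = 2 * real k / S * real m * C' * e" using \<rho> by (simp add: R_def)
        also have "\<dots> \<le> 2 * real k / S * real m * C' * e1" using e S C' by (intro mult_left_mono) auto
        finally show ?thesis using e1(3) by simp
      qed
      \<comment> \<open>Used twice: dropping the integral gives a lower bound for the expectation at
        all times up to \<open>t\<close>, and reinserting the time integral of that bound at
        \<open>s = t\<close> gives a value above 1.\<close>
      have g: "\<phi>0 / 2 + 1 / R\<^sup>2 * (\<integral>w. \<phi> w \<partial>V s x) \<le> (\<integral>w. \<phi> w \<partial>T s x)" if s: "0 \<le> s" "s \<le> t" for s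
      proof -
        interpret Vs: finite_measure "V s x" by (rule finite_measure_V[OF s(1)])
        have ii: "integrable (V r x) (indicator (cube y \<rho>) :: _ \<Rightarrow> real)" if "0 \<le> r" for r
        proof -
          interpret finite_measure "V r x" by (rule finite_measure_V[OF that])
          show ?thesis by (intro integrable_real_indicator) (auto simp: emeasure_eq_measure)
        qed
        have i1: "integrable (V s x) \<phi>" unfolding \<phi>_def by (rule bump_integrable_V[OF R k3 s(1)])
        have i3: "integrable (V s x) (\<lambda>w. drift_on (cball y R) w)" by (rule drift_integrable_V[OF s(1)]) measurable
        have "1 / R\<^sup>2 * (\<integral>w. \<phi> w \<partial>V s x) - K1 / R\<^sup>2 * measure (V s x) (cube y \<rho>) - 2 * real k / R * (\<integral>w. drift_on (cball y R) w \<partial>V s x)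
          = (\<integral>w. 1 / R\<^sup>2 * \<phi> w - K1 / R\<^sup>2 * indicator (cube y \<rho>) w - 2 * real k / R * (drift_on (cball y R) w) \<partial>V s x)"
          using i1 i3 ii[OF s(1)] by simp
        also have "\<dots> \<le> (\<integral>w. Lop a b \<phi> w \<partial>V s x)"
        proof (rule integral_mono)
          show "integrable (V s x) (\<lambda>w. 1 / R\<^sup>2 * \<phi> w - K1 / R\<^sup>2 * indicator (cube y \<rho>) w - 2 * real k / R * (drift_on (cball y R) w))"
            using i1 i3 ii[OF s(1)] by simp
          show "integrable (V s x) (Lop a b \<phi>)" unfolding \<phi>_def by (rule bump_Lop_integrable_V[OF R k3 s(1)])
          fix w
          have "K1 / R\<^sup>2 * indicator {w. (norm (w - y))\<^sup>2 < s0 * R\<^sup>2} w \<le> K1 / R\<^sup>2 * indicator (cube y \<rho>) w"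
            using sub K1 by (intro mult_left_mono) (auto simp: indicator_def)
          moreover have "\<phi> w / R\<^sup>2 - K1 / R\<^sup>2 * indicator {w. (norm (w - y))\<^sup>2 < s0 * R\<^sup>2} w
              - 2 * real k / R * (drift_on (cball y R) w) \<le> Lop a b \<phi> w"
            unfolding K1_def \<phi>_def by (rule bump_Lop_ge[OF R k3 s0 k])
          moreover have "1 / R\<^sup>2 * \<phi> w = \<phi> w / R\<^sup>2" by simp
          ultimately show "1 / R\<^sup>2 * \<phi> w - K1 / R\<^sup>2 * indicator (cube y \<rho>) w - 2 * real k / R * (drift_on (cball y R) w) \<le> Lop a b \<phi> w"
            by linarith
        qed
        finally have L: "1 / R\<^sup>2 * (\<integral>w. \<phi> w \<partial>V s x) - K1 / R\<^sup>2 * measure (V s x) (cube y \<rho>) - 2 * real k / R * (\<integral>w. drift_on (cball y R) w \<partial>V s x)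
          \<le> (\<integral>w. Lop a b \<phi> w \<partial>V s x)" .
        have "measure (V s x) (cube y \<rho>) \<le> q"
          using V_mono_integral[of "indicator (cube y \<rho>)" s t x] s ii[of t] t by (simp add: q_def)
        then have "K1 / R\<^sup>2 * measure (V s x) (cube y \<rho>) \<le> K1 / R\<^sup>2 * q" using K1 by (intro mult_left_mono) auto
        moreover have "(\<integral>w. drift_on (cball y R) w \<partial>V s x) \<le> (\<integral>w. drift_on (cball y R) w \<partial>V t x)"
          by (rule V_mono_integral[OF _ _ s(2) drift_integrable_V]) (use t in auto)
        then have "2 * real k / R * (\<integral>w. drift_on (cball y R) w \<partial>V s x) \<le> 2 * real k / R * (real m * (C' * e * \<rho>))"
          using Dr R by (intro mult_left_mono) auto
        moreover have "(\<integral>w. \<phi> w \<partial>T s x) = \<phi> x + (\<integral>w. Lop a b \<phi> w \<partial>V s x)"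
          unfolding \<phi>_def by (rule Dynkin[OF s(1) bump_C2_compact[OF R k3]])
        ultimately show ?thesis using L q' d' \<phi>x by linarith
      qed
      have \<phi>V0: "0 \<le> (\<integral>w. \<phi> w \<partial>V s x)" for s by (intro Bochner_Integration.integral_nonneg) (simp add: \<phi>_def)
      have g2: "\<phi>0 / 2 \<le> (\<integral>w. \<phi> w \<partial>T s x)" if s: "0 \<le> s" "s \<le> t" for s
        using g[OF s] \<phi>V0[of s] R by (smt (verit) mult_nonneg_nonneg zero_le_divide_1_iff zero_le_power2)
      have Vlow: "\<phi>0 / 2 * t \<le> (\<integral>w. \<phi> w \<partial>V t x)"
      proof -
        have "ennreal (\<phi>0 / 2 * t) = (\<integral>\<^sup>+s. indicator {0..t} s * ennreal (\<phi>0 / 2) \<partial>lborel)"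
          using t \<phi>0 by (simp add: nn_integral_multc ennreal_mult[symmetric] mult.commute)
        also have "\<dots> \<le> (\<integral>\<^sup>+s. indicator {0..t} s * (\<integral>\<^sup>+w. ennreal (\<phi> w) \<partial>T s x) \<partial>lborel)"
        proof (rule nn_integral_mono)
          fix s
          show "indicator {0..t} s * ennreal (\<phi>0 / 2) \<le> indicator {0..t} s * (\<integral>\<^sup>+w. ennreal (\<phi> w) \<partial>T s x)"
          proof (cases "s \<in> {0..t}")
            case True
            have "(\<integral>\<^sup>+w. ennreal (\<phi> w) \<partial>T s x) = ennreal (\<integral>w. \<phi> w \<partial>T s x)"
              unfolding \<phi>_def by (rule nn_integral_eq_integral[OF bump_integrable_T[OF R k3]]) simp
            moreover have "\<phi>0 / 2 \<le> (\<integral>w. \<phi> w \<partial>T s x)" using True by (intro g2) auto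
            ultimately show ?thesis using True by (simp add: ennreal_leI)
          qed simp
        qed
        also have "\<dots> = (\<integral>\<^sup>+w. ennreal (\<phi> w) \<partial>V t x)" by (rule nn_integral_V[symmetric]) measurable
        also have "\<dots> = ennreal (\<integral>w. \<phi> w \<partial>V t x)"
          unfolding \<phi>_def by (rule nn_integral_eq_integral[OF bump_integrable_V[OF R k3]]) (use t in auto)
        finally show ?thesis using \<phi>V0 by (simp add: ennreal_le_iff)
      qed
      have "(\<integral>w. \<phi> w \<partial>T t x) \<le> (\<integral>w. 1 \<partial>T t x)"
      proof -
        interpret prob_space "T t x" by (rule T_prob)
        show ?thesis unfolding \<phi>_def by (rule integral_mono[OF bump_integrable_T[OF R k3]]) (auto simp: bump_le1)
      qed
      also have "\<dots> = 1" using prob_space.prob_space[OF T_prob[of t x]] by simp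
      finally have "(\<integral>w. \<phi> w \<partial>T t x) \<le> 1" .
      moreover have "1 / R\<^sup>2 * (\<phi>0 / 2 * t) \<le> 1 / R\<^sup>2 * (\<integral>w. \<phi> w \<partial>V t x)" using Vlow by (intro mult_left_mono) auto
      moreover have "1 / R\<^sup>2 * (\<phi>0 / 2 * t) = \<phi>0 / 2 * (real m / S\<^sup>2)" using \<rho> by (simp add: t_def R_def power_mult_distrib)
      moreover have "\<phi>0 / 2 * (1 + real m / S\<^sup>2) = \<phi>0 / 2 + \<phi>0 / 2 * (real m / S\<^sup>2)" by (simp add: distrib_left)
      ultimately show False using g[of t] t m(2) by linarith
    qed
    have rest: "measure (V t x) (cube y \<rho> - A) \<le> c3 / 2 * \<rho>\<^sup>2"
    proof -
      have "measure (V t x) (cube y \<rho> - A) \<le> real m * (C * \<rho> * root CARD('n) (vol (cube y \<rho> - A)))"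
        using conjunct2[OF C(3)[unfolded krylov_V_bound_def, rule_format, OF \<rho> e(1) e' sd, where c = y and m = m and x = x]] unfolding t_def
        by (auto dest: bspec[where x = "cube y \<rho> - A"] simp: cube_borel)
      also have "\<dots> \<le> real m * (C * \<rho> * root CARD('n) ((\<eta> * (2 * \<rho>)) ^ CARD('n)))"
        using small C \<rho> by (intro mult_left_mono real_root_le_mono) (auto simp: \<epsilon>0_def power_mult_distrib)
      also have "root CARD('n) ((\<eta> * (2 * \<rho>)) ^ CARD('n)) = \<eta> * (2 * \<rho>)"
        using \<eta> \<rho> by (intro real_root_power_cancel) auto
      also have "real m * (C * \<rho> * (\<eta> * (2 * \<rho>))) = (4 * real m * C * \<eta>) / 2 * \<rho>\<^sup>2" by (simp add: power2_eq_square)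
      also have "\<dots> \<le> c3 / 2 * \<rho>\<^sup>2" using \<eta>(3) by (intro mult_right_mono divide_right_mono) auto
      finally show ?thesis .
    qed
    have "q = measure (V t x) (A \<inter> cube y \<rho>) + measure (V t x) (cube y \<rho> - A)"
    proof -
      have "measure (V t x) ((A \<inter> cube y \<rho>) \<union> (cube y \<rho> - A)) = measure (V t x) (A \<inter> cube y \<rho>) + measure (V t x) (cube y \<rho> - A)"
        by (rule Vt.finite_measure_Union) auto
      moreover have "(A \<inter> cube y \<rho>) \<union> (cube y \<rho> - A) = cube y \<rho>" by blast
      ultimately show ?thesis by (simp add: q_def)
    qed
    then have "c3 / 2 * \<rho>\<^sup>2 \<le> measure (V t x) (A \<inter> cube y \<rho>)" using q_ge rest by (simp add: algebra_simps)
    moreover have "c * t = c3 / 2 * \<rho>\<^sup>2" using m by (simp add: c_def t_def)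
    ultimately show "c * (real m * \<rho>\<^sup>2) \<le> measure (V (real m * \<rho>\<^sup>2) x) (A \<inter> cube y \<rho>)"
      unfolding t_def by linarith
  qed
  then show ?thesis using m c \<epsilon>0 e1 by blast
qed

text \<open>Dynkin's formula for a bump that equals 1 at the starting point and vanishes off the
  ball: its expectation at time \<open>s\<close> bounds the probability of the ball from below. The
  drift up to time \<open>s\<close> is estimated by that up to
  \<open>\<rho>\<^sup>2\<close>.\<close>

lemma exit_probability:
  "\<exists>K>0. \<exists>e0>0. \<forall>\<rho> e s x. 0 < \<rho> \<longrightarrow> 0 \<le> e \<longrightarrow> e \<le> e0 \<longrightarrow> small_drift \<rho> e \<longrightarrow> 0 \<le> s \<longrightarrow> s \<le> \<rho>\<^sup>2 \<longrightarrow>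
     measure (T s x) (- cball x \<rho>) \<le> K * (s / \<rho>\<^sup>2 + e)"
proof -
  obtain C e0 where C: "0 < C" "0 < e0" "krylov_V_bound C e0" using krylov_V by blast
  obtain C' where C': "0 < C'" and dball: "\<forall>(m :: nat) \<rho> e x y. 0 < \<rho> \<longrightarrow> 0 \<le> e \<longrightarrow> e \<le> e0 \<longrightarrow> small_drift \<rho> e \<longrightarrow>
     (\<integral>w. drift_on (cball y (1 * \<rho>)) w \<partial>V (real m * \<rho>\<^sup>2) x) \<le> real m * (C' * e * \<rho>)"
    using drift_ball[OF C, of 1] by blast
  define K2 where "K2 = 15 * (real CARD('n))\<^sup>2 / \<delta>"
  have K2: "0 < K2" using \<delta> by (simp add: K2_def)
  define K where "K = K2 + 6 * C'"
  have K: "0 < K" using K2 C' by (simp add: K_def)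
  have "measure (T s x) (- cball x \<rho>) \<le> K * (s / \<rho>\<^sup>2 + e)"
    if \<rho>: "0 < \<rho>" and e: "0 \<le> e" "e \<le> e0" and sd: "small_drift \<rho> e" and s: "0 \<le> s" "s \<le> \<rho>\<^sup>2" for \<rho> e s x
  proof -
    define \<phi> where "\<phi> = bump 3 x \<rho>"
    have [measurable]: "cball x \<rho> \<in> sets borel" by (simp add: borel_closed)
    interpret Ts: prob_space "T s x" by (rule T_prob)
    interpret Vs: finite_measure "V s x" by (rule finite_measure_V[OF s(1)])
    have z: "\<And>y. y \<notin> cball x \<rho> \<Longrightarrow> bump 3 x \<rho> y = 0"
      using \<rho> by (intro bump_zero) (auto simp: dist_norm norm_minus_commute)
    have C2: "C2_data (bump 3 x \<rho>) (bump_grad 3 x \<rho>) (bump_hess 3 x \<rho>)" by (rule bump_C2_data) (use \<rho> in auto)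
    have low: "- (K2 / \<rho>\<^sup>2) - 6 / \<rho> * (drift_on (cball x \<rho>) y) \<le> Lop a b \<phi> y" for y
    proof (cases "y \<in> cball x \<rho>")
      case True
      have ny: "norm (y - x) \<le> \<rho>" using True by (simp add: dist_norm norm_minus_commute)
      have "\<bar>\<Sum>i\<in>UNIV. \<Sum>j\<in>UNIV. a y $ i $ j * bump_hess 3 x \<rho> y $ j $ i\<bar> \<le> (real CARD('n))\<^sup>2 * (30 / \<rho>\<^sup>2) / \<delta>"
        by (rule second_order_bound) (use bump_hess_le[OF \<rho> ny, of 3] in simp)
      moreover have "(real CARD('n))\<^sup>2 * (30 / \<rho>\<^sup>2) / \<delta> = 2 * (K2 / \<rho>\<^sup>2)" by (simp add: K2_def mult_ac)
      moreover have "\<bar>b y \<bullet> bump_grad 3 x \<rho> y\<bar> \<le> norm (b y) * (6 / \<rho>)"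
      proof -
        have "norm (bump_grad 3 x \<rho> y) \<le> 6 / \<rho>" using bump_grad_le[OF \<rho> ny, of 3] by simp
        then have "norm (b y) * norm (bump_grad 3 x \<rho> y) \<le> norm (b y) * (6 / \<rho>)" by (rule mult_left_mono) simp
        then show ?thesis by (rule order_trans[OF Cauchy_Schwarz_ineq2])
      qed
      moreover have "6 / \<rho> * (drift_on (cball x \<rho>) y) = norm (b y) * (6 / \<rho>)" using True by simp
      moreover have "- k - g \<le> 1 / 2 * S + w" if "\<bar>S\<bar> \<le> k'" "k' = 2 * k" "\<bar>w\<bar> \<le> g'" "g = g'" for S w k k' g g' :: real
        using that by linarith
      ultimately show ?thesis unfolding \<phi>_def Lop_C2_data[OF C2] by blast
    next
      case False
      then have "Lop a b \<phi> y = 0" using C2_data_zero_outside[OF C2 z False] by (simp add: \<phi>_def Lop_C2_data[OF C2])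
      then show ?thesis using False K2 by simp
    qed
    have i3: "integrable (V r x) (\<lambda>w. drift_on (cball x \<rho>) w)" if "0 \<le> r" for r
      by (rule drift_integrable_V[OF that]) measurable
    have "- (K2 / \<rho>\<^sup>2) * s - 6 / \<rho> * (\<integral>y. drift_on (cball x \<rho>) y \<partial>V s x)
      = (\<integral>y. - (K2 / \<rho>\<^sup>2) - 6 / \<rho> * (drift_on (cball x \<rho>) y) \<partial>V s x)"
      using i3[OF s(1)] by (simp add: measure_V_UNIV[OF s(1)])
    also have "\<dots> \<le> (\<integral>y. Lop a b \<phi> y \<partial>V s x)"
      by (rule integral_mono[OF _ _ low])
        (use i3[OF s(1)] bump_Lop_integrable_V[OF \<rho> _ s(1), of 3 x] in \<open>auto simp: \<phi>_def\<close>)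
    finally have 1: "- (K2 / \<rho>\<^sup>2) * s - 6 / \<rho> * (\<integral>y. drift_on (cball x \<rho>) y \<partial>V s x) \<le> (\<integral>y. Lop a b \<phi> y \<partial>V s x)" .
    have "(\<integral>y. drift_on (cball x \<rho>) y \<partial>V s x) \<le> (\<integral>y. drift_on (cball x \<rho>) y \<partial>V (\<rho>\<^sup>2) x)"
      by (rule V_mono_integral[OF _ _ s(2) i3]) auto
    also have "\<dots> \<le> C' * e * \<rho>" using dball[rule_format, OF \<rho> e sd, where m = 1 and x = x and y = x] by simp
    finally have "6 / \<rho> * (\<integral>y. drift_on (cball x \<rho>) y \<partial>V s x) \<le> 6 / \<rho> * (C' * e * \<rho>)"
      using \<rho> by (intro mult_left_mono) auto
    also have "\<dots> = 6 * C' * e" using \<rho> by simp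
    finally have 2: "6 / \<rho> * (\<integral>y. drift_on (cball x \<rho>) y \<partial>V s x) \<le> 6 * C' * e" .
    have "\<phi> x = 1" by (simp add: \<phi>_def bump_def pospow_def)
    then have 3: "(\<integral>y. \<phi> y \<partial>T s x) = 1 + (\<integral>y. Lop a b \<phi> y \<partial>V s x)"
      using Dynkin[OF s(1) bump_C2_compact[OF \<rho>, of 3 x], of x] by (simp add: \<phi>_def)
    have "(\<integral>y. \<phi> y \<partial>T s x) \<le> (\<integral>y. indicator (cball x \<rho>) y \<partial>T s x)"
    proof (rule integral_mono)
      show "integrable (T s x) \<phi>" unfolding \<phi>_def by (rule bump_integrable_T[OF \<rho>]) simp
      show "integrable (T s x) (indicator (cball x \<rho>) :: _ \<Rightarrow> real)" by (intro integrable_real_indicator) (auto simp: Ts.emeasure_eq_measure)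
      show "\<phi> y \<le> indicator (cball x \<rho>) y" for y
        using z[of y] bump_le1[of 3 x \<rho> y] by (cases "y \<in> cball x \<rho>") (auto simp: \<phi>_def)
    qed
    then have 4: "(\<integral>y. \<phi> y \<partial>T s x) \<le> measure (T s x) (cball x \<rho>)" by simp
    have "measure (T s x) (- cball x \<rho>) = 1 - measure (T s x) (cball x \<rho>)"
      using Ts.prob_compl[of "cball x \<rho>"] by (simp add: Compl_eq_Diff_UNIV)
    also have "\<dots> \<le> K2 * (s / \<rho>\<^sup>2) + 6 * C' * e" using 1 2 3 4 by simp
    also have "\<dots> \<le> K * (s / \<rho>\<^sup>2 + e)"
    proof -
      have "0 \<le> 6 * C' * (s / \<rho>\<^sup>2)" "0 \<le> K2 * e" using C' K2 s e by simp_all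
      then show ?thesis by (simp add: K_def algebra_simps)
    qed
    finally show ?thesis .
  qed
  then show ?thesis using K C(2) by blast
qed

end

section \<open>Growth of superlevel sets and continuity of potentials\<close>

definition dcell :: "real ^ 'n \<Rightarrow> real \<Rightarrow> nat \<Rightarrow> real ^ 'n \<Rightarrow> (real ^ 'n) set" where
  "dcell p l n x = gcell p (l / 2 ^ n) (grid p (l / 2 ^ n) x)"

lemma mem_dcell: "y \<in> dcell p l n x \<longleftrightarrow> grid p (l / 2 ^ n) y = grid p (l / 2 ^ n) x"
  by (simp add: dcell_def gcell_def)

abbreviation "dunion p l S \<equiv> {x. \<exists>n. dcell p l n x \<subseteq> S}"

lemma dcell_self [simp]: "x \<in> dcell p l n x" by (simp add: mem_dcell)

lemma dcell_eq: "y \<in> dcell p l n x \<Longrightarrow> dcell p l n y = dcell p l n x"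
  by (simp add: dcell_def gcell_def)

lemma floor_double_div: "\<lfloor>u :: real\<rfloor> = \<lfloor>2 * u\<rfloor> div 2"
  using floor_divide_real_eq_div[of 2 "2 * u"] by simp

lemma dcell_Suc_subset: "dcell p l (Suc n) x \<subseteq> dcell p l n x"
proof
  fix y assume "y \<in> dcell p l (Suc n) x"
  then have "grid p (l / 2 ^ Suc n) y = grid p (l / 2 ^ Suc n) x" by (simp only: mem_dcell)
  then have *: "\<lfloor>(y $ k - p $ k) / (l / 2 ^ Suc n)\<rfloor> = \<lfloor>(x $ k - p $ k) / (l / 2 ^ Suc n)\<rfloor>" for k
    unfolding grid_def vec_eq_iff by simp
  have d: "u / (l / 2 ^ Suc n) = 2 * (u / (l / 2 ^ n))" for u :: real by (simp add: field_simps)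
  have "\<lfloor>(y $ k - p $ k) / (l / 2 ^ n)\<rfloor> = \<lfloor>(x $ k - p $ k) / (l / 2 ^ n)\<rfloor>" for k
    using *[of k] unfolding d floor_double_div[of "_ / (l / 2 ^ n)"] by simp
  then show "y \<in> dcell p l n x" by (simp add: mem_dcell grid_def vec_eq_iff)
qed

lemma dcell_mono: "m \<le> n \<Longrightarrow> dcell p l n x \<subseteq> dcell p l m x"
proof (induction rule: dec_induct)
  case (step k) then show ?case using dcell_Suc_subset by blast
qed simp

lemma dcell_borel: "0 < l \<Longrightarrow> dcell p l n x \<in> sets borel"
  unfolding dcell_def by (rule gcell_borel) simp

lemma dcell_measure:
  fixes x :: "real ^ 'n"
  assumes "0 < l"
  shows "emeasure lborel (dcell p l n x) = ennreal ((l / 2 ^ n) ^ CARD('n))" "vol (dcell p l n x) = (l / 2 ^ n) ^ CARD('n)"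
  unfolding dcell_def using assms by (auto intro!: measure_gcell)

definition dcentre :: "real ^ 'n \<Rightarrow> real \<Rightarrow> nat \<Rightarrow> real ^ 'n \<Rightarrow> real ^ 'n" where
  "dcentre p l n x = gcentre p (l / 2 ^ n) (grid p (l / 2 ^ n) x)"

lemma dcell_subset_cube:
  assumes "0 < l" shows "dcell p l n x \<subseteq> cube (dcentre p l n x) (l / 2 ^ n / 2)"
  unfolding dcell_def dcentre_def by (rule gcell_subset_cube) (use assms in simp)

text \<open>With \<open>s\<close> the half side of the child, a point of the parent is within
  \<open>4 s\<close> of \<open>x\<close> in each coordinate, and \<open>x\<close> is within
  \<open>s\<close> of the centre of the child.\<close>

lemma dcell_parent_subset:
  fixes x :: "real ^ 'n"
  assumes l: "0 < l" shows "dcell p l n x \<subseteq> cube (dcentre p l (Suc n) x) (5 * (l / 2 ^ Suc n / 2))"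
proof
  fix y assume y: "y \<in> dcell p l n x"
  define s where "s = l / 2 ^ Suc n / 2"
  have s: "l / 2 ^ Suc n / 2 = s" "l / 2 ^ n / 2 = 2 * s" by (simp_all add: s_def)
  have "x \<in> cube (dcentre p l (Suc n) x) s" "x \<in> cube (dcentre p l n x) (2 * s)" "y \<in> cube (dcentre p l n x) (2 * s)"
    using dcell_subset_cube[OF l, of p "Suc n" x] dcell_subset_cube[OF l, of p n x] dcell_self y unfolding s by blast+
  then have "\<bar>y $ k - dcentre p l (Suc n) x $ k\<bar> \<le> 5 * s" for k unfolding mem_cube abs_le_iff by (smt (verit))
  then show "y \<in> cube (dcentre p l (Suc n) x) (5 * (l / 2 ^ Suc n / 2))" unfolding mem_cube s(1) by blast
qed

text \<open>The largest cells contained in \<open>S\<close> are disjoint and countable, and their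
  union is \<open>dunion p l S\<close>, so a density bound on each of them adds up. Only maximal
  cells have to be checked, which is what lets the predecessor argument in
  \<open>Calderon_Zygmund_growth\<close> work.\<close>

lemma maximal_dcells_measure:
  fixes S Z :: "(real ^ 'n) set"
  assumes l: "0 < l" and Z: "Z \<in> sets borel"
    and thin: "\<And>x n. dcell p l n x \<subseteq> S \<Longrightarrow> (\<And>m. m < n \<Longrightarrow> \<not> dcell p l m x \<subseteq> S) \<Longrightarrow>
       emeasure lborel (Z \<inter> dcell p l n x) \<le> \<theta> * emeasure lborel (dcell p l n x)"
  shows "emeasure lborel (Z \<inter> dunion p l S) \<le> \<theta> * emeasure lborel (dunion p l S)"
    and "dunion p l S \<in> sets borel"
proof -
  define US where "US = dunion p l S"
  define N where "N x = (LEAST n. dcell p l n x \<subseteq> S)" for x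
  have N: "dcell p l (N x) x \<subseteq> S" "\<And>m. m < N x \<Longrightarrow> \<not> dcell p l m x \<subseteq> S" if "x \<in> US" for x
  proof -
    show "dcell p l (N x) x \<subseteq> S" unfolding N_def by (rule LeastI_ex) (use that in \<open>simp add: US_def\<close>)
    show "\<And>m. m < N x \<Longrightarrow> \<not> dcell p l m x \<subseteq> S" unfolding N_def by (rule not_less_Least)
  qed
  define D where "D = (\<lambda>x. dcell p l (N x) x) ` US"
  have "D \<subseteq> (\<lambda>(n, m). gcell p (l / 2 ^ n) m) ` UNIV" by (auto simp: D_def dcell_def)
  moreover have "countable ((\<lambda>(n, m). gcell p (l / 2 ^ n) m) ` (UNIV :: (nat \<times> (int ^ 'n)) set))"
  proof (rule countable_image)
    have "countable ((UNIV :: nat set) \<times> (UNIV :: (int ^ 'n) set))"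
      by (intro countable_SIGMA countable_UNIV_int_vec) auto
    then show "countable (UNIV :: (nat \<times> (int ^ 'n)) set)" by simp
  qed
  ultimately have cD: "countable D" by (rule countable_subset)
  \<comment> \<open>All points of a maximal cell have that cell as their own maximal cell;
    disjointness follows.\<close>
  have same: "dcell p l (N z) z = dcell p l (N x) x" if x: "x \<in> US" and z: "z \<in> dcell p l (N x) x" for x z
  proof -
    have e: "dcell p l (N x) z = dcell p l (N x) x" by (rule dcell_eq[OF z])
    have zU: "z \<in> US" using N(1)[OF x] e by (auto simp: US_def)
    have "\<not> N x < N z" using N(2)[OF zU, of "N x"] N(1)[OF x] e by auto
    moreover have "\<not> N z < N x"
    proof
      assume lt: "N z < N x"
      have "x \<in> dcell p l (N x) z" using e by simp
      then have "x \<in> dcell p l (N z) z" using dcell_mono[of "N z" "N x" p l z] lt by auto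
      then have "dcell p l (N z) x = dcell p l (N z) z" by (rule dcell_eq)
      then show False using N(2)[OF x lt] N(1)[OF zU] by simp
    qed
    ultimately have "N z = N x" by simp
    then show ?thesis using e by simp
  qed
  have disj: "disjoint_family_on (\<lambda>C. C) D"
    unfolding disjoint_family_on_def
  proof (intro ballI impI)
    fix C C' assume C: "C \<in> D" "C' \<in> D" "C \<noteq> C'"
    show "C \<inter> C' = {}"
    proof (rule ccontr)
      assume "C \<inter> C' \<noteq> {}"
      then obtain z where z: "z \<in> C" "z \<in> C'" by blast
      have "dcell p l (N z) z = A" if A: "A \<in> D" "z \<in> A" for A
        using A(1) unfolding D_def
      proof (rule imageE)
        fix x assume x: "A = dcell p l (N x) x" "x \<in> US"
        show "dcell p l (N z) z = A" unfolding x(1) by (rule same[OF x(2) A(2)[unfolded x(1)]])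
      qed
      then have "dcell p l (N z) z = C" "dcell p l (N z) z = C'" using C z by blast+
      then show False using C(3) by simp
    qed
  qed
  have un: "US = (\<Union>C\<in>D. C)"
  proof
    show "US \<subseteq> (\<Union>C\<in>D. C)" by (auto simp: D_def)
    show "(\<Union>C\<in>D. C) \<subseteq> US"
    proof safe
      fix z C assume z: "z \<in> C" "C \<in> D"
      show "z \<in> US"
        using z(2) unfolding D_def
      proof (rule imageE)
        fix x assume x: "C = dcell p l (N x) x" "x \<in> US"
        have "dcell p l (N x) z = C" using dcell_eq[of z p l "N x" x] z(1) x(1) by simp
        then have "dcell p l (N x) z \<subseteq> S" using N(1)[OF x(2)] x(1) by simp
        then show "z \<in> US" unfolding US_def by blast
      qed
    qed
  qed
  have Dm: "C \<in> sets lborel" if "C \<in> D" for C using that dcell_borel[OF l] by (auto simp: D_def)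
  show "dunion p l S \<in> sets borel"
    unfolding US_def[symmetric] un by (rule sets.countable_UN'[OF cD]) (use Dm in auto)
  have "emeasure lborel (Z \<inter> US) = emeasure lborel (\<Union>C\<in>D. Z \<inter> C)" unfolding un by (simp add: Int_UN_distrib)
  also have "\<dots> = (\<integral>\<^sup>+C. emeasure lborel (Z \<inter> C) \<partial>count_space D)"
    using disj Z Dm by (intro emeasure_UN_countable cD) (auto simp: disjoint_family_on_def)
  also have "\<dots> \<le> (\<integral>\<^sup>+C. \<theta> * emeasure lborel C \<partial>count_space D)"
  proof (rule nn_integral_mono)
    fix C assume "C \<in> space (count_space D)"
    then have "C \<in> (\<lambda>x. dcell p l (N x) x) ` US" by (simp add: D_def)
    then show "emeasure lborel (Z \<inter> C) \<le> \<theta> * emeasure lborel C"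
    proof (rule imageE)
      fix x assume x: "C = dcell p l (N x) x" "x \<in> US"
      show "emeasure lborel (Z \<inter> C) \<le> \<theta> * emeasure lborel C" unfolding x(1) by (rule thin[OF N[OF x(2)]])
    qed
  qed
  also have "\<dots> = \<theta> * (\<integral>\<^sup>+C. emeasure lborel C \<partial>count_space D)" by (rule nn_integral_cmult) simp
  also have "(\<integral>\<^sup>+C. emeasure lborel C \<partial>count_space D) = emeasure lborel US"
    unfolding un using disj Dm by (intro emeasure_UN_countable[symmetric] cD) auto
  finally show "emeasure lborel (Z \<inter> dunion p l S) \<le> \<theta> * emeasure lborel (dunion p l S)"
    by (simp add: US_def)
qed

lemma open_dcell_subset:
  fixes U :: "(real ^ 'n) set"
  assumes l: "0 < l" and U: "open U" and x: "x \<in> U"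
  shows "\<exists>n. dcell p l n x \<subseteq> U"
proof -
  obtain e where e: "e > 0" "ball x e \<subseteq> U" using U x openE by blast
  have "(\<lambda>n. sqrt CARD('n) * (l * (1 / 2) ^ n)) \<longlonglongrightarrow> sqrt CARD('n) * (l * 0)"
    by (intro tendsto_intros LIMSEQ_power_zero) simp
  then have "eventually (\<lambda>n. sqrt CARD('n) * (l * (1 / 2) ^ n) < e) sequentially"
    using e(1) by (intro order_tendstoD(2)) auto
  then obtain n where n: "sqrt CARD('n) * (l * (1 / 2) ^ n) < e" by (auto simp: eventually_sequentially)
  have ln: "0 < l / 2 ^ n" using l by simp
  have "dcell p l n x \<subseteq> ball x e"
  proof
    fix y assume "y \<in> dcell p l n x"
    then have "y \<in> cube (gcentre p (l / 2 ^ n) (grid p (l / 2 ^ n) x)) (l / 2 ^ n / 2)"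
      using dcell_subset_cube[OF l] unfolding dcentre_def by blast
    then have "norm (y - x) \<le> sqrt CARD('n) * (l / 2 ^ n)" by (rule dist_gcell_le[OF ln mem_gcell_grid])
    also have "l / 2 ^ n = l * (1 / 2) ^ n" unfolding power_one_over by simp
    also note n
    finally show "y \<in> ball x e" by (simp add: dist_norm norm_minus_commute)
  qed
  then show ?thesis using e by blast
qed

lemma dense_dcells_measurable:
  assumes l: "0 < l" shows "{x. P (grid p (l / 2 ^ n) x)} \<in> sets borel"
proof -
  have "(\<lambda>x. P (grid p (l / 2 ^ n) x)) \<in> measurable borel (count_space UNIV)"
    using grid_measurable_comp[of "l / 2 ^ n" P "count_space UNIV" p] l by simp
  then have "Measurable.pred borel (\<lambda>x. P (grid p (l / 2 ^ n) x))" .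
  then show ?thesis by simp
qed

text \<open>Call a cell thick if \<open>E\<close> fills more than the fraction
  \<open>\<theta>\<close> of it. Almost every point of \<open>E\<close> lies in a thick cell, hence
  in a cell contained in \<open>F\<close>. A maximal cell contained in \<open>F\<close> and the base
  cell is not thick, for otherwise its parent would also be contained there; so \<open>E\<close> has
  density at most \<open>\<theta>\<close> in each of them.\<close>

lemma Calderon_Zygmund_growth:
  fixes E F :: "(real ^ 'n) set" and x0 p :: "real ^ 'n"
  assumes l: "0 < l" and E: "E \<in> sets borel" "E \<subseteq> dcell p l 0 x0" and F: "F \<in> sets borel"
    and \<theta>: "0 < \<theta>" "\<theta> < 1"
    and thin: "vol E \<le> \<theta> * l ^ CARD('n)"
    and dense: "\<And>x n. x \<in> dcell p l 0 x0 \<Longrightarrow> \<theta> * (l / 2 ^ Suc n) ^ CARD('n) < vol (E \<inter> dcell p l (Suc n) x) \<Longrightarrow> dcell p l n x \<subseteq> F"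
  shows "vol E \<le> \<theta> * vol (F \<inter> dcell p l 0 x0)"
proof -
  define Q0 where "Q0 = dcell p l 0 x0"
  have Q0: "Q0 \<in> sets borel" unfolding Q0_def by (rule dcell_borel[OF l])
  have fin: "emeasure lborel A < \<infinity>" if "A \<subseteq> Q0" "A \<in> sets borel" for A
  proof -
    have "emeasure lborel A \<le> emeasure lborel Q0" using that Q0 by (intro emeasure_mono) auto
    also have "\<dots> < \<infinity>" unfolding Q0_def by (simp add: dcell_measure[OF l])
    finally show ?thesis .
  qed
  define thick where "thick n x \<longleftrightarrow> \<theta> * (l / 2 ^ n) ^ CARD('n) < vol (E \<inter> dcell p l n x)" for n x
  have thinE: "emeasure lborel (E \<inter> dcell p l n x) \<le> ennreal \<theta> * emeasure lborel (dcell p l n x)" if "\<not> thick n x" for n x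
  proof -
    have "emeasure lborel (E \<inter> dcell p l n x) = ennreal (vol (E \<inter> dcell p l n x))"
    proof (rule emeasure_eq_ennreal_measure)
      have "E \<inter> dcell p l n x \<subseteq> Q0" using E(2) by (auto simp: Q0_def)
      then show "emeasure lborel (E \<inter> dcell p l n x) \<noteq> top"
        using fin[of "E \<inter> dcell p l n x"] E(1) dcell_borel[OF l, of p n x] by auto
    qed
    also have "\<dots> \<le> ennreal (\<theta> * (l / 2 ^ n) ^ CARD('n))" using that by (intro ennreal_leI) (simp add: thick_def)
    also have "\<dots> = ennreal \<theta> * emeasure lborel (dcell p l n x)" using \<theta> l by (simp add: dcell_measure ennreal_mult)
    finally show ?thesis .
  qed
  define E1 where "E1 = {x \<in> E. \<exists>n. thick n x}"
  define Z where "Z = E - E1"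
  have tm: "{x. thick n x} \<in> sets borel" for n
    using dense_dcells_measurable[OF l, of "\<lambda>m. \<theta> * (l / 2 ^ n) ^ CARD('n) < vol (E \<inter> gcell p (l / 2 ^ n) m)" p n]
    by (simp add: thick_def dcell_def)
  have "E1 = E \<inter> (\<Union>n. {x. thick n x})" by (auto simp: E1_def)
  then have E1m: "E1 \<in> sets borel" using E tm by auto
  then have Zm: "Z \<in> sets borel" using E by (auto simp: Z_def)
  have thick_cell: "thick n y \<longleftrightarrow> thick n x" if "y \<in> dcell p l n x" for n x y
    unfolding thick_def dcell_eq[OF that] ..
  \<comment> \<open>A substitute for the density theorem: an open \<open>U\<close> around
    \<open>Z\<close> is a disjoint union of maximal cells, and \<open>Z\<close> has density at most
    \<open>\<theta>\<close> in each of them, so the volume of \<open>Z\<close> is at most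
    \<open>\<theta>\<close> times that of \<open>U\<close>, which is close to that of
    \<open>Z\<close>.\<close>
  have Z0: "vol Z = 0"
  proof (rule ccontr)
    assume "vol Z \<noteq> 0"
    then have Zpos: "0 < vol Z" by (simp add: zero_less_measure_iff)
    have Zf: "emeasure lborel Z < \<infinity>" using E Zm by (intro fin) (auto simp: Z_def Q0_def)
    \<comment> \<open>Half of the excess at which \<open>\<theta> * (vol Z + \<eta>)\<close> would
      reach \<open>vol Z\<close>.\<close>
    define \<eta> where "\<eta> = vol Z * (1 - \<theta>) / \<theta> / 2"
    have \<eta>: "0 < \<eta>" using Zpos \<theta> by (simp add: \<eta>_def)
    obtain U where U: "open U" "Z \<subseteq> U" "emeasure lborel (U - Z) < ennreal \<eta>"
      using outer_regular_lborel[OF Zm \<eta>] by blast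
    have mU: "emeasure lborel U \<le> ennreal (vol Z + \<eta>)"
    proof -
      have "emeasure lborel U = emeasure lborel Z + emeasure lborel (U - Z)"
        using U Zm by (subst plus_emeasure) (auto simp: borel_open Un_absorb1)
      also have "\<dots> \<le> ennreal (vol Z) + ennreal \<eta>"
        using U(3) Zf by (intro add_mono) (auto simp: emeasure_eq_ennreal_measure)
      finally show ?thesis using \<eta> by simp
    qed
    have UU: "dunion p l U = U"
      using open_dcell_subset[OF l U(1)] dcell_self by blast
    have "emeasure lborel (Z \<inter> dunion p l U) \<le> ennreal \<theta> * emeasure lborel (dunion p l U)"
    proof (rule maximal_dcells_measure(1)[OF l Zm])
      fix x n
      show "emeasure lborel (Z \<inter> dcell p l n x) \<le> ennreal \<theta> * emeasure lborel (dcell p l n x)"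
      proof (cases "Z \<inter> dcell p l n x = {}")
        case False
        then obtain z where z: "z \<in> Z" "z \<in> dcell p l n x" by auto
        then have "\<not> thick n x" using thick_cell[OF z(2)] by (auto simp: Z_def E1_def)
        have "emeasure lborel (Z \<inter> dcell p l n x) \<le> emeasure lborel (E \<inter> dcell p l n x)"
          using E dcell_borel[OF l, of p n x] by (intro emeasure_mono) (auto simp: Z_def)
        also have "\<dots> \<le> ennreal \<theta> * emeasure lborel (dcell p l n x)" by (rule thinE) fact
        finally show ?thesis .
      qed simp
    qed
    then have "emeasure lborel Z \<le> ennreal \<theta> * emeasure lborel U" unfolding UU using U(2) by (simp add: Int_absorb2)
    also have "\<dots> \<le> ennreal \<theta> * ennreal (vol Z + \<eta>)" by (intro mult_left_mono mU) simp
    also have "\<dots> = ennreal (\<theta> * (vol Z + \<eta>))" using \<theta> \<eta> by (simp add: ennreal_mult)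
    finally have "ennreal (vol Z) \<le> ennreal (\<theta> * (vol Z + \<eta>))"
      using Zf by (simp add: emeasure_eq_ennreal_measure)
    then have "vol Z \<le> \<theta> * (vol Z + \<eta>)" using \<theta> \<eta> by (simp add: ennreal_le_iff)
    also have "\<theta> * (vol Z + \<eta>) = vol Z - vol Z * (1 - \<theta>) / 2"
      using \<theta> by (simp add: \<eta>_def field_simps)
    finally have "vol Z * (1 - \<theta>) \<le> 0" by simp
    moreover have "0 < vol Z * (1 - \<theta>)" using Zpos \<theta> by (intro mult_pos_pos) auto
    ultimately show False by linarith
  qed
  define S where "S = F \<inter> Q0"
  \<comment> \<open>A thick cell therefore has a parent inside the base cell.\<close>
  have notthick0: "\<not> thick 0 x" if "x \<in> Q0" for x
  proof -
    have "dcell p l 0 x = Q0" unfolding Q0_def using that by (intro dcell_eq) (simp add: Q0_def)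
    then have "E \<inter> dcell p l 0 x = E" using E by (auto simp: Q0_def)
    then show ?thesis using thin by (simp add: thick_def)
  qed
  have inQ0: "dcell p l n x \<subseteq> Q0" if "x \<in> Q0" for n x
    using dcell_mono[of 0 n p l x] dcell_eq[of x p l 0 x0] that by (auto simp: Q0_def)
  have E1S: "E1 \<subseteq> dunion p l S"
  proof
    fix x assume x: "x \<in> E1"
    then obtain n where n: "thick n x" and xQ: "x \<in> Q0" using E by (auto simp: E1_def Q0_def)
    then obtain n' where n': "n = Suc n'" using notthick0 by (cases n) auto
    have "dcell p l n' x \<subseteq> F" using xQ n unfolding n' thick_def Q0_def by (rule dense)
    then show "x \<in> dunion p l S" using inQ0[OF xQ] by (auto simp: S_def)
  qed
  have main: "emeasure lborel (E \<inter> dunion p l S) \<le> ennreal \<theta> * emeasure lborel (dunion p l S)"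
  proof (rule maximal_dcells_measure(1)[OF l E(1)])
    fix x n assume n: "dcell p l n x \<subseteq> S" and min: "\<And>m. m < n \<Longrightarrow> \<not> dcell p l m x \<subseteq> S"
    have xQ: "x \<in> Q0" using n dcell_self[of x p l n] by (auto simp: S_def)
    have "\<not> thick n x"
    proof
      assume t: "thick n x"
      then obtain n' where n': "n = Suc n'" using notthick0[OF xQ] by (cases n) auto
      have "dcell p l n' x \<subseteq> F" using xQ t unfolding n' thick_def Q0_def by (rule dense)
      then have "dcell p l n' x \<subseteq> S" using inQ0[OF xQ] by (auto simp: S_def)
      then show False using min[of n'] n' by simp
    qed
    then show "emeasure lborel (E \<inter> dcell p l n x) \<le> ennreal \<theta> * emeasure lborel (dcell p l n x)" by (rule thinE)
  qed
  have USm: "dunion p l S \<in> sets borel"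
  proof (rule maximal_dcells_measure(2)[OF l, where Z = "{}" and \<theta> = 0])
  qed auto
  have USS: "dunion p l S \<subseteq> S" using dcell_self by blast
  have Sm: "S \<in> sets borel" using F Q0 by (auto simp: S_def)
  have "emeasure lborel E1 \<le> emeasure lborel (E \<inter> dunion p l S)"
    using E1S E USm by (intro emeasure_mono) (auto simp: E1_def)
  also have "\<dots> \<le> ennreal \<theta> * emeasure lborel S"
    by (rule order_trans[OF main mult_left_mono[OF emeasure_mono[OF USS]]]) (use Sm in auto)
  also have "\<dots> = ennreal (\<theta> * vol S)"
    using fin[of S] Sm \<theta> by (simp add: S_def emeasure_eq_ennreal_measure ennreal_mult)
  finally have "vol E1 \<le> \<theta> * vol S"
    using \<theta> unfolding measure_def[of lborel E1] by (intro enn2real_leI) auto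
  moreover have "vol E = vol E1 + vol Z"
  proof -
    have "vol (E1 \<union> Z) = vol E1 + vol Z"
    proof (rule measure_Union)
      have "E1 \<subseteq> Q0" "Z \<subseteq> Q0" using E(2) unfolding E1_def Z_def Q0_def by blast+
      then have "emeasure lborel E1 < \<infinity>" "emeasure lborel Z < \<infinity>" by (simp_all only: fin E1m Zm)
      then show "emeasure lborel E1 \<noteq> \<infinity>" "emeasure lborel Z \<noteq> \<infinity>" by (simp_all only: less_irrefl not_False_eq_True less_imp_neq)
    qed (use E1m Zm in \<open>auto simp: Z_def\<close>)
    moreover have "E1 \<union> Z = E" by (auto simp: Z_def E1_def)
    ultimately show ?thesis by simp
  qed
  ultimately show ?thesis using Z0 by (simp add: S_def Q0_def)
qed

section \<open>Almost invariant functions and growth of their superlevel sets\<close>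

context diffusion_kernels
begin

lemma integral_V_eq_nn:
  fixes f :: "real ^ 'n \<Rightarrow> real"
  assumes f: "f \<in> borel_measurable borel" "\<And>x. 0 \<le> f x" "\<And>x. f x \<le> B" and t: "0 \<le> t"
  shows "ennreal (\<integral>y. f y \<partial>V t x) = (\<integral>\<^sup>+y. ennreal (f y) \<partial>V t x)" "integrable (V t x) f"
proof -
  interpret finite_measure "V t x" by (rule finite_measure_V[OF t])
  show i: "integrable (V t x) f"
    by (rule integrable_const_bound[where B = B]) (use f in \<open>auto cong: measurable_cong_sets\<close>)
  show "ennreal (\<integral>y. f y \<partial>V t x) = (\<integral>\<^sup>+y. ennreal (f y) \<partial>V t x)"
    using nn_integral_eq_integral[OF i] f(2) by simp
qed

lemma integral_V_bounds:
  fixes f :: "real ^ 'n \<Rightarrow> real"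
  assumes f: "f \<in> borel_measurable borel" "\<And>x. 0 \<le> f x" "\<And>x. f x \<le> 1" and t: "0 \<le> t"
  shows "0 \<le> (\<integral>y. f y \<partial>V t x)" "(\<integral>y. f y \<partial>V t x) \<le> t"
proof -
  show "0 \<le> (\<integral>y. f y \<partial>V t x)" using f(2) by (intro Bochner_Integration.integral_nonneg) auto
  interpret finite_measure "V t x" by (rule finite_measure_V[OF t])
  have "(\<integral>y. f y \<partial>V t x) \<le> (\<integral>y. 1 \<partial>V t x)"
    by (rule integral_mono[OF integral_V_eq_nn(2)[OF f t]]) (use f(3) in auto)
  then show "(\<integral>y. f y \<partial>V t x) \<le> t" using t by (simp add: measure_V_UNIV)
qed

lemma integral_V_measurable:
  fixes f :: "real ^ 'n \<Rightarrow> real"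
  assumes f: "f \<in> borel_measurable borel" "\<And>x. 0 \<le> f x"
  shows "(\<lambda>x. \<integral>y. f y \<partial>V t x) \<in> borel_measurable borel"
proof -
  note [measurable] = f(1)
  have "(\<lambda>x. enn2real (\<integral>\<^sup>+y. ennreal (f y) \<partial>V t x)) \<in> borel_measurable borel" by measurable
  moreover have "enn2real (\<integral>\<^sup>+y. ennreal (f y) \<partial>V t x) = (\<integral>y. f y \<partial>V t x)" for x
    using f by (subst integral_eq_nn_integral) (auto cong: measurable_cong_sets)
  ultimately show ?thesis by simp
qed

text \<open>The integral of \<open>f\<close> over \<open>[0, s + a']\<close> is decomposed at
  \<open>s\<close> and at \<open>a'\<close>. Each decomposition differs from one of the two compared
  quantities by an integral over a time interval of length \<open>s\<close>, which lies between 0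
  and \<open>s\<close>.\<close>

lemma potential_almost_invariant:
  fixes f :: "real ^ 'n \<Rightarrow> real"
  assumes f: "f \<in> borel_measurable borel" "\<And>x. 0 \<le> f x" "\<And>x. f x \<le> 1" and a0: "0 \<le> a'" and s: "0 \<le> s"
  defines "u \<equiv> \<lambda>x. \<integral>y. f y \<partial>V a' x"
  shows "\<bar>(\<integral>y. u y \<partial>T s x) - u x\<bar> \<le> s"
proof -
  note [measurable] = f(1)
  note um [measurable] = integral_V_measurable[OF f(1,2), of a', folded u_def]
  have u: "0 \<le> u x" "u x \<le> a'" for x unfolding u_def using integral_V_bounds[OF f a0] by auto
  interpret prob_space "T s x" by (rule T_prob)
  have iu: "integrable (T s x) u"
    by (rule integrable_const_bound[where B = a']) (use u um in \<open>auto cong: measurable_cong_sets\<close>)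
  have f': "(\<lambda>y. ennreal (f y)) \<in> borel_measurable borel" by measurable
  have Vf: "ennreal (\<integral>y. f y \<partial>V r x) = (\<integral>\<^sup>+y. ennreal (f y) \<partial>V r x)" if "0 \<le> r" for r x
    by (rule integral_V_eq_nn(1)[OF f that])
  have Tu: "ennreal (\<integral>y. u y \<partial>T s x) = (\<integral>\<^sup>+y. (\<integral>\<^sup>+w. ennreal (f w) \<partial>V a' y) \<partial>T s x)"
    using nn_integral_eq_integral[OF iu] u(1) Vf[OF a0] by (simp add: u_def)
  have nn: "0 \<le> (\<integral>y. f y \<partial>V r x)" "0 \<le> (\<integral>y. u y \<partial>T s x)" for r x
    using f(2) u(1) by (auto intro!: Bochner_Integration.integral_nonneg)
  have "ennreal ((\<integral>y. f y \<partial>V s x) + (\<integral>y. u y \<partial>T s x)) = ennreal (\<integral>y. f y \<partial>V s x) + ennreal (\<integral>y. u y \<partial>T s x)"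
    using nn by (intro ennreal_plus) auto
  also have "\<dots> = ennreal (\<integral>y. f y \<partial>V (s + a') x)"
    using V_add[OF f' s a0, of x] Vf[of "s + a'" x] Vf[OF s] Tu s a0 by simp
  finally have 1: "(\<integral>y. f y \<partial>V s x) + (\<integral>y. u y \<partial>T s x) = (\<integral>y. f y \<partial>V (s + a') x)"
    using nn by (subst (asm) ennreal_inj) auto
  have T1: "(\<integral>\<^sup>+y. (\<integral>\<^sup>+w. ennreal (f w) \<partial>V s y) \<partial>T a' x) \<le> ennreal s"
  proof -
    have "(\<integral>\<^sup>+y. (\<integral>\<^sup>+w. ennreal (f w) \<partial>V s y) \<partial>T a' x) \<le> (\<integral>\<^sup>+y. ennreal s \<partial>T a' x)"
      using integral_V_bounds[OF f s] by (intro nn_integral_mono) (simp add: Vf[OF s, symmetric] ennreal_leI)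
    then show ?thesis by simp
  qed
  have "ennreal (\<integral>y. f y \<partial>V (a' + s) x) \<le> ennreal (\<integral>y. f y \<partial>V a' x) + ennreal s"
    using V_add[OF f' a0 s, of x] Vf[of "a' + s" x] Vf[OF a0, of x] T1 s a0 by (simp add: add_left_mono)
  also have "\<dots> = ennreal ((\<integral>y. f y \<partial>V a' x) + s)" using nn s by (intro ennreal_plus[symmetric]) auto
  finally have "(\<integral>y. f y \<partial>V (a' + s) x) \<le> (\<integral>y. f y \<partial>V a' x) + s"
    using nn(1)[of a' x] s by (subst (asm) ennreal_le_iff) auto
  then have 2: "(\<integral>y. f y \<partial>V (s + a') x) \<le> u x + s" by (simp add: u_def add.commute)
  have "ennreal (\<integral>y. f y \<partial>V a' x) \<le> ennreal (\<integral>y. f y \<partial>V (s + a') x)"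
    using V_mono[OF f', of a' "s + a'" x] s a0 by (simp add: Vf)
  then have 3: "u x \<le> (\<integral>y. f y \<partial>V (s + a') x)" using nn by (simp add: ennreal_le_iff u_def)
  have "0 \<le> (\<integral>y. f y \<partial>V s x)" "(\<integral>y. f y \<partial>V s x) \<le> s" using integral_V_bounds[OF f s] by auto
  then show ?thesis using 1 2 3 by linarith
qed

text \<open>The occupation average of an almost invariant function is nearly its value at the
  starting point. Adding the bound \<open>B\<close> makes the function nonnegative, so that
  \<open>nn_integral_V\<close> can be used.\<close>

lemma potential_average:
  fixes u :: "real ^ 'n \<Rightarrow> real"
  assumes u: "u \<in> borel_measurable borel" "\<And>x. \<bar>u x\<bar> \<le> B" and inv: "\<And>s x. 0 \<le> s \<Longrightarrow> \<bar>(\<integral>y. u y \<partial>T s x) - u x\<bar> \<le> s" and t: "0 \<le> t"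
  shows "(\<integral>y. u y \<partial>V t x) \<le> t * (u x + t)"
proof -
  note [measurable] = u(1)
  define w where "w y = u y + B" for y
  have wm [measurable]: "w \<in> borel_measurable borel" unfolding w_def by measurable
  have w: "0 \<le> w y" "w y \<le> 2 * B" for y using u(2)[of y] by (auto simp: w_def abs_le_iff)
  interpret Vt: finite_measure "V t x" by (rule finite_measure_V[OF t])
  have wT: "(\<integral>\<^sup>+y. ennreal (w y) \<partial>T s x) \<le> ennreal (w x + t)" if "0 \<le> s" "s \<le> t" for s
  proof -
    interpret Ts: prob_space "T s x" by (rule T_prob)
    have iu: "integrable (T s x) u"
      by (rule Ts.integrable_const_bound[where B = B]) (use u in \<open>auto cong: measurable_cong_sets\<close>)
    then have i: "integrable (T s x) w" unfolding w_def by simp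
    have "(\<integral>\<^sup>+y. ennreal (w y) \<partial>T s x) = ennreal (\<integral>y. w y \<partial>T s x)"
      using w by (intro nn_integral_eq_integral i) auto
    also have "(\<integral>y. w y \<partial>T s x) = (\<integral>y. u y \<partial>T s x) + B" unfolding w_def using iu Ts.prob_space by simp
    also have "\<dots> \<le> w x + t" using inv[OF that(1), of x] that by (simp add: w_def abs_le_iff)
    finally show ?thesis by (simp add: ennreal_leI)
  qed
  have "ennreal (\<integral>y. w y \<partial>V t x) = (\<integral>\<^sup>+y. ennreal (w y) \<partial>V t x)" by (rule integral_V_eq_nn(1)[OF wm w t])
  also have "\<dots> = (\<integral>\<^sup>+s. indicator {0..t} s * (\<integral>\<^sup>+y. ennreal (w y) \<partial>T s x) \<partial>lborel)" by (rule nn_integral_V) measurable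
  also have "\<dots> \<le> (\<integral>\<^sup>+s. indicator {0..t} s * ennreal (w x + t) \<partial>lborel)"
    using wT by (intro nn_integral_mono) (auto simp: indicator_def)
  also have "\<dots> = ennreal (t * (w x + t))"
    using t w(1)[of x] by (simp add: nn_integral_multc ennreal_mult)
  finally have "(\<integral>y. w y \<partial>V t x) \<le> t * (w x + t)"
    using t w(1)[of x] by (subst (asm) ennreal_le_iff) auto
  moreover have "(\<integral>y. w y \<partial>V t x) = (\<integral>y. u y \<partial>V t x) + B * t"
  proof -
    have "integrable (V t x) u"
      by (rule Vt.integrable_const_bound[where B = B]) (use u in \<open>auto cong: measurable_cong_sets\<close>)
    then show ?thesis unfolding w_def using t by (simp add: measure_V_UNIV mult.commute)
  qed
  ultimately show ?thesis by (simp add: w_def algebra_simps)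
qed

lemma V_exit:
  assumes K: "\<And>s. 0 \<le> s \<Longrightarrow> s \<le> t \<Longrightarrow> measure (T s x) (- A) \<le> \<kappa>" and A: "A \<in> sets borel" and t: "0 \<le> t" and \<kappa>: "0 \<le> \<kappa>"
  shows "measure (V t x) (- A) \<le> t * \<kappa>"
proof -
  have A' [measurable]: "- A \<in> sets borel" using A by (metis sets.compl_sets space_borel Compl_eq_Diff_UNIV)
  have "emeasure (V t x) (- A) = (\<integral>\<^sup>+y. indicator (- A) y \<partial>V t x)" by simp
  also have "\<dots> = (\<integral>\<^sup>+s. indicator {0..t} s * (\<integral>\<^sup>+y. indicator (- A) y \<partial>T s x) \<partial>lborel)" by (rule nn_integral_V) measurable
  also have "\<dots> \<le> (\<integral>\<^sup>+s. indicator {0..t} s * ennreal \<kappa> \<partial>lborel)"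
  proof (rule nn_integral_mono)
    fix s
    show "indicator {0..t} s * (\<integral>\<^sup>+y. indicator (- A) y \<partial>T s x) \<le> indicator {0..t} s * ennreal \<kappa>"
    proof (cases "s \<in> {0..t}")
      case True
      interpret prob_space "T s x" by (rule T_prob)
      have "emeasure (T s x) (- A) \<le> ennreal \<kappa>" using K[of s] True by (simp add: emeasure_eq_measure ennreal_leI)
      then show ?thesis using True by simp
    qed simp
  qed
  also have "\<dots> = ennreal (t * \<kappa>)" using t \<kappa> by (simp add: nn_integral_multc ennreal_mult)
  finally show ?thesis unfolding measure_def using t \<kappa> by (intro enn2real_leI) auto
qed

text \<open>A mean value inequality: the average of \<open>v\<close> over time \<open>t\<close> is
  at least \<open>s\<close> times the occupation of the superlevel set, minus \<open>B\<close> times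
  the occupation of the complement of \<open>D\<close>, and at most \<open>t * (v x + t)\<close>.
  Division by \<open>t\<close> gives the claim.\<close>

lemma growth_step:
  fixes v :: "real ^ 'n \<Rightarrow> real"
  assumes nf: "near_full_bound m c \<epsilon>0 e1" and c: "0 \<le> c" and e1: "0 \<le> e1" and m: "0 < m" and \<rho>: "0 < \<rho>" "small_drift \<rho> e1"
    and v: "v \<in> borel_measurable borel" "\<And>x. \<bar>v x\<bar> \<le> B" and inv: "\<And>s x. 0 \<le> s \<Longrightarrow> \<bar>(\<integral>y. v y \<partial>T s x) - v x\<bar> \<le> s"
    and D: "D \<in> sets borel" "\<And>x. x \<in> D \<Longrightarrow> 0 \<le> v x" "cube y \<rho> \<subseteq> D" and x: "x \<in> cube y (5 * \<rho>)"
    and exit: "\<And>s. 0 \<le> s \<Longrightarrow> s \<le> real m * \<rho>\<^sup>2 \<Longrightarrow> measure (T s x) (- D) \<le> \<kappa>" and \<kappa>: "0 \<le> \<kappa>"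
    and s: "0 \<le> s" "vol (cube y \<rho> - {x. s \<le> v x}) \<le> \<epsilon>0 * (2 * \<rho>) ^ CARD('n)"
  shows "c * s - B * \<kappa> - real m * \<rho>\<^sup>2 \<le> v x"
proof -
  note [measurable] = v(1) D(1)
  define t where "t = real m * \<rho>\<^sup>2"
  have t: "0 < t" using m \<rho> by (simp add: t_def)
  define A where "A = {x. s \<le> v x} \<inter> cube y \<rho>"
  have [measurable]: "cube y \<rho> \<in> sets borel" by (rule cube_borel)
  have Am [measurable]: "A \<in> sets borel" unfolding A_def by measurable
  have Dm [measurable]: "- D \<in> sets borel" using D(1) by (metis sets.compl_sets space_borel Compl_eq_Diff_UNIV)
  interpret Vt: finite_measure "V t x" by (rule finite_measure_V) (use t in simp)
  have B: "0 \<le> B" using v(2)[of 0] by simp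
  have ge: "c * t \<le> measure (V t x) A"
    unfolding t_def A_def by (rule nf[unfolded near_full_bound_def, rule_format, OF \<rho>(1) e1 _ \<rho>(2) x _ s(2)]) auto
  have "s * measure (V t x) A - B * measure (V t x) (- D) = (\<integral>y. s * indicator A y - B * indicator (- D) y \<partial>V t x)"
  proof -
    have "integrable (V t x) (indicator A :: _ \<Rightarrow> real)" "integrable (V t x) (indicator (- D) :: _ \<Rightarrow> real)"
      by (auto intro!: integrable_real_indicator simp: Vt.emeasure_eq_measure)
    then show ?thesis by simp
  qed
  also have "\<dots> \<le> (\<integral>y. v y \<partial>V t x)"
  proof (rule integral_mono)
    show "integrable (V t x) (\<lambda>y. s * indicator A y - B * indicator (- D) y)"
      by (intro Bochner_Integration.integrable_diff integrable_mult_right integrable_real_indicator) (auto simp: Vt.emeasure_eq_measure)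
    show "integrable (V t x) v"
      by (rule Vt.integrable_const_bound[where B = B]) (use v in \<open>auto cong: measurable_cong_sets\<close>)
    fix w
    show "s * indicator A w - B * indicator (- D) w \<le> v w"
      using v(2)[of w] D(2)[of w] D(3) by (auto simp: A_def indicator_def abs_le_iff)
  qed
  also have "\<dots> \<le> t * (v x + t)" by (rule potential_average[OF v inv]) (use t in auto)
  finally have 1: "s * measure (V t x) A - B * measure (V t x) (- D) \<le> t * (v x + t)" .
  have "s * (c * t) \<le> s * measure (V t x) A" using ge s(1) by (rule mult_left_mono)
  moreover have "B * measure (V t x) (- D) \<le> B * (t * \<kappa>)"
    by (intro mult_left_mono V_exit B \<kappa> D(1)) (use exit t in \<open>auto simp: t_def\<close>)
  ultimately have "t * (c * s - B * \<kappa> - t) \<le> t * v x" using 1 by (simp add: algebra_simps)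
  then have "c * s - B * \<kappa> - t \<le> v x" using t by (simp only: mult_le_cancel_left_pos)
  then show ?thesis by (simp add: t_def)
qed


text \<open>The origin of the grid for which \<open>x0\<close> is the centre of a cell of side
  \<open>2 r\<close>.\<close>

definition corner :: "real ^ 'n \<Rightarrow> real \<Rightarrow> real ^ 'n" where
  "corner x0 r = (\<chi> k. x0 $ k - r)"

lemma dcentre_corner:
  assumes "0 < r" shows "dcentre (corner x0 r) (2 * r) 0 x0 = x0"
  using assms by (simp add: dcentre_def gcentre_def grid_def corner_def vec_eq_iff floor_eq_iff)

lemma dcell_corner_subset:
  assumes "0 < r" shows "dcell (corner x0 r) (2 * r) 0 x0 \<subseteq> cube x0 r"
  using dcell_subset_cube[of "2 * r" "corner x0 r" 0 x0] assms dcentre_corner[OF assms, of x0] by simp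

lemma cball_subset_dcell_corner:
  assumes r: "0 < r" shows "cball x0 (r / 2) \<subseteq> dcell (corner x0 r) (2 * r) 0 x0"
proof
  fix x assume "x \<in> cball x0 (r / 2)"
  then have "x \<in> cube x0 (r / 2)" using cball_subset_cube by blast
  then have *: "\<bar>x $ k - x0 $ k\<bar> \<le> r / 2" for k by (simp add: mem_cube)
  have "\<lfloor>(x $ k - (x0 $ k - r)) / (2 * r)\<rfloor> = 0" for k
  proof -
    have "- (r / 2) \<le> x $ k - x0 $ k" "x $ k - x0 $ k \<le> r / 2" using *[of k] by linarith+
    then show ?thesis using r by (simp add: floor_eq_iff divide_less_eq)
  qed
  moreover have "\<lfloor>(x0 $ k - (x0 $ k - r)) / (2 * r)\<rfloor> = 0" for k using r by (simp add: floor_eq_iff)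
  ultimately show "x \<in> dcell (corner x0 r) (2 * r) 0 x0" by (simp add: mem_dcell grid_def corner_def vec_eq_iff)
qed

text \<open>Lowering the level from \<open>q j\<close> to \<open>q (Suc j)\<close> enlarges the
  volume of the superlevel set by the factor \<open>1 / \<theta>\<close>, or the lower level is
  reached on the whole cell. Starting from half the volume, \<open>k\<close> enlargements would
  exceed the cell.\<close>

lemma growth_iterate:
  fixes v :: "real ^ 'n \<Rightarrow> real"
  assumes nf: "near_full_bound m c \<epsilon>0 e1" and c: "0 < c" "c \<le> 1" and \<epsilon>0: "0 < \<epsilon>0" "\<epsilon>0 < 1" and e1: "0 \<le> e1" and m: "0 < m"
    and r: "0 < r" and sd: "\<And>\<rho>. 0 < \<rho> \<Longrightarrow> \<rho> \<le> r \<Longrightarrow> small_drift \<rho> e1"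
    and v: "v \<in> borel_measurable borel" "\<And>x. \<bar>v x\<bar> \<le> B" and inv: "\<And>s x. 0 \<le> s \<Longrightarrow> \<bar>(\<integral>y. v y \<partial>T s x) - v x\<bar> \<le> s"
    and D: "D \<in> sets borel" "\<And>x. x \<in> D \<Longrightarrow> 0 \<le> v x" "cball x0 (3 * sqrt CARD('n) * r) \<subseteq> D"
    and exit: "\<And>s x. x \<in> cube x0 r \<Longrightarrow> 0 \<le> s \<Longrightarrow> s \<le> real m * r\<^sup>2 \<Longrightarrow> measure (T s x) (- D) \<le> \<kappa>" and \<kappa>: "0 \<le> \<kappa>"
    and s: "0 \<le> s" and half: "(2 * r) ^ CARD('n) / 2 \<le> vol ({x. s \<le> v x} \<inter> dcell (corner x0 r) (2 * r) 0 x0)"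
    and k: "(1 - \<epsilon>0) ^ k < 1 / 2" and x: "x \<in> dcell (corner x0 r) (2 * r) 0 x0"
  shows "c ^ k * s - real k * (B * \<kappa> + real m * r\<^sup>2) \<le> v x"
proof -
  note [measurable] = v(1)
  define p l where "p = corner x0 r" and "l = 2 * r"
  have l: "0 < l" using r by (simp add: l_def)
  define Q0 where "Q0 = dcell p l 0 x0"
  have Q0m [measurable]: "Q0 \<in> sets borel" unfolding Q0_def by (rule dcell_borel[OF l])
  have Q0_cube: "Q0 \<subseteq> cube x0 r" unfolding Q0_def p_def l_def by (rule dcell_corner_subset[OF r])
  have B: "0 \<le> B" using v(2)[of 0] by simp
  define \<epsilon> where "\<epsilon> = B * \<kappa> + real m * r\<^sup>2"
  have \<epsilon>: "0 \<le> \<epsilon>" using B \<kappa> by (simp add: \<epsilon>_def)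
  \<comment> \<open>A loss \<open>\<epsilon>\<close> at each step suffices because
    \<open>c \<le> 1\<close> shrinks the losses already accumulated.\<close>
  define q where "q j = c ^ j * s - real j * \<epsilon>" for j :: nat
  have q_step: "q (Suc j) \<le> c * q j - \<epsilon>" for j
  proof -
    have "c * (real j * \<epsilon>) \<le> 1 * (real j * \<epsilon>)" using c \<epsilon> by (intro mult_right_mono) auto
    then show ?thesis by (simp add: q_def algebra_simps)
  qed
  have q_dec: "q (Suc j) \<le> q j" for j
  proof -
    have "c * (c ^ j * s) \<le> 1 * (c ^ j * s)" using c s by (intro mult_right_mono) auto
    then show ?thesis using \<epsilon> by (simp add: q_def algebra_simps)
  qed
  define \<theta> where "\<theta> = 1 - \<epsilon>0"
  have \<theta>: "0 < \<theta>" "\<theta> < 1" using \<epsilon>0 by (auto simp: \<theta>_def)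
  have Q0_D: "Q0 \<subseteq> D"
  proof
    fix w assume "w \<in> Q0"
    then have "norm (w - x0) \<le> sqrt CARD('n) * r" using Q0_cube by (intro cube_norm_le) auto
    moreover have "0 \<le> sqrt CARD('n) * r" using r by simp
    ultimately show "w \<in> D" using D(3) by (auto simp: dist_norm norm_minus_commute)
  qed
  define E where "E j = {x. q j \<le> v x} \<inter> Q0" for j
  have Em [measurable]: "E j \<in> sets borel" for j unfolding E_def by measurable
  have cell_in: "dcell p l n w \<subseteq> Q0" if "w \<in> Q0" for n w
    using dcell_mono[of 0 n p l w] dcell_eq[of w p l 0 x0] that by (auto simp: Q0_def)
  \<comment> \<open>A cell in which the superlevel set has density above
    \<open>\<theta> = 1 - \<epsilon>0\<close> is nearly full in the sense of
    \<open>near_full_bound\<close>, so the lower level holds on the dilated cube, which contains the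
    parent. For negative \<open>q j\<close> nothing has to be proved, as \<open>v\<close> is
    nonnegative on \<open>D\<close>.\<close>
  have local_step: "q (Suc j) \<le> v z"
    if w: "w \<in> Q0" and dense: "\<theta> * (l / 2 ^ n) ^ CARD('n) < vol (E j \<inter> dcell p l n w)"
      and z: "z \<in> Q0" "z \<in> cube (dcentre p l n w) (5 * (l / 2 ^ n / 2))" for j n w z
  proof (cases "0 \<le> q j")
    case False
    have "0 \<le> v z" using z(1) Q0_D D(2) by blast
    then show ?thesis using False q_dec[of j] by simp
  next
    case True
    define \<rho> where "\<rho> = l / 2 ^ n / 2"
    define y where "y = dcentre p l n w"
    have "1 \<le> (2 :: real) ^ n" by (rule one_le_power) simp
    then have \<rho>: "0 < \<rho>" "\<rho> \<le> r" using l r by (auto simp: \<rho>_def l_def divide_le_eq)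
    have l\<rho>: "l / 2 ^ n = 2 * \<rho>" by (simp add: \<rho>_def)
    have cy: "dcell p l n w \<subseteq> cube y \<rho>" unfolding y_def \<rho>_def by (rule dcell_subset_cube[OF l])
    have [measurable]: "cube y \<rho> \<in> sets borel" by (rule cube_borel)
    have "cube y \<rho> \<subseteq> D"
    proof
      fix u assume u: "u \<in> cube y \<rho>"
      have "w \<in> cube y \<rho>" using cy dcell_self by blast
      then have "norm (w - y) \<le> sqrt CARD('n) * \<rho>" by (rule cube_norm_le)
      moreover have "norm (u - y) \<le> sqrt CARD('n) * \<rho>" using u by (rule cube_norm_le)
      moreover have "norm (w - x0) \<le> sqrt CARD('n) * r" using w Q0_cube by (intro cube_norm_le) auto
      moreover have "sqrt CARD('n) * \<rho> \<le> sqrt CARD('n) * r" using \<rho> by (intro mult_left_mono) auto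
      moreover have "norm (u - x0) \<le> norm (u - y) + norm (w - y) + norm (w - x0)"
      proof -
        have "u - x0 = (u - y) - (w - y) + (w - x0)" by simp
        then show ?thesis by (metis (no_types, lifting) norm_triangle_ineq norm_triangle_ineq4 add_right_mono order_trans)
      qed
      ultimately have "norm (u - x0) \<le> 3 * (sqrt CARD('n) * r)" by linarith
      then show "u \<in> D" using D(3) by (auto simp: dist_norm norm_minus_commute mult.assoc)
    qed
    moreover have "vol (cube y \<rho> - {x. q j \<le> v x}) \<le> \<epsilon>0 * (2 * \<rho>) ^ CARD('n)"
    proof -
      have fm: "cube y \<rho> \<in> fmeasurable lborel" by (intro fmeasurable_compact) simp
      have dm [measurable]: "dcell p l n w \<in> sets borel" by (rule dcell_borel[OF l])
      have "vol (cube y \<rho> - {x. q j \<le> v x}) \<le> vol (cube y \<rho> - (E j \<inter> dcell p l n w))"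
      proof (rule measure_mono_fmeasurable)
        show "cube y \<rho> - (E j \<inter> dcell p l n w) \<in> fmeasurable lborel"
          by (rule fmeasurableI2[OF fm]) (auto, measurable)
      qed (auto simp: E_def)
      also have "\<dots> = vol (cube y \<rho>) - vol (E j \<inter> dcell p l n w)"
        using cy emeasure_cube[of \<rho> y] \<rho> by (intro measure_Diff) auto
      also have "\<dots> \<le> (2 * \<rho>) ^ CARD('n) - \<theta> * (2 * \<rho>) ^ CARD('n)"
        using dense \<rho> unfolding l\<rho> by (simp add: measure_cube)
      also have "\<dots> = \<epsilon>0 * (2 * \<rho>) ^ CARD('n)" by (simp add: \<theta>_def algebra_simps)
      finally show ?thesis .
    qed
    moreover have mr: "real m * \<rho>\<^sup>2 \<le> real m * r\<^sup>2" using \<rho> by (intro mult_left_mono power_mono) auto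
    ultimately have "c * q j - B * \<kappa> - real m * \<rho>\<^sup>2 \<le> v z"
      using z Q0_cube c True
      by (intro growth_step[OF nf _ e1 m \<rho>(1) sd[OF \<rho>] v inv D(1,2), where y = y]) (auto intro!: exit \<kappa> simp: y_def \<rho>_def)
    then show ?thesis using q_step[of j] mr by (simp add: \<epsilon>_def)
  qed
  have main: "(\<forall>w\<in>Q0. q j \<le> v w) \<or> l ^ CARD('n) / 2 \<le> \<theta> ^ j * vol (E j)" for j
  proof (induction j)
    case 0
    show ?case using half by (simp add: q_def E_def Q0_def p_def l_def)
  next
    case (Suc j)
    show ?case
    proof (cases "\<forall>w\<in>Q0. q j \<le> v w")
      case True
      then show ?thesis using q_dec[of j] by (meson order_trans)
    next
      case False
      then have IH: "l ^ CARD('n) / 2 \<le> \<theta> ^ j * vol (E j)" using Suc.IH by blast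
      show ?thesis
      proof (cases "vol (E j) \<le> \<theta> * l ^ CARD('n)")
        case True
        have "vol (E j) \<le> \<theta> * vol ({x. q (Suc j) \<le> v x} \<inter> dcell p l 0 x0)"
        proof (rule Calderon_Zygmund_growth[OF l Em _ _ \<theta> True])
          show "E j \<subseteq> dcell p l 0 x0" by (auto simp: E_def Q0_def)
          fix w n assume w: "w \<in> dcell p l 0 x0" and dense: "\<theta> * (l / 2 ^ Suc n) ^ CARD('n) < vol (E j \<inter> dcell p l (Suc n) w)"
          show "dcell p l n w \<subseteq> {x. q (Suc j) \<le> v x}"
          proof
            fix z assume z: "z \<in> dcell p l n w"
            have wQ: "w \<in> Q0" using w by (simp add: Q0_def)
            have "z \<in> Q0" using z cell_in[OF wQ] by blast
            moreover have "z \<in> cube (dcentre p l (Suc n) w) (5 * (l / 2 ^ Suc n / 2))" using dcell_parent_subset[OF l] z by blast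
            ultimately show "z \<in> {x. q (Suc j) \<le> v x}" using local_step[OF wQ dense] by blast
          qed
        qed measurable
        then have "\<theta> ^ j * vol (E j) \<le> \<theta> ^ j * (\<theta> * vol (E (Suc j)))"
          using \<theta> by (intro mult_left_mono) (auto simp: E_def Q0_def)
        then show ?thesis using IH by (simp add: mult_ac)
      next
        case False
        \<comment> \<open>The covering lemma excludes a thick base cell; but then that cell is
          itself nearly full and the whole of it is reached in one step.\<close>
        have x0Q: "x0 \<in> Q0" by (simp add: Q0_def)
        have EQ: "E j \<inter> dcell p l 0 x0 = E j" by (auto simp: E_def Q0_def)
        have "q (Suc j) \<le> v z" if z: "z \<in> Q0" for z
        proof (rule local_step[OF x0Q _ z, of 0 j])
          show "\<theta> * (l / 2 ^ 0) ^ CARD('n) < vol (E j \<inter> dcell p l 0 x0)" using False unfolding EQ by simp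
          have "z \<in> cube x0 r" using z Q0_cube by blast
          then have "z \<in> cube x0 (5 * r)" using mult_right_mono[of 1 5 r] r by (fastforce simp: mem_cube intro: order_trans)
          moreover have "dcentre p l 0 x0 = x0" unfolding p_def l_def by (rule dcentre_corner[OF r])
          ultimately show "z \<in> cube (dcentre p l 0 x0) (5 * (l / 2 ^ 0 / 2))" by (simp add: l_def)
        qed
        then show ?thesis by blast
      qed
    qed
  qed
  have "\<forall>w\<in>Q0. q k \<le> v w"
  proof (rule ccontr)
    assume "\<not> ?thesis"
    then have "l ^ CARD('n) / 2 \<le> \<theta> ^ k * vol (E k)" using main[of k] by blast
    also have "vol (E k) \<le> vol Q0"
      using dcell_measure(1)[OF l, of p 0 x0] by (intro measure_mono_fmeasurable) (auto simp: E_def Q0_def fmeasurable_def dcell_borel[OF l])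
    then have "\<theta> ^ k * vol (E k) \<le> \<theta> ^ k * l ^ CARD('n)"
      using \<theta> dcell_measure(2)[OF l, of p 0 x0] by (intro mult_left_mono) (auto simp: Q0_def)
    also have "\<dots> < 1 / 2 * l ^ CARD('n)" using k l by (intro mult_strict_right_mono) (auto simp: \<theta>_def)
    finally show False by simp
  qed
  then show ?thesis using x by (simp add: q_def \<epsilon>_def Q0_def p_def l_def)
qed


section \<open>Decay of oscillation and continuity of potentials\<close>

definition oscillation_decay :: "real \<Rightarrow> bool" where
  "oscillation_decay \<gamma> \<longleftrightarrow> (\<forall>u B x0 R \<alpha> w \<epsilon>. u \<in> borel_measurable borel \<longrightarrow> (\<forall>x. \<bar>u x\<bar> \<le> B) \<longrightarrow>
     (\<forall>s x. 0 \<le> s \<longrightarrow> \<bar>(\<integral>y. u y \<partial>T s x) - u x\<bar> \<le> s) \<longrightarrow> 0 < R \<longrightarrow> 0 < \<epsilon> \<longrightarrow> (\<forall>x\<in>cball x0 R. \<alpha> \<le> u x \<and> u x \<le> \<alpha> + w) \<longrightarrow>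
     (\<exists>r>0. \<exists>\<alpha>'. \<forall>x\<in>cball x0 r. \<alpha>' \<le> u x \<and> u x \<le> \<alpha>' + ((1 - \<gamma>) * w + \<epsilon>)))"

text \<open>One of \<open>u - \<alpha>\<close> and \<open>\<alpha> + w - u\<close> is at least
  \<open>w / 2\<close> on half of the cell; growth applied to it moves one end of the interval by
  \<open>c^k * (w / 2)\<close>. As \<open>c\<close> and \<open>k\<close> come from
  \<open>near_full\<close>, they depend neither on \<open>u\<close> nor on the scale.\<close>

lemma oscillation_decay_exists: "\<exists>\<gamma>. 0 < \<gamma> \<and> \<gamma> < 1 \<and> oscillation_decay \<gamma>"
proof -
  obtain m c1 \<epsilon>0 e1 where m: "0 < m" and c1: "0 < c1" and \<epsilon>0: "0 < \<epsilon>0" "\<epsilon>0 < 1" and e1: "0 < e1" and nf1: "near_full_bound m c1 \<epsilon>0 e1"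
    using near_full by blast
  define c where "c = min c1 1"
  have c: "0 < c" "c \<le> 1" using c1 by (auto simp: c_def)
  have "c * (real m * \<rho>\<^sup>2) \<le> c1 * (real m * \<rho>\<^sup>2)" for \<rho> by (intro mult_right_mono) (auto simp: c_def)
  then have nf: "near_full_bound m c \<epsilon>0 e1" using nf1 unfolding near_full_bound_def by (meson order_trans)
  obtain K e0 where K: "0 < K" "0 < e0" and exit: "\<forall>\<rho> e s x. 0 < \<rho> \<longrightarrow> 0 \<le> e \<longrightarrow> e \<le> e0 \<longrightarrow> small_drift \<rho> e \<longrightarrow> 0 \<le> s \<longrightarrow> s \<le> \<rho>\<^sup>2 \<longrightarrow>
     measure (T s x) (- cball x \<rho>) \<le> K * (s / \<rho>\<^sup>2 + e)"
    using exit_probability by blast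
  obtain k where k: "(1 - \<epsilon>0) ^ k < 1 / 2" using real_arch_pow_inv[of "1 / 2" "1 - \<epsilon>0"] \<epsilon>0 by auto
  define \<gamma> where "\<gamma> = c ^ k / 2"
  have ck: "0 < c ^ k" "c ^ k \<le> 1" using c by (auto simp: power_le_one)
  have core: "\<exists>r>0. \<exists>\<alpha>'. \<forall>x\<in>cball x0 r. \<alpha>' \<le> u x \<and> u x \<le> \<alpha>' + ((1 - \<gamma>) * w + \<epsilon>)"
    if u [measurable]: "u \<in> borel_measurable borel" and uB: "\<And>x. \<bar>u x\<bar> \<le> B" and inv: "\<And>s x. 0 \<le> s \<Longrightarrow> \<bar>(\<integral>y. u y \<partial>T s x) - u x\<bar> \<le> s"
      and R: "0 < R" and \<epsilon>: "0 < \<epsilon>" and bnd: "\<And>x. x \<in> cball x0 R \<Longrightarrow> \<alpha> \<le> u x \<and> u x \<le> \<alpha> + w" for u B x0 R \<alpha> w \<epsilon>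
  proof -
    have w: "0 \<le> w" using bnd[of x0] R by simp
    define Bv where "Bv = B + \<bar>\<alpha>\<bar> + w"
    have Bv: "0 \<le> Bv" using uB[of 0] w by (simp add: Bv_def)
    \<comment> \<open>The exit probability that may be tolerated in \<open>k\<close> steps at a
      total cost of \<open>\<epsilon> / 2\<close>; the other half is reserved for the time errors
      \<open>m r^2\<close>.\<close>
    define \<kappa> where "\<kappa> = \<epsilon> / (2 * (real k * Bv + 1))"
    have kB: "0 < real k * Bv + 1" using Bv by (simp add: add_nonneg_pos)
    have \<kappa>: "0 < \<kappa>" using \<epsilon> kB by (simp add: \<kappa>_def)
    have cancel: "A * (\<epsilon> / (2 * A)) = \<epsilon> / 2" if "A \<noteq> 0" for A using that by simp
    have kBv: "real k * (Bv * \<kappa>) \<le> \<epsilon> / 2"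
    proof -
      have "real k * Bv * \<kappa> \<le> (real k * Bv + 1) * \<kappa>" using \<kappa> by (intro mult_right_mono) auto
      also have "\<dots> = \<epsilon> / 2" unfolding \<kappa>_def by (rule cancel) (use kB in simp)
      finally show ?thesis by (simp add: mult.assoc)
    qed
    define e' where "e' = min e0 (\<kappa> / (2 * K))"
    have e': "0 < e'" "e' \<le> e0" "e' \<le> \<kappa> / (2 * K)" using K \<kappa> by (auto simp: e'_def)
    obtain \<rho>1 where \<rho>1: "0 < \<rho>1" "\<forall>\<rho>. 0 < \<rho> \<longrightarrow> \<rho> \<le> \<rho>1 \<longrightarrow> small_drift \<rho> e'" using small_drift_exists[OF e'(1)] by blast
    obtain \<rho>2 where \<rho>2: "0 < \<rho>2" "\<forall>\<rho>. 0 < \<rho> \<longrightarrow> \<rho> \<le> \<rho>2 \<longrightarrow> small_drift \<rho> e1" using small_drift_exists[OF e1] by blast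
    \<comment> \<open>The exit radius is fixed before \<open>r\<close>: the drift must be small at
      scale \<open>\<rho>\<close>, and then \<open>r\<close> is taken so small that
      \<open>m r^2\<close> is negligible against \<open>\<rho>\<^sup>2\<close>.\<close>
    define \<rho> where "\<rho> = min \<rho>1 (R / 2)"
    have \<rho>: "0 < \<rho>" "\<rho> \<le> R / 2" and sd: "small_drift \<rho> e'" using \<rho>1 R by (auto simp: \<rho>_def)
    have small: "eventually (\<lambda>r. C * r < \<eta>) (at_right 0)" "eventually (\<lambda>r. C * r\<^sup>2 < \<eta>) (at_right 0)" if "0 < \<eta>" for C \<eta> :: real
    proof -
      have "((\<lambda>r. C * r) \<longlongrightarrow> C * 0) (at_right 0)" "((\<lambda>r. C * r\<^sup>2) \<longlongrightarrow> C * 0\<^sup>2) (at_right 0)" by (intro tendsto_intros)+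
      then show "eventually (\<lambda>r. C * r < \<eta>) (at_right 0)" "eventually (\<lambda>r. C * r\<^sup>2 < \<eta>) (at_right 0)"
        using that by (auto dest!: order_tendstoD(2)[where a = \<eta>])
    qed
    have "eventually (\<lambda>r. (0 :: real) < r) (at_right 0)" by (rule eventually_at_right_less)
    moreover have "eventually (\<lambda>r. 1 * r < \<rho>2) (at_right 0)" by (rule small(1)) (rule \<rho>2)
    moreover have "eventually (\<lambda>r. real m * r\<^sup>2 < \<rho>\<^sup>2) (at_right 0)" by (rule small(2)) (use \<rho> in simp)
    moreover have "eventually (\<lambda>r. real m * r\<^sup>2 < \<rho>\<^sup>2 * (\<kappa> / (2 * K))) (at_right 0)" by (rule small(2)) (use \<rho> \<kappa> K in simp)
    moreover have "eventually (\<lambda>r. real k * real m * r\<^sup>2 < \<epsilon> / 2) (at_right 0)" by (rule small(2)) (use \<epsilon> in simp)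
    moreover have "eventually (\<lambda>r. 3 * sqrt CARD('n) * r < R) (at_right 0)" by (rule small(1)) (rule R)
    ultimately have "eventually (\<lambda>r. 0 < r \<and> r \<le> \<rho>2 \<and> real m * r\<^sup>2 \<le> \<rho>\<^sup>2 \<and> real m * r\<^sup>2 \<le> \<rho>\<^sup>2 * (\<kappa> / (2 * K)) \<and>
        real k * (real m * r\<^sup>2) \<le> \<epsilon> / 2 \<and> 3 * sqrt CARD('n) * r \<le> R) (at_right 0)"
      by eventually_elim (simp add: mult.assoc)
    then obtain r where r: "0 < r" "r \<le> \<rho>2" "real m * r\<^sup>2 \<le> \<rho>\<^sup>2" "real m * r\<^sup>2 \<le> \<rho>\<^sup>2 * (\<kappa> / (2 * K))"
        "real k * (real m * r\<^sup>2) \<le> \<epsilon> / 2" "3 * sqrt CARD('n) * r \<le> R"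
      by (metis (mono_tags, lifting) eventually_happens trivial_limit_at_right_real)
    have D: "cball x0 R \<in> sets borel" by simp
    have D3: "cball x0 (3 * sqrt CARD('n) * r) \<subseteq> cball x0 R" using r(6) by (intro subset_cball)
    have exitD: "measure (T s x) (- cball x0 R) \<le> \<kappa>" if x: "x \<in> cube x0 r" and s: "0 \<le> s" "s \<le> real m * r\<^sup>2" for s x
    proof -
      have "norm (x - x0) \<le> sqrt CARD('n) * r" by (rule cube_norm_le[OF x])
      moreover have "0 \<le> sqrt CARD('n) * r" using r by simp
      ultimately have dx: "dist x0 x \<le> R / 2" using r(6) by (simp add: dist_norm norm_minus_commute)
      have sub: "cball x \<rho> \<subseteq> cball x0 R"
      proof
        fix y assume "y \<in> cball x \<rho>"
        then show "y \<in> cball x0 R" using \<rho>(2) dx dist_triangle[of x0 y x] by simp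
      qed
      interpret prob_space "T s x" by (rule T_prob)
      have "measure (T s x) (- cball x0 R) \<le> measure (T s x) (- cball x \<rho>)" using sub by (intro finite_measure_mono) auto
      also have "\<dots> \<le> K * (s / \<rho>\<^sup>2 + e')" using exit \<rho>(1) e' sd s r(3) by auto
      also have "\<dots> \<le> K * (\<kappa> / (2 * K) + \<kappa> / (2 * K))"
      proof -
        have "s \<le> \<rho>\<^sup>2 * (\<kappa> / (2 * K))" using s(2) r(4) by (rule order_trans)
        then have "s / \<rho>\<^sup>2 \<le> \<kappa> / (2 * K)" using \<rho>(1) by (simp add: divide_le_eq mult.commute)
        then show ?thesis using K(1) e'(3) by (intro mult_left_mono add_mono) auto
      qed
      also have "\<dots> = \<kappa>" using K(1) by (simp add: distrib_left)
      finally show ?thesis .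
    qed
    define Q where "Q = dcell (corner x0 r) (2 * r) 0 x0"
    have l: "0 < 2 * r" using r by simp
    have Qm [measurable]: "Q \<in> sets borel" unfolding Q_def by (rule dcell_borel[OF l])
    have grow: "c ^ k * (w / 2) - \<epsilon> \<le> v x"
      if v: "v \<in> borel_measurable borel" "\<And>x. \<bar>v x\<bar> \<le> Bv" and vinv: "\<And>s x. 0 \<le> s \<Longrightarrow> \<bar>(\<integral>y. v y \<partial>T s x) - v x\<bar> \<le> s"
        and pos: "\<And>x. x \<in> cball x0 R \<Longrightarrow> 0 \<le> v x" and half: "(2 * r) ^ CARD('n) / 2 \<le> vol ({x. w / 2 \<le> v x} \<inter> Q)" and x: "x \<in> Q" for v x
    proof -
      have "c ^ k * (w / 2) - real k * (Bv * \<kappa> + real m * r\<^sup>2) \<le> v x"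
      proof (rule growth_iterate[OF nf c \<epsilon>0 _ m r(1) _ v vinv D pos D3 exitD _ _ half[unfolded Q_def] k x[unfolded Q_def]])
        show "0 \<le> e1" "0 \<le> \<kappa>" "0 \<le> w / 2" using e1 \<kappa> w by auto
        show "small_drift \<rho>' e1" if "0 < \<rho>'" "\<rho>' \<le> r" for \<rho>' using \<rho>2(2) that r(2) by auto
      qed
      moreover have "real k * (Bv * \<kappa> + real m * r\<^sup>2) \<le> \<epsilon>" using kBv r(5) by (simp add: distrib_left)
      ultimately show ?thesis by linarith
    qed
    have iu: "integrable (T s x) u" for s x
    proof -
      interpret prob_space "T s x" by (rule T_prob)
      show ?thesis by (rule integrable_const_bound[where B = B]) (use uB u in \<open>auto cong: measurable_cong_sets\<close>)
    qed
    have shift: "(\<integral>y. u y - \<alpha> \<partial>T s x) = (\<integral>y. u y \<partial>T s x) - \<alpha>" "(\<integral>y. \<alpha> + w - u y \<partial>T s x) = \<alpha> + w - (\<integral>y. u y \<partial>T s x)" for s x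
    proof -
      interpret prob_space "T s x" by (rule T_prob)
      show "(\<integral>y. u y - \<alpha> \<partial>T s x) = (\<integral>y. u y \<partial>T s x) - \<alpha>" "(\<integral>y. \<alpha> + w - u y \<partial>T s x) = \<alpha> + w - (\<integral>y. u y \<partial>T s x)"
        using iu prob_space by (simp_all add: Bochner_Integration.integral_diff)
    qed
    have QD: "dcell (corner x0 r) (2 * r) 0 x0 \<subseteq> cube x0 r" by (rule dcell_corner_subset[OF r(1)])
    have cQ: "cball x0 (r / 2) \<subseteq> Q" unfolding Q_def by (rule cball_subset_dcell_corner[OF r(1)])
    have in_D: "x \<in> cball x0 R" if "x \<in> Q" for x
    proof -
      have "norm (x - x0) \<le> sqrt CARD('n) * r" using that QD by (intro cube_norm_le) (auto simp: Q_def)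
      moreover have "0 \<le> sqrt CARD('n) * r" using r by simp
      ultimately show ?thesis using r(6) by (simp add: dist_norm norm_minus_commute)
    qed
    \<comment> \<open>The upper and the lower half of the range cover the cell, so one of the two
      sets has at least half of its volume.\<close>
    have total: "(2 * r) ^ CARD('n) \<le> vol ({x. w / 2 \<le> u x - \<alpha>} \<inter> Q) + vol ({x. w / 2 \<le> \<alpha> + w - u x} \<inter> Q)"
    proof -
      have fm: "Q \<in> fmeasurable lborel" unfolding Q_def using dcell_measure(1)[OF l, of "corner x0 r" 0 x0]
        by (simp add: fmeasurable_def dcell_borel[OF l])
      have *: "{x. w / 2 \<le> u x - \<alpha>} \<inter> Q \<in> fmeasurable lborel" "{x. w / 2 \<le> \<alpha> + w - u x} \<inter> Q \<in> fmeasurable lborel"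
        by (rule fmeasurableI2[OF fm], blast, measurable)+
      have "(2 * r) ^ CARD('n) = vol Q" unfolding Q_def using dcell_measure(2)[OF l, of "corner x0 r" 0 x0] by simp
      also have "Q = ({x. w / 2 \<le> u x - \<alpha>} \<inter> Q) \<union> ({x. w / 2 \<le> \<alpha> + w - u x} \<inter> Q)"
      proof -
        have "w / 2 \<le> u x - \<alpha> \<or> w / 2 \<le> \<alpha> + w - u x" for x by linarith
        then show ?thesis by blast
      qed
      also have "vol \<dots> \<le> vol ({x. w / 2 \<le> u x - \<alpha>} \<inter> Q) + vol ({x. w / 2 \<le> \<alpha> + w - u x} \<inter> Q)"
        using * by (intro measure_Un_le) auto
      finally show ?thesis .
    qed
    have w': "(1 - \<gamma>) * w + \<epsilon> = w - c ^ k * (w / 2) + \<epsilon>" by (simp add: \<gamma>_def algebra_simps)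
    consider "(2 * r) ^ CARD('n) / 2 \<le> vol ({x. w / 2 \<le> u x - \<alpha>} \<inter> Q)"
      | "(2 * r) ^ CARD('n) / 2 \<le> vol ({x. w / 2 \<le> \<alpha> + w - u x} \<inter> Q)" using total by linarith
    then show ?thesis
    proof cases
      case 1
      have "c ^ k * (w / 2) - \<epsilon> \<le> u x - \<alpha>" if "x \<in> Q" for x
      proof (rule grow[OF _ _ _ _ 1 that])
        show "\<bar>u x - \<alpha>\<bar> \<le> Bv" for x using uB[of x] w by (simp add: Bv_def)
        show "\<bar>(\<integral>y. u y - \<alpha> \<partial>T s x) - (u x - \<alpha>)\<bar> \<le> s" if "0 \<le> s" for s x using inv[OF that, of x] unfolding shift abs_le_iff by linarith
        show "0 \<le> u x - \<alpha>" if "x \<in> cball x0 R" for x using bnd[OF that] by simp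
      qed measurable
      then have "\<forall>x\<in>cball x0 (r / 2). \<alpha> + c ^ k * (w / 2) - \<epsilon> \<le> u x \<and> u x \<le> (\<alpha> + c ^ k * (w / 2) - \<epsilon>) + ((1 - \<gamma>) * w + \<epsilon>)"
        unfolding w' using cQ in_D bnd by (smt (verit) subsetD)
      then show ?thesis using r(1) by (intro exI[of _ "r / 2"] conjI exI) auto
    next
      case 2
      have "c ^ k * (w / 2) - \<epsilon> \<le> \<alpha> + w - u x" if "x \<in> Q" for x
      proof (rule grow[OF _ _ _ _ 2 that])
        show "\<bar>\<alpha> + w - u x\<bar> \<le> Bv" for x using uB[of x] w unfolding Bv_def by linarith
        show "\<bar>(\<integral>y. \<alpha> + w - u y \<partial>T s x) - (\<alpha> + w - u x)\<bar> \<le> s" if "0 \<le> s" for s x using inv[OF that, of x] unfolding shift abs_le_iff by linarith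
        show "0 \<le> \<alpha> + w - u x" if "x \<in> cball x0 R" for x using bnd[OF that] by simp
      qed measurable
      then have "\<forall>x\<in>cball x0 (r / 2). \<alpha> \<le> u x \<and> u x \<le> \<alpha> + ((1 - \<gamma>) * w + \<epsilon>)"
        unfolding w' using cQ in_D bnd by (smt (verit) subsetD)
      then show ?thesis using r(1) by (intro exI[of _ "r / 2"] conjI exI) auto
    qed
  qed
  have "oscillation_decay \<gamma>"
    unfolding oscillation_decay_def
  proof (intro allI impI)
    fix u :: "real ^ 'n \<Rightarrow> real" and x0 and B R \<alpha> w \<epsilon> :: real
    assume "u \<in> borel_measurable borel" "\<forall>x. \<bar>u x\<bar> \<le> B" "\<forall>s x. 0 \<le> s \<longrightarrow> \<bar>(\<integral>y. u y \<partial>T s x) - u x\<bar> \<le> s" "0 < R" "0 < \<epsilon>"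
      and bnd: "\<forall>x\<in>cball x0 R. \<alpha> \<le> u x \<and> u x \<le> \<alpha> + w"
    then show "\<exists>r>0. \<exists>\<alpha>'. \<forall>x\<in>cball x0 r. \<alpha>' \<le> u x \<and> u x \<le> \<alpha>' + ((1 - \<gamma>) * w + \<epsilon>)"
      by (intro core[where B = B and R = R]) auto
  qed
  moreover have "0 < \<gamma>" "\<gamma> < 1" using ck by (auto simp: \<gamma>_def)
  ultimately show ?thesis by blast
qed

text \<open>The infimum \<open>I\<close> of the interval lengths that bound \<open>u\<close> on some
  ball about \<open>x0\<close> satisfies \<open>I \<le> (1 - \<gamma>) * w + \<epsilon>\<close> for
  \<open>w\<close> close to \<open>I\<close> and arbitrary positive \<open>\<epsilon>\<close>; hence
  it is 0.\<close>

lemma almost_invariant_continuous: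
  fixes u :: "real ^ 'n \<Rightarrow> real"
  assumes u: "u \<in> borel_measurable borel" "\<And>x. \<bar>u x\<bar> \<le> B" and inv: "\<And>s x. 0 \<le> s \<Longrightarrow> \<bar>(\<integral>y. u y \<partial>T s x) - u x\<bar> \<le> s"
  shows "continuous_on UNIV u"
  unfolding continuous_on_iff
proof (intro ballI allI impI)
  fix x0 :: "real ^ 'n" and \<eta> :: real assume \<eta>: "0 < \<eta>"
  obtain \<gamma> where \<gamma>: "0 < \<gamma>" "\<gamma> < 1" and decay: "oscillation_decay \<gamma>"
    using oscillation_decay_exists by blast
  define W where "W = {w. \<exists>R>0. \<exists>\<alpha>. \<forall>x\<in>cball x0 R. \<alpha> \<le> u x \<and> u x \<le> \<alpha> + w}"
  have W0: "0 \<le> w" if "w \<in> W" for w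
  proof -
    obtain R \<alpha> where "0 < R" "\<forall>x\<in>cball x0 R. \<alpha> \<le> u x \<and> u x \<le> \<alpha> + w" using \<open>w \<in> W\<close> by (auto simp: W_def)
    then have "\<alpha> \<le> u x0" "u x0 \<le> \<alpha> + w" by auto
    then show ?thesis by linarith
  qed
  have step: "(1 - \<gamma>) * w + \<epsilon> \<in> W" if "w \<in> W" "0 < \<epsilon>" for w \<epsilon>
  proof -
    obtain R \<alpha> where "0 < R" "\<forall>x\<in>cball x0 R. \<alpha> \<le> u x \<and> u x \<le> \<alpha> + w" using \<open>w \<in> W\<close> by (auto simp: W_def)
    then show ?thesis
      unfolding W_def mem_Collect_eq
      by (intro decay[unfolded oscillation_decay_def, rule_format, OF u inv]) (use \<open>0 < \<epsilon>\<close> in auto)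
  qed
  have "- B \<le> u x \<and> u x \<le> - B + 2 * B" for x using u(2)[of x] by (simp add: abs_le_iff)
  then have "2 * B \<in> W" unfolding W_def mem_Collect_eq by (meson zero_less_one)
  then have ne: "W \<noteq> {}" by blast
  have bd: "bdd_below W" using W0 by (meson bdd_below.I)
  define I where "I = Inf W"
  have I_le: "I \<le> w" if "w \<in> W" for w unfolding I_def by (rule cInf_lower[OF that bd])
  have I0: "0 \<le> I" unfolding I_def using W0 by (intro cInf_greatest[OF ne])
  have "I = 0"
  proof (rule ccontr)
    assume "I \<noteq> 0"
    then have Ip: "0 < I" using I0 by simp
    define \<epsilon> where "\<epsilon> = \<gamma> * I / 4"
    have \<epsilon>: "0 < \<epsilon>" using Ip \<gamma> by (simp add: \<epsilon>_def)
    obtain w where w: "w \<in> W" "w < I + \<epsilon>" using cInf_lessD[OF ne, of "I + \<epsilon>"] \<epsilon> by (auto simp: I_def)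
    have "I \<le> (1 - \<gamma>) * w + \<epsilon>" by (rule I_le[OF step[OF w(1) \<epsilon>]])
    also have "(1 - \<gamma>) * w \<le> (1 - \<gamma>) * (I + \<epsilon>)" using w(2) \<gamma> by (intro mult_left_mono) auto
    also have "(1 - \<gamma>) * (I + \<epsilon>) = I - \<gamma> * I + \<epsilon> - \<gamma> * \<epsilon>" by (simp add: algebra_simps)
    finally have "\<gamma> * I + \<gamma> * \<epsilon> \<le> 2 * \<epsilon>" by simp
    moreover have "0 < \<gamma> * \<epsilon>" "\<gamma> * I = 4 * \<epsilon>" using \<gamma> \<epsilon> by (auto simp: \<epsilon>_def)
    ultimately show False using \<epsilon> by linarith
  qed
  then obtain w where w: "w \<in> W" "w < \<eta>" using cInf_lessD[OF ne, of \<eta>] \<eta> by (auto simp: I_def)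
  then obtain R \<alpha> where R: "0 < R" and bnd: "\<forall>x\<in>cball x0 R. \<alpha> \<le> u x \<and> u x \<le> \<alpha> + w" by (auto simp: W_def)
  show "\<exists>d>0. \<forall>x\<in>UNIV. dist x x0 < d \<longrightarrow> dist (u x) (u x0) < \<eta>"
  proof (intro exI[of _ R] conjI R ballI impI)
    fix x assume "dist x x0 < R"
    then have "x \<in> cball x0 R" "x0 \<in> cball x0 R" using R by (auto simp: dist_commute)
    then have "\<alpha> \<le> u x \<and> u x \<le> \<alpha> + w" "\<alpha> \<le> u x0 \<and> u x0 \<le> \<alpha> + w" using bnd by blast+
    then show "dist (u x) (u x0) < \<eta>" using w(2) unfolding dist_real_def abs_less_iff by linarith
  qed
qed

lemma potential_continuous:
  fixes f :: "real ^ 'n \<Rightarrow> real"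
  assumes f: "f \<in> borel_measurable borel" "\<And>x. 0 \<le> f x" "\<And>x. f x \<le> 1" and t: "0 \<le> t"
  shows "continuous_on UNIV (\<lambda>x. \<integral>y. f y \<partial>V t x)"
  by (rule almost_invariant_continuous[where B = t])
    (use integral_V_measurable[OF f(1,2)] integral_V_bounds[OF f t] potential_almost_invariant[OF f t] in auto)

end

section \<open>The transition kernels of a quasi-diffusion\<close>

lemma floor_approx_tendsto: "(\<lambda>n. real_of_int \<lfloor>real (Suc n) * t\<rfloor> / real (Suc n)) \<longlonglongrightarrow> t"
proof (rule LIMSEQ_I)
  fix e :: real assume "0 < e"
  then obtain n0 where n0: "1 / real (Suc n0) < e" using nat_approx_posE by blast
  have "norm (real_of_int \<lfloor>real (Suc n) * t\<rfloor> / real (Suc n) - t) < e" if "n0 \<le> n" for n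
  proof -
    have "\<bar>real_of_int \<lfloor>real (Suc n) * t\<rfloor> - real (Suc n) * t\<bar> \<le> 1" by linarith
    moreover have "real_of_int \<lfloor>real (Suc n) * t\<rfloor> / real (Suc n) - t = (real_of_int \<lfloor>real (Suc n) * t\<rfloor> - real (Suc n) * t) / real (Suc n)"
      by (simp add: diff_divide_distrib)
    ultimately have "\<bar>real_of_int \<lfloor>real (Suc n) * t\<rfloor> / real (Suc n) - t\<bar> \<le> 1 / real (Suc n)"
      by (simp only: abs_divide abs_of_nat) (intro divide_right_mono, auto)
    also have "\<dots> \<le> 1 / real (Suc n0)" using that by (intro divide_left_mono) auto
    finally show ?thesis using n0 by simp
  qed
  then show "\<exists>n0. \<forall>n\<ge>n0. norm (real_of_int \<lfloor>real (Suc n) * t\<rfloor> / real (Suc n) - t) < e" by blast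
qed

text \<open>The process sampled at the left end points of a time mesh takes countably many times
  only, and it converges by continuity of the paths.\<close>

lemma continuous_process_measurable:
  fixes Y :: "real \<Rightarrow> 'w \<Rightarrow> 'b :: metric_space"
  assumes Y: "\<And>t. Y t \<in> borel_measurable M" and cont: "\<And>\<omega>. \<omega> \<in> space M \<Longrightarrow> continuous_on UNIV (\<lambda>t. Y t \<omega>)"
  shows "(\<lambda>(t, \<omega>). Y t \<omega>) \<in> borel_measurable (borel \<Otimes>\<^sub>M M)"
proof (rule borel_measurable_LIMSEQ_metric)
  fix n :: nat
  note [measurable] = Y
  show "(\<lambda>p. (\<lambda>(i :: int) p. Y (real_of_int i / real (Suc n)) (snd p)) \<lfloor>real (Suc n) * fst p\<rfloor> p) \<in> borel_measurable (borel \<Otimes>\<^sub>M M)"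
    by (rule measurable_compose_countable) measurable
next
  fix p :: "real \<times> 'w" assume "p \<in> space (borel \<Otimes>\<^sub>M M)"
  then have "snd p \<in> space M" by (auto simp: space_pair_measure)
  then have "isCont (\<lambda>t. Y t (snd p)) (fst p)" using cont continuous_on_eq_continuous_at open_UNIV by blast
  from isCont_tendsto_compose[OF this floor_approx_tendsto]
  show "(\<lambda>n. (\<lambda>(i :: int) p. Y (real_of_int i / real (Suc n)) (snd p)) \<lfloor>real (Suc n) * fst p\<rfloor> p) \<longlonglongrightarrow> (case p of (t, \<omega>) \<Rightarrow> Y t \<omega>)"
    by (simp add: case_prod_beta)
qed

lemma measure_open_limit:
  fixes U :: "'b :: metric_space set"
  assumes \<mu>: "finite_measure \<mu>" "sets \<mu> = sets borel"
    and f: "\<And>k. continuous_on UNIV (f k)" "\<And>k y. 0 \<le> f k y" "\<And>k y. f k y \<le> (1 :: real)" "\<And>y. (\<lambda>k. f k y) \<longlonglongrightarrow> indicator U y" and U: "open U"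
  shows "(\<lambda>k. \<integral>y. f k y \<partial>\<mu>) \<longlonglongrightarrow> measure \<mu> U"
proof -
  interpret finite_measure \<mu> by fact
  have fm: "f k \<in> borel_measurable \<mu>" for k using borel_measurable_continuous_onI[OF f(1)] \<mu>(2) by (simp cong: measurable_cong_sets)
  have Um [measurable]: "U \<in> sets \<mu>" using U \<mu>(2) by simp
  have "(\<lambda>k. \<integral>y. f k y \<partial>\<mu>) \<longlonglongrightarrow> (\<integral>y. indicator U y \<partial>\<mu>)"
    by (rule integral_dominated_convergence[where w = "\<lambda>_. 1"]) (use f fm in auto)
  then show ?thesis using sets_eq_imp_space_eq[OF \<mu>(2)] by simp
qed

text \<open>Indicators of open sets are limits of continuous functions with values in
  \<open>[0, 1]\<close>, and the open sets form a generator stable under intersection.\<close>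

lemma finite_measure_eqI_continuous:
  fixes \<mu> \<nu> :: "'b :: metric_space measure"
  assumes \<mu>: "finite_measure \<mu>" "sets \<mu> = sets borel" and \<nu>: "finite_measure \<nu>" "sets \<nu> = sets borel"
    and eq: "\<And>f. continuous_on UNIV f \<Longrightarrow> (\<And>y. 0 \<le> f y) \<Longrightarrow> (\<And>y. f y \<le> (1 :: real)) \<Longrightarrow> (\<integral>y. f y \<partial>\<mu>) = (\<integral>y. f y \<partial>\<nu>)"
  shows "\<mu> = \<nu>"
proof (rule measure_eqI_generator_eq[where E = "{U. open U}" and \<Omega> = UNIV and A = "\<lambda>_. UNIV"])
  show "Int_stable {U :: 'b set. open U}" by (auto simp: Int_stable_def)
  show "sets \<mu> = sigma_sets UNIV {U. open U}" "sets \<nu> = sigma_sets UNIV {U. open U}" using \<mu>(2) \<nu>(2) by (simp_all add: borel_def)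
  show "emeasure \<mu> UNIV \<noteq> \<infinity>" using finite_measure.emeasure_finite[OF \<mu>(1)] by simp
  fix U :: "'b set" assume "U \<in> {U. open U}"
  then have U: "open U" by simp
  obtain f :: "nat \<Rightarrow> 'b \<Rightarrow> real" where f: "\<And>k. continuous_on UNIV (f k)" "\<And>k y. 0 \<le> f k y" "\<And>k y. f k y \<le> 1" "\<And>y. (\<lambda>k. f k y) \<longlonglongrightarrow> indicator U y" "\<And>k y. y \<notin> U \<Longrightarrow> f k y = 0"
    using open_indicator_limit[OF U] by metis
  have "measure \<mu> U = measure \<nu> U"
    using measure_open_limit[OF \<mu> f(1-4) U] measure_open_limit[OF \<nu> f(1-4) U] eq[OF f(1-3)] LIMSEQ_unique by simp
  then show "emeasure \<mu> U = emeasure \<nu> U"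
    using finite_measure.emeasure_eq_measure[OF \<mu>(1)] finite_measure.emeasure_eq_measure[OF \<nu>(1)] by simp
qed auto

section \<open>Kernels, Chapman-Kolmogorov and Dynkin's formula for the process\<close>

locale quasi_diffusion_process = elliptic_operator a b \<delta>
  for a :: "real ^ 'n \<Rightarrow> real ^ 'n ^ 'n" and b :: "real ^ 'n \<Rightarrow> real ^ 'n" and \<delta> :: real +
  fixes K :: real and M0 :: "'w measure" and M :: "real \<Rightarrow> 'w measure"
    and P :: "real ^ 'n \<Rightarrow> 'w measure" and X :: "real \<Rightarrow> 'w \<Rightarrow> real ^ 'n"
  assumes drift_norm: "Ld_norm_le b K" and quasi_diffusion: "quasi_diffusion a b M0 M P X"
begin

lemma P_prob: "prob_space (P x)" and sets_P [simp, measurable_cong]: "sets (P x) = sets M0"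
  and M_subalgebra: "0 \<le> t \<Longrightarrow> subalgebra M0 (M t)"
  and M_mono: "0 \<le> s \<Longrightarrow> s \<le> t \<Longrightarrow> sets (M s) \<subseteq> sets (M t)"
  and X_M: "0 \<le> t \<Longrightarrow> X t \<in> M t \<rightarrow>\<^sub>M borel"
  and P_measurable: "0 \<le> t \<Longrightarrow> \<Gamma> \<in> sets borel \<Longrightarrow> (\<lambda>x. measure (P x) {\<omega>\<in>space M0. X t \<omega> \<in> \<Gamma>}) \<in> borel_measurable borel"
  and Markov: "0 \<le> s \<Longrightarrow> 0 \<le> t \<Longrightarrow> \<Gamma> \<in> sets borel \<Longrightarrow> AE \<omega> in P x.
        real_cond_exp (P x) (M t) (\<lambda>\<omega>'. indicator \<Gamma> (X (t + s) \<omega>')) \<omega> = measure (P (X t \<omega>)) {\<omega>'\<in>space M0. X s \<omega>' \<in> \<Gamma>}"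
  and paths: "\<omega> \<in> space M0 \<Longrightarrow> continuous_on {0..} (\<lambda>t. X t \<omega>)"
  and drift_time: "0 \<le> t \<Longrightarrow> (\<integral>\<^sup>+\<omega>. (\<integral>\<^sup>+s\<in>{0..t}. ennreal (norm (b (X s \<omega>))) \<partial>lborel) \<partial>P x) < \<infinity>"
  and Dynkin_X: "0 \<le> t \<Longrightarrow> C2c_fun u \<Longrightarrow> u x = (\<integral>\<omega>. u (X t \<omega>) \<partial>P x) - (\<integral>\<omega>. (LINT s:{0..t}|lborel. Lop a b u (X s \<omega>)) \<partial>P x)"
  using quasi_diffusion unfolding quasi_diffusion_def markov_process_def continuous_paths_def by simp_all

lemma space_P [simp]: "space (P x) = space M0"
  by (rule sets_eq_imp_space_eq) simp

lemma space_M: "0 \<le> t \<Longrightarrow> space (M t) = space M0"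
  using M_subalgebra[of t] by (simp add: subalgebra_def)

lemma X_measurable: "0 \<le> t \<Longrightarrow> X t \<in> M0 \<rightarrow>\<^sub>M borel"
  using measurable_from_subalg[OF M_subalgebra X_M] by blast

text \<open>Only times \<open>t \<ge> 0\<close> of \<open>X\<close> are meaningful. Freezing the
  path at negative times makes it continuous and measurable on the whole line.\<close>

definition Y :: "real \<Rightarrow> 'w \<Rightarrow> real ^ 'n" where "Y t = X (max 0 t)"

lemma Y_nonneg [simp]: "0 \<le> t \<Longrightarrow> Y t = X t" by (simp add: Y_def)

lemma Y_measurable [measurable]: "Y t \<in> M0 \<rightarrow>\<^sub>M borel"
  by (simp add: Y_def X_measurable)

lemma Y_continuous: "\<omega> \<in> space M0 \<Longrightarrow> continuous_on UNIV (\<lambda>t. Y t \<omega>)"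
  unfolding Y_def by (rule continuous_on_compose2[OF paths]) (auto intro!: continuous_intros)

lemma Y_joint [measurable]: "(\<lambda>(t, \<omega>). Y t \<omega>) \<in> borel \<Otimes>\<^sub>M M0 \<rightarrow>\<^sub>M borel"
  by (rule continuous_process_measurable[OF Y_measurable Y_continuous])

definition T :: "real \<Rightarrow> real ^ 'n \<Rightarrow> (real ^ 'n) measure" where "T t x = distr (P x) borel (Y t)"

lemma sets_T [simp, measurable_cong]: "sets (T t x) = sets borel" and space_T [simp]: "space (T t x) = UNIV"
  by (simp_all add: T_def)

lemma T_prob: "prob_space (T t x)"
  unfolding T_def by (rule prob_space.prob_space_distr[OF P_prob]) measurable

lemma emeasure_T: "\<Gamma> \<in> sets borel \<Longrightarrow> emeasure (T t x) \<Gamma> = ennreal (measure (P x) {\<omega>\<in>space M0. X (max 0 t) \<omega> \<in> \<Gamma>})"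
proof -
  assume "\<Gamma> \<in> sets borel"
  interpret prob_space "P x" by (rule P_prob)
  have "Y t -` \<Gamma> \<inter> space M0 = {\<omega>\<in>space M0. X (max 0 t) \<omega> \<in> \<Gamma>}" by (auto simp: Y_def)
  then show ?thesis using \<open>\<Gamma> \<in> sets borel\<close> by (simp add: T_def emeasure_distr emeasure_eq_measure)
qed

lemma T_kernel_x: "T t \<in> borel \<rightarrow>\<^sub>M subprob_algebra borel"
  by (rule measurable_subprob_algebra) (use T_prob P_measurable in \<open>auto simp: emeasure_T prob_space_imp_subprob_space\<close>)

lemma T_integral: "f \<in> borel_measurable borel \<Longrightarrow> (\<integral>y. f y \<partial>T t x) = (\<integral>\<omega>. f (Y t \<omega>) \<partial>P x)" for f :: "real ^ 'n \<Rightarrow> real"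
  unfolding T_def by (rule integral_distr) measurable

lemma T_continuous_in_time:
  fixes f :: "real ^ 'n \<Rightarrow> real"
  assumes f: "continuous_on UNIV f" "\<And>y. 0 \<le> f y" "\<And>y. f y \<le> 1"
  shows "continuous_on UNIV (\<lambda>t. \<integral>y. f y \<partial>T t x)"
proof -
  interpret prob_space "P x" by (rule P_prob)
  have fm [measurable]: "f \<in> borel_measurable borel" by (rule borel_measurable_continuous_onI[OF f(1)])
  have "(\<lambda>n. \<integral>\<omega>. f (Y (s n) \<omega>) \<partial>P x) \<longlonglongrightarrow> (\<integral>\<omega>. f (Y t \<omega>) \<partial>P x)" if "s \<longlonglongrightarrow> t" for s t
  proof (rule integral_dominated_convergence[where w = "\<lambda>_. 1"])
    show "AE \<omega> in P x. (\<lambda>n. f (Y (s n) \<omega>)) \<longlonglongrightarrow> f (Y t \<omega>)"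
    proof (rule AE_I2)
      fix \<omega> assume "\<omega> \<in> space (P x)"
      then have "continuous_on UNIV (\<lambda>t. f (Y t \<omega>))" using continuous_on_compose2[OF f(1) Y_continuous] by simp
      then have "isCont (\<lambda>t. f (Y t \<omega>)) t" using continuous_on_eq_continuous_at open_UNIV by blast
      then show "(\<lambda>n. f (Y (s n) \<omega>)) \<longlonglongrightarrow> f (Y t \<omega>)" using isCont_tendsto_compose that by blast
    qed
  qed (use f in auto)
  then show ?thesis unfolding T_integral[OF fm] continuous_on_sequentially by (auto simp: o_def)
qed

text \<open>Measurability in \<open>x\<close> is given for each time. For continuous
  \<open>f\<close> the expectation is also continuous in time, which yields joint measurability;
  open sets are reached as limits, and they generate.\<close>

lemma T_kernel: "(\<lambda>(t, x). T t x) \<in> borel \<Otimes>\<^sub>M borel \<rightarrow>\<^sub>M subprob_algebra borel"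
proof (rule measurable_subprob_algebra_generated[where G = "{U. open U}" and \<Omega> = UNIV])
  show "sets borel = sigma_sets UNIV {U :: (real ^ 'n) set. open U}" by (simp add: borel_def)
  show "Int_stable {U :: (real ^ 'n) set. open U}" by (auto simp: Int_stable_def)
  fix U :: "(real ^ 'n) set" assume "U \<in> {U. open U}"
  then have U: "open U" by simp
  obtain f :: "nat \<Rightarrow> real ^ 'n \<Rightarrow> real" where f: "\<And>k. continuous_on UNIV (f k)" "\<And>k y. 0 \<le> f k y" "\<And>k y. f k y \<le> 1" "\<And>y. (\<lambda>k. f k y) \<longlonglongrightarrow> indicator U y" "\<And>k y. y \<notin> U \<Longrightarrow> f k y = 0"
    using open_indicator_limit[OF U] by metis
  have [measurable]: "f k \<in> borel_measurable borel" for k by (rule borel_measurable_continuous_onI[OF f(1)])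
  note T_kernel_x [measurable]
  have "(\<lambda>(t, x). \<integral>y. f k y \<partial>T t x) \<in> borel_measurable (borel \<Otimes>\<^sub>M borel)" for k
    by (rule continuous_process_measurable[OF _ T_continuous_in_time[OF f(1-3)]]) measurable
  then have "(\<lambda>p. \<integral>y. f k y \<partial>T (fst p) (snd p)) \<in> borel_measurable (borel \<Otimes>\<^sub>M borel)" for k by (simp add: case_prod_beta')
  then have "(\<lambda>p. measure (T (fst p) (snd p)) U) \<in> borel_measurable (borel \<Otimes>\<^sub>M borel)"
    by (rule borel_measurable_LIMSEQ_metric)
      (rule measure_open_limit[OF prob_space.finite_measure[OF T_prob] _ f(1-4) U], simp)
  then show "(\<lambda>p. emeasure (case p of (t, x) \<Rightarrow> T t x) U) \<in> borel_measurable (borel \<Otimes>\<^sub>M borel)"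
    using finite_measure.emeasure_eq_measure[OF prob_space.finite_measure[OF T_prob]] by (simp add: case_prod_beta')
next
  have "emeasure (T t x) UNIV = 1" for t x using prob_space.emeasure_space_1[OF T_prob[of t x]] by simp
  then show "(\<lambda>p. emeasure (case p of (t, x) \<Rightarrow> T t x) UNIV) \<in> borel_measurable (borel \<Otimes>\<^sub>M borel)" by (simp add: case_prod_beta')
qed (use T_prob in \<open>auto simp: prob_space_imp_subprob_space\<close>)

text \<open>The Markov property given through \<open>real_cond_exp\<close>, integrated over an event
  of \<open>M t\<close>.\<close>

lemma Markov_set:
  assumes A: "A \<in> sets (M t)" and t: "0 \<le> t" "0 \<le> s" and \<Gamma>: "\<Gamma> \<in> sets borel"
  shows "emeasure (P x) (A \<inter> {\<omega>\<in>space M0. X (t + s) \<omega> \<in> \<Gamma>}) = (\<integral>\<^sup>+\<omega>. indicator A \<omega> * emeasure (T s (X t \<omega>)) \<Gamma> \<partial>P x)"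
proof -
  interpret prob_space "P x" by (rule P_prob)
  have "subalgebra (P x) (M t)" using M_subalgebra[OF t(1)] by (simp add: subalgebra_def)
  then interpret finite_measure_subalgebra "P x" "M t"
    by (intro finite_measure_subalgebra.intro finite_measure_axioms finite_measure_subalgebra_axioms.intro)
  have A0 [measurable]: "A \<in> sets M0" using A M_subalgebra[OF t(1)] by (auto simp: subalgebra_def)
  note [measurable] = \<Gamma> X_measurable[OF t(1)] X_measurable[OF add_nonneg_nonneg[OF t]] T_kernel_x[of s]
  define E where "E = {\<omega>\<in>space M0. X (t + s) \<omega> \<in> \<Gamma>}"
  have [measurable]: "E \<in> sets M0" unfolding E_def by measurable
  have ind: "indicator \<Gamma> (X (t + s) \<omega>) = (indicator E \<omega> :: real)" if "\<omega> \<in> space M0" for \<omega> using that by (simp add: E_def indicator_def)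
  have Tm: "measure (P y) {\<omega>'\<in>space M0. X s \<omega>' \<in> \<Gamma>} = measure (T s y) \<Gamma>" for y
    using emeasure_T[OF \<Gamma>, of s y] t by (simp add: measure_def)
  have le: "measure (T s y) \<Gamma> \<le> 1" for y by (rule prob_space.prob_le_1[OF T_prob])
  have i: "integrable (P x) (\<lambda>\<omega>. indicator \<Gamma> (X (t + s) \<omega>) :: real)"
    by (rule integrable_const_bound[where B = 1]) (auto simp: indicator_def)
  have "measure (P x) (A \<inter> E) = (LINT \<omega>:A|P x. indicator \<Gamma> (X (t + s) \<omega>))"
  proof -
    have "(LINT \<omega>:A|P x. indicator \<Gamma> (X (t + s) \<omega>)) = (\<integral>\<omega>. (indicator (A \<inter> E) \<omega> :: real) \<partial>P x)"
      unfolding set_lebesgue_integral_def by (intro Bochner_Integration.integral_cong) (auto simp: ind indicator_inter_arith)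
    then show ?thesis by simp
  qed
  also have "\<dots> = (LINT \<omega>:A|P x. real_cond_exp (P x) (M t) (\<lambda>\<omega>. indicator \<Gamma> (X (t + s) \<omega>)) \<omega>)"
    by (rule real_cond_exp_intA[OF i A])
  also have "\<dots> = (\<integral>\<omega>. indicator A \<omega> * measure (T s (X t \<omega>)) \<Gamma> \<partial>P x)"
    unfolding set_lebesgue_integral_def
    using Markov[OF t(2,1) \<Gamma>, of x] by (intro integral_cong_AE) (auto simp: Tm)
  finally have "emeasure (P x) (A \<inter> E) = ennreal (\<integral>\<omega>. indicator A \<omega> * measure (T s (X t \<omega>)) \<Gamma> \<partial>P x)"
    by (simp add: emeasure_eq_measure)
  also have "\<dots> = (\<integral>\<^sup>+\<omega>. ennreal (indicator A \<omega> * measure (T s (X t \<omega>)) \<Gamma>) \<partial>P x)"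
    by (intro nn_integral_eq_integral[symmetric] integrable_const_bound[where B = 1]) (auto simp: indicator_def le)
  also have "\<dots> = (\<integral>\<^sup>+\<omega>. indicator A \<omega> * emeasure (T s (X t \<omega>)) \<Gamma> \<partial>P x)"
    using finite_measure.emeasure_eq_measure[OF prob_space.finite_measure[OF T_prob]]
    by (intro nn_integral_cong) (auto simp: indicator_def)
  finally show ?thesis unfolding E_def .
qed

text \<open>Restricting the law to \<open>A\<close> makes both sides integrals of \<open>f\<close>
  for measures on the state space, and \<open>Markov_set\<close> says that these measures
  coincide.\<close>

lemma Markov_nn_integral:
  fixes f :: "real ^ 'n \<Rightarrow> ennreal"
  assumes A: "A \<in> sets (M t)" and t: "0 \<le> t" "0 \<le> s" and f [measurable]: "f \<in> borel_measurable borel"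
  shows "(\<integral>\<^sup>+\<omega>. indicator A \<omega> * f (X (t + s) \<omega>) \<partial>P x) = (\<integral>\<^sup>+\<omega>. indicator A \<omega> * (\<integral>\<^sup>+y. f y \<partial>T s (X t \<omega>)) \<partial>P x)"
proof -
  have A0 [measurable]: "A \<in> sets M0" using A M_subalgebra[OF t(1)] by (auto simp: subalgebra_def)
  note [measurable] = X_measurable[OF t(1)] X_measurable[OF add_nonneg_nonneg[OF t]] T_kernel_x[of s]
  define D where "D = density (P x) (indicator A)"
  have [simp, measurable_cong]: "sets D = sets M0" by (simp add: D_def)
  have [simp]: "space D = space M0" by (simp add: D_def)
  define \<nu> where "\<nu> = distr D borel (X t)"
  have k: "T s \<in> \<nu> \<rightarrow>\<^sub>M subprob_algebra borel" unfolding \<nu>_def by simp measurable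
  have "distr D borel (X (t + s)) = \<nu> \<bind> T s"
  proof (rule measure_eqI)
    have "sets (\<nu> \<bind> T s) = sets borel" by (rule sets_bind) (auto simp: \<nu>_def)
    then show "sets (distr D borel (X (t + s))) = sets (\<nu> \<bind> T s)" by simp
    fix \<Gamma> assume "\<Gamma> \<in> sets (distr D borel (X (t + s)))"
    then have \<Gamma> [measurable]: "\<Gamma> \<in> sets borel" by simp
    have "emeasure (\<nu> \<bind> T s) \<Gamma> = (\<integral>\<^sup>+y. emeasure (T s y) \<Gamma> \<partial>\<nu>)" by (rule emeasure_bind[OF _ k]) (auto simp: \<nu>_def)
    also have "\<dots> = (\<integral>\<^sup>+\<omega>. emeasure (T s (X t \<omega>)) \<Gamma> \<partial>D)" unfolding \<nu>_def by (rule nn_integral_distr) measurable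
    also have "\<dots> = (\<integral>\<^sup>+\<omega>. indicator A \<omega> * emeasure (T s (X t \<omega>)) \<Gamma> \<partial>P x)" unfolding D_def by (rule nn_integral_density) measurable
    also have "\<dots> = emeasure (P x) (A \<inter> {\<omega>\<in>space M0. X (t + s) \<omega> \<in> \<Gamma>})" by (rule Markov_set[OF A t \<Gamma>, symmetric])
    also have "\<dots> = emeasure D (X (t + s) -` \<Gamma> \<inter> space M0)"
    proof -
      have "A \<inter> {\<omega>\<in>space M0. X (t + s) \<omega> \<in> \<Gamma>} = A \<inter> (X (t + s) -` \<Gamma> \<inter> space M0)" by auto
      then show ?thesis unfolding D_def by (subst emeasure_density) (auto simp: nn_integral_indicator[symmetric] indicator_inter_arith simp del: nn_integral_indicator)
    qed
    also have "\<dots> = emeasure (distr D borel (X (t + s))) \<Gamma>" by (simp add: emeasure_distr)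
    finally show "emeasure (distr D borel (X (t + s))) \<Gamma> = emeasure (\<nu> \<bind> T s) \<Gamma>" ..
  qed
  then have "(\<integral>\<^sup>+y. f y \<partial>distr D borel (X (t + s))) = (\<integral>\<^sup>+y. f y \<partial>(\<nu> \<bind> T s))" by simp
  also have "(\<integral>\<^sup>+y. f y \<partial>(\<nu> \<bind> T s)) = (\<integral>\<^sup>+y. (\<integral>\<^sup>+w. f w \<partial>T s y) \<partial>\<nu>)" by (rule nn_integral_bind[OF f k])
  also have "\<dots> = (\<integral>\<^sup>+\<omega>. (\<integral>\<^sup>+w. f w \<partial>T s (X t \<omega>)) \<partial>D)" unfolding \<nu>_def by (rule nn_integral_distr) measurable
  finally show ?thesis by (simp add: nn_integral_distr D_def nn_integral_density)
qed

sublocale markov_kernels T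
proof (rule markov_kernels.intro)
  show "(\<lambda>(t, x). T t x) \<in> borel \<Otimes>\<^sub>M borel \<rightarrow>\<^sub>M subprob_algebra borel" by (rule T_kernel)
  show "prob_space (T t x)" for t x by (rule T_prob)
  fix s t :: real and x and f :: "real ^ 'n \<Rightarrow> ennreal"
  assume s: "0 \<le> s" and t: "0 \<le> t" and f [measurable]: "f \<in> borel_measurable borel"
  have "space M0 \<in> sets (M s)" using space_M[OF s] sets.top[of "M s"] by simp
  moreover have "(\<integral>\<^sup>+\<omega>. indicator (space M0) \<omega> * h \<omega> \<partial>P x) = (\<integral>\<^sup>+\<omega>. h \<omega> \<partial>P x)" for h
    by (rule nn_integral_cong) simp
  ultimately
  have "(\<integral>\<^sup>+\<omega>. f (X (s + t) \<omega>) \<partial>P x) = (\<integral>\<^sup>+\<omega>. (\<integral>\<^sup>+y. f y \<partial>T t (X s \<omega>)) \<partial>P x)"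
    using Markov_nn_integral[OF _ s t f, of "space M0" x] by simp
  moreover have "(\<integral>\<^sup>+y. g y \<partial>T r x) = (\<integral>\<^sup>+\<omega>. g (Y r \<omega>) \<partial>P x)" if "g \<in> borel_measurable borel" for g :: "real ^ 'n \<Rightarrow> ennreal" and r
    unfolding T_def by (rule nn_integral_distr) (use that in auto)
  moreover have "(\<lambda>y. \<integral>\<^sup>+w. f w \<partial>T t y) \<in> borel_measurable borel"
    using T_kernel_x[of t] by measurable
  ultimately show "(\<integral>\<^sup>+y. f y \<partial>T (s + t) x) = (\<integral>\<^sup>+y. (\<integral>\<^sup>+w. f w \<partial>T t y) \<partial>T s x)" using s t by simp
qed

text \<open>As an image of the product of Lebesgue measure and \<open>P x\<close> the occupation
  measure is open to Fubini, so that expectations of time integrals become integrals for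
  \<open>V t x\<close>.\<close>

lemma V_eq_distr:
  "V t x = distr (density lborel (indicator {0..t}) \<Otimes>\<^sub>M P x) borel (\<lambda>(s, \<omega>). Y s \<omega>)"
proof (rule measure_eqI)
  define D where "D = density lborel (indicator {0..t} :: real \<Rightarrow> ennreal)"
  have [simp, measurable_cong]: "sets D = sets borel" by (simp add: D_def)
  interpret prob_space "P x" by (rule P_prob)
  show "sets (V t x) = sets (distr (density lborel (indicator {0..t}) \<Otimes>\<^sub>M P x) borel (\<lambda>(s, \<omega>). Y s \<omega>))" by simp
  fix A assume "A \<in> sets (V t x)"
  then have [measurable]: "A \<in> sets borel" by simp
  have "emeasure (V t x) A = (\<integral>\<^sup>+y. indicator A y \<partial>V t x)" by simp
  also have "\<dots> = (\<integral>\<^sup>+s. indicator {0..t} s * (\<integral>\<^sup>+y. indicator A y \<partial>T s x) \<partial>lborel)" by (rule nn_integral_V) measurable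
  also have "\<dots> = (\<integral>\<^sup>+s. (\<integral>\<^sup>+y. indicator A y \<partial>T s x) \<partial>D)" unfolding D_def by (rule nn_integral_density[symmetric]) measurable
  also have "\<dots> = (\<integral>\<^sup>+s. (\<integral>\<^sup>+\<omega>. indicator A (Y s \<omega>) \<partial>P x) \<partial>D)"
    unfolding T_def by (intro nn_integral_cong nn_integral_distr) measurable
  also have "\<dots> = (\<integral>\<^sup>+p. indicator A (case p of (s, \<omega>) \<Rightarrow> Y s \<omega>) \<partial>(D \<Otimes>\<^sub>M P x))"
    by (subst nn_integral_fst[symmetric]) (auto, measurable)
  also have "\<dots> = (\<integral>\<^sup>+y. indicator A y \<partial>distr (D \<Otimes>\<^sub>M P x) borel (\<lambda>(s, \<omega>). Y s \<omega>))"
    by (rule nn_integral_distr[symmetric]) measurable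
  also have "\<dots> = emeasure (distr (D \<Otimes>\<^sub>M P x) borel (\<lambda>(s, \<omega>). Y s \<omega>)) A" by simp
  finally show "emeasure (V t x) A = emeasure (distr (density lborel (indicator {0..t}) \<Otimes>\<^sub>M P x) borel (\<lambda>(s, \<omega>). Y s \<omega>)) A"
    by (simp add: D_def)
qed

lemma time_pair: fixes t :: real shows "pair_sigma_finite (density lborel (indicator {0..t})) (P x)"
proof -
  have "sigma_finite_measure (density lborel (indicator {0..t} :: real \<Rightarrow> ennreal))"
    by (intro finite_measure.sigma_finite_measure finite_measureI) (auto simp: emeasure_density emeasure_lborel_Icc_eq)
  then show ?thesis by (rule pair_sigma_finite.intro) (rule prob_space_imp_sigma_finite[OF P_prob])
qed

sublocale diffusion_kernels a b \<delta> T
proof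
  fix t :: real and x assume t: "0 \<le> t"
  interpret pair_sigma_finite "density lborel (indicator {0..t})" "P x" by (rule time_pair)
  have "(\<integral>\<^sup>+y. ennreal (norm (b y)) \<partial>V t x) = (\<integral>\<^sup>+(s, \<omega>). ennreal (norm (b (Y s \<omega>))) \<partial>(density lborel (indicator {0..t}) \<Otimes>\<^sub>M P x))"
    unfolding V_eq_distr by (subst nn_integral_distr) (auto simp: case_prod_beta')
  also have "\<dots> = (\<integral>\<^sup>+\<omega>. (\<integral>\<^sup>+s. ennreal (norm (b (Y s \<omega>))) \<partial>density lborel (indicator {0..t})) \<partial>P x)"
    by (subst nn_integral_snd[symmetric]) (auto simp: case_prod_beta')
  also have "\<dots> = (\<integral>\<^sup>+\<omega>. (\<integral>\<^sup>+s\<in>{0..t}. ennreal (norm (b (X s \<omega>))) \<partial>lborel) \<partial>P x)"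
  proof (rule nn_integral_cong)
    fix \<omega> assume "\<omega> \<in> space (P x)"
    then have [measurable]: "(\<lambda>s. Y s \<omega>) \<in> borel_measurable borel" using borel_measurable_continuous_onI[OF Y_continuous] by simp
    have "(\<integral>\<^sup>+s. ennreal (norm (b (Y s \<omega>))) \<partial>density lborel (indicator {0..t})) = (\<integral>\<^sup>+s. indicator {0..t} s * ennreal (norm (b (Y s \<omega>))) \<partial>lborel)"
      by (rule nn_integral_density) measurable
    also have "\<dots> = (\<integral>\<^sup>+s\<in>{0..t}. ennreal (norm (b (X s \<omega>))) \<partial>lborel)" by (intro nn_integral_cong) (auto simp: indicator_def)
    finally show "(\<integral>\<^sup>+s. ennreal (norm (b (Y s \<omega>))) \<partial>density lborel (indicator {0..t})) = (\<integral>\<^sup>+s\<in>{0..t}. ennreal (norm (b (X s \<omega>))) \<partial>lborel)" .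
  qed
  also have "\<dots> < \<infinity>" by (rule drift_time[OF t])
  finally show fin: "(\<integral>\<^sup>+y. ennreal (norm (b y)) \<partial>V t x) < \<infinity>" .
  fix u :: "real ^ 'n \<Rightarrow> real" assume "C2_compact u"
  then obtain g H c r where C: "C2_data u g H" and z: "\<And>x. x \<notin> cball c r \<Longrightarrow> u x = 0" by (auto simp: C2_compact_def)
  have u: "C2c_fun u" by (rule C2_data_imp_C2c_fun[OF C z])
  have Lm [measurable]: "Lop a b u \<in> borel_measurable borel" by (rule Lop_measurable[OF C])
  have "continuous_on UNIV u" using C unfolding C2_data_def
    by (meson continuous_at_imp_continuous_on has_derivative_continuous)
  then have um: "u \<in> borel_measurable borel" by (rule borel_measurable_continuous_onI)
  obtain B where B: "0 \<le> B" "\<And>x. \<bar>Lop a b u x\<bar> \<le> B * (1 + norm (b x))" using Lop_bounded[OF C z] by blast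
  interpret Vt: finite_measure "V t x" by (rule finite_measure_V[OF t])
  have iL: "integrable (V t x) (Lop a b u)"
  proof (rule Bochner_Integration.integrable_bound)
    have "integrable (V t x) (\<lambda>x. norm (b x))" using fin by (intro integrableI_bounded) (auto cong: measurable_cong_sets)
    then show "integrable (V t x) (\<lambda>x. B * (1 + norm (b x)))" by simp
  qed (use Lm B in \<open>auto cong: measurable_cong_sets\<close>)
  have "(\<integral>y. Lop a b u y \<partial>V t x) = (\<integral>(s, \<omega>). Lop a b u (Y s \<omega>) \<partial>(density lborel (indicator {0..t}) \<Otimes>\<^sub>M P x))"
    unfolding V_eq_distr by (subst integral_distr) (auto simp: case_prod_beta')
  also have "\<dots> = (\<integral>\<omega>. (\<integral>s. Lop a b u (Y s \<omega>) \<partial>density lborel (indicator {0..t})) \<partial>P x)"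
  proof (rule integral_snd[symmetric])
    have "integrable (density lborel (indicator {0..t}) \<Otimes>\<^sub>M P x) (\<lambda>p. Lop a b u (case p of (s, \<omega>) \<Rightarrow> Y s \<omega>))"
      using iL unfolding V_eq_distr by (subst (asm) integrable_distr_eq) auto
    then show "integrable (density lborel (indicator {0..t}) \<Otimes>\<^sub>M P x) (\<lambda>(s, \<omega>). Lop a b u (Y s \<omega>))" by (simp add: case_prod_beta')
  qed
  also have "\<dots> = (\<integral>\<omega>. (LINT s:{0..t}|lborel. Lop a b u (X s \<omega>)) \<partial>P x)"
  proof (rule Bochner_Integration.integral_cong[OF refl])
    fix \<omega> assume "\<omega> \<in> space (P x)"
    then have [measurable]: "(\<lambda>s. Y s \<omega>) \<in> borel_measurable borel" using borel_measurable_continuous_onI[OF Y_continuous] by simp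
    have "density lborel (indicator {0..t}) = density lborel (\<lambda>s. ennreal (indicator {0..t} s))" by (simp add: ennreal_indicator)
    then have "(\<integral>s. Lop a b u (Y s \<omega>) \<partial>density lborel (indicator {0..t})) = (\<integral>s. indicator {0..t} s *\<^sub>R Lop a b u (Y s \<omega>) \<partial>lborel)"
      by (simp only:) (rule integral_density, auto)
    also have "\<dots> = (LINT s:{0..t}|lborel. Lop a b u (X s \<omega>))"
      unfolding set_lebesgue_integral_def by (intro Bochner_Integration.integral_cong) (auto simp: indicator_def)
    finally show "(\<integral>s. Lop a b u (Y s \<omega>) \<partial>density lborel (indicator {0..t})) = (LINT s:{0..t}|lborel. Lop a b u (X s \<omega>))" .
  qed
  finally show "(\<integral>y. u y \<partial>T t x) = u x + (\<integral>y. Lop a b u y \<partial>V t x)"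
    using Dynkin_X[OF t u, of x] T_integral[OF um, of t x] t by simp
next
  show "integrable lborel (\<lambda>x. norm (b x) ^ CARD('n))" using drift_norm by (simp add: Ld_norm_le_def)
qed

end

section \<open>Completed filtrations and stopping times\<close>

lemma sigma_algebra_INTER:
  assumes "\<And>i. i \<in> I \<Longrightarrow> sigma_algebra \<Omega> (F i)" "I \<noteq> {}"
  shows "sigma_algebra \<Omega> (\<Inter>i\<in>I. F i)"
proof -
  obtain i where i: "i \<in> I" using assms(2) by blast
  have F: "F i \<subseteq> Pow \<Omega>" "{} \<in> F i" "A \<in> F i \<Longrightarrow> \<Omega> - A \<in> F i" "range B \<subseteq> F i \<Longrightarrow> (\<Union>k :: nat. B k) \<in> F i" if "i \<in> I" for i A B
    using assms(1)[OF that] unfolding sigma_algebra_iff2 by blast+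
  show ?thesis
    unfolding sigma_algebra_iff2
  proof (intro conjI ballI allI impI)
    show "(\<Inter>i\<in>I. F i) \<subseteq> Pow \<Omega>" using F(1)[OF i] i by blast
    show "(\<Union>k :: nat. B k) \<in> (\<Inter>i\<in>I. F i)" if "range B \<subseteq> (\<Inter>i\<in>I. F i)" for B
      by (rule INT_I, rule F(4)) (use that in auto)
  qed (use F(2,3) in auto)
qed

lemma completion_wrt_sigma_algebra:
  assumes "subalgebra Q G"
  shows "sigma_algebra (space Q) (completion_wrt Q G)"
  unfolding sigma_algebra_iff2
proof (intro conjI ballI allI impI)
  have sp: "space G = space Q" using assms by (simp add: subalgebra_def)
  show "completion_wrt Q G \<subseteq> Pow (space Q)" by (auto simp: completion_wrt_def)
  show "{} \<in> completion_wrt Q G" unfolding completion_wrt_def by force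
  show "space Q - A \<in> completion_wrt Q G" if A: "A \<in> completion_wrt Q G" for A
  proof -
    obtain B C where B: "B \<in> sets G" "C \<in> null_sets Q" "(A - B) \<union> (B - A) \<subseteq> C" using A by (auto simp: completion_wrt_def)
    have "((space Q - A) - (space Q - B)) \<union> ((space Q - B) - (space Q - A)) \<subseteq> C" using B(3) by blast
    moreover have "space Q - B \<in> sets G" using sets.compl_sets[OF B(1)] sp by simp
    ultimately show ?thesis using B(2) unfolding completion_wrt_def by blast
  qed
  show "(\<Union>i :: nat. A i) \<in> completion_wrt Q G" if A: "range A \<subseteq> completion_wrt Q G" for A
  proof -
    have "\<exists>B C. B \<in> sets G \<and> C \<in> null_sets Q \<and> (A i - B) \<union> (B - A i) \<subseteq> C" for i
    proof -
      have "A i \<in> completion_wrt Q G" using A by auto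
      then obtain B C where "B \<in> sets G" "C \<in> null_sets Q" "(A i - B) \<union> (B - A i) \<subseteq> C" by (auto simp: completion_wrt_def)
      then show ?thesis by blast
    qed
    then obtain B C where B: "\<And>i. B i \<in> sets G" "\<And>i. C i \<in> null_sets Q" "\<And>i. (A i - B i) \<union> (B i - A i) \<subseteq> C i" by metis
    have "(\<Union>i. B i) \<in> sets G" "(\<Union>i. C i) \<in> null_sets Q" using B by auto
    moreover have "((\<Union>i. A i) - (\<Union>i. B i)) \<union> ((\<Union>i. B i) - (\<Union>i. A i)) \<subseteq> (\<Union>i. C i)" using B(3) by blast
    moreover have "(\<Union>i. A i) \<subseteq> space Q" using A by (auto simp: completion_wrt_def)
    ultimately show ?thesis unfolding completion_wrt_def by blast
  qed
qed

lemma completion_wrt_superset: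
  assumes "subalgebra Q G" shows "sets G \<subseteq> completion_wrt Q G"
proof
  fix A assume A: "A \<in> sets G"
  then have "A \<subseteq> space Q" using sets.sets_into_space[OF A] assms by (simp add: subalgebra_def)
  then show "A \<in> completion_wrt Q G" using A unfolding completion_wrt_def by force
qed

lemma completion_wrt_mono: "sets G \<subseteq> sets G' \<Longrightarrow> completion_wrt Q G \<subseteq> completion_wrt Q G'"
  unfolding completion_wrt_def by blast

text \<open>The equivalent set \<open>B\<close> may depend on \<open>Q\<close>, that is, on the
  starting point; this is harmless where a single law is considered.\<close>

lemma completion_wrt_AE:
  assumes G: "subalgebra Q G" and A: "A \<in> completion_wrt Q G"
  shows "A \<in> sets (completion Q)" "\<exists>B\<in>sets G. AE \<omega> in completion Q. \<omega> \<in> A \<longleftrightarrow> \<omega> \<in> B"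
proof -
  obtain B C where B: "B \<in> sets G" and C: "C \<in> null_sets Q" "(A - B) \<union> (B - A) \<subseteq> C" using A by (auto simp: completion_wrt_def)
  have BQ: "B \<in> sets Q" using B G by (auto simp: subalgebra_def)
  show "A \<in> sets (completion Q)"
  proof (rule sets_completionI)
    show "A = (B - C) \<union> (A \<inter> C)" using C(2) by blast
    show "A \<inter> C \<subseteq> C" by blast
    show "B - C \<in> sets Q" using BQ C(1) by (intro sets.Diff) auto
  qed (rule C(1))
  have "AE \<omega> in Q. \<omega> \<in> A \<longleftrightarrow> \<omega> \<in> B" by (rule AE_I'[OF C(1)]) (use C(2) in blast)
  then show "\<exists>B\<in>sets G. AE \<omega> in completion Q. \<omega> \<in> A \<longleftrightarrow> \<omega> \<in> B" using B AE_completion by blast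
qed

lemma space_path_sigma [simp]: "space (path_sigma M0 X S) = space M0"
  by (simp add: path_sigma_def space_measure_of_conv)

lemma sets_path_sigma: "sets (path_sigma M0 X S) = sigma_sets (space M0) {{\<omega>\<in>space M0. X s \<omega> \<in> \<Gamma>} | s \<Gamma>. s \<in> S \<and> \<Gamma> \<in> sets borel}"
  unfolding path_sigma_def by (rule sets_measure_of) blast

lemma path_sigma_mono: "S \<subseteq> S' \<Longrightarrow> sets (path_sigma M0 X S) \<subseteq> sets (path_sigma M0 X S')"
  unfolding sets_path_sigma by (rule sigma_sets_mono') blast

lemma path_sigma_measurable:
  fixes X :: "real \<Rightarrow> 'w \<Rightarrow> real ^ 'n"
  shows "s \<in> S \<Longrightarrow> X s \<in> path_sigma M0 X S \<rightarrow>\<^sub>M borel"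
proof (rule measurableI)
  fix \<Gamma> :: "(real ^ 'n) set" assume "s \<in> S" "\<Gamma> \<in> sets borel"
  then have "{\<omega>\<in>space M0. X s \<omega> \<in> \<Gamma>} \<in> sets (path_sigma M0 X S)" unfolding sets_path_sigma by (intro sigma_sets.Basic) blast
  moreover have "X s -` \<Gamma> \<inter> space (path_sigma M0 X S) = {\<omega>\<in>space M0. X s \<omega> \<in> \<Gamma>}" by auto
  ultimately show "X s -` \<Gamma> \<inter> space (path_sigma M0 X S) \<in> sets (path_sigma M0 X S)" by simp
qed simp

lemma path_sigma_least:
  fixes X :: "real \<Rightarrow> 'w \<Rightarrow> real ^ 'n"
  assumes sp: "space G = space M0" and X: "\<And>s. s \<in> S \<Longrightarrow> X s \<in> G \<rightarrow>\<^sub>M borel"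
  shows "sets (path_sigma M0 X S) \<subseteq> sets G"
  unfolding sets_path_sigma sp[symmetric]
proof (rule sets.sigma_sets_subset, safe)
  fix s and \<Gamma> :: "(real ^ 'n) set" assume s: "s \<in> S" "\<Gamma> \<in> sets borel"
  have "{\<omega>\<in>space G. X s \<omega> \<in> \<Gamma>} = X s -` \<Gamma> \<inter> space G" by auto
  then show "{\<omega>\<in>space G. X s \<omega> \<in> \<Gamma>} \<in> sets G" using measurable_sets[OF X[OF s(1)] s(2)] by simp
qed

section \<open>Completed filtrations of the process\<close>

context quasi_diffusion_process
begin

abbreviation "N \<equiv> N_upto M0 X"
abbreviation "Ninf \<equiv> N_infty M0 X"
abbreviation "Q x \<equiv> restr_to_subalg (P x) Ninf"
abbreviation "Pc \<equiv> Pbar M0 P X"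

lemma N_subset_M: assumes t: "0 \<le> t" shows "sets (N t) \<subseteq> sets (M t)"
proof (rule path_sigma_least)
  show "space (M t) = space M0" by (rule space_M[OF t])
  fix s assume s: "s \<in> {0..t}"
  have "subalgebra (M t) (M s)" using s M_mono[of s t] space_M by (auto simp: subalgebra_def)
  then show "X s \<in> M t \<rightarrow>\<^sub>M borel" using X_M[of s] s by (auto intro: measurable_from_subalg)
qed

lemma Ninf_subalgebra: "subalgebra (P x) Ninf"
  unfolding subalgebra_def
proof
  show "sets Ninf \<subseteq> sets (P x)" by (rule path_sigma_least) (use X_measurable in auto)
qed simp

lemma sets_Q: "sets (Q x) = sets Ninf" and space_Q [simp]: "space (Q x) = space M0"
  using sets_restr_to_subalg[OF Ninf_subalgebra[of x]] by (simp_all add: space_restr_to_subalg)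

lemma N_subset_Ninf: "sets (N t) \<subseteq> sets Ninf"
  by (rule path_sigma_mono) auto

lemma N_subalgebra_Q: "subalgebra (Q x) (N t)" "subalgebra (Q x) Ninf"
  using N_subset_Ninf sets_Q[of x] by (auto simp: subalgebra_def)

lemma Pc_eq: "Pc x = completion (Q x)" by (simp add: Pbar_def)

lemma space_Pc [simp]: "space (Pc x) = space M0" by (simp add: Pc_eq)

lemma sets_Ninf_Pc: "sets Ninf \<subseteq> sets (Pc x)"
  unfolding Pc_eq sets_Q[of x, symmetric] by auto

lemma Pc_prob: "prob_space (Pc x)"
proof
  have "emeasure (Q x) (space M0) = emeasure (P x) (space M0)"
    by (rule emeasure_restr_to_subalg[OF Ninf_subalgebra]) (metis sets.top space_path_sigma)
  then show "emeasure (Pc x) (space (Pc x)) = 1"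
    using prob_space.emeasure_space_1[OF P_prob[of x]] sets.top[of "Q x"] by (simp add: Pc_eq)
qed

lemma nn_integral_Pc:
  assumes "f \<in> borel_measurable Ninf" shows "(\<integral>\<^sup>+\<omega>. f \<omega> \<partial>Pc x) = (\<integral>\<^sup>+\<omega>. f \<omega> \<partial>P x)"
  unfolding Pc_eq nn_integral_completion by (rule nn_integral_subalgebra2[OF Ninf_subalgebra assms])

abbreviation "Nc \<equiv> Nbar M0 P X"
abbreviation "Ncinf \<equiv> Nbar_infty M0 P X"
abbreviation "Np \<equiv> Nbar_plus M0 P X"

lemma sigma_algebra_Nc: "sigma_algebra (space M0) (Nc t)"
proof -
  have "sigma_algebra (space M0) (completion_wrt (Q x) (N t))" for x
    using completion_wrt_sigma_algebra[OF N_subalgebra_Q(1), of x t] by simp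
  then show ?thesis unfolding Nbar_def by (intro sigma_algebra_INTER) auto
qed

lemma sigma_algebra_Ncinf: "sigma_algebra (space M0) Ncinf"
proof -
  have "sigma_algebra (space M0) (completion_wrt (Q x) Ninf)" for x
    using completion_wrt_sigma_algebra[OF N_subalgebra_Q(2), of x] by simp
  then show ?thesis unfolding Nbar_infty_def by (intro sigma_algebra_INTER) auto
qed

lemma sigma_algebra_Np: "sigma_algebra (space M0) (Np t)"
  unfolding Nbar_plus_def by (intro sigma_algebra_INTER sigma_algebra_Nc) (auto intro: gt_ex)

lemma N_subset_Nc: "sets (N t) \<subseteq> Nc t"
  unfolding Nbar_def using completion_wrt_superset[OF N_subalgebra_Q(1)] by blast

lemma Nc_subset_Ncinf: "Nc t \<subseteq> Ncinf"
  unfolding Nbar_def Nbar_infty_def using completion_wrt_mono[OF N_subset_Ninf] by blast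

lemma Ncinf_subset_Pc: "Ncinf \<subseteq> sets (Pc x)"
  unfolding Nbar_infty_def Pc_eq using completion_wrt_AE(1)[OF N_subalgebra_Q(2)] by blast

lemma Np_subset_Nc: "t < s \<Longrightarrow> Np t \<subseteq> Nc s"
  unfolding Nbar_plus_def by blast

text \<open>Capping the time at \<open>s\<close> keeps the process adapted to \<open>N s\<close> for
  all \<open>u\<close> at once. Together with continuity this gives progressive
  measurability.\<close>

lemma Y_N: "(\<lambda>\<omega>. Y (min u s) \<omega>) \<in> N s \<rightarrow>\<^sub>M borel" if "0 \<le> s"
  unfolding Y_def by (rule path_sigma_measurable) (use that in auto)

lemma Y_Ninf: "Y u \<in> Ninf \<rightarrow>\<^sub>M borel"
  unfolding Y_def by (rule path_sigma_measurable) auto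

lemma Y_joint_N: "0 \<le> s \<Longrightarrow> (\<lambda>(u, \<omega>). Y (min u s) \<omega>) \<in> borel \<Otimes>\<^sub>M N s \<rightarrow>\<^sub>M borel"
  by (rule continuous_process_measurable[OF Y_N]) (auto intro!: continuous_on_compose2[OF Y_continuous] continuous_intros)

lemma Y_joint_Ninf: "(\<lambda>(u, \<omega>). Y u \<omega>) \<in> borel \<Otimes>\<^sub>M Ninf \<rightarrow>\<^sub>M borel"
  by (rule continuous_process_measurable[OF Y_Ninf]) (auto intro!: Y_continuous)

text \<open>For the given \<open>x\<close> an event of the completed filtration is replaced by an
  almost surely equal event of \<open>N t\<close>, which belongs to \<open>M t\<close>.\<close>

lemma Markov_Pc:
  fixes f :: "real ^ 'n \<Rightarrow> ennreal"
  assumes A: "A \<in> Nc t" and t: "0 \<le> t" "0 \<le> s" and f [measurable]: "f \<in> borel_measurable borel"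
  shows "(\<integral>\<^sup>+\<omega>. indicator A \<omega> * f (Y (t + s) \<omega>) \<partial>Pc x) = (\<integral>\<^sup>+\<omega>. indicator A \<omega> * (\<integral>\<^sup>+y. f y \<partial>T s (Y t \<omega>)) \<partial>Pc x)"
proof -
  note Y_Ninf [measurable]
  have "A \<in> completion_wrt (Q x) (N t)" using A by (simp add: Nbar_def)
  then obtain B where B: "B \<in> sets (N t)" and AB: "AE \<omega> in Pc x. \<omega> \<in> A \<longleftrightarrow> \<omega> \<in> B"
    using completion_wrt_AE(2)[OF N_subalgebra_Q(1)] unfolding Pc_eq by blast
  have [measurable]: "B \<in> sets Ninf" using B N_subset_Ninf by blast
  have BM: "B \<in> sets (M t)" using B N_subset_M[OF t(1)] by blast
  have sw: "(\<integral>\<^sup>+\<omega>. indicator A \<omega> * g \<omega> \<partial>Pc x) = (\<integral>\<^sup>+\<omega>. indicator B \<omega> * g \<omega> \<partial>P x)" if "g \<in> borel_measurable Ninf" for g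
  proof -
    have "(\<integral>\<^sup>+\<omega>. indicator A \<omega> * g \<omega> \<partial>Pc x) = (\<integral>\<^sup>+\<omega>. indicator B \<omega> * g \<omega> \<partial>Pc x)"
      by (rule nn_integral_cong_AE) (use AB in eventually_elim, auto simp: indicator_def)
    also have "\<dots> = (\<integral>\<^sup>+\<omega>. indicator B \<omega> * g \<omega> \<partial>P x)" by (rule nn_integral_Pc) (use that in measurable)
    finally show ?thesis .
  qed
  have "(\<integral>\<^sup>+\<omega>. indicator A \<omega> * f (Y (t + s) \<omega>) \<partial>Pc x) = (\<integral>\<^sup>+\<omega>. indicator B \<omega> * f (X (t + s) \<omega>) \<partial>P x)"
    by (subst sw, measurable) (use t in simp)
  also have "\<dots> = (\<integral>\<^sup>+\<omega>. indicator B \<omega> * (\<integral>\<^sup>+y. f y \<partial>T s (X t \<omega>)) \<partial>P x)" by (rule Markov_nn_integral[OF BM t f])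
  also have "\<dots> = (\<integral>\<^sup>+\<omega>. indicator A \<omega> * (\<integral>\<^sup>+y. f y \<partial>T s (Y t \<omega>)) \<partial>Pc x)"
    by (subst sw, measurable) (use t in simp)
  finally show ?thesis .
qed

end

text \<open>Differentiate the integrals in their upper limit.\<close>

lemma continuous_eq_if_integrals_eq:
  fixes h k :: "real \<Rightarrow> real"
  assumes h: "continuous_on UNIV h" "\<And>s. 0 \<le> h s" and k: "continuous_on UNIV k" "\<And>s. 0 \<le> k s"
    and eq: "\<And>r. 0 \<le> r \<Longrightarrow> (\<integral>\<^sup>+s. indicator {0..r} s * ennreal (h s) \<partial>lborel) = (\<integral>\<^sup>+s. indicator {0..r} s * ennreal (k s) \<partial>lborel)"
    and s: "0 \<le> s"
  shows "h s = k s"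
proof -
  have I: "integral {0..r} h = integral {0..r} k" if "0 \<le> r" for r
  proof -
    have *: "(\<integral>\<^sup>+s. indicator {0..r} s * ennreal (g s) \<partial>lborel) = ennreal (integral {0..r} g)" "0 \<le> integral {0..r} g"
      if "continuous_on UNIV g" "\<And>s. 0 \<le> g s" for g :: "real \<Rightarrow> real"
    proof -
      have "g integrable_on {0..r}" by (rule integrable_continuous_interval) (rule continuous_on_subset[OF that(1)], simp)
      then have "(g has_integral integral {0..r} g) {0..r}" by (rule integrable_integral)
      from nn_integral_has_integral_lebesgue[OF _ this]
      have "(\<integral>\<^sup>+s. ennreal (indicator {0..r} s * g s) \<partial>lborel) = ennreal (integral {0..r} g)" using that by simp
      then show "(\<integral>\<^sup>+s. indicator {0..r} s * ennreal (g s) \<partial>lborel) = ennreal (integral {0..r} g)"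
        using that by (simp add: ennreal_mult' ennreal_indicator)
      show "0 \<le> integral {0..r} g" using that by (intro Henstock_Kurzweil_Integration.integral_nonneg \<open>g integrable_on {0..r}\<close>) auto
    qed
    show ?thesis using eq[OF that] *[OF h] *[OF k] by simp
  qed
  \<comment> \<open>The derivative is taken within an interval that starts at 0, so that
    \<open>s = 0\<close> is included.\<close>
  have d: "((\<lambda>u. integral {0..u} g) has_vector_derivative g s) (at s within {0..s + 1})" if "continuous_on UNIV g" for g :: "real \<Rightarrow> real"
    by (rule integral_has_vector_derivative) (use that s in \<open>auto intro: continuous_on_subset\<close>)
  have "((\<lambda>u. integral {0..u} h) has_vector_derivative k s) (at s within {0..s + 1})"
    by (rule has_vector_derivative_transform[OF _ _ d[OF k(1)]]) (use s I in auto)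
  then show ?thesis
    using d[OF h(1)] vector_derivative_unique_within_closed_interval[of 0 "s + 1" s "\<lambda>u. integral {0..u} h" "h s" "k s"] s by (simp add: cbox_interval)
qed

lemma ennreal_finite_iff: "c < \<infinity> \<longleftrightarrow> (\<exists>n. c < ennreal (real n))"
proof (cases c)
  case (real v)
  obtain n where "v < real n" using reals_Archimedean2 by blast
  then have "c < ennreal (real n)" using real by (simp add: ennreal_less_iff)
  then show ?thesis using real by auto
qed auto

lemma ennreal_le_imp_finite: "c \<le> ennreal r \<Longrightarrow> c < \<infinity>"
  by (rule le_less_trans[OF _ ennreal_less_top[of r, folded infinity_ennreal_def]])

context quasi_diffusion_process
begin

lemma id_Ninf [measurable]: "(\<lambda>\<omega>. \<omega>) \<in> Pc x \<rightarrow>\<^sub>M Ninf"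
  by (rule measurable_from_subalg[OF _ measurable_ident_sets[OF refl]]) (simp add: subalgebra_def sets_Ninf_Pc)

lemma Y_random_time:
  "\<sigma> \<in> borel_measurable R \<Longrightarrow> \<psi> \<in> R \<rightarrow>\<^sub>M Ninf \<Longrightarrow> (\<lambda>z. Y (\<sigma> z) (\<psi> z)) \<in> R \<rightarrow>\<^sub>M borel"
  using measurable_compose[OF measurable_Pair[of \<sigma> R borel \<psi> Ninf] Y_joint_Ninf] by simp

lemma Y_random_time_Pc [measurable (raw)]:
  "\<sigma> \<in> borel_measurable R \<Longrightarrow> \<psi> \<in> R \<rightarrow>\<^sub>M Pc x \<Longrightarrow> (\<lambda>z. Y (\<sigma> z) (\<psi> z)) \<in> R \<rightarrow>\<^sub>M borel"
  by (rule Y_random_time) (auto intro: measurable_compose[OF _ id_Ninf])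

lemma V_Fubini:
  assumes D: "finite_measure D" and [measurable]: "W \<in> D \<rightarrow>\<^sub>M borel" "f \<in> borel_measurable borel"
  shows "(\<integral>\<^sup>+\<omega>. (\<integral>\<^sup>+y. f y \<partial>V r (W \<omega>)) \<partial>D) = (\<integral>\<^sup>+s. indicator {0..r} s * (\<integral>\<^sup>+\<omega>. (\<integral>\<^sup>+y. f y \<partial>T s (W \<omega>)) \<partial>D) \<partial>lborel)"
proof -
  interpret D: finite_measure D by fact
  interpret pair_sigma_finite D lborel by (intro pair_sigma_finite.intro D.sigma_finite_measure_axioms sigma_finite_lborel)
  have "(\<integral>\<^sup>+\<omega>. (\<integral>\<^sup>+y. f y \<partial>V r (W \<omega>)) \<partial>D) = (\<integral>\<^sup>+s. (\<integral>\<^sup>+\<omega>. indicator {0..r} s * (\<integral>\<^sup>+y. f y \<partial>T s (W \<omega>)) \<partial>D) \<partial>lborel)"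
    unfolding nn_integral_V[OF assms(3)] by (rule Fubini'[symmetric]) measurable
  also have "\<dots> = (\<integral>\<^sup>+s. indicator {0..r} s * (\<integral>\<^sup>+\<omega>. (\<integral>\<^sup>+y. f y \<partial>T s (W \<omega>)) \<partial>D) \<partial>lborel)"
    by (intro nn_integral_cong nn_integral_cmult) measurable
  finally show ?thesis .
qed

end

section \<open>Measurability at the stopping time\<close>

locale stopped_quasi_diffusion = quasi_diffusion_process a b \<delta> K M0 M P X
  for a :: "real ^ 'n \<Rightarrow> real ^ 'n ^ 'n" and b :: "real ^ 'n \<Rightarrow> real ^ 'n" and \<delta> K :: real
    and M0 :: "'w measure" and M :: "real \<Rightarrow> 'w measure" and P :: "real ^ 'n \<Rightarrow> 'w measure" and X :: "real \<Rightarrow> 'w \<Rightarrow> real ^ 'n" +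
  fixes \<tau> :: "'w \<Rightarrow> ennreal"
  assumes \<tau>: "ext_stopping_time M0 (Nbar_plus M0 P X) \<tau>"
begin

abbreviation "N\<tau> \<equiv> Nbar_tau_plus M0 P X \<tau>"
abbreviation "before t \<equiv> {\<omega>\<in>space M0. \<tau> \<omega> \<le> ennreal t}"
abbreviation "finite_time \<equiv> {\<omega>\<in>space M0. \<tau> \<omega> < \<infinity>}"
abbreviation "\<tau>\<^sub>r \<omega> \<equiv> enn2real (\<tau> \<omega>)"

lemma tau_le: "0 \<le> t \<Longrightarrow> before t \<in> Np t"
  using \<tau> by (simp add: ext_stopping_time_def)

lemma sigma_algebra_tau: "sigma_algebra (space M0) {A \<in> Ncinf. \<forall>t\<ge>0. A \<inter> before t \<in> Np t}"
proof -
  interpret I: sigma_algebra "space M0" Ncinf by (rule sigma_algebra_Ncinf)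
  have compl: "(space M0 - A) \<inter> before t \<in> Np t" if "0 \<le> t" "A \<inter> before t \<in> Np t" for A t
  proof -
    interpret sigma_algebra "space M0" "Np t" by (rule sigma_algebra_Np)
    have "before t - A \<inter> before t \<in> Np t" using tau_le that by blast
    moreover have "(space M0 - A) \<inter> before t = before t - A \<inter> before t" by blast
    ultimately show ?thesis by simp
  qed
  have UN: "(\<Union>i :: nat. A i) \<inter> before t \<in> Np t" if "\<And>i. A i \<inter> before t \<in> Np t" for A t
  proof -
    interpret sigma_algebra "space M0" "Np t" by (rule sigma_algebra_Np)
    have "(\<Union>i. A i) \<inter> before t = (\<Union>i. A i \<inter> before t)" by blast
    also have "\<dots> \<in> Np t" using that by (intro countable_UN) blast
    finally show ?thesis .
  qed
  have empty: "{} \<in> Np t" for t using sigma_algebra_Np[of t] by (simp add: sigma_algebra_iff2)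
  show ?thesis
    unfolding sigma_algebra_iff2 using I.space_closed compl UN empty by (auto simp: image_subset_iff)
qed

lemma space_Ntau [simp]: "space N\<tau> = space M0"
  by (simp add: Nbar_tau_plus_def space_measure_of_conv)

lemma sets_Ntau: "A \<in> sets N\<tau> \<longleftrightarrow> A \<in> Ncinf \<and> (\<forall>t\<ge>0. A \<inter> before t \<in> Np t)"
  unfolding Nbar_tau_plus_def sigma_algebra.sets_measure_of_eq[OF sigma_algebra_tau] by simp

lemma Ntau_subalgebra: "subalgebra (Pc x) N\<tau>"
  unfolding subalgebra_def using Ncinf_subset_Pc[of x] by (auto simp: sets_Ntau)

text \<open>The event is a countable union over rational \<open>q < s\<close> of events in
  \<open>Np q\<close>, and \<open>Np q\<close> is contained in \<open>Nc s\<close>. A strict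
  inequality thus lands in the filtration without the right limit.\<close>

lemma tau_lt:
  assumes A: "\<And>t. 0 \<le> t \<Longrightarrow> A \<inter> before t \<in> Np t"
  shows "A \<inter> {\<omega>\<in>space M0. \<tau> \<omega> < ennreal s} \<in> Nc s"
proof -
  interpret sigma_algebra "space M0" "Nc s" by (rule sigma_algebra_Nc)
  have "A \<inter> {\<omega>\<in>space M0. \<tau> \<omega> < ennreal s} = (\<Union>q\<in>\<rat> \<inter> {0..<s}. A \<inter> before q)"
  proof (intro equalityI subsetI)
    fix \<omega> assume \<omega>: "\<omega> \<in> A \<inter> {\<omega>\<in>space M0. \<tau> \<omega> < ennreal s}"
    then have lt: "\<tau> \<omega> < ennreal s" by simp
    then obtain v where v: "\<tau> \<omega> = ennreal v" "0 \<le> v" by (cases "\<tau> \<omega>") auto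
    then have "v < s" using lt by (simp add: ennreal_less_iff)
    then obtain q where "q \<in> \<rat>" "v < q" "q < s" using Rats_dense_in_real by blast
    then show "\<omega> \<in> (\<Union>q\<in>\<rat> \<inter> {0..<s}. A \<inter> before q)"
      using \<omega> v by (intro UN_I[of q]) (auto intro: ennreal_leI)
  next
    fix \<omega> assume "\<omega> \<in> (\<Union>q\<in>\<rat> \<inter> {0..<s}. A \<inter> before q)"
    then obtain q where q: "0 \<le> q" "q < s" "\<tau> \<omega> \<le> ennreal q" "\<omega> \<in> A" "\<omega> \<in> space M0" by auto
    have "ennreal q < ennreal s" using q by (simp add: ennreal_less_iff)
    then show "\<omega> \<in> A \<inter> {\<omega>\<in>space M0. \<tau> \<omega> < ennreal s}" using q by auto
  qed
  also have "\<dots> \<in> Nc s"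
    by (rule countable_UN'') (use A Np_subset_Nc in \<open>auto intro: countable_Int1 countable_rat\<close>)
  finally show ?thesis .
qed

lemma tau_finite: "finite_time \<in> sets N\<tau>"
proof -
  interpret I: sigma_algebra "space M0" Ncinf by (rule sigma_algebra_Ncinf)
  have "finite_time = (\<Union>n :: nat. space M0 \<inter> {\<omega>\<in>space M0. \<tau> \<omega> < ennreal (real n)})"
    unfolding ennreal_finite_iff by auto
  also have "\<dots> \<in> Ncinf"
  proof (rule I.countable_UN)
    have *: "space M0 \<inter> before t = before t" for t by blast
    show "range (\<lambda>n :: nat. space M0 \<inter> {\<omega>\<in>space M0. \<tau> \<omega> < ennreal (real n)}) \<subseteq> Ncinf"
      using tau_lt[of "space M0", unfolded *, OF tau_le] Nc_subset_Ncinf by blast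
  qed
  finally have "finite_time \<in> Ncinf" .
  moreover have "finite_time \<inter> before t = before t" for t
    using ennreal_le_imp_finite by blast
  ultimately show ?thesis using tau_le by (simp add: sets_Ntau)
qed

lemma tau_truncated:
  assumes s: "0 \<le> s" shows "(\<lambda>\<omega>. enn2real (min (\<tau> \<omega>) (ennreal s))) \<in> borel_measurable (sigma (space M0) (Nc s))"
proof -
  interpret sigma_algebra "space M0" "Nc s" by (rule sigma_algebra_Nc)
  have min_le: "enn2real (min (\<tau> \<omega>) (ennreal s)) \<le> c \<longleftrightarrow> 0 \<le> c \<and> (s \<le> c \<or> \<tau> \<omega> \<le> ennreal c)" for c \<omega>
  proof (cases "\<tau> \<omega>")
    case (real v)
    then show ?thesis using s by (cases "v \<le> s") (auto simp: min_def ennreal_le_iff2)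
  next
    case top
    then show ?thesis using s by (auto simp: min_def top_unique)
  qed
  have "{\<omega>\<in>space M0. enn2real (min (\<tau> \<omega>) (ennreal s)) \<le> c} \<in> Nc s" for c
  proof -
    consider "c < 0" | "s \<le> c" | "0 \<le> c" "c < s" by linarith
    then show ?thesis
    proof cases
      case 1 then show ?thesis unfolding min_le by simp
    next
      case 2 then show ?thesis unfolding min_le using s by simp
    next
      case 3 then show ?thesis unfolding min_le using tau_le[of c] Np_subset_Nc[of c s] by auto
    qed
  qed
  then show ?thesis by (simp add: borel_measurable_iff_le)
qed

text \<open>Progressive measurability, applied to the stopping time truncated at \<open>s\<close>,
  which is \<open>Nc s\<close>-measurable; on the event considered the truncation has no
  effect.\<close>

lemma X_tau_adapted:
  assumes t: "0 \<le> t" "t < s" and \<Gamma> [measurable]: "\<Gamma> \<in> sets borel"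
  shows "{\<omega>\<in>space M0. \<tau> \<omega> \<le> ennreal t \<and> Y (\<tau>\<^sub>r \<omega>) \<omega> \<in> \<Gamma>} \<in> Nc s"
proof -
  interpret sigma_algebra "space M0" "Nc s" by (rule sigma_algebra_Nc)
  define F where "F = sigma (space M0) (Nc s)"
  define \<sigma> where "\<sigma> \<omega> = enn2real (min (\<tau> \<omega>) (ennreal s))" for \<omega>
  have [measurable]: "\<sigma> \<in> borel_measurable F" unfolding F_def \<sigma>_def by (rule tau_truncated) (use t in simp)
  have id: "(\<lambda>\<omega>. \<omega>) \<in> F \<rightarrow>\<^sub>M N s" by (rule measurable_from_subalg[OF _ measurable_ident_sets[OF refl]]) (simp add: subalgebra_def F_def N_subset_Nc)
  have m [measurable]: "(\<lambda>\<omega>. Y (min (\<sigma> \<omega>) s) \<omega>) \<in> F \<rightarrow>\<^sub>M borel"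
    using measurable_compose[OF measurable_Pair[OF \<open>\<sigma> \<in> borel_measurable F\<close> id] Y_joint_N[of s]] t by simp
  have "{\<omega>\<in>space F. Y (min (\<sigma> \<omega>) s) \<omega> \<in> \<Gamma>} \<in> sets F" by measurable
  then have "{\<omega>\<in>space M0. Y (min (\<sigma> \<omega>) s) \<omega> \<in> \<Gamma>} \<in> Nc s" by (simp add: F_def)
  then have "{\<omega>\<in>space M0. Y (min (\<sigma> \<omega>) s) \<omega> \<in> \<Gamma>} \<inter> before t \<in> Nc s"
    using tau_le[OF t(1)] Np_subset_Nc[OF t(2)] by blast
  also have "{\<omega>\<in>space M0. Y (min (\<sigma> \<omega>) s) \<omega> \<in> \<Gamma>} \<inter> before t = {\<omega>\<in>space M0. \<tau> \<omega> \<le> ennreal t \<and> Y (\<tau>\<^sub>r \<omega>) \<omega> \<in> \<Gamma>}"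
  proof -
    have "min (\<sigma> \<omega>) s = \<tau>\<^sub>r \<omega>" if "\<tau> \<omega> \<le> ennreal t" for \<omega>
    proof -
      have "\<tau> \<omega> \<le> ennreal s" using that ennreal_leI[of t s] t by (meson less_imp_le order_trans)
      then have "\<sigma> \<omega> = \<tau>\<^sub>r \<omega>" by (simp add: \<sigma>_def min_def)
      moreover have "\<tau>\<^sub>r \<omega> \<le> s" using \<open>\<tau> \<omega> \<le> ennreal s\<close> t by (intro enn2real_leI) auto
      ultimately show ?thesis by simp
    qed
    then show ?thesis by auto
  qed
  finally show ?thesis .
qed

text \<open>Needed to recognise the right-hand side of the strong Markov property as a version of a
  conditional expectation given \<open>N\<tau>\<close>; the value 0 on
  \<open>\<tau> = \<infinity>\<close> is arbitrary.\<close>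

lemma X_tau_measurable: "(\<lambda>\<omega>. if \<tau> \<omega> < \<infinity> then Y (\<tau>\<^sub>r \<omega>) \<omega> else 0) \<in> N\<tau> \<rightarrow>\<^sub>M borel"
proof (rule measurableI)
  fix \<Gamma> :: "(real ^ 'n) set" assume \<Gamma>: "\<Gamma> \<in> sets borel"
  interpret I: sigma_algebra "space M0" Ncinf by (rule sigma_algebra_Ncinf)
  define E where "E = {\<omega>\<in>space M0. \<tau> \<omega> < \<infinity> \<and> Y (\<tau>\<^sub>r \<omega>) \<omega> \<in> \<Gamma>}"
  have Et: "E \<inter> before t = {\<omega>\<in>space M0. \<tau> \<omega> \<le> ennreal t \<and> Y (\<tau>\<^sub>r \<omega>) \<omega> \<in> \<Gamma>}" for t
    unfolding E_def using ennreal_le_imp_finite by blast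
  have fin: "\<tau> \<omega> < \<infinity> \<longleftrightarrow> (\<exists>n. \<tau> \<omega> \<le> ennreal (real n))" for \<omega>
    by (metis ennreal_finite_iff ennreal_le_imp_finite less_imp_le)
  have "E = (\<Union>n :: nat. {\<omega>\<in>space M0. \<tau> \<omega> \<le> ennreal (real n) \<and> Y (\<tau>\<^sub>r \<omega>) \<omega> \<in> \<Gamma>})"
    unfolding E_def fin by auto
  also have "\<dots> \<in> Ncinf"
  proof (rule I.countable_UN)
    show "range (\<lambda>n :: nat. {\<omega>\<in>space M0. \<tau> \<omega> \<le> ennreal (real n) \<and> Y (\<tau>\<^sub>r \<omega>) \<omega> \<in> \<Gamma>}) \<subseteq> Ncinf"
      using X_tau_adapted[OF of_nat_0_le_iff less_add_one \<Gamma>] Nc_subset_Ncinf by blast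
  qed
  finally have "E \<in> sets N\<tau>" using X_tau_adapted[OF _ _ \<Gamma>] by (auto simp: sets_Ntau Et Nbar_plus_def)
  moreover have "(\<lambda>\<omega>. if \<tau> \<omega> < \<infinity> then Y (\<tau>\<^sub>r \<omega>) \<omega> else 0) -` \<Gamma> \<inter> space N\<tau> =
      E \<union> (if 0 \<in> \<Gamma> then space M0 - finite_time else {})" by (auto simp: E_def split: if_splits)
  moreover have "space M0 - finite_time \<in> sets N\<tau>" using sets.compl_sets[OF tau_finite] by simp
  ultimately show "(\<lambda>\<omega>. if \<tau> \<omega> < \<infinity> then Y (\<tau>\<^sub>r \<omega>) \<omega> else 0) -` \<Gamma> \<inter> space N\<tau> \<in> sets N\<tau>" by auto
qed simp

lemma tau_real_measurable: "\<tau>\<^sub>r \<in> borel_measurable (Pc x)"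
proof -
  have "{\<omega>\<in>space M0. \<tau>\<^sub>r \<omega> \<le> c} \<in> sets (Pc x)" for c
  proof (cases "0 \<le> c")
    case True
    \<comment> \<open>\<open>enn2real\<close> sends infinity to 0, so the paths with infinite
      \<open>\<tau>\<close> belong to this set for every \<open>c \<ge> 0\<close>.\<close>
    have "{\<omega>\<in>space M0. \<tau>\<^sub>r \<omega> \<le> c} = before c \<union> (space M0 - finite_time)"
    proof -
      have "\<tau>\<^sub>r \<omega> \<le> c \<longleftrightarrow> \<tau> \<omega> \<le> ennreal c \<or> \<not> \<tau> \<omega> < \<infinity>" for \<omega>
        using True by (cases "\<tau> \<omega>") (auto simp: ennreal_le_iff2)
      then show ?thesis by blast
    qed
    moreover have "before c \<in> sets (Pc x)"
      using tau_le[OF True] Np_subset_Nc[of c "c + 1"] Nc_subset_Ncinf Ncinf_subset_Pc[of x] by auto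
    moreover have "space M0 - finite_time \<in> sets (Pc x)"
      using sets.compl_sets[OF tau_finite] Ntau_subalgebra[of x] by (auto simp: subalgebra_def)
    ultimately show ?thesis by simp
  next
    case False
    then have empty: "{\<omega>\<in>space M0. \<tau>\<^sub>r \<omega> \<le> c} = {}" using enn2real_nonneg order_trans by blast
    show ?thesis unfolding empty by (rule sets.empty_sets)
  qed
  then show ?thesis by (simp add: borel_measurable_iff_le)
qed


section \<open>Discretised stopping times\<close>

text \<open>The first point of the mesh strictly after \<open>\<tau>\<close>. By strictness the
  information in the right limits of the filtration is available at the discretised time in the
  filtration itself.\<close>

definition \<tau>\<^sub>d :: "nat \<Rightarrow> 'w \<Rightarrow> real" where
  "\<tau>\<^sub>d n \<omega> = (real_of_int \<lfloor>real (Suc n) * \<tau>\<^sub>r \<omega>\<rfloor> + 1) / real (Suc n)"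

lemma tau_discrete_tendsto: "(\<lambda>n. \<tau>\<^sub>d n \<omega>) \<longlonglongrightarrow> \<tau>\<^sub>r \<omega>"
proof -
  have "(\<lambda>n. real_of_int \<lfloor>real (Suc n) * \<tau>\<^sub>r \<omega>\<rfloor> / real (Suc n) + inverse (real (Suc n))) \<longlonglongrightarrow> \<tau>\<^sub>r \<omega> + 0"
    by (intro tendsto_add floor_approx_tendsto LIMSEQ_inverse_real_of_nat)
  then show ?thesis by (simp add: \<tau>\<^sub>d_def add_divide_distrib inverse_eq_divide)
qed

lemma tau_discrete_measurable [measurable]: "\<tau>\<^sub>d n \<in> borel_measurable (Pc x)"
proof -
  note tau_real_measurable [measurable]
  show ?thesis unfolding \<tau>\<^sub>d_def by measurable
qed

lemma Ntau_sets_Pc: "A \<in> sets N\<tau> \<Longrightarrow> A \<in> sets (Pc x)"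
  using Ntau_subalgebra[of x] by (auto simp: subalgebra_def)

text \<open>On this piece \<open>\<tau>\<^sub>d\<close> equals \<open>(j + 1) / (n + 1)\<close>, and
  \<open>\<tau>\<close> is strictly smaller, so the piece is decided by events with
  \<open>\<tau>\<close> below that time and by the truncated stopping time.\<close>

lemma piece_Nc:
  assumes A: "A \<in> sets N\<tau>" "\<And>\<omega>. \<omega> \<in> A \<Longrightarrow> \<tau> \<omega> < \<infinity>"
  shows "{\<omega>\<in>A. nat \<lfloor>real (Suc n) * \<tau>\<^sub>r \<omega>\<rfloor> = j} \<in> Nc (real (Suc j) / real (Suc n))"
proof -
  define s where "s = real (Suc j) / real (Suc n)"
  have s: "0 < s" by (simp add: s_def)
  interpret sigma_algebra "space M0" "Nc s" by (rule sigma_algebra_Nc)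
  define F where "F = sigma (space M0) (Nc s)"
  define \<sigma> where "\<sigma> \<omega> = enn2real (min (\<tau> \<omega>) (ennreal s))" for \<omega>
  have [measurable]: "\<sigma> \<in> borel_measurable F" unfolding F_def \<sigma>_def by (rule tau_truncated) (use s in simp)
  have "{\<omega>\<in>space F. nat \<lfloor>real (Suc n) * \<sigma> \<omega>\<rfloor> = j} \<in> sets F" by measurable
  then have 1: "{\<omega>\<in>space M0. nat \<lfloor>real (Suc n) * \<sigma> \<omega>\<rfloor> = j} \<in> Nc s" by (simp add: F_def)
  have 2: "A \<inter> {\<omega>\<in>space M0. \<tau> \<omega> < ennreal s} \<in> Nc s" by (rule tau_lt) (use A(1) in \<open>simp add: sets_Ntau\<close>)
  have "A \<subseteq> space M0" using sets.sets_into_space[OF A(1)] by simp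
  moreover have "(nat \<lfloor>real (Suc n) * \<tau>\<^sub>r \<omega>\<rfloor> = j) \<longleftrightarrow> (\<tau> \<omega> < ennreal s \<and> nat \<lfloor>real (Suc n) * \<sigma> \<omega>\<rfloor> = j)" if \<omega>A: "\<omega> \<in> A" for \<omega>
  proof -
    obtain v where v: "\<tau> \<omega> = ennreal v" "0 \<le> v" using A(2)[OF \<omega>A] by (cases "\<tau> \<omega>") auto
    have \<sigma>: "\<sigma> \<omega> = v" if "v < s" using v that by (simp add: \<sigma>_def min_def ennreal_le_iff2)
    have "v < s" if "nat \<lfloor>real (Suc n) * v\<rfloor> = j"
    proof -
      have "real (Suc n) * v < real (Suc j)" using that v(2) by linarith
      then show ?thesis by (simp add: s_def less_divide_eq mult.commute)
    qed
    then show ?thesis using \<sigma> v by (auto simp: ennreal_less_iff)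
  qed
  ultimately have "{\<omega>\<in>A. nat \<lfloor>real (Suc n) * \<tau>\<^sub>r \<omega>\<rfloor> = j} = (A \<inter> {\<omega>\<in>space M0. \<tau> \<omega> < ennreal s}) \<inter> {\<omega>\<in>space M0. nat \<lfloor>real (Suc n) * \<sigma> \<omega>\<rfloor> = j}"
    by blast
  also have "\<dots> \<in> Nc s" using 1 2 by blast
  finally show ?thesis by (simp add: s_def)
qed

abbreviation "piece A n j \<equiv> {\<omega>\<in>A. nat \<lfloor>real (Suc n) * \<tau>\<^sub>r \<omega>\<rfloor> = j}"

lemma piece_sum:
  fixes G :: "real \<Rightarrow> 'w \<Rightarrow> ennreal"
  assumes A: "A \<in> sets N\<tau>" "\<And>\<omega>. \<omega> \<in> A \<Longrightarrow> \<tau> \<omega> < \<infinity>" and G: "\<And>u. G u \<in> borel_measurable (Pc x)"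
  shows "(\<integral>\<^sup>+\<omega>. indicator A \<omega> * G (\<tau>\<^sub>d n \<omega>) \<omega> \<partial>Pc x) =
    (\<Sum>j. \<integral>\<^sup>+\<omega>. indicator (piece A n j) \<omega> * G (real (Suc j) / real (Suc n)) \<omega> \<partial>Pc x)"
proof -
  note G [measurable]
  have [measurable]: "piece A n j \<in> sets (Pc x)" for j
    using piece_Nc[OF A, of n j] Nc_subset_Ncinf Ncinf_subset_Pc by blast
  have "(\<integral>\<^sup>+\<omega>. indicator A \<omega> * G (\<tau>\<^sub>d n \<omega>) \<omega> \<partial>Pc x) =
    (\<integral>\<^sup>+\<omega>. (\<Sum>j. indicator (piece A n j) \<omega> * G (real (Suc j) / real (Suc n)) \<omega>) \<partial>Pc x)"
  proof (rule nn_integral_cong)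
    fix \<omega>
    define i where "i = nat \<lfloor>real (Suc n) * \<tau>\<^sub>r \<omega>\<rfloor>"
    have "\<tau>\<^sub>d n \<omega> = real (Suc i) / real (Suc n)"
    proof -
      have "0 \<le> real (Suc n) * \<tau>\<^sub>r \<omega>" by simp
      then have "real_of_int \<lfloor>real (Suc n) * \<tau>\<^sub>r \<omega>\<rfloor> = real i" unfolding i_def by linarith
      then show ?thesis by (simp add: \<tau>\<^sub>d_def add.commute)
    qed
    then have "(\<lambda>j. indicator (piece A n j) \<omega> * G (real (Suc j) / real (Suc n)) \<omega>) =
        (\<lambda>j. if j = i then indicator A \<omega> * G (\<tau>\<^sub>d n \<omega>) \<omega> else 0)"
      by (auto simp: fun_eq_iff indicator_def i_def)
    then show "indicator A \<omega> * G (\<tau>\<^sub>d n \<omega>) \<omega> = (\<Sum>j. indicator (piece A n j) \<omega> * G (real (Suc j) / real (Suc n)) \<omega>)"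
      using sums_unique[OF sums_single[of i "\<lambda>_. indicator A \<omega> * G (\<tau>\<^sub>d n \<omega>) \<omega>"]] by (simp only:)
  qed
  also have "\<dots> = (\<Sum>j. \<integral>\<^sup>+\<omega>. indicator (piece A n j) \<omega> * G (real (Suc j) / real (Suc n)) \<omega> \<partial>Pc x)"
    by (rule nn_integral_suminf) measurable
  finally show ?thesis .
qed

text \<open>Integrals over an event become integrals for a finite measure, for which dominated
  convergence and images of measures are directly available.\<close>

abbreviation "P\<^sub>A A x \<equiv> density (Pc x) (indicator A)"

lemma finite_P_A:
  assumes "A \<in> sets N\<tau>" shows "finite_measure (P\<^sub>A A x)"
proof (rule finite_measureI)
  interpret prob_space "Pc x" by (rule Pc_prob)
  have [measurable]: "A \<in> sets (Pc x)" by (rule Ntau_sets_Pc[OF assms])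
  have "emeasure (P\<^sub>A A x) (space (P\<^sub>A A x)) = (\<integral>\<^sup>+\<omega>. 1 \<partial>P\<^sub>A A x)" by simp
  also have "\<dots> = (\<integral>\<^sup>+\<omega>. indicator A \<omega> * 1 \<partial>Pc x)" by (rule nn_integral_density) measurable
  finally show "emeasure (P\<^sub>A A x) (space (P\<^sub>A A x)) \<noteq> \<infinity>" by (simp add: emeasure_eq_measure)
qed

text \<open>\<open>\<tau>\<^sub>d\<close> takes countably many values, and on each piece the Markov
  property at a deterministic time applies.\<close>

lemma Markov_discrete:
  fixes f :: "real ^ 'n \<Rightarrow> ennreal"
  assumes A: "A \<in> sets N\<tau>" "\<And>\<omega>. \<omega> \<in> A \<Longrightarrow> \<tau> \<omega> < \<infinity>" and s: "0 \<le> s" and f [measurable]: "f \<in> borel_measurable borel"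
  shows "(\<integral>\<^sup>+\<omega>. f (Y (\<tau>\<^sub>d n \<omega> + s) \<omega>) \<partial>P\<^sub>A A x) = (\<integral>\<^sup>+\<omega>. (\<integral>\<^sup>+y. f y \<partial>T s (Y (\<tau>\<^sub>d n \<omega>) \<omega>)) \<partial>P\<^sub>A A x)"
proof -
  have [measurable]: "A \<in> sets (Pc x)" by (rule Ntau_sets_Pc[OF A(1)])
  have "(\<integral>\<^sup>+\<omega>. f (Y (\<tau>\<^sub>d n \<omega> + s) \<omega>) \<partial>P\<^sub>A A x) = (\<integral>\<^sup>+\<omega>. indicator A \<omega> * f (Y (\<tau>\<^sub>d n \<omega> + s) \<omega>) \<partial>Pc x)"
    by (rule nn_integral_density) measurable
  also have "\<dots> = (\<Sum>j. \<integral>\<^sup>+\<omega>. indicator (piece A n j) \<omega> * f (Y (real (Suc j) / real (Suc n) + s) \<omega>) \<partial>Pc x)"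
    by (rule piece_sum[OF A]) measurable
  also have "\<dots> = (\<Sum>j. \<integral>\<^sup>+\<omega>. indicator (piece A n j) \<omega> * (\<integral>\<^sup>+y. f y \<partial>T s (Y (real (Suc j) / real (Suc n)) \<omega>)) \<partial>Pc x)"
    by (intro arg_cong[where f = suminf] ext Markov_Pc piece_Nc A s f) simp_all
  also have "\<dots> = (\<integral>\<^sup>+\<omega>. indicator A \<omega> * (\<integral>\<^sup>+y. f y \<partial>T s (Y (\<tau>\<^sub>d n \<omega>) \<omega>)) \<partial>Pc x)"
    by (rule piece_sum[OF A, symmetric]) measurable
  also have "\<dots> = (\<integral>\<^sup>+\<omega>. (\<integral>\<^sup>+y. f y \<partial>T s (Y (\<tau>\<^sub>d n \<omega>) \<omega>)) \<partial>P\<^sub>A A x)"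
    by (rule nn_integral_density[symmetric]) measurable
  finally show ?thesis .
qed

section \<open>Passage to the limit and the strong Markov property\<close>

lemma Y_tendsto:
  assumes "\<omega> \<in> space M0" "continuous_on UNIV g" "t \<longlonglongrightarrow> t0" shows "(\<lambda>n. g (Y (t n) \<omega>)) \<longlonglongrightarrow> g (Y t0 \<omega>)"
proof -
  have "continuous_on UNIV (\<lambda>t. g (Y t \<omega>))" using continuous_on_compose2[OF assms(2) Y_continuous[OF assms(1)]] by simp
  then have "isCont (\<lambda>t. g (Y t \<omega>)) t0" using continuous_on_eq_continuous_at open_UNIV by blast
  then show ?thesis using isCont_tendsto_compose assms(3) by blast
qed

text \<open>The place where continuity of potentials enters: after integration over \<open>s\<close>
  in \<open>[0, r]\<close> the right-hand side of \<open>Markov_discrete\<close> is a continuous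
  function \<open>U\<close> of the position at \<open>\<tau>\<^sub>d\<close>, so it converges along
  the path. On the left, continuity of \<open>f\<close> and of the paths is enough.\<close>

lemma strong_Markov_integrated:
  fixes f :: "real ^ 'n \<Rightarrow> real"
  assumes A: "A \<in> sets N\<tau>" "\<And>\<omega>. \<omega> \<in> A \<Longrightarrow> \<tau> \<omega> < \<infinity>" and r: "0 \<le> r" and f: "continuous_on UNIV f" "\<And>y. 0 \<le> f y" "\<And>y. f y \<le> 1"
  shows "(\<integral>\<^sup>+s. indicator {0..r} s * (\<integral>\<^sup>+\<omega>. ennreal (f (Y (\<tau>\<^sub>r \<omega> + s) \<omega>)) \<partial>P\<^sub>A A x) \<partial>lborel) =
    (\<integral>\<^sup>+s. indicator {0..r} s * (\<integral>\<^sup>+\<omega>. (\<integral>\<^sup>+y. ennreal (f y) \<partial>T s (Y (\<tau>\<^sub>r \<omega>) \<omega>)) \<partial>P\<^sub>A A x) \<partial>lborel)"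
proof -
  note tau_real_measurable [measurable]
  have fm [measurable]: "f \<in> borel_measurable borel" by (rule borel_measurable_continuous_onI[OF f(1)])
  define D where "D = P\<^sub>A A x"
  have [simp, measurable_cong]: "sets D = sets (Pc x)" by (simp add: D_def)
  have [simp]: "space D = space M0" by (simp add: D_def)
  have finD: "finite_measure D" unfolding D_def by (rule finite_P_A[OF A(1)])
  then interpret D: finite_measure D .
  interpret pair_sigma_finite lborel D by (intro pair_sigma_finite.intro D.sigma_finite_measure_axioms sigma_finite_lborel)
  define U where "U y = (\<integral>\<^sup>+w. ennreal (f w) \<partial>V r y)" for y
  define h where "h \<sigma> s \<omega> = ennreal (f (Y (\<sigma> \<omega> + s) \<omega>))" for \<sigma> s \<omega>
  define L where "L n = (\<integral>\<^sup>+s. indicator {0..r} s * (\<integral>\<^sup>+\<omega>. h (\<tau>\<^sub>d n) s \<omega> \<partial>D) \<partial>lborel)" for n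
  have LU: "L n = (\<integral>\<^sup>+\<omega>. U (Y (\<tau>\<^sub>d n \<omega>) \<omega>) \<partial>D)" for n
  proof -
    have "L n = (\<integral>\<^sup>+s. indicator {0..r} s * (\<integral>\<^sup>+\<omega>. (\<integral>\<^sup>+y. ennreal (f y) \<partial>T s (Y (\<tau>\<^sub>d n \<omega>) \<omega>)) \<partial>D) \<partial>lborel)"
      unfolding L_def D_def h_def by (intro nn_integral_cong) (use Markov_discrete[OF A, where f = "\<lambda>y. ennreal (f y)" and n = n and x = x] in \<open>auto simp: indicator_def\<close>)
    also have "\<dots> = (\<integral>\<^sup>+\<omega>. U (Y (\<tau>\<^sub>d n \<omega>) \<omega>) \<partial>D)"
      unfolding U_def by (rule V_Fubini[OF finD, symmetric]) measurable
    finally show ?thesis .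
  qed
  have Um [measurable]: "U \<in> borel_measurable borel" unfolding U_def by measurable
  have U: "U y = ennreal (\<integral>w. f w \<partial>V r y)" "U y \<le> ennreal r" for y
    unfolding U_def integral_V_eq_nn(1)[OF fm f(2,3) r, symmetric] using integral_V_bounds(2)[OF fm f(2,3) r, of y] by (auto intro: ennreal_leI)
  have cU: "continuous_on UNIV (\<lambda>y. \<integral>w. f w \<partial>V r y)" by (rule potential_continuous[OF fm f(2,3) r])
  have fin: "(\<integral>\<^sup>+\<omega>. ennreal c \<partial>D) < \<infinity>" for c by (simp add: D.emeasure_eq_measure ennreal_mult_less_top)
  have "(\<lambda>n. L n) \<longlonglongrightarrow> (\<integral>\<^sup>+\<omega>. U (Y (\<tau>\<^sub>r \<omega>) \<omega>) \<partial>D)"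
    unfolding LU
  proof (rule nn_integral_dominated_convergence[where w = "\<lambda>_. ennreal r"])
    show "AE \<omega> in D. (\<lambda>n. U (Y (\<tau>\<^sub>d n \<omega>) \<omega>)) \<longlonglongrightarrow> U (Y (\<tau>\<^sub>r \<omega>) \<omega>)"
      unfolding U(1) by (intro AE_I2 tendsto_ennrealI Y_tendsto[OF _ cU tau_discrete_tendsto]) simp
    show "AE \<omega> in D. U (Y (\<tau>\<^sub>d n \<omega>) \<omega>) \<le> ennreal r" for n using U(2) by simp
    show "(\<integral>\<^sup>+\<omega>. ennreal r \<partial>D) < \<infinity>" by (rule fin)
  qed measurable
  moreover have "(\<lambda>n. L n) \<longlonglongrightarrow> (\<integral>\<^sup>+s. indicator {0..r} s * (\<integral>\<^sup>+\<omega>. h \<tau>\<^sub>r s \<omega> \<partial>D) \<partial>lborel)"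
    unfolding L_def
  proof (rule nn_integral_dominated_convergence[where w = "\<lambda>s. indicator {0..r} s * emeasure D (space D)"])
    have h1: "h \<sigma> s \<omega> \<le> 1" for \<sigma> s \<omega> using f(3) by (simp add: h_def)
    show "AE s in lborel. indicator {0..r} s * (\<integral>\<^sup>+\<omega>. h (\<tau>\<^sub>d n) s \<omega> \<partial>D) \<le> indicator {0..r} s * emeasure D (space D)" for n
      using nn_integral_mono[of D "h (\<tau>\<^sub>d n) _" "\<lambda>_. 1"] h1 by (intro AE_I2 mult_left_mono) auto
    show "(\<integral>\<^sup>+s. indicator {0..r} s * emeasure D (space D) \<partial>lborel) < \<infinity>"
      using r by (simp add: nn_integral_multc D.emeasure_eq_measure ennreal_mult_less_top)
    have "(\<lambda>n. \<integral>\<^sup>+\<omega>. h (\<tau>\<^sub>d n) s \<omega> \<partial>D) \<longlonglongrightarrow> (\<integral>\<^sup>+\<omega>. h \<tau>\<^sub>r s \<omega> \<partial>D)" for s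
    proof (rule nn_integral_dominated_convergence[where w = "\<lambda>_. ennreal 1"])
      show "AE \<omega> in D. h (\<tau>\<^sub>d n) s \<omega> \<le> ennreal 1" for n using h1 by simp
      show "(\<integral>\<^sup>+\<omega>. ennreal 1 \<partial>D) < \<infinity>" by (rule fin)
      show "AE \<omega> in D. (\<lambda>n. h (\<tau>\<^sub>d n) s \<omega>) \<longlonglongrightarrow> h \<tau>\<^sub>r s \<omega>"
        unfolding h_def by (intro AE_I2 tendsto_ennrealI Y_tendsto[OF _ f(1)] tendsto_add tau_discrete_tendsto tendsto_const) simp
    qed (unfold h_def, measurable)
    then show "AE s in lborel. (\<lambda>n. indicator {0..r} s * (\<integral>\<^sup>+\<omega>. h (\<tau>\<^sub>d n) s \<omega> \<partial>D)) \<longlonglongrightarrow> indicator {0..r} s * (\<integral>\<^sup>+\<omega>. h \<tau>\<^sub>r s \<omega> \<partial>D)"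
      by (intro AE_I2) (auto simp: indicator_def)
  qed (unfold h_def, measurable)
  ultimately have "(\<integral>\<^sup>+s. indicator {0..r} s * (\<integral>\<^sup>+\<omega>. h \<tau>\<^sub>r s \<omega> \<partial>D) \<partial>lborel) = (\<integral>\<^sup>+\<omega>. U (Y (\<tau>\<^sub>r \<omega>) \<omega>) \<partial>D)"
    using LIMSEQ_unique by blast
  also have "\<dots> = (\<integral>\<^sup>+s. indicator {0..r} s * (\<integral>\<^sup>+\<omega>. (\<integral>\<^sup>+y. ennreal (f y) \<partial>T s (Y (\<tau>\<^sub>r \<omega>) \<omega>)) \<partial>D) \<partial>lborel)"
    unfolding U_def by (rule V_Fubini[OF finD]) measurable
  finally show ?thesis unfolding h_def D_def .
qed


text \<open>Both sides are continuous functions of the time \<open>t\<close>, the left one by the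
  paths after \<open>\<tau>\<close>, the right one by \<open>T_continuous_in_time\<close>; their
  integrals over all \<open>[0, r]\<close> agree.\<close>

lemma strong_Markov_continuous:
  fixes f :: "real ^ 'n \<Rightarrow> real"
  assumes A: "A \<in> sets N\<tau>" "\<And>\<omega>. \<omega> \<in> A \<Longrightarrow> \<tau> \<omega> < \<infinity>" and t: "0 \<le> t" and f: "continuous_on UNIV f" "\<And>y. 0 \<le> f y" "\<And>y. f y \<le> 1"
  shows "(\<integral>\<^sup>+\<omega>. ennreal (f (Y (\<tau>\<^sub>r \<omega> + t) \<omega>)) \<partial>P\<^sub>A A x) = (\<integral>\<^sup>+\<omega>. (\<integral>\<^sup>+y. ennreal (f y) \<partial>T t (Y (\<tau>\<^sub>r \<omega>) \<omega>)) \<partial>P\<^sub>A A x)"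
proof -
  note tau_real_measurable [measurable]
  have fm [measurable]: "f \<in> borel_measurable borel" by (rule borel_measurable_continuous_onI[OF f(1)])
  define D where "D = P\<^sub>A A x"
  have [simp, measurable_cong]: "sets D = sets (Pc x)" by (simp add: D_def)
  have [simp]: "space D = space M0" by (simp add: D_def)
  interpret D: finite_measure D unfolding D_def by (rule finite_P_A[OF A(1)])
  define h where "h s \<omega> = f (Y (\<tau>\<^sub>r \<omega> + s) \<omega>)" for s \<omega>
  define k where "k s \<omega> = (\<integral>y. f y \<partial>T s (Y (\<tau>\<^sub>r \<omega>) \<omega>))" for s \<omega>
  have Tf: "(\<integral>\<^sup>+y. ennreal (f y) \<partial>T s z) = ennreal (\<integral>y. f y \<partial>T s z)" "0 \<le> (\<integral>y. f y \<partial>T s z)" "(\<integral>y. f y \<partial>T s z) \<le> 1" for s z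
  proof -
    interpret prob_space "T s z" by (rule T_prob)
    have i: "integrable (T s z) f" by (rule integrable_const_bound[where B = 1]) (use f in \<open>auto cong: measurable_cong_sets\<close>)
    show "(\<integral>\<^sup>+y. ennreal (f y) \<partial>T s z) = ennreal (\<integral>y. f y \<partial>T s z)" by (rule nn_integral_eq_integral[OF i]) (use f in auto)
    show "0 \<le> (\<integral>y. f y \<partial>T s z)" using f by (intro Bochner_Integration.integral_nonneg) auto
    have "(\<integral>y. f y \<partial>T s z) \<le> (\<integral>y. 1 \<partial>T s z)" by (rule integral_mono[OF i]) (use f in auto)
    then show "(\<integral>y. f y \<partial>T s z) \<le> 1" using prob_space by simp
  qed
  have D: "(\<integral>\<^sup>+\<omega>. ennreal (g s \<omega>) \<partial>D) = ennreal (\<integral>\<omega>. g s \<omega> \<partial>D)" "continuous_on UNIV (\<lambda>s. \<integral>\<omega>. g s \<omega> \<partial>D)" "0 \<le> (\<integral>\<omega>. g s \<omega> \<partial>D)"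
    if g [measurable]: "\<And>s. g s \<in> borel_measurable D" and b: "\<And>s \<omega>. 0 \<le> g s \<omega>" "\<And>s \<omega>. g s \<omega> \<le> 1"
      and c: "\<And>\<omega>. \<omega> \<in> space M0 \<Longrightarrow> continuous_on UNIV (\<lambda>s. g s \<omega>)" for g :: "real \<Rightarrow> 'w \<Rightarrow> real" and s
  proof -
    show "(\<integral>\<^sup>+\<omega>. ennreal (g s \<omega>) \<partial>D) = ennreal (\<integral>\<omega>. g s \<omega> \<partial>D)"
      by (intro nn_integral_eq_integral D.integrable_const_bound[where B = 1]) (use b in auto)
    show "0 \<le> (\<integral>\<omega>. g s \<omega> \<partial>D)" using b by (intro Bochner_Integration.integral_nonneg) auto
    have "(\<lambda>n. \<integral>\<omega>. g (s n) \<omega> \<partial>D) \<longlonglongrightarrow> (\<integral>\<omega>. g s0 \<omega> \<partial>D)" if "s \<longlonglongrightarrow> s0" for s s0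
    proof (rule integral_dominated_convergence[where w = "\<lambda>_. 1"])
      show "AE \<omega> in D. (\<lambda>n. g (s n) \<omega>) \<longlonglongrightarrow> g s0 \<omega>"
      proof (rule AE_I2)
        fix \<omega> assume "\<omega> \<in> space D"
        then have "continuous_on UNIV (\<lambda>s. g s \<omega>)" using c by simp
        then have "isCont (\<lambda>s. g s \<omega>) s0" by (simp add: continuous_on_eq_continuous_at)
        then show "(\<lambda>n. g (s n) \<omega>) \<longlonglongrightarrow> g s0 \<omega>" by (rule isCont_tendsto_compose[OF _ that])
      qed
    qed (use b in auto)
    then show "continuous_on UNIV (\<lambda>s. \<integral>\<omega>. g s \<omega> \<partial>D)" unfolding continuous_on_sequentially by (auto simp: o_def)
  qed
  have "h s \<in> borel_measurable D" "0 \<le> h s \<omega>" "h s \<omega> \<le> 1" for s \<omega> unfolding h_def by (measurable, (rule f)+)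
  moreover have "continuous_on UNIV (\<lambda>s. h s \<omega>)" if "\<omega> \<in> space M0" for \<omega>
  proof -
    have "continuous_on UNIV (\<lambda>s. Y (\<tau>\<^sub>r \<omega> + s) \<omega>)" by (rule continuous_on_compose2[OF Y_continuous[OF that]]) (auto intro: continuous_intros)
    then show ?thesis unfolding h_def by (rule continuous_on_compose2[OF f(1)]) simp
  qed
  ultimately have h: "(\<integral>\<^sup>+\<omega>. ennreal (h s \<omega>) \<partial>D) = ennreal (\<integral>\<omega>. h s \<omega> \<partial>D)" "continuous_on UNIV (\<lambda>s. \<integral>\<omega>. h s \<omega> \<partial>D)" "0 \<le> (\<integral>\<omega>. h s \<omega> \<partial>D)" for s
    using D[of h] by blast+
  have "k s \<in> borel_measurable D" "0 \<le> k s \<omega>" "k s \<omega> \<le> 1" "continuous_on UNIV (\<lambda>s. k s \<omega>)" for s \<omega>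
    unfolding k_def by (measurable, (rule Tf T_continuous_in_time[OF f])+)
  then have k: "(\<integral>\<^sup>+\<omega>. ennreal (k s \<omega>) \<partial>D) = ennreal (\<integral>\<omega>. k s \<omega> \<partial>D)" "continuous_on UNIV (\<lambda>s. \<integral>\<omega>. k s \<omega> \<partial>D)" "0 \<le> (\<integral>\<omega>. k s \<omega> \<partial>D)" for s
    using D[of k] by blast+
  have "(\<integral>\<omega>. h t \<omega> \<partial>D) = (\<integral>\<omega>. k t \<omega> \<partial>D)"
  proof (rule continuous_eq_if_integrals_eq[OF h(2,3) k(2,3) _ t])
    show "(\<integral>\<^sup>+s. indicator {0..r} s * ennreal (\<integral>\<omega>. h s \<omega> \<partial>D) \<partial>lborel) = (\<integral>\<^sup>+s. indicator {0..r} s * ennreal (\<integral>\<omega>. k s \<omega> \<partial>D) \<partial>lborel)" if "0 \<le> r" for r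
      unfolding h(1)[symmetric] k(1)[symmetric] unfolding h_def k_def Tf(1)[symmetric] D_def by (rule strong_Markov_integrated[OF A that f])
  qed
  then show ?thesis unfolding Tf(1) D_def[symmetric] k_def[symmetric] h_def[symmetric] h(1) k(1) by simp
qed

text \<open>Passing to measures extends the identity from continuous functions to all Borel
  functions without a monotone class argument on functions.\<close>

lemma strong_Markov_distr:
  fixes x :: "real ^ 'n"
  assumes A: "A \<in> sets N\<tau>" "\<And>\<omega>. \<omega> \<in> A \<Longrightarrow> \<tau> \<omega> < \<infinity>" and t: "0 \<le> t"
  defines "D \<equiv> P\<^sub>A A x"
  shows "distr D borel (\<lambda>\<omega>. Y (\<tau>\<^sub>r \<omega> + t) \<omega>) = distr D borel (\<lambda>\<omega>. Y (\<tau>\<^sub>r \<omega>) \<omega>) \<bind> T t"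
proof -
  note tau_real_measurable [measurable]
  have [simp, measurable_cong]: "sets D = sets (Pc x)" by (simp add: D_def)
  interpret D: finite_measure D unfolding D_def by (rule finite_P_A[OF A(1)])
  define \<mu> where "\<mu> = distr D borel (\<lambda>\<omega>. Y (\<tau>\<^sub>r \<omega> + t) \<omega>)"
  define \<nu>0 where "\<nu>0 = distr D borel (\<lambda>\<omega>. Y (\<tau>\<^sub>r \<omega>) \<omega>)"
  have s0 [simp, measurable_cong]: "sets \<nu>0 = sets borel" "sets \<mu> = sets borel" by (simp_all add: \<nu>0_def \<mu>_def)
  have k: "T t \<in> \<nu>0 \<rightarrow>\<^sub>M subprob_algebra borel" by measurable
  have s: "sets (\<nu>0 \<bind> T t) = sets borel" by (rule sets_bind) (auto simp: \<nu>0_def)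
  have \<mu>I: "(\<integral>\<^sup>+y. f y \<partial>\<mu>) = (\<integral>\<^sup>+\<omega>. f (Y (\<tau>\<^sub>r \<omega> + t) \<omega>) \<partial>D)" if [measurable]: "f \<in> borel_measurable borel" for f
    unfolding \<mu>_def by (rule nn_integral_distr) measurable
  have \<nu>I: "(\<integral>\<^sup>+y. f y \<partial>(\<nu>0 \<bind> T t)) = (\<integral>\<^sup>+\<omega>. (\<integral>\<^sup>+y. f y \<partial>T t (Y (\<tau>\<^sub>r \<omega>) \<omega>)) \<partial>D)" if [measurable]: "f \<in> borel_measurable borel" for f
    unfolding nn_integral_bind[OF that k] unfolding \<nu>0_def by (rule nn_integral_distr) measurable
  have "\<mu> = \<nu>0 \<bind> T t"
  proof (rule finite_measure_eqI_continuous)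
    have "emeasure \<mu> (space \<mu>) = (\<integral>\<^sup>+y. 1 \<partial>\<mu>)" by simp
    then show "finite_measure \<mu>" using \<mu>I[of "\<lambda>_. 1"] by (intro finite_measureI) (simp add: D.emeasure_eq_measure)
    have "emeasure (\<nu>0 \<bind> T t) (space (\<nu>0 \<bind> T t)) = (\<integral>\<^sup>+y. 1 \<partial>(\<nu>0 \<bind> T t))" by simp
    then show "finite_measure (\<nu>0 \<bind> T t)" using \<nu>I[of "\<lambda>_. 1"] by (intro finite_measureI) (simp add: D.emeasure_eq_measure)
    fix f :: "real ^ 'n \<Rightarrow> real" assume f: "continuous_on UNIV f" "\<And>y. 0 \<le> f y" "\<And>y. f y \<le> 1"
    have fm [measurable]: "f \<in> borel_measurable borel" by (rule borel_measurable_continuous_onI[OF f(1)])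
    have "(\<integral>\<^sup>+y. ennreal (f y) \<partial>\<mu>) = (\<integral>\<^sup>+y. ennreal (f y) \<partial>(\<nu>0 \<bind> T t))"
      by (subst \<mu>I, simp, subst \<nu>I, simp, unfold D_def, rule strong_Markov_continuous[OF A t f])
    then show "(\<integral>y. f y \<partial>\<mu>) = (\<integral>y. f y \<partial>(\<nu>0 \<bind> T t))"
      using f s by (subst (1 2) integral_eq_nn_integral) (auto cong: measurable_cong_sets)
  qed (simp_all add: s)
  then show ?thesis by (simp add: \<mu>_def \<nu>0_def)
qed

lemma strong_Markov_integral:
  fixes f :: "real ^ 'n \<Rightarrow> real"
  assumes A: "A \<in> sets N\<tau>" "\<And>\<omega>. \<omega> \<in> A \<Longrightarrow> \<tau> \<omega> < \<infinity>" and t: "0 \<le> t" and f [measurable]: "f \<in> borel_measurable borel" and B: "\<And>y. \<bar>f y\<bar> \<le> B"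
  shows "(\<integral>\<omega>. indicator A \<omega> * f (Y (\<tau>\<^sub>r \<omega> + t) \<omega>) \<partial>Pc x) = (\<integral>\<omega>. indicator A \<omega> * (\<integral>y. f y \<partial>T t (Y (\<tau>\<^sub>r \<omega>) \<omega>)) \<partial>Pc x)"
proof -
  note tau_real_measurable [measurable]
  have [measurable]: "A \<in> sets (Pc x)" by (rule Ntau_sets_Pc[OF A(1)])
  define D where "D = P\<^sub>A A x"
  have [simp, measurable_cong]: "sets D = sets (Pc x)" by (simp add: D_def)
  have Dd: "D = density (Pc x) (\<lambda>\<omega>. ennreal (indicator A \<omega>))" by (simp add: D_def ennreal_indicator)
  have dens: "(\<integral>\<omega>. indicator A \<omega> * g \<omega> \<partial>Pc x) = (\<integral>\<omega>. g \<omega> \<partial>D)" if "g \<in> borel_measurable (Pc x)" for g :: "'w \<Rightarrow> real"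
    unfolding Dd by (subst integral_density) (use that in auto)
  have fin: "finite_measure (distr D borel (\<lambda>\<omega>. Y (\<tau>\<^sub>r \<omega>) \<omega>))"
    unfolding D_def by (rule finite_measure.finite_measure_distr[OF finite_P_A[OF A(1)]]) measurable
  have "(\<integral>\<omega>. f (Y (\<tau>\<^sub>r \<omega> + t) \<omega>) \<partial>D) = (\<integral>y. f y \<partial>distr D borel (\<lambda>\<omega>. Y (\<tau>\<^sub>r \<omega> + t) \<omega>))"
    by (rule integral_distr[symmetric]) measurable
  also have "\<dots> = (\<integral>y. f y \<partial>(distr D borel (\<lambda>\<omega>. Y (\<tau>\<^sub>r \<omega>) \<omega>) \<bind> T t))" unfolding D_def by (simp only: strong_Markov_distr[OF A t])
  also have "\<dots> = (\<integral>y. (\<integral>w. f w \<partial>T t y) \<partial>distr D borel (\<lambda>\<omega>. Y (\<tau>\<^sub>r \<omega>) \<omega>))"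
  proof (rule integral_bind[where B = B and B' = 1 and K = borel])
    show "T t \<in> distr D borel (\<lambda>\<omega>. Y (\<tau>\<^sub>r \<omega>) \<omega>) \<rightarrow>\<^sub>M subprob_algebra borel" by measurable
  qed (use B fin in auto)
  also have "\<dots> = (\<integral>\<omega>. (\<integral>w. f w \<partial>T t (Y (\<tau>\<^sub>r \<omega>) \<omega>)) \<partial>D)" by (rule integral_distr) measurable
  finally show ?thesis by (subst (1 2) dens) measurable
qed

text \<open>The candidate \<open>G\<close> vanishes off \<open>finite_time\<close>, is
  \<open>N\<tau>\<close>-measurable, and has the same integrals as \<open>value_after\<close> over
  the events of \<open>N\<tau>\<close>; this characterises the conditional expectation.\<close>

lemma strong_Markov_cond_exp:
  fixes f :: "real ^ 'n \<Rightarrow> real"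
  assumes t: "0 \<le> t" and f [measurable]: "f \<in> borel_measurable borel" and B: "\<And>y. \<bar>f y\<bar> \<le> B"
  shows "AE \<omega> in Pc x. \<tau> \<omega> < \<infinity> \<longrightarrow> real_cond_exp (Pc x) N\<tau> (value_after X \<tau> t f) \<omega> = (\<integral>\<omega>'. f (X t \<omega>') \<partial>P (X (\<tau>\<^sub>r \<omega>) \<omega>))"
proof -
  note tau_real_measurable [measurable]
  interpret p: prob_space "Pc x" by (rule Pc_prob)
  interpret finite_measure_subalgebra "Pc x" N\<tau>
    by (intro finite_measure_subalgebra.intro p.finite_measure_axioms finite_measure_subalgebra_axioms.intro Ntau_subalgebra)
  define E where "E = finite_time"
  have E: "E \<in> sets N\<tau>" unfolding E_def by (rule tau_finite)
  have Em [measurable]: "E \<in> sets (Pc x)" by (rule Ntau_sets_Pc[OF E])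
  define h where "h y = (\<integral>w. f w \<partial>T t y)" for y
  have hm [measurable]: "h \<in> borel_measurable borel" unfolding h_def by measurable
  have h_eq: "h y = (\<integral>\<omega>'. f (X t \<omega>') \<partial>P y)" for y unfolding h_def using T_integral[OF f] t by simp
  have hB: "\<bar>h y\<bar> \<le> B" for y
  proof -
    interpret prob_space "T t y" by (rule T_prob)
    have i: "integrable (T t y) f" by (rule integrable_const_bound[where B = B]) (use B in \<open>auto cong: measurable_cong_sets\<close>)
    have "\<bar>h y\<bar> \<le> (\<integral>w. \<bar>f w\<bar> \<partial>T t y)" unfolding h_def using integral_norm_bound[of "T t y" f] by simp
    also have "\<dots> \<le> (\<integral>w. B \<partial>T t y)" by (rule integral_mono) (use i B in auto)
    finally show ?thesis using prob_space by simp
  qed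
  define F where "F = value_after X \<tau> t f"
  define G where "G \<omega> = indicator E \<omega> * h (Y (\<tau>\<^sub>r \<omega>) \<omega>)" for \<omega>
  have F_eq: "F \<omega> = indicator E \<omega> * f (Y (\<tau>\<^sub>r \<omega> + t) \<omega>)" if "\<omega> \<in> space M0" for \<omega>
    using that t by (simp add: F_def value_after_def E_def indicator_def)
  have B0: "0 \<le> B" using B[of 0] by simp
  have "(\<lambda>\<omega>. indicator E \<omega> * f (Y (\<tau>\<^sub>r \<omega> + t) \<omega>)) \<in> borel_measurable (Pc x)" by measurable
  then have Fm: "F \<in> borel_measurable (Pc x)" using F_eq by (subst measurable_cong) auto
  have iF: "integrable (Pc x) F"
    by (rule p.integrable_const_bound[where B = B]) (use F_eq B B0 Fm in \<open>auto simp: indicator_def\<close>)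
  have Gm: "G \<in> borel_measurable N\<tau>"
  proof -
    note X_tau_measurable [measurable] E [measurable]
    have "(\<lambda>\<omega>. indicator E \<omega> * h (if \<tau> \<omega> < \<infinity> then Y (\<tau>\<^sub>r \<omega>) \<omega> else 0)) \<in> borel_measurable N\<tau>" by measurable
    moreover have "indicator E \<omega> * h (if \<tau> \<omega> < \<infinity> then Y (\<tau>\<^sub>r \<omega>) \<omega> else 0) = G \<omega>" for \<omega>
      by (simp add: G_def E_def indicator_def)
    ultimately show ?thesis by simp
  qed
  have iG: "integrable (Pc x) G"
    by (rule p.integrable_const_bound[where B = B])
      (use hB B0 measurable_from_subalg[OF subalg Gm] in \<open>auto simp: indicator_def G_def\<close>)
  have "AE \<omega> in Pc x. real_cond_exp (Pc x) N\<tau> F \<omega> = G \<omega>"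
  proof (rule real_cond_exp_charact[OF _ iF iG Gm])
    fix A assume A: "A \<in> sets N\<tau>"
    \<comment> \<open>Both integrands vanish off \<open>E\<close>, so every event may be cut to the
      paths on which \<open>\<tau>\<close> is finite.\<close>
    have AE: "A \<inter> E \<in> sets N\<tau>" using A E by blast
    have AE': "\<tau> \<omega> < \<infinity>" if "\<omega> \<in> A \<inter> E" for \<omega> using that by (simp add: E_def)
    have "(LINT \<omega>:A|Pc x. F \<omega>) = (\<integral>\<omega>. indicator (A \<inter> E) \<omega> * f (Y (\<tau>\<^sub>r \<omega> + t) \<omega>) \<partial>Pc x)"
      unfolding set_lebesgue_integral_def by (intro Bochner_Integration.integral_cong) (auto simp: F_eq indicator_def)
    also have "\<dots> = (\<integral>\<omega>. indicator (A \<inter> E) \<omega> * h (Y (\<tau>\<^sub>r \<omega>) \<omega>) \<partial>Pc x)"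
      unfolding h_def by (rule strong_Markov_integral[OF AE AE' t f B])
    also have "\<dots> = (LINT \<omega>:A|Pc x. G \<omega>)"
      unfolding set_lebesgue_integral_def by (intro Bochner_Integration.integral_cong) (auto simp: G_def indicator_def)
    finally show "(LINT \<omega>:A|Pc x. F \<omega>) = (LINT \<omega>:A|Pc x. G \<omega>)" .
  qed
  then show ?thesis
  proof (rule AE_mp[OF _ AE_I2], intro impI)
    fix \<omega> assume "\<omega> \<in> space (Pc x)" "real_cond_exp (Pc x) N\<tau> F \<omega> = G \<omega>" "\<tau> \<omega> < \<infinity>"
    then show "real_cond_exp (Pc x) N\<tau> (value_after X \<tau> t f) \<omega> = (\<integral>\<omega>'. f (X t \<omega>') \<partial>P (X (\<tau>\<^sub>r \<omega>) \<omega>))"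
      by (simp add: F_def G_def E_def h_eq)
  qed
qed

end

theorem corollary4p2:
  fixes a :: "real ^ 'n \<Rightarrow> real ^ 'n ^ 'n"
    and b :: "real ^ 'n \<Rightarrow> real ^ 'n"
    and \<delta> K :: real
    and M0 :: "'w measure"
    and M :: "real \<Rightarrow> 'w measure"
    and P :: "real ^ 'n \<Rightarrow> 'w measure"
    and X :: "real \<Rightarrow> 'w \<Rightarrow> real ^ 'n"
  assumes "0 < \<delta>" and "\<delta> < 1" and "0 < K"
    and "a \<in> borel_measurable borel" and "\<And>x. a x \<in> sym_elliptic \<delta>"
    and "b \<in> borel_measurable borel" and "Ld_norm_le b K"
    and "quasi_diffusion a b M0 M P X"
  shows "\<forall>x \<tau> t f.
    ext_stopping_time M0 (Nbar_plus M0 P X) \<tau> \<longrightarrow> 0 \<le> t \<longrightarrow>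
    f \<in> borel_measurable borel \<longrightarrow> bounded (range f) \<longrightarrow>
    (AE \<omega> in Pbar M0 P X x. \<tau> \<omega> < \<infinity> \<longrightarrow>
       real_cond_exp (Pbar M0 P X x) (Nbar_tau_plus M0 P X \<tau>) (value_after X \<tau> t f) \<omega>
         = (\<integral>\<omega>'. f (X t \<omega>') \<partial>P (X (enn2real (\<tau> \<omega>)) \<omega>)))"
proof (intro allI impI)
  fix x \<tau> and t :: real and f :: "real ^ 'n \<Rightarrow> real"
  assume \<tau>: "ext_stopping_time M0 (Nbar_plus M0 P X) \<tau>" and t: "0 \<le> t" and f: "f \<in> borel_measurable borel" and bnd: "bounded (range f)"
  interpret stopped_quasi_diffusion a b \<delta> K M0 M P X \<tau>
    by unfold_locales (use assms \<tau> in auto)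
  obtain B where "\<And>y. \<bar>f y\<bar> \<le> B" using bnd by (auto simp: bounded_iff)
  then show "AE \<omega> in Pbar M0 P X x. \<tau> \<omega> < \<infinity> \<longrightarrow>
       real_cond_exp (Pbar M0 P X x) (Nbar_tau_plus M0 P X \<tau>) (value_after X \<tau> t f) \<omega>
         = (\<integral>\<omega>'. f (X t \<omega>') \<partial>P (X (enn2real (\<tau> \<omega>)) \<omega>))"
    by (rule strong_Markov_cond_exp[OF t f])
qed

end
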